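(* Let $n$ be a nonnegative integer and let $\Lambda$ be an $n$-Igusa-Todorov artin algebra. Then $\mathrm{tri.dim}\, D^{b}(\mathrm{mod}\,\Lambda) \leqslant n+3$.
   Context: $\mathrm{mod}\,\Lambda$ is the category of finitely generated right $\Lambda$-modules, $D^{b}(\mathrm{mod}\,\Lambda)$ its bounded derived category, and $\Omega^{n}(M)$ the $n$-th syzygy of $M$ (taken with respect to projective covers, $\Omega^0(M)=M$). $n$-Igusa-Todorov algebra: an artin algebra $\Lambda$ is $n$-Igusa-Todorov if there is a module $V\in\mathrm{mod}\,\Lambda$ such that for every $M\in \mathrm{mod}\,\Lambda$ there is an exact sequence $$0\to V_{1}\to V_{0}\to \Omega^{n}(M)\to 0$$ with $V_0,V_1\in\mathrm{add}\,V$, the class of direct summands of finite direct sums of copies of $V$. Dimension of a triangulated category $\mathcal{T}$: for $\mathcal{I}\subseteq \mathrm{Ob}\,\mathcal{T}$, let $\langle\mathcal{I}\rangle_1$ be the full subcategory of all direct summands of finite direct sums of shifts of objects in $\mathcal{I}$. For $\mathcal{I}_1,\mathcal{I}_2\subseteq\mathrm{Ob}\,\mathcal{T}$, let $\mathcal{I}_1*\mathcal{I}_2$ be the full subcategory of objects $X$ fitting in a triangle $X_1\to X\to X_2\to X_1[1]$ with $X_1\in\mathcal{I}_1$, $X_2\in\mathcal{I}_2$, and let $\mathcal{I}_1\diamond\mathcal{I}_2=\langle\mathcal{I}_1*\mathcal{I}_2\rangle_1$. Set $\langle\mathcal{I}\rangle_0=0$ and $\langle\mathcal{I}\rangle_{k+1}=\langle\mathcal{I}\rangle_k\diamond\langle\mathcal{I}\rangle_1$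 for $k\geqslant 1$; write $\langle M\rangle_k$ for $\langle\{M\}\rangle_k$. Then $\mathrm{tri.dim}\,\mathcal{T}$ is the minimal $d\geqslant 0$ such that $\mathcal{T}=\langle M\rangle_{d+1}$ for some object $M\in\mathcal{T}$, and $\infty$ if there is no such $d$. *)

theory Defs
  imports "HOL-Library.Extended_Nat" "HOL-Algebra.Module" "HOL-Algebra.Ideal"
begin

section \<open>Artin algebras and finitely generated right modules\<close>

definition fin_gen :: "('r, 'x) ring_scheme \<Rightarrow> ('r, 'm, 'y) module_scheme \<Rightarrow> bool" where
  "fin_gen R M \<longleftrightarrow> (\<exists>S. finite S \<and> S \<subseteq> carrier M \<and>
     (\<forall>N. submodule N R M \<and> S \<subseteq> N \<longrightarrow> N = carrier M))"

definition artinian :: "('r, 'x) ring_scheme \<Rightarrow> bool" where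
  "artinian R \<longleftrightarrow> (\<forall>I :: nat \<Rightarrow> 'r set.
     (\<forall>k. ideal (I k) R) \<and> (\<forall>k. I (Suc k) \<subseteq> I k) \<longrightarrow> (\<exists>k. \<forall>l\<ge>k. I l = I k))"

text \<open>An artin algebra is an algebra, in general not commutative, over a commutative artinian
  ring, and finitely generated as a module over it. (The library locale \<^locale>\<open>algebra\<close>
  is restricted to commutative algebras.) The locale \<^locale>\<open>module\<close> includes
  commutativity of the base ring.\<close>

locale artin_algebra = Module.module R A + ring A
  for R :: "('r, 'x) ring_scheme" and A :: "('r, 'a, 'y) module_scheme" +
  assumes smult_mult_left: "\<lbrakk>r \<in> carrier R; x \<in> carrier A; y \<in> carrier A\<rbrakk> \<Longrightarrow>
      (r \<odot>\<^bsub>A\<^esub> x) \<otimes>\<^bsub>A\<^esub> y = r \<odot>\<^bsub>A\<^esub> (x \<otimes>\<^bsub>A\<^esub> y)"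
    and smult_mult_right: "\<lbrakk>r \<in> carrier R; x \<in> carrier A; y \<in> carrier A\<rbrakk> \<Longrightarrow>
      x \<otimes>\<^bsub>A\<^esub> (r \<odot>\<^bsub>A\<^esub> y) = r \<odot>\<^bsub>A\<^esub> (x \<otimes>\<^bsub>A\<^esub> y)"
    and base_artinian: "artinian R"
    and fin_gen_base: "fin_gen R A"

text \<open>The scalar multiplication of the record type \<^typ>\<open>('a, 'm) module\<close> has the scalar
  as its first argument: \<open>a \<odot> x\<close> stands for the right action \<open>x\<cdot>a\<close>, whence the order of the factors
  in the associativity law. The fields \<^const>\<open>mult\<close> and \<^const>\<open>one\<close> of a module are unused.\<close>

locale right_module = L?: ring L + M?: abelian_group M
  for L :: "('a, 'x) ring_scheme" and M :: "('a, 'm) module" +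
  assumes ract_closed: "\<lbrakk>a \<in> carrier L; x \<in> carrier M\<rbrakk> \<Longrightarrow> a \<odot>\<^bsub>M\<^esub> x \<in> carrier M"
    and ract_add_scalar: "\<lbrakk>a \<in> carrier L; b \<in> carrier L; x \<in> carrier M\<rbrakk> \<Longrightarrow>
      (a \<oplus>\<^bsub>L\<^esub> b) \<odot>\<^bsub>M\<^esub> x = a \<odot>\<^bsub>M\<^esub> x \<oplus>\<^bsub>M\<^esub> b \<odot>\<^bsub>M\<^esub> x"
    and ract_add: "\<lbrakk>a \<in> carrier L; x \<in> carrier M; y \<in> carrier M\<rbrakk> \<Longrightarrow>
      a \<odot>\<^bsub>M\<^esub> (x \<oplus>\<^bsub>M\<^esub> y) = a \<odot>\<^bsub>M\<^esub> x \<oplus>\<^bsub>M\<^esub> a \<odot>\<^bsub>M\<^esub> y"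
    and ract_assoc: "\<lbrakk>a \<in> carrier L; b \<in> carrier L; x \<in> carrier M\<rbrakk> \<Longrightarrow>
      (a \<otimes>\<^bsub>L\<^esub> b) \<odot>\<^bsub>M\<^esub> x = b \<odot>\<^bsub>M\<^esub> (a \<odot>\<^bsub>M\<^esub> x)"
    and ract_one: "x \<in> carrier M \<Longrightarrow> \<one>\<^bsub>L\<^esub> \<odot>\<^bsub>M\<^esub> x = x"

text \<open>Homomorphisms are extensional functions, so that equality of functions is equality
  of homomorphisms.\<close>

definition rhom ::
  "('a, 'x) ring_scheme \<Rightarrow> ('a, 'm) module \<Rightarrow> ('a, 'k) module \<Rightarrow> ('m \<Rightarrow> 'k) set" where
  "rhom L M N = {f \<in> carrier M \<rightarrow>\<^sub>E carrier N.
     (\<forall>x\<in>carrier M. \<forall>y\<in>carrier M. f (x \<oplus>\<^bsub>M\<^esub> y) = f x \<oplus>\<^bsub>N\<^esub> f y) \<and>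
     (\<forall>a\<in>carrier L. \<forall>x\<in>carrier M. f (a \<odot>\<^bsub>M\<^esub> x) = a \<odot>\<^bsub>N\<^esub> f x)}"

text \<open>The category of finitely generated modules is realised on modules whose carrier is a set of
  sequences of elements of the ground type. By the lemma \<open>fg_module_iso_seq\<close> below, every finitely
  generated right module, on whatever type, is isomorphic to one of these, so this is
  a small category equivalent to the category of all finitely generated right modules.
  Interleaving of sequences identifies pairs of sequences with sequences, which gives
  direct sums (and mapping cones) inside this type.\<close>

type_synonym 'a smod = "('a, nat \<Rightarrow> 'a) module"

definition fgmod :: "('a, 'x) ring_scheme \<Rightarrow> 'a smod set" where
  "fgmod L = {M. right_module L M \<and> fin_gen L M}"

lemma fin_span_param:
  assumes M: "right_module L (M :: ('a, 'm) module)" and "finite S" and "S \<subseteq> carrier M"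
  shows "\<exists>N n (\<phi> :: 'a list \<Rightarrow> 'm). submodule N L M \<and> S \<subseteq> N \<and> N \<subseteq> \<phi> ` {l. length l = n}"
  using assms(2,3)
proof (induction S rule: finite_induct)
  case empty
  interpret right_module L M by (rule M)
  have z: "a \<odot>\<^bsub>M\<^esub> \<zero>\<^bsub>M\<^esub> = \<zero>\<^bsub>M\<^esub>" if "a \<in> carrier L" for a
  proof -
    have "a \<odot>\<^bsub>M\<^esub> \<zero>\<^bsub>M\<^esub> \<oplus>\<^bsub>M\<^esub> a \<odot>\<^bsub>M\<^esub> \<zero>\<^bsub>M\<^esub> = a \<odot>\<^bsub>M\<^esub> \<zero>\<^bsub>M\<^esub>"
      using ract_add[OF that M.zero_closed M.zero_closed] by simp
    then show ?thesis
      using M.add.l_cancel_one' ract_closed[OF that M.zero_closed] by metis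
  qed
  have "subgroup {\<zero>\<^bsub>M\<^esub>} (add_monoid M)"
    using M.add.triv_subgroup by simp
  then have "submodule {\<zero>\<^bsub>M\<^esub>} L M"
    by (simp add: submodule_def submodule_axioms_def z)
  moreover have "{\<zero>\<^bsub>M\<^esub>} \<subseteq> (\<lambda>_. \<zero>\<^bsub>M\<^esub>) ` {l::'a list. length l = 0}" by simp
  ultimately show ?case by blast
next
  case (insert s S)
  interpret right_module L M by (rule M)
  obtain N n and \<phi> :: "'a list \<Rightarrow> 'm" where N: "submodule N L M" "S \<subseteq> N"
    and \<phi>: "N \<subseteq> \<phi> ` {l. length l = n}"
    using insert by auto
  have s: "s \<in> carrier M" using insert by simp
  interpret N: submodule N L M by (rule N)
  have Nc: "x \<in> carrier M" if "x \<in> N" for x using N.subset that by auto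
  have Na: "x \<oplus>\<^bsub>M\<^esub> y \<in> N" if "x \<in> N" "y \<in> N" for x y
    using N.m_closed that by simp
  have N0: "\<zero>\<^bsub>M\<^esub> \<in> N" using N.one_closed by simp
  have Nm: "\<ominus>\<^bsub>M\<^esub> x \<in> N" if "x \<in> N" for x
    using N.m_inv_closed[OF that] by (simp add: a_inv_def)
  have Ns: "a \<odot>\<^bsub>M\<^esub> x \<in> N" if "a \<in> carrier L" "x \<in> N" for a x
    using N.smult_closed that by simp
  note cl = ract_closed[OF _ s]
  have z: "\<zero>\<^bsub>L\<^esub> \<odot>\<^bsub>M\<^esub> s = \<zero>\<^bsub>M\<^esub>"
  proof -
    have "\<zero>\<^bsub>L\<^esub> \<odot>\<^bsub>M\<^esub> s \<oplus>\<^bsub>M\<^esub> \<zero>\<^bsub>L\<^esub> \<odot>\<^bsub>M\<^esub> s = \<zero>\<^bsub>L\<^esub> \<odot>\<^bsub>M\<^esub> s"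
      using ract_add_scalar[OF L.zero_closed L.zero_closed s] by simp
    then show ?thesis
      using M.add.l_cancel_one' cl[OF L.zero_closed] by metis
  qed
  have neg: "(\<ominus>\<^bsub>L\<^esub> a) \<odot>\<^bsub>M\<^esub> s = \<ominus>\<^bsub>M\<^esub> (a \<odot>\<^bsub>M\<^esub> s)" if a: "a \<in> carrier L" for a
  proof -
    have "(\<ominus>\<^bsub>L\<^esub> a) \<odot>\<^bsub>M\<^esub> s \<oplus>\<^bsub>M\<^esub> a \<odot>\<^bsub>M\<^esub> s = \<zero>\<^bsub>M\<^esub>"
      using ract_add_scalar[OF L.a_inv_closed[OF a] a s] z a by (simp add: L.l_neg)
    then show ?thesis
      using M.minus_equality cl a by simp
  qed
  let ?K = "{x \<oplus>\<^bsub>M\<^esub> a \<odot>\<^bsub>M\<^esub> s | x a. x \<in> N \<and> a \<in> carrier L}"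
  have sub: "subgroup ?K (add_monoid M)"
  proof (rule M.add.subgroupI)
    show "?K \<subseteq> carrier M" using Nc cl by auto
    show "?K \<noteq> {}" using N0 L.zero_closed by blast
  next
    fix u assume "u \<in> ?K"
    then obtain x a where u: "u = x \<oplus>\<^bsub>M\<^esub> a \<odot>\<^bsub>M\<^esub> s" "x \<in> N" "a \<in> carrier L" by blast
    have "\<ominus>\<^bsub>M\<^esub> u = \<ominus>\<^bsub>M\<^esub> x \<oplus>\<^bsub>M\<^esub> (\<ominus>\<^bsub>L\<^esub> a) \<odot>\<^bsub>M\<^esub> s"
      using u Nc cl by (simp add: neg M.minus_add)
    then show "\<ominus>\<^bsub>M\<^esub> u \<in> ?K" using Nm[OF u(2)] L.a_inv_closed[OF u(3)] by blast
  next
    fix u v assume "u \<in> ?K" "v \<in> ?K"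
    then obtain x a y b where u: "u = x \<oplus>\<^bsub>M\<^esub> a \<odot>\<^bsub>M\<^esub> s" "x \<in> N" "a \<in> carrier L"
      and v: "v = y \<oplus>\<^bsub>M\<^esub> b \<odot>\<^bsub>M\<^esub> s" "y \<in> N" "b \<in> carrier L" by blast
    have "u \<oplus>\<^bsub>M\<^esub> v = (x \<oplus>\<^bsub>M\<^esub> y) \<oplus>\<^bsub>M\<^esub> (a \<oplus>\<^bsub>L\<^esub> b) \<odot>\<^bsub>M\<^esub> s"
      using u v Nc cl by (simp add: ract_add_scalar s M.a_ac)
    then show "u \<oplus>\<^bsub>M\<^esub> v \<in> ?K" using Na[OF u(2) v(2)] L.a_closed[OF u(3) v(3)] by blast
  qed
  have "b \<odot>\<^bsub>M\<^esub> u \<in> ?K" if b: "b \<in> carrier L" and uK: "u \<in> ?K" for b u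
  proof -
    obtain x a where u: "u = x \<oplus>\<^bsub>M\<^esub> a \<odot>\<^bsub>M\<^esub> s" "x \<in> N" "a \<in> carrier L" using uK by blast
    have "b \<odot>\<^bsub>M\<^esub> u = b \<odot>\<^bsub>M\<^esub> x \<oplus>\<^bsub>M\<^esub> (a \<otimes>\<^bsub>L\<^esub> b) \<odot>\<^bsub>M\<^esub> s"
      using u b Nc cl by (simp add: ract_add ract_assoc s)
    then show ?thesis using Ns[OF b u(2)] L.m_closed[OF u(3) b] by blast
  qed
  with sub have K: "submodule ?K L M"
    by (simp add: submodule_def submodule_axioms_def)
  have "S \<subseteq> ?K"
  proof
    fix x assume "x \<in> S"
    then have "x \<in> N" using N by auto
    moreover have "x = x \<oplus>\<^bsub>M\<^esub> \<zero>\<^bsub>L\<^esub> \<odot>\<^bsub>M\<^esub> s" using Nc[OF \<open>x \<in> N\<close>] z by simp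
    ultimately show "x \<in> ?K" using L.zero_closed by blast
  qed
  moreover have "s \<in> ?K"
  proof -
    have "s = \<zero>\<^bsub>M\<^esub> \<oplus>\<^bsub>M\<^esub> \<one>\<^bsub>L\<^esub> \<odot>\<^bsub>M\<^esub> s" using s ract_one by simp
    then show ?thesis using N0 L.one_closed by blast
  qed
  moreover have "?K \<subseteq> (\<lambda>l. \<phi> (tl l) \<oplus>\<^bsub>M\<^esub> hd l \<odot>\<^bsub>M\<^esub> s) ` {l. length l = Suc n}"
  proof
    fix u assume "u \<in> ?K"
    then obtain x a where u: "u = x \<oplus>\<^bsub>M\<^esub> a \<odot>\<^bsub>M\<^esub> s" "x \<in> N" "a \<in> carrier L" by blast
    obtain l where "length l = n" "x = \<phi> l" using \<phi> u(2) by auto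
    then show "u \<in> (\<lambda>l. \<phi> (tl l) \<oplus>\<^bsub>M\<^esub> hd l \<odot>\<^bsub>M\<^esub> s) ` {l. length l = Suc n}"
      using u by (intro image_eqI[of _ _ "a # l"]) auto
  qed
  ultimately show ?case using K by blast
qed

lemma fg_module_iso_seq:
  assumes M: "right_module L (M :: ('a, 'm) module)" and fg: "fin_gen L M"
  shows "\<exists>N \<in> fgmod L. \<exists>f \<in> rhom L M N. bij_betw f (carrier M) (carrier N)"
proof -
  interpret right_module L M by (rule M)
  obtain S where S: "finite S" "S \<subseteq> carrier M"
    "\<And>N. submodule N L M \<Longrightarrow> S \<subseteq> N \<Longrightarrow> N = carrier M"
    using fg unfolding fin_gen_def by auto
  obtain N n and \<phi> :: "'a list \<Rightarrow> 'm" where N: "submodule N L M" "S \<subseteq> N"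
    and \<phi>: "N \<subseteq> \<phi> ` {l. length l = n}"
    using fin_span_param[OF M S(1,2)] by blast
  have NM: "N = carrier M" using S(3) N by blast
  define c where "c x = (SOME l. length l = n \<and> \<phi> l = x)" for x
  have c: "length (c x) = n \<and> \<phi> (c x) = x" if "x \<in> carrier M" for x
    unfolding c_def by (rule someI_ex) (use \<phi> NM that in auto)
  define e where "e x = (\<lambda>i. if i < n then c x ! i else undefined)" for x
  have inj: "inj_on e (carrier M)"
  proof
    fix x y assume x: "x \<in> carrier M" and y: "y \<in> carrier M" and "e x = e y"
    then have "c x ! i = c y ! i" if "i < n" for i
      using that unfolding e_def by (metis (full_types))
    then have "c x = c y" using c[OF x] c[OF y] by (intro nth_equalityI) auto
    then show "x = y" using c[OF x] c[OF y] by metis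
  qed
  define d where "d = inv_into (carrier M) e"
  have de: "d (e x) = x" if "x \<in> carrier M" for x
    unfolding d_def using inj that by simp
  define K :: "'a smod" where "K = \<lparr>carrier = e ` carrier M, monoid.mult = undefined, one = undefined,
     zero = e \<zero>\<^bsub>M\<^esub>, add = (\<lambda>u v. e (d u \<oplus>\<^bsub>M\<^esub> d v)), smult = (\<lambda>a u. e (a \<odot>\<^bsub>M\<^esub> d u))\<rparr>"
  have Ks: "carrier K = e ` carrier M" "\<zero>\<^bsub>K\<^esub> = e \<zero>\<^bsub>M\<^esub>"
    "\<And>u v. u \<oplus>\<^bsub>K\<^esub> v = e (d u \<oplus>\<^bsub>M\<^esub> d v)" "\<And>a u. a \<odot>\<^bsub>K\<^esub> u = e (a \<odot>\<^bsub>M\<^esub> d u)"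
    by (simp_all add: K_def)
  have ab: "abelian_group K"
  proof (rule abelian_groupI)
    fix u assume "u \<in> carrier K"
    then obtain x where x: "x \<in> carrier M" "u = e x" by (auto simp: Ks)
    have "e (\<ominus>\<^bsub>M\<^esub> x) \<oplus>\<^bsub>K\<^esub> u = \<zero>\<^bsub>K\<^esub>"
      using x by (simp add: Ks de M.l_neg)
    then show "\<exists>y\<in>carrier K. y \<oplus>\<^bsub>K\<^esub> u = \<zero>\<^bsub>K\<^esub>" using x by (auto simp: Ks)
  qed (auto simp: Ks de M.a_ac)
  have KM: "right_module L K"
  proof (intro right_module.intro right_module_axioms.intro)
    show "ring L" by (rule L.ring_axioms)
    show "abelian_group K" by (rule ab)
  qed (auto simp: Ks de ract_closed ract_add_scalar ract_add ract_assoc ract_one)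
  have fgK: "fin_gen L K" unfolding fin_gen_def
  proof (intro exI[of _ "e ` S"] conjI allI impI)
    show "finite (e ` S)" "e ` S \<subseteq> carrier K" using S by (auto simp: Ks)
  next
    fix H assume H: "submodule H L K \<and> e ` S \<subseteq> H"
    then interpret H: submodule H L K by simp
    interpret K: right_module L K by (rule KM)
    let ?G = "{x \<in> carrier M. e x \<in> H}"
    have "subgroup ?G (add_monoid M)"
    proof (rule M.add.subgroupI)
      show "?G \<noteq> {}" using H.one_closed by (auto simp: Ks)
    next
      fix x assume x: "x \<in> ?G"
      have "e (\<ominus>\<^bsub>M\<^esub> x) \<oplus>\<^bsub>K\<^esub> e x = \<zero>\<^bsub>K\<^esub>"
        using x by (simp add: Ks de M.l_neg)
      then have "\<ominus>\<^bsub>K\<^esub> (e x) = e (\<ominus>\<^bsub>M\<^esub> x)"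
        by (rule K.M.minus_equality) (use x in \<open>auto simp: Ks\<close>)
      moreover have "\<ominus>\<^bsub>K\<^esub> (e x) \<in> H" using H.m_inv_closed[of "e x"] x by (simp add: a_inv_def)
      ultimately show "\<ominus>\<^bsub>M\<^esub> x \<in> ?G" using x by simp
    next
      fix x y assume "x \<in> ?G" "y \<in> ?G"
      then show "x \<oplus>\<^bsub>M\<^esub> y \<in> ?G" using H.m_closed[of "e x" "e y"] by (simp add: Ks de)
    qed auto
    moreover have "a \<odot>\<^bsub>M\<^esub> x \<in> ?G" if "a \<in> carrier L" "x \<in> ?G" for a x
      using H.smult_closed[of a "e x"] that by (simp add: Ks de ract_closed)
    ultimately have "submodule ?G L M" by (simp add: submodule_def submodule_axioms_def)
    moreover have "S \<subseteq> ?G" using S(2) H by auto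
    ultimately have "?G = carrier M" by (rule S(3))
    then show "H = carrier K" using H.subset by (auto simp: Ks)
  qed
  let ?f = "restrict e (carrier M)"
  have "?f \<in> rhom L M K" unfolding rhom_def by (auto simp: Ks de ract_closed)
  moreover have "bij_betw ?f (carrier M) (carrier K)"
    using inj by (auto simp: bij_betw_def Ks)
  ultimately show ?thesis using KM fgK unfolding fgmod_def by blast
qed


section \<open>Additive and triangulated categories\<close>

text \<open>These records hold the data on which direct sums and the dimension of a triangulated category
  depend; the axioms play no role in the definitions. Sets of morphisms need not be disjoint, so the
  operations on morphisms take the objects involved as arguments:
  \<open>Comp C X Y Z g f\<close> is the composite of \<open>f : X \<rightarrow> Y\<close> and \<open>g : Y \<rightarrow> Z\<close>.\<close>

record ('o, 'h) cat =
  Ob :: "'o set"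
  Hom :: "'o \<Rightarrow> 'o \<Rightarrow> 'h set"
  IdMor :: "'o \<Rightarrow> 'h"
  Comp :: "'o \<Rightarrow> 'o \<Rightarrow> 'o \<Rightarrow> 'h \<Rightarrow> 'h \<Rightarrow> 'h"

record ('o, 'h) addcat = "('o, 'h) cat" +
  ZeroMor :: "'o \<Rightarrow> 'o \<Rightarrow> 'h"
  AddMor :: "'o \<Rightarrow> 'o \<Rightarrow> 'h \<Rightarrow> 'h \<Rightarrow> 'h"

record ('o, 'h) tricat = "('o, 'h) addcat" +
  Shift :: "int \<Rightarrow> 'o \<Rightarrow> 'o"
  Tri :: "('o \<times> 'o \<times> 'o \<times> 'h \<times> 'h \<times> 'h) set"

definition iso_mor :: "('o, 'h, 'x) cat_scheme \<Rightarrow> 'o \<Rightarrow> 'o \<Rightarrow> 'h \<Rightarrow> bool" where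
  "iso_mor C X Y f \<longleftrightarrow> f \<in> Hom C X Y \<and>
     (\<exists>g\<in>Hom C Y X. Comp C X Y X g f = IdMor C X \<and> Comp C Y X Y f g = IdMor C Y)"

definition zero_obj :: "('o, 'h, 'x) addcat_scheme \<Rightarrow> 'o \<Rightarrow> bool" where
  "zero_obj C X \<longleftrightarrow> X \<in> Ob C \<and> IdMor C X = ZeroMor C X X"

text \<open>\<open>Y\<close> is a direct sum (biproduct) of the finite list \<open>Xs\<close>, with inclusions \<open>\<iota>\<close>
  and projections \<open>\<pi>\<close>; for the empty list this says that \<open>Y\<close> is a zero object.\<close>

definition direct_sum :: "('o, 'h, 'x) addcat_scheme \<Rightarrow> 'o list \<Rightarrow> 'o \<Rightarrow> bool" where
  "direct_sum C Xs Y \<longleftrightarrow> set Xs \<subseteq> Ob C \<and> Y \<in> Ob C \<and> (\<exists>\<iota> \<pi> :: nat \<Rightarrow> 'h.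
     (\<forall>k<length Xs. \<iota> k \<in> Hom C (Xs ! k) Y \<and> \<pi> k \<in> Hom C Y (Xs ! k)) \<and>
     (\<forall>k<length Xs. \<forall>l<length Xs. Comp C (Xs ! l) Y (Xs ! k) (\<pi> k) (\<iota> l) =
        (if k = l then IdMor C (Xs ! k) else ZeroMor C (Xs ! l) (Xs ! k))) \<and>
     foldr (\<lambda>k. AddMor C Y Y (Comp C Y (Xs ! k) Y (\<iota> k) (\<pi> k))) [0..<length Xs]
       (ZeroMor C Y Y) = IdMor C Y)"

definition direct_summand :: "('o, 'h, 'x) addcat_scheme \<Rightarrow> 'o \<Rightarrow> 'o \<Rightarrow> bool" where
  "direct_summand C X Y \<longleftrightarrow> (\<exists>X'. direct_sum C [X, X'] Y)"

definition add_closure :: "('o, 'h, 'x) addcat_scheme \<Rightarrow> 'o set \<Rightarrow> 'o set" where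
  "add_closure C I = {X. \<exists>Ys Y. set Ys \<subseteq> I \<and> direct_sum C Ys Y \<and> direct_summand C X Y}"

definition tri_gen1 :: "('o, 'h, 'x) tricat_scheme \<Rightarrow> 'o set \<Rightarrow> 'o set" where
  "tri_gen1 T I = add_closure T {Shift T k X | k X. X \<in> I}"

definition tri_star :: "('o, 'h, 'x) tricat_scheme \<Rightarrow> 'o set \<Rightarrow> 'o set \<Rightarrow> 'o set" where
  "tri_star T I J = {X. \<exists>X1\<in>I. \<exists>X2\<in>J. \<exists>f g h. (X1, X, X2, f, g, h) \<in> Tri T}"

definition tri_diamond :: "('o, 'h, 'x) tricat_scheme \<Rightarrow> 'o set \<Rightarrow> 'o set \<Rightarrow> 'o set" where
  "tri_diamond T I J = tri_gen1 T (tri_star T I J)"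

fun tri_gen :: "('o, 'h, 'x) tricat_scheme \<Rightarrow> 'o set \<Rightarrow> nat \<Rightarrow> 'o set" where
  "tri_gen T I 0 = {X. zero_obj T X}"
| "tri_gen T I (Suc 0) = tri_gen1 T I"
| "tri_gen T I (Suc (Suc k)) = tri_diamond T (tri_gen T I (Suc k)) (tri_gen1 T I)"

text \<open>In \<^typ>\<open>enat\<close> the infimum of a nonempty set is its least element, and that of the empty
  set is \<open>\<infinity>\<close>. \<close>

definition tri_dim :: "('o, 'h, 'x) tricat_scheme \<Rightarrow> enat" where
  "tri_dim T = Inf {enat d | d. \<exists>M\<in>Ob T. Ob T = tri_gen T {M} (d + 1)}"


section \<open>Syzygies and Igusa-Todorov algebras\<close>

definition mod_cat :: "('a, 'x) ring_scheme \<Rightarrow> ('a smod, (nat \<Rightarrow> 'a) \<Rightarrow> nat \<Rightarrow> 'a) addcat" where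
  "mod_cat L = \<lparr>Ob = fgmod L, Hom = rhom L,
     IdMor = (\<lambda>M. \<lambda>x\<in>carrier M. x),
     Comp = (\<lambda>M N K g f. compose (carrier M) g f),
     ZeroMor = (\<lambda>M N. \<lambda>x\<in>carrier M. \<zero>\<^bsub>N\<^esub>),
     AddMor = (\<lambda>M N f g. \<lambda>x\<in>carrier M. f x \<oplus>\<^bsub>N\<^esub> g x)\<rparr>"

definition short_exact :: "('a, 'x) ring_scheme \<Rightarrow> 'a smod \<Rightarrow> 'a smod \<Rightarrow> 'a smod \<Rightarrow>
    ((nat \<Rightarrow> 'a) \<Rightarrow> nat \<Rightarrow> 'a) \<Rightarrow> ((nat \<Rightarrow> 'a) \<Rightarrow> nat \<Rightarrow> 'a) \<Rightarrow> bool" where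
  "short_exact L A B C f g \<longleftrightarrow> f \<in> rhom L A B \<and> g \<in> rhom L B C \<and>
     inj_on f (carrier A) \<and> f ` carrier A = a_kernel B C g \<and> g ` carrier B = carrier C"

definition projective :: "('a, 'x) ring_scheme \<Rightarrow> 'a smod \<Rightarrow> bool" where
  "projective L P \<longleftrightarrow> P \<in> fgmod L \<and>
     (\<forall>M\<in>fgmod L. \<forall>N\<in>fgmod L. \<forall>g\<in>rhom L M N. \<forall>f\<in>rhom L P N.
        g ` carrier M = carrier N \<longrightarrow> (\<exists>h\<in>rhom L P M. compose (carrier P) g h = f))"

definition projective_cover ::
  "('a, 'x) ring_scheme \<Rightarrow> 'a smod \<Rightarrow> 'a smod \<Rightarrow> ((nat \<Rightarrow> 'a) \<Rightarrow> nat \<Rightarrow> 'a) \<Rightarrow> bool" where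
  "projective_cover L M P p \<longleftrightarrow> projective L P \<and> p \<in> rhom L P M \<and> p ` carrier P = carrier M \<and>
     (\<forall>N. submodule N L P \<and> N <+>\<^bsub>P\<^esub> a_kernel P M p = carrier P \<longrightarrow> N = carrier P)"

text \<open>\<open>syzygy L n M K\<close>: \<open>K\<close> is an \<open>n\<close>-th syzygy of \<open>M\<close>. Over an artin algebra projective covers
  exist and are unique up to isomorphism, so for \<open>n > 0\<close> these \<open>K\<close> form exactly one
  isomorphism class.\<close>

primrec syzygy :: "('a, 'x) ring_scheme \<Rightarrow> nat \<Rightarrow> 'a smod \<Rightarrow> 'a smod \<Rightarrow> bool" where
  "syzygy L 0 M K \<longleftrightarrow> K = M"
| "syzygy L (Suc n) M K \<longleftrightarrow> (\<exists>N P i p. syzygy L n M N \<and> K \<in> fgmod L \<and>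
     projective_cover L N P p \<and> short_exact L K P N i p)"

definition igusa_todorov :: "nat \<Rightarrow> ('a, 'x) ring_scheme \<Rightarrow> bool" where
  "igusa_todorov n L \<longleftrightarrow> (\<exists>V\<in>fgmod L. \<forall>M\<in>fgmod L. \<exists>K. syzygy L n M K \<and>
     (\<exists>V1\<in>add_closure (mod_cat L) {V}. \<exists>V0\<in>add_closure (mod_cat L) {V}.
        \<exists>f g. short_exact L V1 V0 K f g))"


section \<open>Bounded complexes\<close>

text \<open>Complexes are graded cohomologically: \<open>Dif X i\<close> maps degree \<open>i\<close> to degree \<open>i + 1\<close>.\<close>

record 'a cpx =
  Deg :: "int \<Rightarrow> 'a smod"
  Dif :: "int \<Rightarrow> (nat \<Rightarrow> 'a) \<Rightarrow> nat \<Rightarrow> 'a"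

type_synonym 'a cmap = "int \<Rightarrow> (nat \<Rightarrow> 'a) \<Rightarrow> nat \<Rightarrow> 'a"

definition bcpx :: "('a, 'x) ring_scheme \<Rightarrow> 'a cpx set" where
  "bcpx L = {X. (\<forall>i. Deg X i \<in> fgmod L) \<and>
     (\<forall>i. Dif X i \<in> rhom L (Deg X i) (Deg X (i + 1))) \<and>
     (\<forall>i. \<forall>x\<in>carrier (Deg X i). Dif X (i + 1) (Dif X i x) = \<zero>\<^bsub>Deg X (i + 2)\<^esub>) \<and>
     finite {i. carrier (Deg X i) \<noteq> {\<zero>\<^bsub>Deg X i\<^esub>}}}"

definition chain_maps :: "('a, 'x) ring_scheme \<Rightarrow> 'a cpx \<Rightarrow> 'a cpx \<Rightarrow> 'a cmap set" where
  "chain_maps L X Y = {f. (\<forall>i. f i \<in> rhom L (Deg X i) (Deg Y i)) \<and>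
     (\<forall>i. \<forall>x\<in>carrier (Deg X i). f (i + 1) (Dif X i x) = Dif Y i (f i x))}"

definition cid :: "'a cpx \<Rightarrow> 'a cmap" where
  "cid X = (\<lambda>i. \<lambda>x\<in>carrier (Deg X i). x)"

definition czero :: "'a cpx \<Rightarrow> 'a cpx \<Rightarrow> 'a cmap" where
  "czero X Y = (\<lambda>i. \<lambda>x\<in>carrier (Deg X i). \<zero>\<^bsub>Deg Y i\<^esub>)"

definition cadd :: "'a cpx \<Rightarrow> 'a cpx \<Rightarrow> 'a cmap \<Rightarrow> 'a cmap \<Rightarrow> 'a cmap" where
  "cadd X Y f g = (\<lambda>i. \<lambda>x\<in>carrier (Deg X i). f i x \<oplus>\<^bsub>Deg Y i\<^esub> g i x)"

definition ccomp :: "'a cpx \<Rightarrow> 'a cmap \<Rightarrow> 'a cmap \<Rightarrow> 'a cmap" where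
  "ccomp X g f = (\<lambda>i. compose (carrier (Deg X i)) (g i) (f i))"

definition homotopic ::
  "('a, 'x) ring_scheme \<Rightarrow> 'a cpx \<Rightarrow> 'a cpx \<Rightarrow> 'a cmap \<Rightarrow> 'a cmap \<Rightarrow> bool" where
  "homotopic L X Y f g \<longleftrightarrow> (\<exists>s :: 'a cmap. (\<forall>i. s i \<in> rhom L (Deg X i) (Deg Y (i - 1))) \<and>
     (\<forall>i. \<forall>x\<in>carrier (Deg X i). f i x \<ominus>\<^bsub>Deg Y i\<^esub> g i x =
        Dif Y (i - 1) (s i x) \<oplus>\<^bsub>Deg Y i\<^esub> s (i + 1) (Dif X i x)))"

definition cycles :: "'a cpx \<Rightarrow> int \<Rightarrow> (nat \<Rightarrow> 'a) set" where
  "cycles X i = a_kernel (Deg X i) (Deg X (i + 1)) (Dif X i)"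

definition boundaries :: "'a cpx \<Rightarrow> int \<Rightarrow> (nat \<Rightarrow> 'a) set" where
  "boundaries X i = Dif X (i - 1) ` carrier (Deg X (i - 1))"

text \<open>The two clauses spell out injectivity and surjectivity of the map induced in cohomology,
  cycles modulo boundaries.\<close>

definition quasi_isos :: "('a, 'x) ring_scheme \<Rightarrow> 'a cpx \<Rightarrow> 'a cpx \<Rightarrow> 'a cmap set" where
  "quasi_isos L X Y = {f \<in> chain_maps L X Y.
     (\<forall>i. \<forall>x\<in>cycles X i. f i x \<in> boundaries Y i \<longrightarrow> x \<in> boundaries X i) \<and>
     (\<forall>i. \<forall>y\<in>cycles Y i. \<exists>x\<in>cycles X i. y \<ominus>\<^bsub>Deg Y i\<^esub> f i x \<in> boundaries Y i)}"

text \<open>\<open>X[n]\<close> is \<open>X\<^sup>i\<^sup>+\<^sup>n\<close> in degree \<open>i\<close>, with differential multiplied by \<open>(-1)\<^sup>n\<close>.\<close>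

definition cshift :: "int \<Rightarrow> 'a cpx \<Rightarrow> 'a cpx" where
  "cshift n X = \<lparr>Deg = (\<lambda>i. Deg X (i + n)),
     Dif = (\<lambda>i. \<lambda>x\<in>carrier (Deg X (i + n)).
        if even n then Dif X (i + n) x else \<ominus>\<^bsub>Deg X (i + n + 1)\<^esub> Dif X (i + n) x)\<rparr>"

definition cshift_map :: "int \<Rightarrow> 'a cmap \<Rightarrow> 'a cmap" where
  "cshift_map n f = (\<lambda>i. f (i + n))"

definition spair :: "(nat \<Rightarrow> 'a) \<Rightarrow> (nat \<Rightarrow> 'a) \<Rightarrow> nat \<Rightarrow> 'a" where
  "spair x y = (\<lambda>i. if even i then x (i div 2) else y (i div 2))"

definition sfst :: "(nat \<Rightarrow> 'a) \<Rightarrow> nat \<Rightarrow> 'a" where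
  "sfst z = (\<lambda>i. z (2 * i))"

definition ssnd :: "(nat \<Rightarrow> 'a) \<Rightarrow> nat \<Rightarrow> 'a" where
  "ssnd z = (\<lambda>i. z (2 * i + 1))"

lemma spair_simps [simp]: "sfst (spair x y) = x" "ssnd (spair x y) = y"
  "spair (sfst z) (ssnd z) = z"
  by (auto simp: spair_def sfst_def ssnd_def fun_eq_iff elim!: evenE oddE)

definition mod_sum :: "'a smod \<Rightarrow> 'a smod \<Rightarrow> 'a smod" where
  "mod_sum M N = \<lparr>carrier = {z. sfst z \<in> carrier M \<and> ssnd z \<in> carrier N},
     monoid.mult = undefined, one = undefined, zero = spair \<zero>\<^bsub>M\<^esub> \<zero>\<^bsub>N\<^esub>,
     add = (\<lambda>z w. spair (sfst z \<oplus>\<^bsub>M\<^esub> sfst w) (ssnd z \<oplus>\<^bsub>N\<^esub> ssnd w)),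
     smult = (\<lambda>a z. spair (a \<odot>\<^bsub>M\<^esub> sfst z) (a \<odot>\<^bsub>N\<^esub> ssnd z))\<rparr>"

text \<open>The mapping cone of \<open>f : X \<rightarrow> Y\<close> is \<open>X\<^sup>i\<^sup>+\<^sup>1 \<oplus> Y\<^sup>i\<close> in degree \<open>i\<close>, with differential
  \<open>(x, y) \<mapsto> (-d x, f x + d y)\<close>.\<close>

definition cone :: "'a cpx \<Rightarrow> 'a cpx \<Rightarrow> 'a cmap \<Rightarrow> 'a cpx" where
  "cone X Y f = \<lparr>Deg = (\<lambda>i. mod_sum (Deg X (i + 1)) (Deg Y i)),
     Dif = (\<lambda>i. \<lambda>z\<in>carrier (mod_sum (Deg X (i + 1)) (Deg Y i)).
        spair (\<ominus>\<^bsub>Deg X (i + 2)\<^esub> Dif X (i + 1) (sfst z))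
              (f (i + 1) (sfst z) \<oplus>\<^bsub>Deg Y (i + 1)\<^esub> Dif Y i (ssnd z)))\<rparr>"

definition cone_incl :: "'a cpx \<Rightarrow> 'a cpx \<Rightarrow> 'a cmap" where
  "cone_incl X Y = (\<lambda>i. \<lambda>y\<in>carrier (Deg Y i). spair \<zero>\<^bsub>Deg X (i + 1)\<^esub> y)"

definition cone_proj :: "'a cpx \<Rightarrow> 'a cpx \<Rightarrow> 'a cmap" where
  "cone_proj X Y = (\<lambda>i. \<lambda>z\<in>carrier (mod_sum (Deg X (i + 1)) (Deg Y i)). sfst z)"


section \<open>The bounded derived category\<close>

text \<open>The bounded derived category is the localisation of the homotopy category of bounded complexes
  of finitely generated modules at the quasi-isomorphisms. A morphism from \<open>X\<close> to \<open>Y\<close> is an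
  equivalence class of roofs \<open>(W, s, f)\<close>, with \<open>s : W \<rightarrow> X\<close> a quasi-isomorphism and \<open>f : W \<rightarrow> Y\<close>
  a chain map, representing \<open>f \<circ> s\<^sup>-\<^sup>1\<close>. Two roofs are equivalent if they agree up to
  homotopy after passage to a common third roof.\<close>

type_synonym 'a roof = "'a cpx \<times> 'a cmap \<times> 'a cmap"

definition roofs :: "('a, 'x) ring_scheme \<Rightarrow> 'a cpx \<Rightarrow> 'a cpx \<Rightarrow> 'a roof set" where
  "roofs L X Y = {(W, s, f). W \<in> bcpx L \<and> s \<in> quasi_isos L W X \<and> f \<in> chain_maps L W Y}"

fun roof_equiv ::
  "('a, 'x) ring_scheme \<Rightarrow> 'a cpx \<Rightarrow> 'a cpx \<Rightarrow> 'a roof \<Rightarrow> 'a roof \<Rightarrow> bool" where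
  "roof_equiv L X Y (W, s, f) (W', s', f') \<longleftrightarrow>
     (\<exists>V\<in>bcpx L. \<exists>u\<in>chain_maps L V W. \<exists>u'\<in>chain_maps L V W'.
        ccomp V s u \<in> quasi_isos L V X \<and>
        homotopic L V X (ccomp V s u) (ccomp V s' u') \<and>
        homotopic L V Y (ccomp V f u) (ccomp V f' u'))"

text \<open>Operations on classes of roofs are given as the saturation, under equivalence, of the set of
  all results for representatives; as these results are equivalent to one another,
  the saturation is a single class.\<close>

definition saturate ::
  "('a, 'x) ring_scheme \<Rightarrow> 'a cpx \<Rightarrow> 'a cpx \<Rightarrow> 'a roof set \<Rightarrow> 'a roof set" where
  "saturate L X Y S = {r \<in> roofs L X Y. \<exists>q\<in>S. roof_equiv L X Y q r}"

definition dmor :: "('a, 'x) ring_scheme \<Rightarrow> 'a cpx \<Rightarrow> 'a cpx \<Rightarrow> 'a cmap \<Rightarrow> 'a roof set" where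
  "dmor L X Y f = saturate L X Y {(X, cid X, f)}"

definition dcomp :: "('a, 'x) ring_scheme \<Rightarrow> 'a cpx \<Rightarrow> 'a cpx \<Rightarrow> 'a cpx \<Rightarrow>
    'a roof set \<Rightarrow> 'a roof set \<Rightarrow> 'a roof set" where
  "dcomp L X Y Z b a = saturate L X Z
     {(V, ccomp V s u, ccomp V g v) | V W W' s f t g u v.
        (W, s, f) \<in> a \<and> (W', t, g) \<in> b \<and> V \<in> bcpx L \<and>
        u \<in> quasi_isos L V W \<and> v \<in> chain_maps L V W' \<and>
        homotopic L V Y (ccomp V f u) (ccomp V t v)}"

definition dadd :: "('a, 'x) ring_scheme \<Rightarrow> 'a cpx \<Rightarrow> 'a cpx \<Rightarrow>
    'a roof set \<Rightarrow> 'a roof set \<Rightarrow> 'a roof set" where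
  "dadd L X Y a b = saturate L X Y
     {(W, s, cadd W Y f g) | W s f g. (W, s, f) \<in> a \<and> (W, s, g) \<in> b}"

definition dshift ::
  "('a, 'x) ring_scheme \<Rightarrow> int \<Rightarrow> 'a cpx \<Rightarrow> 'a cpx \<Rightarrow> 'a roof set \<Rightarrow> 'a roof set" where
  "dshift L n X Y a = saturate L (cshift n X) (cshift n Y)
     {(cshift n W, cshift_map n s, cshift_map n f) | W s f. (W, s, f) \<in> a}"

definition derived_addcat :: "('a, 'x) ring_scheme \<Rightarrow> ('a cpx, 'a roof set) addcat" where
  "derived_addcat L = \<lparr>Ob = bcpx L,
     Hom = (\<lambda>X Y. {saturate L X Y {r} | r. r \<in> roofs L X Y}),
     IdMor = (\<lambda>X. dmor L X X (cid X)),
     Comp = dcomp L,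
     ZeroMor = (\<lambda>X Y. dmor L X Y (czero X Y)),
     AddMor = dadd L\<rparr>"

text \<open>A triangle is distinguished if it is isomorphic, in the derived category, to the triangle
  \<open>A \<rightarrow> B \<rightarrow> cone \<phi> \<rightarrow> A[1]\<close> of some chain map \<open>\<phi> : A \<rightarrow> B\<close>.\<close>

definition derived_triangles :: "('a, 'x) ring_scheme \<Rightarrow>
    ('a cpx \<times> 'a cpx \<times> 'a cpx \<times> 'a roof set \<times> 'a roof set \<times> 'a roof set) set" where
  "derived_triangles L = (let D = derived_addcat L in
     {(X, Y, Z, f, g, h). X \<in> Ob D \<and> Y \<in> Ob D \<and> Z \<in> Ob D \<and>
        f \<in> Hom D X Y \<and> g \<in> Hom D Y Z \<and> h \<in> Hom D Z (cshift 1 X) \<and>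
        (\<exists>A\<in>Ob D. \<exists>B\<in>Ob D. \<exists>\<phi>\<in>chain_maps L A B. \<exists>a b c.
           iso_mor D X A a \<and> iso_mor D Y B b \<and> iso_mor D Z (cone A B \<phi>) c \<and>
           Comp D X Y B b f = Comp D X A B (dmor L A B \<phi>) a \<and>
           Comp D Y Z (cone A B \<phi>) c g =
             Comp D Y B (cone A B \<phi>) (dmor L B (cone A B \<phi>) (cone_incl A B)) b \<and>
           Comp D Z (cshift 1 X) (cshift 1 A) (dshift L 1 X A a) h =
             Comp D Z (cone A B \<phi>) (cshift 1 A)
               (dmor L (cone A B \<phi>) (cshift 1 A) (cone_proj A B)) c)})"

definition bounded_derived_cat :: "('a, 'x) ring_scheme \<Rightarrow> ('a cpx, 'a roof set) tricat" where
  "bounded_derived_cat L = addcat.extend (derived_addcat L)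
     (tricat.fields cshift (derived_triangles L))"

end

theory Submission
  imports Defs "HOL-Algebra.Ring_Divisibility"
begin

text \<open>The Igusa-Todorov property gives a module \<open>M0\<close> (namely \<open>V\<close> plus the regular module) such that every
  module, after \<open>n\<close> projective covers, has a kernel with a two term presentation by the additive closure of
  \<open>M0\<close>. Let \<open>T\<close> consist of the summands of sums of shifts of \<open>M0\<close>. If the cycles and boundaries of a complex \<open>X\<close>
  have such presentations at once, then \<open>X\<close> is an extension of two complexes with zero differential, each of
  which takes two objects of \<open>T\<close>, so \<open>X\<close> takes four. Otherwise projective covers of the cycles and boundaries
  assemble to an epimorphism \<open>P \<rightarrow> X\<close> with \<open>P\<close> in \<open>T\<close>, whose kernel has as cycles and boundaries the
  syzygies of those of \<open>X\<close> up to projective summands. After \<open>n\<close> such steps every complex is built from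
  \<open>n + 4\<close> objects of \<open>T\<close>.\<close>

text \<open>Three obstacles shape the proof. Cycles, boundaries and kernels must remain finitely
  generated, whereas the artinian condition concerns ideals of the base ring alone; hence the
  passage from artinian to noetherian over the base, and from there to submodules over the algebra.
  Next, pieces come off a complex X on the left, as maps S -> X replaced by their cones, which
  produces extensions nested to the right, while \<open>tri_gen\<close> nests to the left;
  \<open>tri_gen_extend\<close> converts one form into the other by explicit twisted sums. Finally,
  each projective summand that separates the new cycles from a syzygy has to be absorbed into the
  middle term of a presentation. At the last level this term must lie in the additive closure of
  \<open>M0\<close>, which is why the regular module is added to V. The bound is one less than the
  number of pieces because dimension d allows d + 1 of them.\<close>

section \<open>Commutative artinian rings are noetherian\<close>

text \<open>\<open>artinian\<close> is phrased with sequences of ideals; well-foundedness of strict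
  inclusion converts it into the minimum condition.\<close>

lemma artinian_minimal_ideal:
  assumes "artinian R" and "I0 \<in> S" and S: "\<And>I. I \<in> S \<Longrightarrow> ideal I R"
  shows "\<exists>I\<in>S. \<forall>J\<in>S. J \<subseteq> I \<longrightarrow> J = I"
proof -
  have "wf {(J, I). J \<in> S \<and> I \<in> S \<and> J \<subset> I}"
  proof (unfold wf_iff_no_infinite_down_chain, rule notI, elim exE)
    fix f assume f: "\<forall>i. (f (Suc i), f i) \<in> {(J, I). J \<in> S \<and> I \<in> S \<and> J \<subset> I}"
    then have "f (Suc k) \<in> S \<and> f k \<in> S \<and> f (Suc k) \<subset> f k" for k by simp
    then have "\<forall>k. ideal (f k) R" "\<forall>k. f (Suc k) \<subseteq> f k" using S by (simp_all add: psubset_eq)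
    then have "\<exists>k. \<forall>l\<ge>k. f l = f k"
      by (intro mp[OF assms(1)[unfolded artinian_def, THEN spec, of f]] conjI)
    then obtain k where k: "\<forall>l\<ge>k. f l = f k" by blast
    have "f (Suc k) = f k" using k[THEN spec, of "Suc k"] by (rule mp) simp
    then show False using f by blast
  qed
  then obtain I where "I \<in> S" "\<And>J. (J, I) \<in> {(J, I). J \<in> S \<and> I \<in> S \<and> J \<subset> I} \<Longrightarrow> J \<notin> S"
    using assms(2) by (rule wfE_min) blast
  then show ?thesis by blast
qed

text \<open>Multiplication by r presents I as an extension of r I by the elements of I that r kills
  (\<open>ideal_annihilated\<close>). Both ideals are compared with a minimal I in the theorem
  below.\<close>

lemma (in cring) ideal_cmult_image:
  assumes "ideal I R" "r \<in> carrier R"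
  shows "ideal ((\<otimes>) r ` I) R" "(\<otimes>) r ` I \<subseteq> I"
proof -
  interpret I: ideal I R by fact
  show "(\<otimes>) r ` I \<subseteq> I" using assms I.I_l_closed by blast
  show "ideal ((\<otimes>) r ` I) R"
  proof (rule idealI[OF ring_axioms])
    show "subgroup ((\<otimes>) r ` I) (add_monoid R)"
    proof (rule add.subgroupI)
      show "(\<otimes>) r ` I \<subseteq> carrier R" using assms by (auto dest: I.Icarr)
      show "(\<otimes>) r ` I \<noteq> {}" using I.zero_closed by blast
    next
      fix a assume "a \<in> (\<otimes>) r ` I"
      then obtain x where "x \<in> I" "a = r \<otimes> x" by blast
      then have "\<ominus> a = r \<otimes> (\<ominus> x)" using assms I.Icarr by (simp add: r_minus)
      then show "\<ominus> a \<in> (\<otimes>) r ` I" using \<open>x \<in> I\<close> by simp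
    next
      fix a b assume "a \<in> (\<otimes>) r ` I" "b \<in> (\<otimes>) r ` I"
      then obtain x y where "x \<in> I" "y \<in> I" "a = r \<otimes> x" "b = r \<otimes> y" by blast
      then have "a \<oplus> b = r \<otimes> (x \<oplus> y)" using assms I.Icarr by (simp add: r_distr)
      then show "a \<oplus> b \<in> (\<otimes>) r ` I" using \<open>x \<in> I\<close> \<open>y \<in> I\<close> by simp
    qed
  next
    fix a x assume "a \<in> (\<otimes>) r ` I" and x: "x \<in> carrier R"
    then obtain y where y: "y \<in> I" "a = r \<otimes> y" by blast
    have "x \<otimes> a = r \<otimes> (x \<otimes> y)" "a \<otimes> x = r \<otimes> (x \<otimes> y)" using assms x y I.Icarr by (auto simp: m_ac)
    then show "x \<otimes> a \<in> (\<otimes>) r ` I" "a \<otimes> x \<in> (\<otimes>) r ` I"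
      using I.I_l_closed[OF y(1) x] by auto
  qed
qed

lemma (in cring) ideal_annihilated:
  assumes "ideal I R" "r \<in> carrier R"
  shows "ideal {x \<in> I. r \<otimes> x = \<zero>} R"
proof -
  interpret I: ideal I R by fact
  show ?thesis
  proof (rule idealI[OF ring_axioms])
    show "subgroup {x \<in> I. r \<otimes> x = \<zero>} (add_monoid R)"
    proof (rule add.subgroupI)
      have "\<zero> \<in> {x \<in> I. r \<otimes> x = \<zero>}" using assms(2) I.zero_closed by simp
      then show "{x \<in> I. r \<otimes> x = \<zero>} \<noteq> {}" by blast
      show "{x \<in> I. r \<otimes> x = \<zero>} \<subseteq> carrier R" using I.Icarr by blast
    next
      fix a b assume "a \<in> {x \<in> I. r \<otimes> x = \<zero>}" "b \<in> {x \<in> I. r \<otimes> x = \<zero>}"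
      then show "a \<oplus> b \<in> {x \<in> I. r \<otimes> x = \<zero>}" using assms(2) I.Icarr[of a] I.Icarr[of b] by (simp add: r_distr)
    next
      fix a assume "a \<in> {x \<in> I. r \<otimes> x = \<zero>}"
      then show "\<ominus> a \<in> {x \<in> I. r \<otimes> x = \<zero>}" using assms(2) I.Icarr[of a] by (simp add: r_minus)
    qed
  next
    fix a x assume a: "a \<in> {x \<in> I. r \<otimes> x = \<zero>}" and x: "x \<in> carrier R"
    have ac: "a \<in> carrier R" using a I.Icarr by blast
    have "r \<otimes> (x \<otimes> a) = x \<otimes> (r \<otimes> a)" using assms(2) x ac by (intro m_lcomm)
    then have "r \<otimes> (x \<otimes> a) = \<zero>" using a x by simp
    moreover have "x \<otimes> a \<in> I" using a x I.I_l_closed by blast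
    ultimately show "x \<otimes> a \<in> {x \<in> I. r \<otimes> x = \<zero>}" by simp
    then show "a \<otimes> x \<in> {x \<in> I. r \<otimes> x = \<zero>}" using m_comm[OF x ac] by simp
  qed
qed

lemma (in cring) ideal_add_principal:
  assumes "ideal J R" "y \<in> carrier R"
  shows "ideal {j \<oplus> a \<otimes> y | j a. j \<in> J \<and> a \<in> carrier R} R" (is "ideal ?K R")
    and "J \<subseteq> {j \<oplus> a \<otimes> y | j a. j \<in> J \<and> a \<in> carrier R}"
    and "y \<in> {j \<oplus> a \<otimes> y | j a. j \<in> J \<and> a \<in> carrier R}"
proof -
  interpret J: ideal J R by fact
  have y: "y \<in> carrier R" by fact
  show "J \<subseteq> ?K"
  proof
    fix j assume j: "j \<in> J"
    then have "j = j \<oplus> \<zero> \<otimes> y" using y J.Icarr by simp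
    then show "j \<in> ?K" using j by blast
  qed
  have "y = \<zero> \<oplus> \<one> \<otimes> y" using y by simp
  then show "y \<in> ?K" using J.zero_closed by blast
  show "ideal ?K R"
  proof (rule idealI[OF ring_axioms])
    show "subgroup ?K (add_monoid R)"
    proof (rule add.subgroupI)
      show "?K \<subseteq> carrier R" using y J.Icarr by auto
      show "?K \<noteq> {}" using \<open>J \<subseteq> ?K\<close> J.zero_closed by blast
    next
      fix u assume "u \<in> ?K"
      then obtain j a where u: "u = j \<oplus> a \<otimes> y" "j \<in> J" "a \<in> carrier R" by blast
      then have "\<ominus> u = \<ominus> j \<oplus> (\<ominus> a) \<otimes> y" using y J.Icarr by (simp add: minus_add l_minus)
      then show "\<ominus> u \<in> ?K" using u by blast
    next
      fix u v assume "u \<in> ?K" "v \<in> ?K"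
      then obtain j a k b where u: "u = j \<oplus> a \<otimes> y" "j \<in> J" "a \<in> carrier R"
        and v: "v = k \<oplus> b \<otimes> y" "k \<in> J" "b \<in> carrier R" by blast
      then have "u \<oplus> v = (j \<oplus> k) \<oplus> (a \<oplus> b) \<otimes> y" using y J.Icarr by (simp add: l_distr a_ac)
      moreover have "j \<oplus> k \<in> J" using u v by simp
      ultimately show "u \<oplus> v \<in> ?K" using u v by blast
    qed
  next
    fix u x assume "u \<in> ?K" and x: "x \<in> carrier R"
    then obtain j a where u: "u = j \<oplus> a \<otimes> y" "j \<in> J" "a \<in> carrier R" by blast
    then have "x \<otimes> u = x \<otimes> j \<oplus> (x \<otimes> a) \<otimes> y" "u \<otimes> x = x \<otimes> j \<oplus> (x \<otimes> a) \<otimes> y"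
      using x y J.Icarr by (simp_all add: r_distr l_distr m_ac)
    moreover have "x \<otimes> j \<in> J" using u x J.I_l_closed by simp
    ultimately show "x \<otimes> u \<in> ?K" "u \<otimes> x \<in> ?K" using u x by blast+
  qed
qed

lemma (in cring) ideal_Union_chain:
  assumes "\<And>J. J \<in> C \<Longrightarrow> ideal J R" "C \<noteq> {}" "\<And>J K. J \<in> C \<Longrightarrow> K \<in> C \<Longrightarrow> J \<subseteq> K \<or> K \<subseteq> J"
  shows "ideal (\<Union>C) R"
proof (rule idealI[OF ring_axioms])
  note I = ideal.Icarr[OF assms(1)]
  show "subgroup (\<Union>C) (add_monoid R)"
  proof (rule add.subgroupI)
    show "\<Union>C \<subseteq> carrier R" using I by blast
    obtain J where "J \<in> C" using assms(2) by blast
    then have "\<zero> \<in> J" using additive_subgroup.zero_closed[OF ideal.axioms(1)[OF assms(1)]] by blast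
    then show "\<Union>C \<noteq> {}" using \<open>J \<in> C\<close> by blast
  next
    fix a assume "a \<in> \<Union>C"
    then show "\<ominus> a \<in> \<Union>C" using additive_subgroup.a_inv_closed[OF ideal.axioms(1)[OF assms(1)]] by blast
  next
    fix a b assume "a \<in> \<Union>C" "b \<in> \<Union>C"
    then obtain J K where "J \<in> C" "K \<in> C" "a \<in> J" "b \<in> K" by blast
    then show "a \<oplus> b \<in> \<Union>C"
      using assms(3)[of J K] additive_subgroup.a_closed[OF ideal.axioms(1)[OF assms(1)]] by blast
  qed
next
  fix a x assume "a \<in> \<Union>C" "x \<in> carrier R"
  then show "x \<otimes> a \<in> \<Union>C" "a \<otimes> x \<in> \<Union>C"
    using ideal.I_l_closed[OF assms(1)] ideal.I_r_closed[OF assms(1)] by blast+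
qed

text \<open>An ideal \<open>I\<close> minimal among those not finitely generated satisfies \<open>r I = I\<close> or \<open>r I = 0\<close>
  for every \<open>r\<close>, so it is a vector space over the field \<open>R / ann I\<close>, but a vector space has
  a complement to each line.\<close>

theorem (in cring) artinian_imp_noetherian:
  assumes art: "artinian R"
  shows "noetherian_ring R"
proof (rule noetherian_ringI, rule ccontr)
  fix I1 assume "ideal I1 R" and neg: "\<not> (\<exists>A\<subseteq>carrier R. finite A \<and> I1 = Idl A)"
  define fg where "fg J \<longleftrightarrow> (\<exists>A\<subseteq>carrier R. finite A \<and> J = Idl A)" for J
  have "I1 \<in> {J. ideal J R \<and> \<not> fg J}" using \<open>ideal I1 R\<close> neg by (simp add: fg_def)
  from artinian_minimal_ideal[OF art this] obtain I where I: "ideal I R" "\<not> fg I" and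
    I_min: "\<And>J. ideal J R \<Longrightarrow> \<not> fg J \<Longrightarrow> J \<subseteq> I \<Longrightarrow> J = I"
    by auto
  interpret I: ideal I R by fact
  \<comment> \<open>If r I and the part of I killed by r are both proper, minimality makes both
    finitely generated. Preimages X of generators of the first and generators B of the second then
    generate I, which is excluded.\<close>
  have dich: "(\<otimes>) r ` I = I \<or> (\<forall>x\<in>I. r \<otimes> x = \<zero>)" if r: "r \<in> carrier R" for r
  proof (rule ccontr)
    assume "\<not> ?thesis"
    then have ne: "(\<otimes>) r ` I \<noteq> I" "{x \<in> I. r \<otimes> x = \<zero>} \<noteq> I" by auto
    then have "fg ((\<otimes>) r ` I)" "fg {x \<in> I. r \<otimes> x = \<zero>}"
      using I_min ideal_cmult_image[OF I(1) r] ideal_annihilated[OF I(1) r] by blast+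
    then obtain A B where A: "A \<subseteq> carrier R" "finite A" "(\<otimes>) r ` I = Idl A"
      and B: "B \<subseteq> carrier R" "finite B" "{x \<in> I. r \<otimes> x = \<zero>} = Idl B" unfolding fg_def by blast
    have "A \<subseteq> (\<otimes>) r ` I" using A genideal_self by auto
    then obtain X where X: "X \<subseteq> I" "finite X" "A = (\<otimes>) r ` X" using A(2) finite_subset_image by metis
    have "B \<subseteq> I" using genideal_self[OF B(1)] B(3) by blast
    have XB: "X \<union> B \<subseteq> carrier R" using X(1) B(1) I.Icarr by blast
    interpret J: ideal "Idl (X \<union> B)" R by (rule genideal_ideal[OF XB])
    have "Idl (X \<union> B) \<subseteq> I" using X(1) \<open>B \<subseteq> I\<close> by (intro genideal_minimal I) auto
    moreover have "I \<subseteq> Idl (X \<union> B)"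
    proof
      fix x assume x: "x \<in> I"
      have "Idl A \<subseteq> (\<otimes>) r ` (Idl (X \<union> B))"
        using genideal_self[OF XB] X(3) by (intro genideal_minimal ideal_cmult_image J.is_ideal r) auto
      then obtain j where j: "j \<in> Idl (X \<union> B)" "r \<otimes> x = r \<otimes> j" using A(3) x by blast
      have jI: "j \<in> I" using j \<open>Idl (X \<union> B) \<subseteq> I\<close> by blast
      have "r \<otimes> (x \<ominus> j) = \<zero>" using r x jI j(2) I.Icarr by (simp add: a_minus_def r_distr r_minus r_neg)
      then have "x \<ominus> j \<in> Idl B" using B(3) x jI by (auto simp: a_minus_def)
      moreover have "Idl B \<subseteq> Idl (X \<union> B)" using genideal_self[OF XB] by (intro genideal_minimal J.is_ideal) auto
      ultimately have "x \<ominus> j \<oplus> j \<in> Idl (X \<union> B)" using j by blast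
      then show "x \<in> Idl (X \<union> B)" using x jI I.Icarr by (simp add: a_minus_def a_assoc l_neg)
    qed
    ultimately have "fg I" unfolding fg_def using XB X(2) B(2) by blast
    then show False using I by simp
  qed
  have "\<not> I \<subseteq> {\<zero>}"
  proof
    assume "I \<subseteq> {\<zero>}"
    then have "I = Idl {\<zero>}" using I.zero_closed genideal_zero by auto
    moreover have "fg (Idl {\<zero>})" unfolding fg_def by (intro exI[of _ "{\<zero>}"]) simp
    ultimately have "fg I" by (rule ssubst)
    then show False using I by simp
  qed
  then obtain x where x: "x \<in> I" "x \<noteq> \<zero>" by blast
  \<comment> \<open>Zorn's lemma gives an ideal J maximal among those inside I that avoid x; it
    plays the part of a hyperplane complementary to the line through x.\<close>
  define Z where "Z = {J. ideal J R \<and> J \<subseteq> I \<and> x \<notin> J}"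
  have "{\<zero>} \<in> Z" unfolding Z_def using x zeroideal I.zero_closed by auto
  then have "\<exists>J\<in>Z. \<forall>K\<in>Z. J \<subseteq> K \<longrightarrow> K = J"
  proof (intro subset_Zorn_nonempty)
    fix C assume C: "C \<noteq> {}" "subset.chain Z C"
    then have "ideal (\<Union>C) R"
      by (intro ideal_Union_chain) (auto simp: subset.chain_def Z_def)
    then show "\<Union>C \<in> Z" using C by (auto simp: subset.chain_def Z_def)
  qed auto
  then obtain J where JZ: "J \<in> Z" and Jm: "\<forall>K\<in>Z. J \<subseteq> K \<longrightarrow> K = J" by blast
  have J: "ideal J R" "J \<subseteq> I" "x \<notin> J" using JZ by (auto simp: Z_def)
  have J_max: "K = J" if "ideal K R" "K \<subseteq> I" "x \<notin> K" "J \<subseteq> K" for K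
    using Jm that by (simp add: Z_def)
  interpret J: ideal J R by fact
  have xc: "x \<in> carrier R" using x I.Icarr by blast
  \<comment> \<open>Surjective scalars are invertible on I: the descending chain of ideals generated
    by the powers of a becomes stationary, so a^k = b a^(k+1) for some b. Every z in I has the form
    a^k w, hence multiplication by b undoes multiplication by a.\<close>
  have inv: "\<exists>b\<in>carrier R. \<forall>z\<in>I. b \<otimes> (a \<otimes> z) = z" if a: "a \<in> carrier R" "(\<otimes>) a ` I = I" for a
  proof -
    have pw: "(\<otimes>) (a [^] (k::nat)) ` I = I" for k
    proof (induction k)
      case 0
      show ?case using I.Icarr by force
    next
      case (Suc k)
      have "(\<otimes>) (a [^] Suc k) ` I = (\<otimes>) (a [^] k) ` ((\<otimes>) a ` I)"
        unfolding image_image using a I.Icarr by (intro image_cong) (auto simp: m_assoc)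
      then show ?case using Suc a by simp
    qed
    have "PIdl (a [^] Suc k) \<subseteq> PIdl (a [^] k)" for k :: nat
    proof
      fix z assume "z \<in> PIdl (a [^] Suc k)"
      then obtain c where c: "c \<in> carrier R" "z = c \<otimes> (a [^] Suc k)" unfolding cgenideal_def by blast
      then have "z = (c \<otimes> a) \<otimes> a [^] k" using a by (simp add: m_ac)
      then show "z \<in> PIdl (a [^] k)" using c a unfolding cgenideal_def by blast
    qed
    moreover have "ideal (PIdl (a [^] k)) R" for k :: nat using a by (intro cgenideal_ideal) simp
    ultimately have "\<exists>k::nat. \<forall>l\<ge>k. PIdl (a [^] l) = PIdl (a [^] k)"
      by (intro mp[OF art[unfolded artinian_def, THEN spec, of "\<lambda>k::nat. PIdl (a [^] k)"]] conjI allI)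
    then obtain k :: nat where k: "\<forall>l\<ge>k. PIdl (a [^] l) = PIdl (a [^] k)" by blast
    have "PIdl (a [^] Suc k) = PIdl (a [^] k)" using k[THEN spec, of "Suc k"] by (rule mp) simp
    moreover have "a [^] k \<in> PIdl (a [^] k)" using a by (intro cgenideal_self) simp
    ultimately have "a [^] k \<in> PIdl (a [^] Suc k)" by (rule ssubst)
    then obtain b where b: "b \<in> carrier R" "a [^] k = b \<otimes> (a [^] Suc k)" unfolding cgenideal_def by blast
    have "b \<otimes> (a \<otimes> z) = z" if z: "z \<in> I" for z
    proof -
      obtain w where w: "w \<in> I" "z = a [^] k \<otimes> w" using pw[of k] z by blast
      have wc: "w \<in> carrier R" using w I.Icarr by blast
      have "b \<otimes> (a \<otimes> (p \<otimes> w)) = (b \<otimes> (p \<otimes> a)) \<otimes> w" if "p \<in> carrier R" for p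
        using that a(1) b(1) wc by (simp add: m_ac)
      from this[of "a [^] k"] have "b \<otimes> (a \<otimes> z) = (b \<otimes> (a [^] Suc k)) \<otimes> w"
        using a(1) unfolding w(2) by simp
      then show ?thesis unfolding b(2)[symmetric] w(2) .
    qed
    then show ?thesis using b by blast
  qed
  \<comment> \<open>Maximality of J puts x into J + R y, say x = j + a y. Since x is not in J, a y
    is nonzero, so a is invertible on I by \<open>dich\<close> and \<open>inv\<close>, and the
    equation can be solved for y.\<close>
  have JI: "y \<in> {j \<oplus> a \<otimes> x | j a. j \<in> J \<and> a \<in> carrier R}" if y: "y \<in> I" "y \<notin> J" for y
  proof -
    have yc: "y \<in> carrier R" using y I.Icarr by blast
    let ?K = "{j \<oplus> a \<otimes> y | j a. j \<in> J \<and> a \<in> carrier R}"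
    note K = ideal_add_principal[OF J(1) yc]
    have "j \<oplus> a \<otimes> y \<in> I" if "j \<in> J" "a \<in> carrier R" for j a
      using I.a_closed[OF subsetD[OF J(2) that(1)] I.I_l_closed[OF y(1) that(2)]] .
    then have "?K \<subseteq> I" by blast
    have "x \<in> ?K"
    proof (rule ccontr)
      assume "x \<notin> ?K"
      from J_max[OF K(1) \<open>?K \<subseteq> I\<close> this K(2)] show False using K(3) y(2) by simp
    qed
    then obtain j a where ja: "x = j \<oplus> a \<otimes> y" "j \<in> J" "a \<in> carrier R" by blast
    have jc: "j \<in> carrier R" using ja J.Icarr by blast
    have "a \<otimes> y \<noteq> \<zero>"
    proof
      assume "a \<otimes> y = \<zero>"
      then have "x = j" using ja(1) jc by simp
      then show False using ja(2) J(3) by simp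
    qed
    then have "(\<otimes>) a ` I = I" using dich[OF ja(3)] y(1) by blast
    then obtain b where b: "b \<in> carrier R" "b \<otimes> (a \<otimes> y) = y" using inv[OF ja(3)] y(1) by blast
    have "\<ominus> (b \<otimes> j) \<oplus> b \<otimes> x = \<ominus> (b \<otimes> j) \<oplus> (b \<otimes> j \<oplus> y)"
      unfolding ja(1) using r_distr[of j "a \<otimes> y" b] jc ja(3) yc b by simp
    then have "y = \<ominus> (b \<otimes> j) \<oplus> b \<otimes> x" using yc jc b(1) by (simp add: r_neg1)
    moreover have "\<ominus> (b \<otimes> j) \<in> J" using J.I_l_closed[OF ja(2) b(1)] by simp
    ultimately show ?thesis using b by blast
  qed
  \<comment> \<open>J is a proper part of I and hence finitely generated by minimality of I;
    together with x it generates I, the contradiction sought.\<close>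
  have "J \<noteq> I" using J x by blast
  then have "fg J" using I_min J by blast
  then obtain A where A: "A \<subseteq> carrier R" "finite A" "J = Idl A" unfolding fg_def by blast
  have xA: "insert x A \<subseteq> carrier R" using A xc by simp
  interpret K: ideal "Idl (insert x A)" R by (rule genideal_ideal[OF xA])
  have "A \<subseteq> I" using A(3) J(2) genideal_self[OF A(1)] by blast
  then have "Idl (insert x A) \<subseteq> I" using x by (intro genideal_minimal I) auto
  moreover have "I \<subseteq> Idl (insert x A)"
  proof
    fix y assume y: "y \<in> I"
    have JK: "J \<subseteq> Idl (insert x A)" unfolding A(3) using genideal_self[OF xA] by (intro genideal_minimal K.is_ideal) auto
    show "y \<in> Idl (insert x A)"
    proof (cases "y \<in> J")
      case False
      then obtain j a where "y = j \<oplus> a \<otimes> x" "j \<in> J" "a \<in> carrier R" using JI y by blast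
      then show ?thesis using JK K.I_l_closed genideal_self[OF xA] by auto
    qed (use JK in blast)
  qed
  ultimately have "fg I" unfolding fg_def using xA A(2) by blast
  then show False using I by simp
qed

section \<open>Submodules of finitely generated modules\<close>

context module
begin

text \<open>The span grows by one scalar multiple of a generator at a time, so induction on
  membership takes the place of finite linear combinations.\<close>

inductive_set rspan for U where
  zero: "\<zero>\<^bsub>M\<^esub> \<in> rspan U"
| step: "x \<in> rspan U \<Longrightarrow> u \<in> U \<Longrightarrow> r \<in> carrier R \<Longrightarrow> x \<oplus>\<^bsub>M\<^esub> r \<odot>\<^bsub>M\<^esub> u \<in> rspan U"

lemma rspan_carrier:
  assumes "U \<subseteq> carrier M" "x \<in> rspan U"
  shows "x \<in> carrier M"
  using assms(2) by induction (use assms(1) in auto)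

lemma rspan_add:
  assumes "U \<subseteq> carrier M" "x \<in> rspan U" "y \<in> rspan U"
  shows "x \<oplus>\<^bsub>M\<^esub> y \<in> rspan U"
  using assms(3)
proof induction
  case zero
  then show ?case using assms rspan_carrier[OF assms(1)] by simp
next
  case (step y u r)
  have "x \<oplus>\<^bsub>M\<^esub> (y \<oplus>\<^bsub>M\<^esub> r \<odot>\<^bsub>M\<^esub> u) = (x \<oplus>\<^bsub>M\<^esub> y) \<oplus>\<^bsub>M\<^esub> r \<odot>\<^bsub>M\<^esub> u"
    using step assms rspan_carrier[OF assms(1)] by (intro M.a_assoc[symmetric]) auto
  then show ?case using step rspan.step by simp
qed

lemma rspan_smult:
  assumes "U \<subseteq> carrier M" "x \<in> rspan U" "s \<in> carrier R"
  shows "s \<odot>\<^bsub>M\<^esub> x \<in> rspan U"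
  using assms(2)
proof induction
  case zero
  then show ?case using assms by (simp add: rspan.zero)
next
  case (step x u r)
  have "s \<odot>\<^bsub>M\<^esub> (x \<oplus>\<^bsub>M\<^esub> r \<odot>\<^bsub>M\<^esub> u) = s \<odot>\<^bsub>M\<^esub> x \<oplus>\<^bsub>M\<^esub> (s \<otimes> r) \<odot>\<^bsub>M\<^esub> u"
    using step assms rspan_carrier[OF assms(1)] by (auto simp: smult_r_distr smult_assoc1)
  then show ?case using step assms rspan.step by simp
qed

lemma rspan_base:
  assumes "U \<subseteq> carrier M" "u \<in> U"
  shows "u \<in> rspan U"
proof -
  have "u = \<zero>\<^bsub>M\<^esub> \<oplus>\<^bsub>M\<^esub> \<one> \<odot>\<^bsub>M\<^esub> u" using assms by auto
  then show ?thesis using rspan.step[OF rspan.zero assms(2) R.one_closed] by simp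
qed

lemma rspan_submodule:
  assumes "U \<subseteq> carrier M"
  shows "submodule (rspan U) R M"
proof (rule submoduleI)
  fix a assume a: "a \<in> rspan U"
  have "(\<ominus> \<one>) \<odot>\<^bsub>M\<^esub> a = \<ominus>\<^bsub>M\<^esub> a" using rspan_carrier[OF assms a] by (simp add: smult_l_minus)
  then show "\<ominus>\<^bsub>M\<^esub> a \<in> rspan U" using rspan_smult[OF assms a, of "\<ominus> \<one>"] by simp
qed (auto intro: rspan.zero rspan_add[OF assms] rspan_smult[OF assms] rspan_carrier[OF assms])

lemma rspan_minimal:
  assumes "submodule N R M" "U \<subseteq> N"
  shows "rspan U \<subseteq> N"
proof
  fix x assume "x \<in> rspan U"
  then show "x \<in> N"
  proof induction
    case zero
    show ?case using submodule.axioms(1)[OF assms(1)] subgroup.one_closed by fastforce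
  next
    case (step x u r)
    then show ?case using submoduleE[OF assms(1)] assms(2) by auto
  qed
qed

text \<open>For a new generator u, the coefficients at u of elements of N form an ideal, which has
  finitely many generators. Elements of N realising these (F1), together with generators F2 of the
  part of N inside \<open>rspan U\<close>, generate N.\<close>

lemma noetherian_submodule:
  assumes noeth: "noetherian_ring R" and "finite U" "U \<subseteq> carrier M" "submodule N R M" "N \<subseteq> rspan U"
  shows "\<exists>F. finite F \<and> F \<subseteq> N \<and> N = rspan F"
  using assms(2-)
proof (induction U arbitrary: N rule: finite_induct)
  case empty
  have "x = \<zero>\<^bsub>M\<^esub>" if "x \<in> rspan {}" for x using that by induction auto
  then have "N \<subseteq> rspan {}" using empty by auto
  moreover have "rspan {} \<subseteq> N" using rspan_minimal[of N "{}"] empty by auto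
  ultimately show ?case by blast
next
  case (insert u U)
  have uc: "u \<in> carrier M" and U: "U \<subseteq> carrier M" using insert by auto
  note sU = submoduleE[OF rspan_submodule[OF U]] and sN = submoduleE[OF insert.prems(2)]
  \<comment> \<open>Coefficients at u of elements of H, modulo \<open>rspan U\<close>. H is kept
    arbitrary because J is applied both to N and to \<open>rspan F1\<close>.\<close>
  define J where "J H = {r \<in> carrier R. \<exists>y\<in>rspan U. r \<odot>\<^bsub>M\<^esub> u \<oplus>\<^bsub>M\<^esub> y \<in> H}" for H
  have J: "ideal (J H) R" if H: "submodule H R M" for H
  proof (rule idealI[OF R.ring_axioms])
    note sH = submoduleE[OF H]
    show "subgroup (J H) (add_monoid R)"
    proof (rule R.add.subgroupI)
      show "J H \<subseteq> carrier R" by (auto simp: J_def)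
      have "\<zero> \<odot>\<^bsub>M\<^esub> u \<oplus>\<^bsub>M\<^esub> \<zero>\<^bsub>M\<^esub> \<in> H"
        using uc submodule.axioms(1)[OF H] subgroup.one_closed by fastforce
      then show "J H \<noteq> {}" unfolding J_def using rspan.zero by blast
    next
      fix a assume "a \<in> J H"
      then obtain y where a: "a \<in> carrier R" "y \<in> rspan U" "a \<odot>\<^bsub>M\<^esub> u \<oplus>\<^bsub>M\<^esub> y \<in> H" by (auto simp: J_def)
      have "\<ominus>\<^bsub>M\<^esub> (a \<odot>\<^bsub>M\<^esub> u \<oplus>\<^bsub>M\<^esub> y) = (\<ominus> a) \<odot>\<^bsub>M\<^esub> u \<oplus>\<^bsub>M\<^esub> \<ominus>\<^bsub>M\<^esub> y"
        using a uc rspan_carrier[OF U] by (simp add: smult_l_minus M.minus_add)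
      then have "(\<ominus> a) \<odot>\<^bsub>M\<^esub> u \<oplus>\<^bsub>M\<^esub> \<ominus>\<^bsub>M\<^esub> y \<in> H" using sH(3)[OF a(3)] by simp
      then show "\<ominus> a \<in> J H" unfolding J_def using a sU(3) by blast
    next
      fix a b assume "a \<in> J H" "b \<in> J H"
      then obtain y z where a: "a \<in> carrier R" "y \<in> rspan U" "a \<odot>\<^bsub>M\<^esub> u \<oplus>\<^bsub>M\<^esub> y \<in> H"
        and b: "b \<in> carrier R" "z \<in> rspan U" "b \<odot>\<^bsub>M\<^esub> u \<oplus>\<^bsub>M\<^esub> z \<in> H" by (auto simp: J_def)
      have "(a \<odot>\<^bsub>M\<^esub> u \<oplus>\<^bsub>M\<^esub> y) \<oplus>\<^bsub>M\<^esub> (b \<odot>\<^bsub>M\<^esub> u \<oplus>\<^bsub>M\<^esub> z) = (a \<oplus> b) \<odot>\<^bsub>M\<^esub> u \<oplus>\<^bsub>M\<^esub> (y \<oplus>\<^bsub>M\<^esub> z)"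
        using a b uc rspan_carrier[OF U] by (simp add: smult_l_distr M.a_ac)
      then have "(a \<oplus> b) \<odot>\<^bsub>M\<^esub> u \<oplus>\<^bsub>M\<^esub> (y \<oplus>\<^bsub>M\<^esub> z) \<in> H" using sH(5)[OF a(3) b(3)] by simp
      then show "a \<oplus> b \<in> J H" unfolding J_def using a b sU(5) by blast
    qed
  next
    note sH = submoduleE[OF H]
    fix a x assume "a \<in> J H" and x: "x \<in> carrier R"
    then obtain y where a: "a \<in> carrier R" "y \<in> rspan U" "a \<odot>\<^bsub>M\<^esub> u \<oplus>\<^bsub>M\<^esub> y \<in> H" by (auto simp: J_def)
    have "x \<odot>\<^bsub>M\<^esub> (a \<odot>\<^bsub>M\<^esub> u \<oplus>\<^bsub>M\<^esub> y) = (x \<otimes> a) \<odot>\<^bsub>M\<^esub> u \<oplus>\<^bsub>M\<^esub> x \<odot>\<^bsub>M\<^esub> y"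
      using a x uc rspan_carrier[OF U] by (simp add: smult_r_distr smult_assoc1)
    then have "(x \<otimes> a) \<odot>\<^bsub>M\<^esub> u \<oplus>\<^bsub>M\<^esub> x \<odot>\<^bsub>M\<^esub> y \<in> H" using sH(4)[OF x a(3)] by simp
    then have "x \<otimes> a \<in> J H" unfolding J_def using a x sU(4) by blast
    then show "x \<otimes> a \<in> J H" "a \<otimes> x \<in> J H" using a x R.m_comm by auto
  qed
  obtain A where A: "A \<subseteq> carrier R" "finite A" "J N = Idl A"
    using noetherian_ring.finetely_gen[OF noeth J[OF insert.prems(2)]] by blast
  have "\<forall>r\<in>A. \<exists>y. y \<in> rspan U \<and> r \<odot>\<^bsub>M\<^esub> u \<oplus>\<^bsub>M\<^esub> y \<in> N"
    using R.genideal_self[OF A(1)] A(3) by (auto simp: J_def)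
  then obtain g where g: "\<And>r. r \<in> A \<Longrightarrow> g r \<in> rspan U \<and> r \<odot>\<^bsub>M\<^esub> u \<oplus>\<^bsub>M\<^esub> g r \<in> N" by metis
  define F1 where "F1 = (\<lambda>r. r \<odot>\<^bsub>M\<^esub> u \<oplus>\<^bsub>M\<^esub> g r) ` A"
  have F1: "finite F1" "F1 \<subseteq> N" "F1 \<subseteq> carrier M" using g A sN(1) by (auto simp: F1_def)
  have "submodule (N \<inter> rspan U) R M"
  proof (rule submoduleI)
    show "\<zero>\<^bsub>M\<^esub> \<in> N \<inter> rspan U"
      using submodule.axioms(1)[OF insert.prems(2)] subgroup.one_closed rspan.zero by fastforce
  qed (use sN sU in auto)
  then obtain F2 where F2: "finite F2" "F2 \<subseteq> N \<inter> rspan U" "N \<inter> rspan U = rspan F2"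
    using insert.IH[of "N \<inter> rspan U"] U by blast
  have F: "F1 \<union> F2 \<subseteq> carrier M" using F1 F2 sN(1) by auto
  note sF = submoduleE[OF rspan_submodule[OF F]]
  have "rspan F1 \<subseteq> N" using rspan_minimal[OF insert.prems(2) F1(2)] .
  have m1: "rspan F1 \<subseteq> rspan (F1 \<union> F2)" and m2: "rspan F2 \<subseteq> rspan (F1 \<union> F2)"
    using rspan_base[OF F] by (intro rspan_minimal rspan_submodule F; blast)+
  have "N \<subseteq> rspan (F1 \<union> F2)"
  proof
    fix n assume n: "n \<in> N"
    have "\<exists>y\<in>rspan U. \<exists>r\<in>carrier R. x = r \<odot>\<^bsub>M\<^esub> u \<oplus>\<^bsub>M\<^esub> y" if "x \<in> rspan (insert u U)" for x
      using that
    proof induction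
      case zero
      have "\<zero>\<^bsub>M\<^esub> = \<zero> \<odot>\<^bsub>M\<^esub> u \<oplus>\<^bsub>M\<^esub> \<zero>\<^bsub>M\<^esub>" using uc by simp
      then show ?case using rspan.zero by blast
    next
      case (step x v s)
      then obtain y r where yr: "y \<in> rspan U" "r \<in> carrier R" "x = r \<odot>\<^bsub>M\<^esub> u \<oplus>\<^bsub>M\<^esub> y" by blast
      note yc = rspan_carrier[OF U yr(1)]
      show ?case
      proof (cases "v = u")
        case True
        then have "x \<oplus>\<^bsub>M\<^esub> s \<odot>\<^bsub>M\<^esub> v = (r \<oplus> s) \<odot>\<^bsub>M\<^esub> u \<oplus>\<^bsub>M\<^esub> y"
          using yr yc step uc by (simp add: smult_l_distr M.a_ac)
        then show ?thesis using yr step by blast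
      next
        case False
        then have v: "v \<in> U" using step by blast
        then have "x \<oplus>\<^bsub>M\<^esub> s \<odot>\<^bsub>M\<^esub> v = r \<odot>\<^bsub>M\<^esub> u \<oplus>\<^bsub>M\<^esub> (y \<oplus>\<^bsub>M\<^esub> s \<odot>\<^bsub>M\<^esub> v)"
          using yr yc step uc U by (intro trans[OF _ M.a_assoc]) auto
        moreover have "y \<oplus>\<^bsub>M\<^esub> s \<odot>\<^bsub>M\<^esub> v \<in> rspan U" using rspan.step[OF yr(1) v step(3)] .
        ultimately show ?thesis using yr by blast
      qed
    qed
    then obtain y r where yr: "y \<in> rspan U" "r \<in> carrier R" "n = r \<odot>\<^bsub>M\<^esub> u \<oplus>\<^bsub>M\<^esub> y"
      using n insert.prems by blast
    then have "r \<in> J N" using n by (auto simp: J_def)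
    \<comment> \<open>\<open>J (rspan F1)\<close> is an ideal containing the generators of
      \<open>J N\<close>, so every coefficient occurring in N is realised within
      \<open>rspan F1\<close>.\<close>
    moreover have "A \<subseteq> J (rspan F1)"
      using rspan_base[OF F1(3)] A(1) g by (fastforce simp: J_def F1_def)
    ultimately have "r \<in> J (rspan F1)"
      using R.genideal_minimal[OF J[OF rspan_submodule[OF F1(3)]]] A(3) by blast
    then obtain y' where y': "y' \<in> rspan U" "r \<odot>\<^bsub>M\<^esub> u \<oplus>\<^bsub>M\<^esub> y' \<in> rspan F1" by (auto simp: J_def)
    let ?m = "r \<odot>\<^bsub>M\<^esub> u \<oplus>\<^bsub>M\<^esub> y'"
    have yc: "y \<in> carrier M" "y' \<in> carrier M" using yr y' rspan_carrier[OF U] by auto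
    \<comment> \<open>Subtracting an element of \<open>rspan F1\<close> with the same coefficient at
      u leaves an element of N inside \<open>rspan U\<close>, which F2 generates.\<close>
    have eq: "n \<oplus>\<^bsub>M\<^esub> \<ominus>\<^bsub>M\<^esub> ?m = y \<oplus>\<^bsub>M\<^esub> \<ominus>\<^bsub>M\<^esub> y'"
      using yr y' yc uc by (simp add: M.minus_add M.a_ac M.r_neg1 M.r_neg2 M.r_neg)
    have "n \<oplus>\<^bsub>M\<^esub> \<ominus>\<^bsub>M\<^esub> ?m \<in> N" using n y' \<open>rspan F1 \<subseteq> N\<close> sN by blast
    moreover have "y \<oplus>\<^bsub>M\<^esub> \<ominus>\<^bsub>M\<^esub> y' \<in> rspan U" using yr y' sU by blast
    ultimately have "n \<oplus>\<^bsub>M\<^esub> \<ominus>\<^bsub>M\<^esub> ?m \<in> rspan (F1 \<union> F2)" using F2 m2 eq by auto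
    then have "n \<oplus>\<^bsub>M\<^esub> \<ominus>\<^bsub>M\<^esub> ?m \<oplus>\<^bsub>M\<^esub> ?m \<in> rspan (F1 \<union> F2)" using sF(5) y' m1 by blast
    moreover have "n \<oplus>\<^bsub>M\<^esub> \<ominus>\<^bsub>M\<^esub> ?m \<oplus>\<^bsub>M\<^esub> ?m = n" using n sN(1) yc uc yr by (simp add: M.a_assoc M.l_neg subset_iff)
    ultimately show "n \<in> rspan (F1 \<union> F2)" by simp
  qed
  moreover have "rspan (F1 \<union> F2) \<subseteq> N" using F1 F2 by (intro rspan_minimal insert.prems) auto
  ultimately show ?case using F1 F2 by (metis Un_subset_iff finite_Un le_inf_iff subset_antisym)
qed

end

section \<open>Right modules and restriction of scalars to the base ring\<close>

lemma right_submodule_right_module: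
  assumes M: "right_module L M" and N: "submodule N L M"
  shows "right_module L (M\<lparr>carrier := N\<rparr>)"
proof -
  interpret right_module L M by fact
  interpret N: submodule N L M by fact
  have sub: "N \<subseteq> carrier M" using N.subset by simp
  have "comm_group ((add_monoid M)\<lparr>carrier := N\<rparr>)"
    using M.add.subgroup_imp_group[OF N.subgroup_axioms] sub M.a_comm
    by (intro group.group_comm_groupI) auto
  then have "abelian_group (M\<lparr>carrier := N\<rparr>)"
    by (intro abelian_group.intro abelian_monoid.intro abelian_group_axioms.intro) (auto simp: comm_group_def)
  then show ?thesis
    using sub by (intro right_module.intro right_module_axioms.intro L.ring_axioms)
      (auto simp: subset_iff ract_add_scalar ract_add ract_assoc ract_one)
qed

context right_module
begin

lemma ract_zero: "a \<in> carrier L \<Longrightarrow> a \<odot>\<^bsub>M\<^esub> \<zero>\<^bsub>M\<^esub> = \<zero>\<^bsub>M\<^esub>"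
  using ract_add[of a "\<zero>\<^bsub>M\<^esub>" "\<zero>\<^bsub>M\<^esub>"] M.add.l_cancel_one'[of "a \<odot>\<^bsub>M\<^esub> \<zero>\<^bsub>M\<^esub>" "a \<odot>\<^bsub>M\<^esub> \<zero>\<^bsub>M\<^esub>"]
  by (simp add: ract_closed)

lemma ract_zero_scalar: "x \<in> carrier M \<Longrightarrow> \<zero>\<^bsub>L\<^esub> \<odot>\<^bsub>M\<^esub> x = \<zero>\<^bsub>M\<^esub>"
  using ract_add_scalar[of "\<zero>\<^bsub>L\<^esub>" "\<zero>\<^bsub>L\<^esub>" x] M.add.l_cancel_one'[of "\<zero>\<^bsub>L\<^esub> \<odot>\<^bsub>M\<^esub> x" "\<zero>\<^bsub>L\<^esub> \<odot>\<^bsub>M\<^esub> x"]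
  by (simp add: ract_closed)

lemma ract_minus_scalar:
  assumes "a \<in> carrier L" "x \<in> carrier M"
  shows "(\<ominus>\<^bsub>L\<^esub> a) \<odot>\<^bsub>M\<^esub> x = \<ominus>\<^bsub>M\<^esub> (a \<odot>\<^bsub>M\<^esub> x)"
  using ract_add_scalar[of "\<ominus>\<^bsub>L\<^esub> a" a x] assms
  by (intro M.minus_equality[symmetric]) (auto simp: L.l_neg ract_closed ract_zero_scalar)

lemma ract_minus:
  assumes "a \<in> carrier L" "x \<in> carrier M"
  shows "a \<odot>\<^bsub>M\<^esub> (\<ominus>\<^bsub>M\<^esub> x) = \<ominus>\<^bsub>M\<^esub> (a \<odot>\<^bsub>M\<^esub> x)"
  using ract_add[of a "\<ominus>\<^bsub>M\<^esub> x" x] assms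
  by (intro M.minus_equality[symmetric]) (auto simp: M.l_neg ract_closed ract_zero)

lemma right_submoduleI:
  assumes "H \<subseteq> carrier M" "\<zero>\<^bsub>M\<^esub> \<in> H"
    and add: "\<And>x y. x \<in> H \<Longrightarrow> y \<in> H \<Longrightarrow> x \<oplus>\<^bsub>M\<^esub> y \<in> H"
    and smult: "\<And>a x. a \<in> carrier L \<Longrightarrow> x \<in> H \<Longrightarrow> a \<odot>\<^bsub>M\<^esub> x \<in> H"
  shows "submodule H L M"
proof -
  have "subgroup H (add_monoid M)"
  proof (rule M.add.subgroupI)
    fix x assume x: "x \<in> H"
    then have "x \<in> carrier M" using assms(1) by blast
    then have "(\<ominus>\<^bsub>L\<^esub> \<one>\<^bsub>L\<^esub>) \<odot>\<^bsub>M\<^esub> x = \<ominus>\<^bsub>M\<^esub> x" by (simp add: ract_minus_scalar ract_one)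
    then show "\<ominus>\<^bsub>M\<^esub> x \<in> H" using smult[of "\<ominus>\<^bsub>L\<^esub> \<one>\<^bsub>L\<^esub>" x] x by simp
  qed (use assms in auto)
  then show ?thesis using smult by (simp add: submodule_def submodule_axioms_def)
qed

lemma right_submoduleE:
  assumes "submodule H L M"
  shows "H \<subseteq> carrier M" "\<zero>\<^bsub>M\<^esub> \<in> H"
    and "\<And>x y. x \<in> H \<Longrightarrow> y \<in> H \<Longrightarrow> x \<oplus>\<^bsub>M\<^esub> y \<in> H"
    and "\<And>a x. a \<in> carrier L \<Longrightarrow> x \<in> H \<Longrightarrow> a \<odot>\<^bsub>M\<^esub> x \<in> H"
    and "\<And>x. x \<in> H \<Longrightarrow> \<ominus>\<^bsub>M\<^esub> x \<in> H"
  using subgroup.subset[OF submodule.axioms(1)[OF assms]] subgroup.one_closed[OF submodule.axioms(1)[OF assms]]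
    subgroup.m_closed[OF submodule.axioms(1)[OF assms]] submodule.smult_closed[OF assms]
    subgroup.m_inv_closed[OF submodule.axioms(1)[OF assms]]
  by (simp_all add: a_inv_def)

end

text \<open>Restriction of scalars along r |-> r 1 from the base ring to the algebra.\<close>

definition base_module :: "('r, 'a, 'y) module_scheme \<Rightarrow> ('a, 'm) module \<Rightarrow> ('r, 'm) module" where
  "base_module A M = \<lparr>carrier = carrier M, monoid.mult = undefined, one = undefined,
     zero = \<zero>\<^bsub>M\<^esub>, add = (\<oplus>\<^bsub>M\<^esub>), smult = (\<lambda>r. smult M (r \<odot>\<^bsub>A\<^esub> \<one>\<^bsub>A\<^esub>))\<rparr>"

lemma base_module_simps [simp]:
  "carrier (base_module A M) = carrier M" "zero (base_module A M) = \<zero>\<^bsub>M\<^esub>"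
  "add (base_module A M) = (\<oplus>\<^bsub>M\<^esub>)" "smult (base_module A M) r = smult M (r \<odot>\<^bsub>A\<^esub> \<one>\<^bsub>A\<^esub>)"
  by (simp_all add: base_module_def)

lemma (in artin_algebra) right_module_base:
  assumes M: "right_module A M"
  shows "module R (base_module A M)"
proof -
  interpret X: right_module A M by (rule M)
  have ab: "abelian_group (base_module A M)"
    by (rule abelian_groupI) (auto simp: X.M.a_ac intro: X.M.l_neg X.M.a_inv_closed)
  show ?thesis
  proof (rule moduleI)
    fix a b x assume ab: "a \<in> carrier R" "b \<in> carrier R" and x: "x \<in> carrier (base_module A M)"
    \<comment> \<open>A right action applies the left factor of a product first, so acting by b and
      then by a is the action of (b 1)(a 1), and this product has to be identified with (a b)
      1.\<close>
    have "(b \<odot>\<^bsub>A\<^esub> \<one>\<^bsub>A\<^esub>) \<otimes>\<^bsub>A\<^esub> (a \<odot>\<^bsub>A\<^esub> \<one>\<^bsub>A\<^esub>) = (a \<otimes>\<^bsub>R\<^esub> b) \<odot>\<^bsub>A\<^esub> \<one>\<^bsub>A\<^esub>"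
      using ab by (simp add: smult_mult_right smult_assoc1)
    then show "(a \<otimes>\<^bsub>R\<^esub> b) \<odot>\<^bsub>base_module A M\<^esub> x =
      a \<odot>\<^bsub>base_module A M\<^esub> (b \<odot>\<^bsub>base_module A M\<^esub> x)"
      using X.ract_assoc[of "b \<odot>\<^bsub>A\<^esub> \<one>\<^bsub>A\<^esub>" "a \<odot>\<^bsub>A\<^esub> \<one>\<^bsub>A\<^esub>" x] ab x by simp
  qed (use ab in \<open>auto intro: R.is_cring simp: X.ract_closed X.ract_add X.ract_one smult_l_distr X.ract_add_scalar\<close>)
qed

text \<open>If T generates A over R and S generates M over A, then the products of S and T generate
  M over R. Over the noetherian ring R every submodule is finitely generated, and generators over R
  are generators over A.\<close>

theorem (in artin_algebra) fin_gen_submodule: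
  assumes M: "right_module A M" and fg: "fin_gen A M" and N: "submodule N A M"
  shows "fin_gen A (M\<lparr>carrier := N\<rparr>)"
proof -
  interpret X: right_module A M by (rule M)
  let ?B = "base_module A M"
  interpret B: module R ?B by (rule right_module_base[OF M])
  have inv: "\<ominus>\<^bsub>?B\<^esub> x = \<ominus>\<^bsub>M\<^esub> x" if "x \<in> carrier M" for x
    using that by (intro B.minus_equality) (auto simp: X.M.l_neg)
  have noeth: "noetherian_ring R" using R.artinian_imp_noetherian base_artinian .
  obtain T where T: "finite T" "T \<subseteq> carrier A"
    "\<And>N. submodule N R A \<Longrightarrow> T \<subseteq> N \<Longrightarrow> N = carrier A"
    using fin_gen_base unfolding fin_gen_def by blast
  obtain S where S: "finite S" "S \<subseteq> carrier M"
    "\<And>N. submodule N A M \<Longrightarrow> S \<subseteq> N \<Longrightarrow> N = carrier M"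
    using fg unfolding fin_gen_def by blast
  define U where "U = (\<lambda>(t, s). t \<odot>\<^bsub>M\<^esub> s) ` (T \<times> S)"
  have U: "finite U" "U \<subseteq> carrier M" using T(1,2) S(1,2) X.ract_closed by (auto simp: U_def subset_iff)
  then have U': "U \<subseteq> carrier ?B" by simp
  note K = B.submoduleE[OF B.rspan_submodule[OF U']]
  have Kneg: "\<ominus>\<^bsub>M\<^esub> y \<in> B.rspan U" if "y \<in> B.rspan U" for y
  proof -
    have "y \<in> carrier M" using K(1) that by auto
    then show ?thesis using K(3)[OF that] inv[of y] by simp
  qed
  \<comment> \<open>The elements of A that send s into the span form an R-submodule of A containing
    T, hence they exhaust A.\<close>
  have As: "a \<odot>\<^bsub>M\<^esub> s \<in> B.rspan U" if a: "a \<in> carrier A" and s: "s \<in> S" for a s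
  proof -
    have sc: "s \<in> carrier M" using s S by blast
    have "submodule {a \<in> carrier A. a \<odot>\<^bsub>M\<^esub> s \<in> B.rspan U} R A"
    proof (rule submoduleI)
      show "\<zero>\<^bsub>A\<^esub> \<in> {a \<in> carrier A. a \<odot>\<^bsub>M\<^esub> s \<in> B.rspan U}"
        using B.rspan.zero[of U] by (simp add: X.ract_zero_scalar[OF sc])
    next
      fix r b assume "r \<in> carrier R" "b \<in> {a \<in> carrier A. a \<odot>\<^bsub>M\<^esub> s \<in> B.rspan U}"
      moreover from this have "r \<odot>\<^bsub>A\<^esub> b = b \<otimes>\<^bsub>A\<^esub> (r \<odot>\<^bsub>A\<^esub> \<one>\<^bsub>A\<^esub>)" by (simp add: smult_mult_right)
      ultimately show "r \<odot>\<^bsub>A\<^esub> b \<in> {a \<in> carrier A. a \<odot>\<^bsub>M\<^esub> s \<in> B.rspan U}"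
        using K(4)[of r "b \<odot>\<^bsub>M\<^esub> s"] sc by (simp add: X.ract_assoc)
    qed (use sc Kneg K(5) in \<open>auto simp: X.ract_minus_scalar X.ract_add_scalar X.ract_closed\<close>)
    moreover have "T \<subseteq> {a \<in> carrier A. a \<odot>\<^bsub>M\<^esub> s \<in> B.rspan U}"
      using T(2) s B.rspan_base[OF U'] by (auto simp: U_def)
    ultimately show ?thesis using T(3) a by blast
  qed
  \<comment> \<open>The span is formed over R and has to be stable under A. The elements r 1 commute
    with b, so the action of b passes them and merely replaces t by the product t b, which
    \<open>As\<close> covers.\<close>
  have Ab: "b \<odot>\<^bsub>M\<^esub> x \<in> B.rspan U" if "x \<in> B.rspan U" "b \<in> carrier A" for x b
    using that
  proof (induction)
    case zero
    then show ?case using X.ract_zero B.rspan.zero[of U] by simp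
  next
    case (step x u r)
    obtain t s where ts: "t \<in> T" "s \<in> S" "u = t \<odot>\<^bsub>M\<^esub> s" using step by (auto simp: U_def)
    then have c: "t \<in> carrier A" "s \<in> carrier M" "x \<in> carrier M" "u \<in> carrier M"
      using T(2) S(2) B.rspan_carrier[OF U' step(1)] U step by auto
    have comm: "(r \<odot>\<^bsub>A\<^esub> \<one>\<^bsub>A\<^esub>) \<otimes>\<^bsub>A\<^esub> b = b \<otimes>\<^bsub>A\<^esub> (r \<odot>\<^bsub>A\<^esub> \<one>\<^bsub>A\<^esub>)"
      using step by (simp add: smult_mult_left smult_mult_right)
    have "b \<odot>\<^bsub>M\<^esub> ((r \<odot>\<^bsub>A\<^esub> \<one>\<^bsub>A\<^esub>) \<odot>\<^bsub>M\<^esub> u) = (r \<odot>\<^bsub>A\<^esub> \<one>\<^bsub>A\<^esub>) \<odot>\<^bsub>M\<^esub> (b \<odot>\<^bsub>M\<^esub> u)"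
      using step c comm X.ract_assoc[of "r \<odot>\<^bsub>A\<^esub> \<one>\<^bsub>A\<^esub>" b u] X.ract_assoc[of b "r \<odot>\<^bsub>A\<^esub> \<one>\<^bsub>A\<^esub>" u]
      by simp
    also have "b \<odot>\<^bsub>M\<^esub> u = (t \<otimes>\<^bsub>A\<^esub> b) \<odot>\<^bsub>M\<^esub> s" using c step ts by (simp add: X.ract_assoc)
    finally have "b \<odot>\<^bsub>M\<^esub> (x \<oplus>\<^bsub>M\<^esub> (r \<odot>\<^bsub>A\<^esub> \<one>\<^bsub>A\<^esub>) \<odot>\<^bsub>M\<^esub> u) =
      b \<odot>\<^bsub>M\<^esub> x \<oplus>\<^bsub>M\<^esub> (r \<odot>\<^bsub>A\<^esub> \<one>\<^bsub>A\<^esub>) \<odot>\<^bsub>M\<^esub> ((t \<otimes>\<^bsub>A\<^esub> b) \<odot>\<^bsub>M\<^esub> s)"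
      using step c by (simp add: X.ract_add X.ract_closed)
    moreover have "(t \<otimes>\<^bsub>A\<^esub> b) \<odot>\<^bsub>M\<^esub> s \<in> B.rspan U" using As ts c step by simp
    ultimately show ?case using K(4,5) step by simp
  qed
  have "submodule (B.rspan U) A M"
    using K(1,5) B.rspan.zero[of U] Ab by (intro X.right_submoduleI) auto
  moreover have "S \<subseteq> B.rspan U" using As[of "\<one>\<^bsub>A\<^esub>"] S(2) X.ract_one by (metis one_closed subset_iff)
  ultimately have span: "B.rspan U = carrier M" by (rule S(3))
  have base: "submodule H R ?B" if "submodule H A M" for H
  proof (rule B.submoduleI)
    note E = X.right_submoduleE[OF that]
    show "\<ominus>\<^bsub>?B\<^esub> x \<in> H" if "x \<in> H" for x
    proof -
      have "x \<in> carrier M" using E(1) that by auto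
      then show ?thesis using E(5)[OF that] inv by simp
    qed
  qed (use X.right_submoduleE[OF that] in auto)
  interpret N: submodule N A M by fact
  have sub: "N \<subseteq> carrier M" using N.subset by simp
  then obtain F where F: "finite F" "F \<subseteq> N" "N = B.rspan F"
    using B.noetherian_submodule[OF noeth U(1) U' base[OF N]] unfolding span by blast
  show ?thesis unfolding fin_gen_def
  proof (intro exI[of _ F] conjI allI impI)
    fix H assume H: "submodule H A (M\<lparr>carrier := N\<rparr>) \<and> F \<subseteq> H"
    have "subgroup H ((add_monoid M)\<lparr>carrier := N\<rparr>)" using H by (simp add: submodule_def)
    then have "subgroup H (add_monoid M)"
      using X.add.incl_subgroup[OF N.subgroup_axioms] by simp
    moreover have "a \<odot>\<^bsub>M\<^esub> x \<in> H" if "a \<in> carrier A" "x \<in> H" for a x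
      using submodule.smult_closed[of H A "M\<lparr>carrier := N\<rparr>" a x] H that by simp
    ultimately have "submodule H A M" by (simp add: submodule_def submodule_axioms_def)
    then have "N \<subseteq> H" using B.rspan_minimal[OF base] F H by blast
    moreover have "H \<subseteq> N" using subgroup.subset[OF \<open>subgroup H ((add_monoid M)\<lparr>carrier := N\<rparr>)\<close>] by simp
    ultimately show "H = carrier (M\<lparr>carrier := N\<rparr>)" by simp
  qed (use F in auto)
qed

section \<open>Modules\<close>

text \<open>What an artin algebra contributes to the homological part: \<open>submodule_fg\<close>
  keeps cycles, boundaries and kernels of chain maps inside \<open>fgmod L\<close>.\<close>

locale noeth_mods =
  fixes L :: "('a, 'x) ring_scheme"
  assumes ring_L: "ring L"
    and submodule_fg: "M \<in> fgmod L \<Longrightarrow> submodule N L M \<Longrightarrow> M\<lparr>carrier := N\<rparr> \<in> fgmod L"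
begin

lemma fg_rm: "M \<in> fgmod L \<Longrightarrow> right_module L M"
  by (simp add: fgmod_def)

context
  fixes M :: "'a smod"
  assumes M: "M \<in> fgmod L"
begin

interpretation right_module L M by (rule fg_rm[OF M])

lemma fg_zero [simp]: "\<zero>\<^bsub>M\<^esub> \<in> carrier M" by simp
lemma fg_add [simp]: "x \<in> carrier M \<Longrightarrow> y \<in> carrier M \<Longrightarrow> x \<oplus>\<^bsub>M\<^esub> y \<in> carrier M" by simp
lemma fg_neg [simp]: "x \<in> carrier M \<Longrightarrow> \<ominus>\<^bsub>M\<^esub> x \<in> carrier M" by simp
lemma fg_minus [simp]: "x \<in> carrier M \<Longrightarrow> y \<in> carrier M \<Longrightarrow> x \<ominus>\<^bsub>M\<^esub> y \<in> carrier M" by simp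
lemma fg_smult [simp]: "a \<in> carrier L \<Longrightarrow> x \<in> carrier M \<Longrightarrow> a \<odot>\<^bsub>M\<^esub> x \<in> carrier M" by (rule ract_closed)
lemma fg_zero_add [simp]: "x \<in> carrier M \<Longrightarrow> \<zero>\<^bsub>M\<^esub> \<oplus>\<^bsub>M\<^esub> x = x" by simp
lemma fg_add_zero [simp]: "x \<in> carrier M \<Longrightarrow> x \<oplus>\<^bsub>M\<^esub> \<zero>\<^bsub>M\<^esub> = x" by simp
lemma fg_neg_zero [simp]: "\<ominus>\<^bsub>M\<^esub> \<zero>\<^bsub>M\<^esub> = \<zero>\<^bsub>M\<^esub>" by simp
lemma fg_neg_neg [simp]: "x \<in> carrier M \<Longrightarrow> \<ominus>\<^bsub>M\<^esub> (\<ominus>\<^bsub>M\<^esub> x) = x" by simp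
lemma fg_smult_zero [simp]: "a \<in> carrier L \<Longrightarrow> a \<odot>\<^bsub>M\<^esub> \<zero>\<^bsub>M\<^esub> = \<zero>\<^bsub>M\<^esub>" by (rule ract_zero)
lemma fg_smult_add: "a \<in> carrier L \<Longrightarrow> x \<in> carrier M \<Longrightarrow> y \<in> carrier M \<Longrightarrow>
    a \<odot>\<^bsub>M\<^esub> (x \<oplus>\<^bsub>M\<^esub> y) = a \<odot>\<^bsub>M\<^esub> x \<oplus>\<^bsub>M\<^esub> a \<odot>\<^bsub>M\<^esub> y" by (rule ract_add)
lemma fg_smult_neg: "a \<in> carrier L \<Longrightarrow> x \<in> carrier M \<Longrightarrow> a \<odot>\<^bsub>M\<^esub> (\<ominus>\<^bsub>M\<^esub> x) = \<ominus>\<^bsub>M\<^esub> (a \<odot>\<^bsub>M\<^esub> x)"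
  by (rule ract_minus)

lemma fg_minus_self [simp]: "x \<in> carrier M \<Longrightarrow> x \<ominus>\<^bsub>M\<^esub> x = \<zero>\<^bsub>M\<^esub>"
  by (simp add: a_minus_def M.r_neg)
lemma fg_minus_zero [simp]: "x \<in> carrier M \<Longrightarrow> x \<ominus>\<^bsub>M\<^esub> \<zero>\<^bsub>M\<^esub> = x"
  by (simp add: a_minus_def)
lemma fg_neg_unique: "x \<oplus>\<^bsub>M\<^esub> y = \<zero>\<^bsub>M\<^esub> \<Longrightarrow> x \<in> carrier M \<Longrightarrow> y \<in> carrier M \<Longrightarrow> x = \<ominus>\<^bsub>M\<^esub> y"
  using M.minus_equality by simp
lemma fg_minus_eq_zero: "x \<in> carrier M \<Longrightarrow> y \<in> carrier M \<Longrightarrow> x \<ominus>\<^bsub>M\<^esub> y = \<zero>\<^bsub>M\<^esub> \<longleftrightarrow> x = y"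
  by (metis M.a_inv_closed M.minus_eq M.minus_equality M.minus_minus M.r_neg)
lemma fg_neg_eq_zero [simp]: "x \<in> carrier M \<Longrightarrow> \<ominus>\<^bsub>M\<^esub> x = \<zero>\<^bsub>M\<^esub> \<longleftrightarrow> x = \<zero>\<^bsub>M\<^esub>"
  by (metis M.minus_minus fg_neg_zero)
lemma fg_add_left_cancel: "x \<in> carrier M \<Longrightarrow> y \<in> carrier M \<Longrightarrow> z \<in> carrier M \<Longrightarrow> x \<oplus>\<^bsub>M\<^esub> y = x \<oplus>\<^bsub>M\<^esub> z \<longleftrightarrow> y = z"
  by simp

lemma fg_c1:
  assumes "x \<in> carrier M" "y \<in> carrier M"
  shows "x \<oplus>\<^bsub>M\<^esub> (y \<oplus>\<^bsub>M\<^esub> \<ominus>\<^bsub>M\<^esub> x) = y" "\<ominus>\<^bsub>M\<^esub> x \<oplus>\<^bsub>M\<^esub> (y \<oplus>\<^bsub>M\<^esub> x) = y"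
proof -
  have "x \<oplus>\<^bsub>M\<^esub> (y \<oplus>\<^bsub>M\<^esub> \<ominus>\<^bsub>M\<^esub> x) = y \<oplus>\<^bsub>M\<^esub> (x \<oplus>\<^bsub>M\<^esub> \<ominus>\<^bsub>M\<^esub> x)" using assms by (intro M.a_lcomm) auto
  then show "x \<oplus>\<^bsub>M\<^esub> (y \<oplus>\<^bsub>M\<^esub> \<ominus>\<^bsub>M\<^esub> x) = y" using assms by (simp add: M.r_neg)
  have "\<ominus>\<^bsub>M\<^esub> x \<oplus>\<^bsub>M\<^esub> (y \<oplus>\<^bsub>M\<^esub> x) = y \<oplus>\<^bsub>M\<^esub> (\<ominus>\<^bsub>M\<^esub> x \<oplus>\<^bsub>M\<^esub> x)" using assms by (intro M.a_lcomm) auto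
  then show "\<ominus>\<^bsub>M\<^esub> x \<oplus>\<^bsub>M\<^esub> (y \<oplus>\<^bsub>M\<^esub> x) = y" using assms by (simp add: M.l_neg)
qed

lemma fg_c2:
  assumes "x \<in> carrier M" "y \<in> carrier M" "z \<in> carrier M"
  shows "x \<oplus>\<^bsub>M\<^esub> (y \<oplus>\<^bsub>M\<^esub> (\<ominus>\<^bsub>M\<^esub> x \<oplus>\<^bsub>M\<^esub> z)) = y \<oplus>\<^bsub>M\<^esub> z"
    "\<ominus>\<^bsub>M\<^esub> x \<oplus>\<^bsub>M\<^esub> (y \<oplus>\<^bsub>M\<^esub> (x \<oplus>\<^bsub>M\<^esub> z)) = y \<oplus>\<^bsub>M\<^esub> z"
  using fg_c1[of x y] assms
  by (metis M.a_assoc M.a_closed M.a_inv_closed)+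

lemma fg_c3:
  assumes "x \<in> carrier M" "y \<in> carrier M" "z \<in> carrier M"
  shows "x \<oplus>\<^bsub>M\<^esub> (y \<oplus>\<^bsub>M\<^esub> (z \<oplus>\<^bsub>M\<^esub> \<ominus>\<^bsub>M\<^esub> x)) = y \<oplus>\<^bsub>M\<^esub> z"
    "\<ominus>\<^bsub>M\<^esub> x \<oplus>\<^bsub>M\<^esub> (y \<oplus>\<^bsub>M\<^esub> (z \<oplus>\<^bsub>M\<^esub> x)) = y \<oplus>\<^bsub>M\<^esub> z"
  using fg_c1[of x "y \<oplus>\<^bsub>M\<^esub> z"] assms by (simp_all add: M.a_assoc)

lemma fg_c4:
  assumes "x \<in> carrier M" "y \<in> carrier M" "z \<in> carrier M" "w \<in> carrier M"
  shows "x \<oplus>\<^bsub>M\<^esub> (y \<oplus>\<^bsub>M\<^esub> (z \<oplus>\<^bsub>M\<^esub> (\<ominus>\<^bsub>M\<^esub> x \<oplus>\<^bsub>M\<^esub> w))) = y \<oplus>\<^bsub>M\<^esub> (z \<oplus>\<^bsub>M\<^esub> w)"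
    "\<ominus>\<^bsub>M\<^esub> x \<oplus>\<^bsub>M\<^esub> (y \<oplus>\<^bsub>M\<^esub> (z \<oplus>\<^bsub>M\<^esub> (x \<oplus>\<^bsub>M\<^esub> w))) = y \<oplus>\<^bsub>M\<^esub> (z \<oplus>\<^bsub>M\<^esub> w)"
  using fg_c2[of x "y \<oplus>\<^bsub>M\<^esub> z" w] assms by (simp_all add: M.a_assoc)

lemma fg_c5:
  assumes "x \<in> carrier M" "y \<in> carrier M" "z \<in> carrier M" "w \<in> carrier M"
  shows "x \<oplus>\<^bsub>M\<^esub> (y \<oplus>\<^bsub>M\<^esub> (z \<oplus>\<^bsub>M\<^esub> (w \<oplus>\<^bsub>M\<^esub> \<ominus>\<^bsub>M\<^esub> x))) = y \<oplus>\<^bsub>M\<^esub> (z \<oplus>\<^bsub>M\<^esub> w)"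
    "\<ominus>\<^bsub>M\<^esub> x \<oplus>\<^bsub>M\<^esub> (y \<oplus>\<^bsub>M\<^esub> (z \<oplus>\<^bsub>M\<^esub> (w \<oplus>\<^bsub>M\<^esub> x))) = y \<oplus>\<^bsub>M\<^esub> (z \<oplus>\<^bsub>M\<^esub> w)"
  using fg_c3[of x "y \<oplus>\<^bsub>M\<^esub> z" w] assms by (simp_all add: M.a_assoc)

lemma fg_c6:
  assumes "x \<in> carrier M" "y \<in> carrier M" "z \<in> carrier M" "w \<in> carrier M" "v \<in> carrier M"
  shows "x \<oplus>\<^bsub>M\<^esub> (y \<oplus>\<^bsub>M\<^esub> (z \<oplus>\<^bsub>M\<^esub> (w \<oplus>\<^bsub>M\<^esub> (\<ominus>\<^bsub>M\<^esub> x \<oplus>\<^bsub>M\<^esub> v)))) = y \<oplus>\<^bsub>M\<^esub> (z \<oplus>\<^bsub>M\<^esub> (w \<oplus>\<^bsub>M\<^esub> v))"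
    "\<ominus>\<^bsub>M\<^esub> x \<oplus>\<^bsub>M\<^esub> (y \<oplus>\<^bsub>M\<^esub> (z \<oplus>\<^bsub>M\<^esub> (w \<oplus>\<^bsub>M\<^esub> (x \<oplus>\<^bsub>M\<^esub> v)))) = y \<oplus>\<^bsub>M\<^esub> (z \<oplus>\<^bsub>M\<^esub> (w \<oplus>\<^bsub>M\<^esub> v))"
  using fg_c4[of x "y \<oplus>\<^bsub>M\<^esub> z" w v] assms by (simp_all add: M.a_assoc)

lemma fg_a_assoc: "x \<in> carrier M \<Longrightarrow> y \<in> carrier M \<Longrightarrow> z \<in> carrier M \<Longrightarrow> x \<oplus>\<^bsub>M\<^esub> y \<oplus>\<^bsub>M\<^esub> z = x \<oplus>\<^bsub>M\<^esub> (y \<oplus>\<^bsub>M\<^esub> z)"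
  by (rule M.a_assoc)
lemma fg_a_comm: "x \<in> carrier M \<Longrightarrow> y \<in> carrier M \<Longrightarrow> x \<oplus>\<^bsub>M\<^esub> y = y \<oplus>\<^bsub>M\<^esub> x"
  by (rule M.a_comm)
lemma fg_a_lcomm: "x \<in> carrier M \<Longrightarrow> y \<in> carrier M \<Longrightarrow> z \<in> carrier M \<Longrightarrow> x \<oplus>\<^bsub>M\<^esub> (y \<oplus>\<^bsub>M\<^esub> z) = y \<oplus>\<^bsub>M\<^esub> (x \<oplus>\<^bsub>M\<^esub> z)"
  by (rule M.a_lcomm)
lemma fg_neg_add: "x \<in> carrier M \<Longrightarrow> y \<in> carrier M \<Longrightarrow> \<ominus>\<^bsub>M\<^esub> (x \<oplus>\<^bsub>M\<^esub> y) = \<ominus>\<^bsub>M\<^esub> x \<oplus>\<^bsub>M\<^esub> \<ominus>\<^bsub>M\<^esub> y"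
  by (rule M.minus_add)
lemma fg_r_neg: "x \<in> carrier M \<Longrightarrow> x \<oplus>\<^bsub>M\<^esub> \<ominus>\<^bsub>M\<^esub> x = \<zero>\<^bsub>M\<^esub>"
  by (rule M.r_neg)
lemma fg_l_neg: "x \<in> carrier M \<Longrightarrow> \<ominus>\<^bsub>M\<^esub> x \<oplus>\<^bsub>M\<^esub> x = \<zero>\<^bsub>M\<^esub>"
  by (rule M.l_neg)
lemma fg_r_neg2: "x \<in> carrier M \<Longrightarrow> y \<in> carrier M \<Longrightarrow> x \<oplus>\<^bsub>M\<^esub> (\<ominus>\<^bsub>M\<^esub> x \<oplus>\<^bsub>M\<^esub> y) = y"
  by (rule M.r_neg2)
lemma fg_r_neg1: "x \<in> carrier M \<Longrightarrow> y \<in> carrier M \<Longrightarrow> \<ominus>\<^bsub>M\<^esub> x \<oplus>\<^bsub>M\<^esub> (x \<oplus>\<^bsub>M\<^esub> y) = y"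
  by (rule M.r_neg1)

end

text \<open>Ordered rewriting does not place \<open>x\<close> next to \<open>\<ominus> x\<close>, hence the cancellation laws \<open>fg_c1\<close> to
  \<open>fg_c6\<close> across several summands.\<close>

lemmas agn = a_minus_def fg_a_assoc fg_a_comm fg_a_lcomm fg_neg_add fg_r_neg fg_l_neg fg_r_neg1 fg_r_neg2
  fg_c1 fg_c2 fg_c3 fg_c4 fg_c5 fg_c6

lemma rhom_simps:
  assumes f: "f \<in> rhom L M N"
  shows "\<And>x. x \<in> carrier M \<Longrightarrow> f x \<in> carrier N"
    and "\<And>x y. x \<in> carrier M \<Longrightarrow> y \<in> carrier M \<Longrightarrow> f (x \<oplus>\<^bsub>M\<^esub> y) = f x \<oplus>\<^bsub>N\<^esub> f y"
    and "\<And>a x. a \<in> carrier L \<Longrightarrow> x \<in> carrier M \<Longrightarrow> f (a \<odot>\<^bsub>M\<^esub> x) = a \<odot>\<^bsub>N\<^esub> f x"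
  using f by (auto simp: rhom_def)

lemma rhom_group:
  assumes f: "f \<in> rhom L M N" and M: "M \<in> fgmod L" and N: "N \<in> fgmod L"
  shows "f \<zero>\<^bsub>M\<^esub> = \<zero>\<^bsub>N\<^esub>"
    and "\<And>x. x \<in> carrier M \<Longrightarrow> f (\<ominus>\<^bsub>M\<^esub> x) = \<ominus>\<^bsub>N\<^esub> f x"
    and "\<And>x y. x \<in> carrier M \<Longrightarrow> y \<in> carrier M \<Longrightarrow> f (x \<ominus>\<^bsub>M\<^esub> y) = f x \<ominus>\<^bsub>N\<^esub> f y"
proof -
  note h = rhom_simps[OF f]
  have "f \<zero>\<^bsub>M\<^esub> \<oplus>\<^bsub>N\<^esub> f \<zero>\<^bsub>M\<^esub> = f \<zero>\<^bsub>M\<^esub> \<oplus>\<^bsub>N\<^esub> \<zero>\<^bsub>N\<^esub>"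
    using M N h(1) by (simp add: h(2)[symmetric])
  then show z: "f \<zero>\<^bsub>M\<^esub> = \<zero>\<^bsub>N\<^esub>"
    using fg_add_left_cancel[OF N h(1)[OF fg_zero[OF M]] h(1)[OF fg_zero[OF M]] fg_zero[OF N]] by (rule iffD1[rotated])
  show neg: "f (\<ominus>\<^bsub>M\<^esub> x) = \<ominus>\<^bsub>N\<^esub> f x" if x: "x \<in> carrier M" for x
    using M N h(1) x z by (intro fg_neg_unique[OF N]) (simp_all add: h(2)[symmetric] fg_l_neg)
  show "f (x \<ominus>\<^bsub>M\<^esub> y) = f x \<ominus>\<^bsub>N\<^esub> f y" if "x \<in> carrier M" "y \<in> carrier M" for x y
    using M N that h neg by (simp add: a_minus_def)
qed

lemmas rhom_all = rhom_simps rhom_group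

lemma rhomI:
  assumes "\<And>x. x \<in> carrier M \<Longrightarrow> g x \<in> carrier N"
    and "\<And>x y. x \<in> carrier M \<Longrightarrow> y \<in> carrier M \<Longrightarrow> g (x \<oplus>\<^bsub>M\<^esub> y) = g x \<oplus>\<^bsub>N\<^esub> g y"
    and "\<And>a x. a \<in> carrier L \<Longrightarrow> x \<in> carrier M \<Longrightarrow> g (a \<odot>\<^bsub>M\<^esub> x) = a \<odot>\<^bsub>N\<^esub> g x"
    and "M \<in> fgmod L"
  shows "restrict g (carrier M) \<in> rhom L M N"
  using assms by (auto simp: rhom_def)

lemma rhom_ext:
  "f \<in> rhom L M N \<Longrightarrow> g \<in> rhom L M N \<Longrightarrow> (\<And>x. x \<in> carrier M \<Longrightarrow> f x = g x) \<Longrightarrow> f = g"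
  unfolding rhom_def by (auto intro: PiE_ext)

lemma rhom_restrict: "f \<in> rhom L M N \<Longrightarrow> restrict f (carrier M) = f"
  by (auto simp: rhom_def intro: PiE_restrict)

lemma rhom_id: "M \<in> fgmod L \<Longrightarrow> (\<lambda>x\<in>carrier M. x) \<in> rhom L M M"
  by (intro rhomI) auto

lemma rhom_zero: "M \<in> fgmod L \<Longrightarrow> N \<in> fgmod L \<Longrightarrow> (\<lambda>x\<in>carrier M. \<zero>\<^bsub>N\<^esub>) \<in> rhom L M N"
  by (intro rhomI) auto

lemma rhom_compose:
  assumes "f \<in> rhom L M N" "g \<in> rhom L N K" "M \<in> fgmod L"
  shows "compose (carrier M) g f \<in> rhom L M K"
  unfolding compose_def using assms(3)
  by (intro rhomI) (auto simp: rhom_simps[OF assms(1)] rhom_simps[OF assms(2)])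

lemma rhom_add:
  assumes "f \<in> rhom L M N" "g \<in> rhom L M N" "M \<in> fgmod L" "N \<in> fgmod L"
  shows "(\<lambda>x\<in>carrier M. f x \<oplus>\<^bsub>N\<^esub> g x) \<in> rhom L M N"
  using assms(3,4) by (intro rhomI)
    (simp_all add: rhom_simps[OF assms(1)] rhom_simps[OF assms(2)] fg_smult_add agn)

lemma rhom_neg:
  assumes "f \<in> rhom L M N" "M \<in> fgmod L" "N \<in> fgmod L"
  shows "(\<lambda>x\<in>carrier M. \<ominus>\<^bsub>N\<^esub> f x) \<in> rhom L M N"
  using assms(2,3) by (intro rhomI) (simp_all add: rhom_simps[OF assms(1)] fg_smult_neg fg_neg_add)

lemma a_kernel_eq: "a_kernel M N f = {x \<in> carrier M. f x = \<zero>\<^bsub>N\<^esub>}"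
  by (simp add: a_kernel_def kernel_def)

lemma kernel_submodule:
  assumes "f \<in> rhom L M N" "M \<in> fgmod L" "N \<in> fgmod L"
  shows "submodule {x \<in> carrier M. f x = \<zero>\<^bsub>N\<^esub>} L M"
  using assms(2,3) by (intro right_module.right_submoduleI[OF fg_rm[OF assms(2)]])
    (auto simp: rhom_simps[OF assms(1)] rhom_group[OF assms])

lemma image_submodule:
  assumes "f \<in> rhom L M N" "M \<in> fgmod L" "N \<in> fgmod L"
  shows "submodule (f ` carrier M) L N"
proof (rule right_module.right_submoduleI[OF fg_rm[OF assms(3)]])
  note h = rhom_simps[OF assms(1)] rhom_group[OF assms]
  show "f ` carrier M \<subseteq> carrier N" using h(1) by auto
  show "\<zero>\<^bsub>N\<^esub> \<in> f ` carrier M" using h(4) fg_zero[OF assms(2)] by (metis imageI)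
next
  note h = rhom_simps[OF assms(1)] rhom_group[OF assms]
  fix u v assume "u \<in> f ` carrier M" "v \<in> f ` carrier M"
  then obtain x y where "x \<in> carrier M" "y \<in> carrier M" "u = f x" "v = f y" by blast
  then show "u \<oplus>\<^bsub>N\<^esub> v \<in> f ` carrier M" using h(2)[symmetric] assms(2) by simp
next
  note h = rhom_simps[OF assms(1)] rhom_group[OF assms]
  fix a u assume "a \<in> carrier L" "u \<in> f ` carrier M"
  then obtain x where "x \<in> carrier M" "u = f x" by blast
  then show "a \<odot>\<^bsub>N\<^esub> u \<in> f ` carrier M" using h(3)[symmetric] assms(2) \<open>a \<in> carrier L\<close> by simp
qed

section \<open>Submodules, direct sums of two modules, and the zero module\<close>

definition sub :: "'a smod \<Rightarrow> (nat \<Rightarrow> 'a) set \<Rightarrow> 'a smod" where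
  "sub M N = M\<lparr>carrier := N\<rparr>"

lemma sub_simps [simp]:
  "carrier (sub M N) = N" "zero (sub M N) = \<zero>\<^bsub>M\<^esub>" "add (sub M N) = add M" "smult (sub M N) = smult M"
  by (simp_all add: sub_def)

lemma sub_fg [simp]: "M \<in> fgmod L \<Longrightarrow> submodule N L M \<Longrightarrow> sub M N \<in> fgmod L"
  unfolding sub_def by (rule submodule_fg)

lemma submodule_carrier: "M \<in> fgmod L \<Longrightarrow> submodule N L M \<Longrightarrow> x \<in> N \<Longrightarrow> x \<in> carrier M"
  using right_module.right_submoduleE(1)[OF fg_rm] by blast

lemma sfst_ext: "z = w \<longleftrightarrow> sfst z = sfst w \<and> ssnd z = ssnd w"
  by (metis spair_simps(3))

lemma spair_eq [simp]: "spair a b = spair c d \<longleftrightarrow> a = c \<and> b = d"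
  by (metis spair_simps(1,2))

lemma mod_sum_simps [simp]:
  "z \<in> carrier (mod_sum M N) \<longleftrightarrow> sfst z \<in> carrier M \<and> ssnd z \<in> carrier N"
  "zero (mod_sum M N) = spair \<zero>\<^bsub>M\<^esub> \<zero>\<^bsub>N\<^esub>"
  "add (mod_sum M N) z w = spair (sfst z \<oplus>\<^bsub>M\<^esub> sfst w) (ssnd z \<oplus>\<^bsub>N\<^esub> ssnd w)"
  "smult (mod_sum M N) a z = spair (a \<odot>\<^bsub>M\<^esub> sfst z) (a \<odot>\<^bsub>N\<^esub> ssnd z)"
  by (simp_all add: mod_sum_def)

lemma mod_sum_fg [simp]:
  assumes M: "M \<in> fgmod L" and N: "N \<in> fgmod L"
  shows "mod_sum M N \<in> fgmod L"
proof -
  interpret M: right_module L M by (rule fg_rm[OF M])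
  interpret N: right_module L N by (rule fg_rm[OF N])
  have ab: "abelian_group (mod_sum M N)"
  proof (rule abelian_groupI)
    fix x assume x: "x \<in> carrier (mod_sum M N)"
    then show "\<exists>y\<in>carrier (mod_sum M N). y \<oplus>\<^bsub>mod_sum M N\<^esub> x = \<zero>\<^bsub>mod_sum M N\<^esub>"
      by (intro bexI[of _ "spair (\<ominus>\<^bsub>M\<^esub> sfst x) (\<ominus>\<^bsub>N\<^esub> ssnd x)"]) (auto simp: M.M.l_neg N.M.l_neg)
  qed (auto simp: M.M.a_ac N.M.a_ac)
  have rm: "right_module L (mod_sum M N)"
    using ab by (intro right_module.intro right_module_axioms.intro M.L.ring_axioms)
      (auto simp: M.ract_add_scalar M.ract_add M.ract_assoc M.ract_one M.ract_closed
        N.ract_add_scalar N.ract_add N.ract_assoc N.ract_one N.ract_closed)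
  interpret S: right_module L "mod_sum M N" by (rule rm)
  obtain A where A: "finite A" "A \<subseteq> carrier M" and Am: "\<And>H. submodule H L M \<Longrightarrow> A \<subseteq> H \<Longrightarrow> H = carrier M"
    using M unfolding fgmod_def fin_gen_def by auto
  obtain B where B: "finite B" "B \<subseteq> carrier N" and Bm: "\<And>H. submodule H L N \<Longrightarrow> B \<subseteq> H \<Longrightarrow> H = carrier N"
    using N unfolding fgmod_def fin_gen_def by auto
  let ?S = "(\<lambda>x. spair x \<zero>\<^bsub>N\<^esub>) ` A \<union> (\<lambda>y. spair \<zero>\<^bsub>M\<^esub> y) ` B"
  have "fin_gen L (mod_sum M N)" unfolding fin_gen_def
  proof (intro exI[of _ ?S] conjI allI impI)
    show "finite ?S" using A B by simp
    show "?S \<subseteq> carrier (mod_sum M N)" using A(2) B(2) by auto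
  next
    fix H assume H: "submodule H L (mod_sum M N) \<and> ?S \<subseteq> H"
    note E = S.right_submoduleE[OF conjunct1[OF H]]
    have "submodule {x \<in> carrier M. spair x \<zero>\<^bsub>N\<^esub> \<in> H} L M"
    proof (rule M.right_submoduleI)
      fix x y assume "x \<in> {x \<in> carrier M. spair x \<zero>\<^bsub>N\<^esub> \<in> H}" "y \<in> {x \<in> carrier M. spair x \<zero>\<^bsub>N\<^esub> \<in> H}"
      then show "x \<oplus>\<^bsub>M\<^esub> y \<in> {x \<in> carrier M. spair x \<zero>\<^bsub>N\<^esub> \<in> H}" using E(3)[of "spair x \<zero>\<^bsub>N\<^esub>" "spair y \<zero>\<^bsub>N\<^esub>"] by simp
    next
      fix a x assume "a \<in> carrier L" "x \<in> {x \<in> carrier M. spair x \<zero>\<^bsub>N\<^esub> \<in> H}"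
      then show "a \<odot>\<^bsub>M\<^esub> x \<in> {x \<in> carrier M. spair x \<zero>\<^bsub>N\<^esub> \<in> H}"
        using E(4)[of a "spair x \<zero>\<^bsub>N\<^esub>"] by (simp add: M.ract_closed N.ract_zero)
    qed (use E(2) in auto)
    moreover have "A \<subseteq> {x \<in> carrier M. spair x \<zero>\<^bsub>N\<^esub> \<in> H}" using A(2) H by auto
    ultimately have HM: "{x \<in> carrier M. spair x \<zero>\<^bsub>N\<^esub> \<in> H} = carrier M" by (rule Am)
    have "submodule {x \<in> carrier N. spair \<zero>\<^bsub>M\<^esub> x \<in> H} L N"
    proof (rule N.right_submoduleI)
      fix x y assume "x \<in> {x \<in> carrier N. spair \<zero>\<^bsub>M\<^esub> x \<in> H}" "y \<in> {x \<in> carrier N. spair \<zero>\<^bsub>M\<^esub> x \<in> H}"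
      then show "x \<oplus>\<^bsub>N\<^esub> y \<in> {x \<in> carrier N. spair \<zero>\<^bsub>M\<^esub> x \<in> H}" using E(3)[of "spair \<zero>\<^bsub>M\<^esub> x" "spair \<zero>\<^bsub>M\<^esub> y"] by simp
    next
      fix a x assume "a \<in> carrier L" "x \<in> {x \<in> carrier N. spair \<zero>\<^bsub>M\<^esub> x \<in> H}"
      then show "a \<odot>\<^bsub>N\<^esub> x \<in> {x \<in> carrier N. spair \<zero>\<^bsub>M\<^esub> x \<in> H}"
        using E(4)[of a "spair \<zero>\<^bsub>M\<^esub> x"] by (simp add: M.ract_zero N.ract_closed)
    qed (use E(2) in auto)
    moreover have "B \<subseteq> {x \<in> carrier N. spair \<zero>\<^bsub>M\<^esub> x \<in> H}" using B(2) H by auto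
    ultimately have HN: "{x \<in> carrier N. spair \<zero>\<^bsub>M\<^esub> x \<in> H} = carrier N" by (rule Bm)
    have "z \<in> H" if z: "z \<in> carrier (mod_sum M N)" for z
    proof -
      have "spair (sfst z) \<zero>\<^bsub>N\<^esub> \<in> H" "spair \<zero>\<^bsub>M\<^esub> (ssnd z) \<in> H" using z HM HN by auto
      from E(3)[OF this] show ?thesis using z by simp
    qed
    then show "H = carrier (mod_sum M N)" using E(1) by blast
  qed
  with rm show ?thesis by (simp add: fgmod_def)
qed

lemma mod_sum_neg [simp]:
  assumes "M \<in> fgmod L" "N \<in> fgmod L" "sfst z \<in> carrier M" "ssnd z \<in> carrier N"
  shows "\<ominus>\<^bsub>mod_sum M N\<^esub> z = spair (\<ominus>\<^bsub>M\<^esub> sfst z) (\<ominus>\<^bsub>N\<^esub> ssnd z)"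
  using assms by (intro sym[OF fg_neg_unique[OF mod_sum_fg[OF assms(1,2)]]]) (auto simp: fg_l_neg)

lemma mod_sum_minus [simp]:
  assumes "M \<in> fgmod L" "N \<in> fgmod L" "sfst w \<in> carrier M" "ssnd w \<in> carrier N"
  shows "z \<ominus>\<^bsub>mod_sum M N\<^esub> w = spair (sfst z \<ominus>\<^bsub>M\<^esub> sfst w) (ssnd z \<ominus>\<^bsub>N\<^esub> ssnd w)"
  using assms by (simp add: a_minus_def)

definition zmod :: "'a smod" where
  "zmod = \<lparr>carrier = {\<lambda>_. \<zero>\<^bsub>L\<^esub>}, monoid.mult = undefined, one = undefined, zero = \<lambda>_. \<zero>\<^bsub>L\<^esub>,
     add = (\<lambda>_ _ _. \<zero>\<^bsub>L\<^esub>), smult = (\<lambda>_ _ _. \<zero>\<^bsub>L\<^esub>)\<rparr>"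

lemma zmod_simps [simp]: "carrier zmod = {\<zero>\<^bsub>zmod\<^esub>}" "add zmod x y = \<zero>\<^bsub>zmod\<^esub>" "smult zmod a x = \<zero>\<^bsub>zmod\<^esub>"
  by (simp_all add: zmod_def)

lemma zmod_fg [simp]: "zmod \<in> fgmod L"
proof -
  have "abelian_group zmod" by (rule abelian_groupI) auto
  then have rm: "right_module L zmod"
    by (intro right_module.intro right_module_axioms.intro ring_L) auto
  moreover have "fin_gen L zmod" unfolding fin_gen_def
  proof (intro exI[of _ "{}"] conjI allI impI)
    fix H assume "submodule H L zmod \<and> {} \<subseteq> H"
    then show "H = carrier zmod"
      using right_module.right_submoduleE(1,2)[OF rm, of H] by auto
  qed auto
  ultimately show ?thesis by (simp add: fgmod_def)
qed

section \<open>Complexes\<close>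

text \<open>The arithmetic of the simplifier leaves degrees in the form \<open>1 + i\<close>.\<close>

lemma degree_simps [simp]: "1 + i = i + 1" "2 + i = i + 2" "3 + i = i + 3" for i :: int
  by simp_all

lemma bcpx_fg [simp]: "X \<in> bcpx L \<Longrightarrow> Deg X i \<in> fgmod L"
  unfolding bcpx_def by simp

lemma bcpx_rhom: "X \<in> bcpx L \<Longrightarrow> j = i + 1 \<Longrightarrow> Dif X i \<in> rhom L (Deg X i) (Deg X j)"
  unfolding bcpx_def by simp

lemma bcpx_finite: "X \<in> bcpx L \<Longrightarrow> finite {i. carrier (Deg X i) \<noteq> {\<zero>\<^bsub>Deg X i\<^esub>}}"
  unfolding bcpx_def by simp

lemma bcpxI:
  assumes "\<And>i. Deg X i \<in> fgmod L" "\<And>i. Dif X i \<in> rhom L (Deg X i) (Deg X (i + 1))"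
    and "\<And>i x. x \<in> carrier (Deg X i) \<Longrightarrow> Dif X (i + 1) (Dif X i x) = \<zero>\<^bsub>Deg X (i + 2)\<^esub>"
    and "finite S" "\<And>i x. i \<notin> S \<Longrightarrow> x \<in> carrier (Deg X i) \<Longrightarrow> x = \<zero>\<^bsub>Deg X i\<^esub>"
  shows "X \<in> bcpx L"
proof -
  have "carrier (Deg X i) = {\<zero>\<^bsub>Deg X i\<^esub>}" if "i \<notin> S" for i
    using assms(5)[OF that] fg_zero[OF assms(1)[of i]] by blast
  then have "{i. carrier (Deg X i) \<noteq> {\<zero>\<^bsub>Deg X i\<^esub>}} \<subseteq> S" by blast
  then show ?thesis using assms finite_subset[OF _ assms(4)] unfolding bcpx_def by simp
qed

context
  fixes X :: "'a cpx"
  assumes X: "X \<in> bcpx L"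
begin

lemma dif_closed [simp]: "x \<in> carrier (Deg X i) \<Longrightarrow> j = i + 1 \<Longrightarrow> Dif X i x \<in> carrier (Deg X j)"
  using rhom_simps(1)[OF bcpx_rhom[OF X refl]] by simp

lemma dif_dif [simp]: "x \<in> carrier (Deg X i) \<Longrightarrow> j = i + 1 \<Longrightarrow> Dif X j (Dif X i x) = \<zero>\<^bsub>Deg X (j + 1)\<^esub>"
  using X unfolding bcpx_def by simp

lemma dif_add: "x \<in> carrier (Deg X i) \<Longrightarrow> y \<in> carrier (Deg X i) \<Longrightarrow>
    Dif X i (x \<oplus>\<^bsub>Deg X i\<^esub> y) = Dif X i x \<oplus>\<^bsub>Deg X (i + 1)\<^esub> Dif X i y"
  using rhom_simps(2)[OF bcpx_rhom[OF X refl]] by simp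

lemma dif_smult: "a \<in> carrier L \<Longrightarrow> x \<in> carrier (Deg X i) \<Longrightarrow>
    Dif X i (a \<odot>\<^bsub>Deg X i\<^esub> x) = a \<odot>\<^bsub>Deg X (i + 1)\<^esub> Dif X i x"
  using rhom_simps(3)[OF bcpx_rhom[OF X refl]] by simp

lemma dif_zero [simp]: "Dif X i \<zero>\<^bsub>Deg X i\<^esub> = \<zero>\<^bsub>Deg X (i + 1)\<^esub>"
  using rhom_group(1)[OF bcpx_rhom[OF X refl]] X by simp

lemma dif_neg: "x \<in> carrier (Deg X i) \<Longrightarrow> Dif X i (\<ominus>\<^bsub>Deg X i\<^esub> x) = \<ominus>\<^bsub>Deg X (i + 1)\<^esub> Dif X i x"
  using rhom_group(2)[OF bcpx_rhom[OF X refl]] X by simp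

lemma dif_minus: "x \<in> carrier (Deg X i) \<Longrightarrow> y \<in> carrier (Deg X i) \<Longrightarrow>
    Dif X i (x \<ominus>\<^bsub>Deg X i\<^esub> y) = Dif X i x \<ominus>\<^bsub>Deg X (i + 1)\<^esub> Dif X i y"
  using rhom_group(3)[OF bcpx_rhom[OF X refl]] X by simp

end

lemmas difs = dif_add dif_smult dif_neg dif_minus

lemma chain_mapsI:
  assumes "\<And>i. f i \<in> rhom L (Deg X i) (Deg Y i)"
    and "\<And>i x. x \<in> carrier (Deg X i) \<Longrightarrow> f (i + 1) (Dif X i x) = Dif Y i (f i x)"
  shows "f \<in> chain_maps L X Y"
  using assms by (simp add: chain_maps_def)

lemma chain_maps_rhom: "f \<in> chain_maps L X Y \<Longrightarrow> f i \<in> rhom L (Deg X i) (Deg Y i)"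
  by (simp add: chain_maps_def)

lemma chmap:
  assumes f: "f \<in> chain_maps L X Y" and X: "X \<in> bcpx L" and Y: "Y \<in> bcpx L"
  shows "\<And>x i. x \<in> carrier (Deg X i) \<Longrightarrow> f i x \<in> carrier (Deg Y i)"
    and "\<And>x i j. x \<in> carrier (Deg X i) \<Longrightarrow> j = i + 1 \<Longrightarrow> f j (Dif X i x) = Dif Y i (f i x)"
    and "\<And>x y i. x \<in> carrier (Deg X i) \<Longrightarrow> y \<in> carrier (Deg X i) \<Longrightarrow>
      f i (x \<oplus>\<^bsub>Deg X i\<^esub> y) = f i x \<oplus>\<^bsub>Deg Y i\<^esub> f i y"
    and "\<And>a x i. a \<in> carrier L \<Longrightarrow> x \<in> carrier (Deg X i) \<Longrightarrow> f i (a \<odot>\<^bsub>Deg X i\<^esub> x) = a \<odot>\<^bsub>Deg Y i\<^esub> f i x"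
    and "\<And>i. f i \<zero>\<^bsub>Deg X i\<^esub> = \<zero>\<^bsub>Deg Y i\<^esub>"
    and "\<And>x i. x \<in> carrier (Deg X i) \<Longrightarrow> f i (\<ominus>\<^bsub>Deg X i\<^esub> x) = \<ominus>\<^bsub>Deg Y i\<^esub> f i x"
    and "\<And>x y i. x \<in> carrier (Deg X i) \<Longrightarrow> y \<in> carrier (Deg X i) \<Longrightarrow>
      f i (x \<ominus>\<^bsub>Deg X i\<^esub> y) = f i x \<ominus>\<^bsub>Deg Y i\<^esub> f i y"
proof -
  have r: "f i \<in> rhom L (Deg X i) (Deg Y i)" for i using f by (rule chain_maps_rhom)
  note all = rhom_all[OF r]
  show "x \<in> carrier (Deg X i) \<Longrightarrow> f i x \<in> carrier (Deg Y i)" for x i by (rule rhom_simps(1)[OF r])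
  show "x \<in> carrier (Deg X i) \<Longrightarrow> j = i + 1 \<Longrightarrow> f j (Dif X i x) = Dif Y i (f i x)" for x i j
    using f by (simp add: chain_maps_def)
qed (use X Y in \<open>simp_all add: rhom_simps[OF chain_maps_rhom[OF f]] rhom_group[OF chain_maps_rhom[OF f]]\<close>)

lemma chain_map_ext:
  assumes "f \<in> chain_maps L X Y" "g \<in> chain_maps L X Y" "\<And>i x. x \<in> carrier (Deg X i) \<Longrightarrow> f i x = g i x"
  shows "f = g"
proof (rule ext)
  show "f i = g i" for i
    using chain_maps_rhom[OF assms(1)] chain_maps_rhom[OF assms(2)] assms(3) by (rule rhom_ext)
qed

lemma cid_chain [simp]: "X \<in> bcpx L \<Longrightarrow> cid X \<in> chain_maps L X X"
  by (intro chain_mapsI) (simp_all add: cid_def rhom_id)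

lemma czero_chain [simp]: "X \<in> bcpx L \<Longrightarrow> Y \<in> bcpx L \<Longrightarrow> czero X Y \<in> chain_maps L X Y"
  by (intro chain_mapsI) (simp_all add: czero_def rhom_zero)

lemma cadd_chain:
  assumes "f \<in> chain_maps L X Y" "g \<in> chain_maps L X Y" and [simp]: "X \<in> bcpx L" "Y \<in> bcpx L"
  shows "cadd X Y f g \<in> chain_maps L X Y"
  using chmap[OF assms(1,3,4)] chmap[OF assms(2,3,4)]
  by (intro chain_mapsI) (simp_all add: cadd_def rhom_add chain_maps_rhom[OF assms(1)] chain_maps_rhom[OF assms(2)] difs)

lemma ccomp_chain:
  assumes "f \<in> chain_maps L X Y" "g \<in> chain_maps L Y Z" and [simp]: "X \<in> bcpx L" "Y \<in> bcpx L" "Z \<in> bcpx L"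
  shows "ccomp X g f \<in> chain_maps L X Z"
  unfolding ccomp_def using chmap[OF assms(1,3,4)] chmap[OF assms(2,4,5)]
  by (intro chain_mapsI) (auto simp: compose_eq intro: rhom_compose chain_maps_rhom[OF assms(1)] chain_maps_rhom[OF assms(2)])

lemma ccomp_apply [simp]: "x \<in> carrier (Deg X i) \<Longrightarrow> ccomp X g f i x = g i (f i x)"
  by (simp add: ccomp_def compose_eq)

lemma cid_apply [simp]: "x \<in> carrier (Deg X i) \<Longrightarrow> cid X i x = x"
  by (simp add: cid_def)

lemma czero_apply [simp]: "x \<in> carrier (Deg X i) \<Longrightarrow> czero X Y i x = \<zero>\<^bsub>Deg Y i\<^esub>"
  by (simp add: czero_def)

lemma cadd_apply [simp]: "x \<in> carrier (Deg X i) \<Longrightarrow> cadd X Y f g i x = f i x \<oplus>\<^bsub>Deg Y i\<^esub> g i x"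
  by (simp add: cadd_def)

lemma ccomp_assoc:
  assumes "f \<in> chain_maps L X Y" and [simp]: "X \<in> bcpx L" "Y \<in> bcpx L"
  shows "ccomp X h (ccomp X g f) = ccomp X (ccomp Y h g) f"
proof (rule ext, rule ext)
  fix i x
  have "f i x \<in> carrier (Deg Y i)" if "x \<in> carrier (Deg X i)" using chmap(1)[OF assms] that .
  then show "ccomp X h (ccomp X g f) i x = ccomp X (ccomp Y h g) f i x"
    by (cases "x \<in> carrier (Deg X i)") (simp_all add: ccomp_def compose_def)
qed

lemma ccomp_id [simp]:
  assumes "f \<in> chain_maps L X Y" "X \<in> bcpx L" "Y \<in> bcpx L"
  shows "ccomp X f (cid X) = f" "ccomp X (cid Y) f = f"
proof -
  have "ccomp X f (cid X) \<in> chain_maps L X Y" "ccomp X (cid Y) f \<in> chain_maps L X Y"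
    using assms ccomp_chain[of "cid X" X X f Y] ccomp_chain[of f X Y "cid Y" Y] by simp_all
  then show "ccomp X f (cid X) = f" "ccomp X (cid Y) f = f"
    using chmap(1)[OF assms] by (auto intro!: chain_map_ext[OF _ assms(1)])
qed

section \<open>Homotopy\<close>

lemma homotopicI:
  assumes "\<And>i. s i \<in> rhom L (Deg X i) (Deg Y (i - 1))"
    and "\<And>i x. x \<in> carrier (Deg X i) \<Longrightarrow> f i x \<ominus>\<^bsub>Deg Y i\<^esub> g i x =
        Dif Y (i - 1) (s i x) \<oplus>\<^bsub>Deg Y i\<^esub> s (i + 1) (Dif X i x)"
  shows "homotopic L X Y f g"
  using assms unfolding homotopic_def by blast

lemma homotopicE:
  assumes "homotopic L X Y f g" and [simp]: "X \<in> bcpx L" "Y \<in> bcpx L"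
  obtains s where "\<And>i j. j = i - 1 \<Longrightarrow> s i \<in> rhom L (Deg X i) (Deg Y j)"
    and "\<And>x i j. x \<in> carrier (Deg X i) \<Longrightarrow> j = i - 1 \<Longrightarrow> s i x \<in> carrier (Deg Y j)"
    and "\<And>x i j. x \<in> carrier (Deg X i) \<Longrightarrow> f i x \<ominus>\<^bsub>Deg Y i\<^esub> g i x =
        Dif Y (i - 1) (s i x) \<oplus>\<^bsub>Deg Y i\<^esub> s (i + 1) (Dif X i x)"
    and "\<And>i. s i \<zero>\<^bsub>Deg X i\<^esub> = \<zero>\<^bsub>Deg Y (i - 1)\<^esub>"
proof -
  obtain s where s: "\<And>i. s i \<in> rhom L (Deg X i) (Deg Y (i - 1))"
    "\<And>i x. x \<in> carrier (Deg X i) \<Longrightarrow> f i x \<ominus>\<^bsub>Deg Y i\<^esub> g i x =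
        Dif Y (i - 1) (s i x) \<oplus>\<^bsub>Deg Y i\<^esub> s (i + 1) (Dif X i x)"
    using assms(1) unfolding homotopic_def by auto
  show ?thesis
    by (rule that[of s]) (use s rhom_simps(1)[OF s(1)] rhom_group(1)[OF s(1)] in auto)
qed

lemma homotopic_refl:
  assumes f: "f \<in> chain_maps L X Y" and [simp]: "X \<in> bcpx L" "Y \<in> bcpx L"
  shows "homotopic L X Y f f"
  by (rule homotopicI[where s = "\<lambda>i. \<lambda>x\<in>carrier (Deg X i). \<zero>\<^bsub>Deg Y (i - 1)\<^esub>"])
    (use dif_zero[OF assms(3), of "i - 1" for i] in \<open>simp_all add: rhom_zero chmap(1)[OF assms]\<close>)

lemma homotopic_sym:
  assumes h: "homotopic L X Y f g" and f: "f \<in> chain_maps L X Y" and g: "g \<in> chain_maps L X Y"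
    and [simp]: "X \<in> bcpx L" "Y \<in> bcpx L"
  shows "homotopic L X Y g f"
proof -
  obtain s where s: "\<And>i j. j = i - 1 \<Longrightarrow> s i \<in> rhom L (Deg X i) (Deg Y j)"
    and [simp]: "\<And>x i j. x \<in> carrier (Deg X i) \<Longrightarrow> j = i - 1 \<Longrightarrow> s i x \<in> carrier (Deg Y j)"
    and e: "\<And>x i j. x \<in> carrier (Deg X i) \<Longrightarrow> f i x \<ominus>\<^bsub>Deg Y i\<^esub> g i x =
        Dif Y (i - 1) (s i x) \<oplus>\<^bsub>Deg Y i\<^esub> s (i + 1) (Dif X i x)"
    using homotopicE[OF h assms(4,5)] by metis
  note [simp] = chmap[OF f assms(4,5)] chmap[OF g assms(4,5)]
  show ?thesis
  proof (rule homotopicI[where s = "\<lambda>i. \<lambda>x\<in>carrier (Deg X i). \<ominus>\<^bsub>Deg Y (i - 1)\<^esub> s i x"])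
    fix i x assume x [simp]: "x \<in> carrier (Deg X i)"
    have "g i x \<ominus>\<^bsub>Deg Y i\<^esub> f i x = \<ominus>\<^bsub>Deg Y i\<^esub> (f i x \<ominus>\<^bsub>Deg Y i\<^esub> g i x)"
      by (simp add: agn)
    also have "\<dots> = \<ominus>\<^bsub>Deg Y i\<^esub> (Dif Y (i - 1) (s i x)) \<oplus>\<^bsub>Deg Y i\<^esub> \<ominus>\<^bsub>Deg Y i\<^esub> s (i + 1) (Dif X i x)"
      by (simp add: e fg_neg_add)
    finally show "g i x \<ominus>\<^bsub>Deg Y i\<^esub> f i x = Dif Y (i - 1) ((\<lambda>x\<in>carrier (Deg X i). \<ominus>\<^bsub>Deg Y (i - 1)\<^esub> s i x) x)
      \<oplus>\<^bsub>Deg Y i\<^esub> (\<lambda>x\<in>carrier (Deg X (i + 1)). \<ominus>\<^bsub>Deg Y (i + 1 - 1)\<^esub> s (i + 1) x) (Dif X i x)"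
      using dif_neg[OF assms(5), of "s i x" "i - 1"] by simp
  qed (simp add: rhom_neg s)
qed

lemma homotopic_trans:
  assumes h: "homotopic L X Y f g" "homotopic L X Y g k" and f: "f \<in> chain_maps L X Y"
    and g: "g \<in> chain_maps L X Y" and k: "k \<in> chain_maps L X Y"
    and [simp]: "X \<in> bcpx L" "Y \<in> bcpx L"
  shows "homotopic L X Y f k"
proof -
  obtain s where s: "\<And>i j. j = i - 1 \<Longrightarrow> s i \<in> rhom L (Deg X i) (Deg Y j)"
    and [simp]: "\<And>x i j. x \<in> carrier (Deg X i) \<Longrightarrow> j = i - 1 \<Longrightarrow> s i x \<in> carrier (Deg Y j)"
    and e: "\<And>x i j. x \<in> carrier (Deg X i) \<Longrightarrow> f i x \<ominus>\<^bsub>Deg Y i\<^esub> g i x =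
        Dif Y (i - 1) (s i x) \<oplus>\<^bsub>Deg Y i\<^esub> s (i + 1) (Dif X i x)"
    using homotopicE[OF h(1) assms(6,7)] by metis
  obtain t where t: "\<And>i j. j = i - 1 \<Longrightarrow> t i \<in> rhom L (Deg X i) (Deg Y j)"
    and [simp]: "\<And>x i j. x \<in> carrier (Deg X i) \<Longrightarrow> j = i - 1 \<Longrightarrow> t i x \<in> carrier (Deg Y j)"
    and e': "\<And>x i j. x \<in> carrier (Deg X i) \<Longrightarrow> g i x \<ominus>\<^bsub>Deg Y i\<^esub> k i x =
        Dif Y (i - 1) (t i x) \<oplus>\<^bsub>Deg Y i\<^esub> t (i + 1) (Dif X i x)"
    using homotopicE[OF h(2) assms(6,7)] by metis
  note [simp] = chmap[OF f assms(6,7)] chmap[OF g assms(6,7)] chmap[OF k assms(6,7)]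
  show ?thesis
  proof (rule homotopicI[where s = "\<lambda>i. \<lambda>x\<in>carrier (Deg X i). s i x \<oplus>\<^bsub>Deg Y (i - 1)\<^esub> t i x"])
    fix i x assume x [simp]: "x \<in> carrier (Deg X i)"
    have "f i x \<ominus>\<^bsub>Deg Y i\<^esub> k i x = (f i x \<ominus>\<^bsub>Deg Y i\<^esub> g i x) \<oplus>\<^bsub>Deg Y i\<^esub> (g i x \<ominus>\<^bsub>Deg Y i\<^esub> k i x)"
      by (simp add: agn)
    also have "\<dots> = Dif Y (i - 1) (s i x) \<oplus>\<^bsub>Deg Y i\<^esub> Dif Y (i - 1) (t i x) \<oplus>\<^bsub>Deg Y i\<^esub>
       (s (i + 1) (Dif X i x) \<oplus>\<^bsub>Deg Y i\<^esub> t (i + 1) (Dif X i x))"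
      unfolding e[OF x] e'[OF x] by (simp add: agn)
    finally show "f i x \<ominus>\<^bsub>Deg Y i\<^esub> k i x = Dif Y (i - 1) ((\<lambda>x\<in>carrier (Deg X i). s i x \<oplus>\<^bsub>Deg Y (i - 1)\<^esub> t i x) x)
      \<oplus>\<^bsub>Deg Y i\<^esub> (\<lambda>x\<in>carrier (Deg X (i + 1)). s (i + 1) x \<oplus>\<^bsub>Deg Y (i + 1 - 1)\<^esub> t (i + 1) x) (Dif X i x)"
      using dif_add[OF assms(7), of "s i x" "i - 1" "t i x"] by simp
  qed (simp add: rhom_add s t)
qed

lemma homotopic_comp_right:
  assumes h: "homotopic L X Y f g" and u: "u \<in> chain_maps L V X"
    and [simp]: "X \<in> bcpx L" "Y \<in> bcpx L" "V \<in> bcpx L"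
  shows "homotopic L V Y (ccomp V f u) (ccomp V g u)"
proof -
  obtain s where s: "\<And>i j. j = i - 1 \<Longrightarrow> s i \<in> rhom L (Deg X i) (Deg Y j)"
    and [simp]: "\<And>x i j. x \<in> carrier (Deg X i) \<Longrightarrow> j = i - 1 \<Longrightarrow> s i x \<in> carrier (Deg Y j)"
    and e: "\<And>x i j. x \<in> carrier (Deg X i) \<Longrightarrow> f i x \<ominus>\<^bsub>Deg Y i\<^esub> g i x =
        Dif Y (i - 1) (s i x) \<oplus>\<^bsub>Deg Y i\<^esub> s (i + 1) (Dif X i x)"
    using homotopicE[OF h assms(3,4)] by metis
  note [simp] = chmap[OF u assms(5,3)]
  show ?thesis
    by (rule homotopicI[where s = "\<lambda>i. compose (carrier (Deg V i)) (s i) (u i)"])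
      (simp_all add: rhom_compose[OF chain_maps_rhom[OF u] s] e compose_eq)
qed

lemma homotopic_comp_left:
  assumes h: "homotopic L X Y f g" and f: "f \<in> chain_maps L X Y" and g: "g \<in> chain_maps L X Y"
    and u: "u \<in> chain_maps L Y Z"
    and [simp]: "X \<in> bcpx L" "Y \<in> bcpx L" "Z \<in> bcpx L"
  shows "homotopic L X Z (ccomp X u f) (ccomp X u g)"
proof -
  obtain s where s: "\<And>i j. j = i - 1 \<Longrightarrow> s i \<in> rhom L (Deg X i) (Deg Y j)"
    and [simp]: "\<And>x i j. x \<in> carrier (Deg X i) \<Longrightarrow> j = i - 1 \<Longrightarrow> s i x \<in> carrier (Deg Y j)"
    and e: "\<And>x i j. x \<in> carrier (Deg X i) \<Longrightarrow> f i x \<ominus>\<^bsub>Deg Y i\<^esub> g i x =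
        Dif Y (i - 1) (s i x) \<oplus>\<^bsub>Deg Y i\<^esub> s (i + 1) (Dif X i x)"
    using homotopicE[OF h assms(5,6)] by metis
  note [simp] = chmap[OF f assms(5,6)] chmap[OF g assms(5,6)]
  note U = chmap[OF u assms(6,7)]
  show ?thesis
  proof (rule homotopicI[where s = "\<lambda>i. compose (carrier (Deg X i)) (u (i - 1)) (s i)"])
    show "compose (carrier (Deg X i)) (u (i - 1)) (s i) \<in> rhom L (Deg X i) (Deg Z (i - 1))" for i
      by (simp add: rhom_compose[OF s chain_maps_rhom[OF u]])
  next
    fix i x assume x [simp]: "x \<in> carrier (Deg X i)"
    have "u i (f i x) \<ominus>\<^bsub>Deg Z i\<^esub> u i (g i x) = u i (Dif Y (i - 1) (s i x) \<oplus>\<^bsub>Deg Y i\<^esub> s (i + 1) (Dif X i x))"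
      by (simp add: U(7)[symmetric] e)
    also have "\<dots> = Dif Z (i - 1) (u (i - 1) (s i x)) \<oplus>\<^bsub>Deg Z i\<^esub> u i (s (i + 1) (Dif X i x))"
      by (simp add: U)
    finally show "ccomp X u f i x \<ominus>\<^bsub>Deg Z i\<^esub> ccomp X u g i x = Dif Z (i - 1) (compose (carrier (Deg X i)) (u (i - 1)) (s i) x)
       \<oplus>\<^bsub>Deg Z i\<^esub> compose (carrier (Deg X (i + 1))) (u (i + 1 - 1)) (s (i + 1)) (Dif X i x)"
      by (simp add: compose_eq)
  qed
qed

lemma homotopic_add:
  assumes h: "homotopic L X Y f g" "homotopic L X Y f' g'" and f: "f \<in> chain_maps L X Y"
    and g: "g \<in> chain_maps L X Y" and f': "f' \<in> chain_maps L X Y" and g': "g' \<in> chain_maps L X Y"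
    and [simp]: "X \<in> bcpx L" "Y \<in> bcpx L"
  shows "homotopic L X Y (cadd X Y f f') (cadd X Y g g')"
proof -
  obtain s where s: "\<And>i j. j = i - 1 \<Longrightarrow> s i \<in> rhom L (Deg X i) (Deg Y j)"
    and [simp]: "\<And>x i j. x \<in> carrier (Deg X i) \<Longrightarrow> j = i - 1 \<Longrightarrow> s i x \<in> carrier (Deg Y j)"
    and e: "\<And>x i j. x \<in> carrier (Deg X i) \<Longrightarrow> f i x \<ominus>\<^bsub>Deg Y i\<^esub> g i x =
        Dif Y (i - 1) (s i x) \<oplus>\<^bsub>Deg Y i\<^esub> s (i + 1) (Dif X i x)"
    using homotopicE[OF h(1) assms(7,8)] by metis
  obtain t where t: "\<And>i j. j = i - 1 \<Longrightarrow> t i \<in> rhom L (Deg X i) (Deg Y j)"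
    and [simp]: "\<And>x i j. x \<in> carrier (Deg X i) \<Longrightarrow> j = i - 1 \<Longrightarrow> t i x \<in> carrier (Deg Y j)"
    and e': "\<And>x i j. x \<in> carrier (Deg X i) \<Longrightarrow> f' i x \<ominus>\<^bsub>Deg Y i\<^esub> g' i x =
        Dif Y (i - 1) (t i x) \<oplus>\<^bsub>Deg Y i\<^esub> t (i + 1) (Dif X i x)"
    using homotopicE[OF h(2) assms(7,8)] by metis
  note [simp] = chmap[OF f assms(7,8)] chmap[OF g assms(7,8)] chmap[OF f' assms(7,8)] chmap[OF g' assms(7,8)]
  show ?thesis
  proof (rule homotopicI[where s = "\<lambda>i. \<lambda>x\<in>carrier (Deg X i). s i x \<oplus>\<^bsub>Deg Y (i - 1)\<^esub> t i x"])
    fix i x assume x [simp]: "x \<in> carrier (Deg X i)"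
    have "cadd X Y f f' i x \<ominus>\<^bsub>Deg Y i\<^esub> cadd X Y g g' i x = (f i x \<ominus>\<^bsub>Deg Y i\<^esub> g i x) \<oplus>\<^bsub>Deg Y i\<^esub> (f' i x \<ominus>\<^bsub>Deg Y i\<^esub> g' i x)"
      by (simp add: agn)
    also have "\<dots> = Dif Y (i - 1) (s i x) \<oplus>\<^bsub>Deg Y i\<^esub> Dif Y (i - 1) (t i x) \<oplus>\<^bsub>Deg Y i\<^esub>
       (s (i + 1) (Dif X i x) \<oplus>\<^bsub>Deg Y i\<^esub> t (i + 1) (Dif X i x))"
      unfolding e[OF x] e'[OF x] by (simp add: agn)
    finally show "cadd X Y f f' i x \<ominus>\<^bsub>Deg Y i\<^esub> cadd X Y g g' i x = Dif Y (i - 1) ((\<lambda>x\<in>carrier (Deg X i). s i x \<oplus>\<^bsub>Deg Y (i - 1)\<^esub> t i x) x)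
      \<oplus>\<^bsub>Deg Y i\<^esub> (\<lambda>x\<in>carrier (Deg X (i + 1)). s (i + 1) x \<oplus>\<^bsub>Deg Y (i + 1 - 1)\<^esub> t (i + 1) x) (Dif X i x)"
      using dif_add[OF assms(8), of "s i x" "i - 1" "t i x"] by simp
  qed (simp add: rhom_add s t)
qed

section \<open>Quasi-isomorphisms\<close>

lemma cycles_iff: "x \<in> cycles X i \<longleftrightarrow> x \<in> carrier (Deg X i) \<and> Dif X i x = \<zero>\<^bsub>Deg X (i + 1)\<^esub>"
  by (simp add: cycles_def a_kernel_eq)

lemma cycles_carrier [simp]: "x \<in> cycles X i \<Longrightarrow> x \<in> carrier (Deg X i)"
  by (simp add: cycles_iff)

lemma cyclesD: "x \<in> cycles X i \<Longrightarrow> Dif X i x = \<zero>\<^bsub>Deg X (i + 1)\<^esub>"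
  by (simp del: cycles_carrier add: cycles_iff)

lemma cycles_submodule:
  assumes X: "X \<in> bcpx L"
  shows "submodule (cycles X i) L (Deg X i)"
  using kernel_submodule[OF bcpx_rhom[OF X refl, of i]] X by (simp del: cycles_carrier add: cycles_def a_kernel_eq)

lemma boundaries_submodule:
  assumes X: "X \<in> bcpx L"
  shows "submodule (boundaries X i) L (Deg X i)"
  unfolding boundaries_def using image_submodule[OF bcpx_rhom[OF X, of i "i - 1"]] X by simp

lemma boundariesI: "y \<in> carrier (Deg X i) \<Longrightarrow> j = i + 1 \<Longrightarrow> Dif X i y \<in> boundaries X j"
  by (simp add: boundaries_def)

lemma boundariesE:
  assumes "x \<in> boundaries X j"
  obtains y where "y \<in> carrier (Deg X (j - 1))" "x = Dif X (j - 1) y"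
  using assms by (auto simp: boundaries_def)

lemma boundaries_cycles: "X \<in> bcpx L \<Longrightarrow> x \<in> boundaries X i \<Longrightarrow> x \<in> cycles X i"
  by (auto simp: boundaries_def cycles_iff simp del: cycles_carrier)

lemma boundaries_carrier: "X \<in> bcpx L \<Longrightarrow> x \<in> boundaries X i \<Longrightarrow> x \<in> carrier (Deg X i)"
  by (rule cycles_carrier[OF boundaries_cycles])

lemma
  assumes "X \<in> bcpx L"
  shows cycles_zero [simp]: "\<zero>\<^bsub>Deg X i\<^esub> \<in> cycles X i"
    and cycles_add: "x \<in> cycles X i \<Longrightarrow> y \<in> cycles X i \<Longrightarrow> x \<oplus>\<^bsub>Deg X i\<^esub> y \<in> cycles X i"
    and cycles_neg: "x \<in> cycles X i \<Longrightarrow> \<ominus>\<^bsub>Deg X i\<^esub> x \<in> cycles X i"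
    and cycles_minus: "x \<in> cycles X i \<Longrightarrow> y \<in> cycles X i \<Longrightarrow> x \<ominus>\<^bsub>Deg X i\<^esub> y \<in> cycles X i"
    and boundaries_zero [simp]: "\<zero>\<^bsub>Deg X i\<^esub> \<in> boundaries X i"
    and boundaries_add: "x \<in> boundaries X i \<Longrightarrow> y \<in> boundaries X i \<Longrightarrow> x \<oplus>\<^bsub>Deg X i\<^esub> y \<in> boundaries X i"
    and boundaries_neg: "x \<in> boundaries X i \<Longrightarrow> \<ominus>\<^bsub>Deg X i\<^esub> x \<in> boundaries X i"
    and boundaries_minus: "x \<in> boundaries X i \<Longrightarrow> y \<in> boundaries X i \<Longrightarrow> x \<ominus>\<^bsub>Deg X i\<^esub> y \<in> boundaries X i"
  using right_module.right_submoduleE[OF fg_rm[OF bcpx_fg[OF assms]] cycles_submodule[OF assms, of i]]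
    right_module.right_submoduleE[OF fg_rm[OF bcpx_fg[OF assms]] boundaries_submodule[OF assms, of i]]
  by (simp_all add: a_minus_def)

lemma chain_cycles:
  assumes "f \<in> chain_maps L X Y" "X \<in> bcpx L" "Y \<in> bcpx L" "x \<in> cycles X i"
  shows "f i x \<in> cycles Y i"
proof -
  note F = chmap[OF assms(1-3)]
  have x: "x \<in> carrier (Deg X i)" "Dif X i x = \<zero>\<^bsub>Deg X (i + 1)\<^esub>" using assms(4) by (auto simp del: cycles_carrier simp: cycles_iff)
  have "Dif Y i (f i x) = f (i + 1) (Dif X i x)" by (rule F(2)[symmetric]) (use x in auto)
  then show ?thesis using x F by (simp del: cycles_carrier add: cycles_iff)
qed

lemma chain_boundaries:
  assumes "f \<in> chain_maps L X Y" "X \<in> bcpx L" "Y \<in> bcpx L" "x \<in> boundaries X i"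
  shows "f i x \<in> boundaries Y i"
proof -
  note F = chmap[OF assms(1-3)]
  obtain y where y: "y \<in> carrier (Deg X (i - 1))" "x = Dif X (i - 1) y" using assms(4) by (rule boundariesE)
  have "f i x = Dif Y (i - 1) (f (i - 1) y)" unfolding y(2) by (rule F(2)) (use y in auto)
  then show ?thesis using boundariesI[of "f (i - 1) y" Y "i - 1" i] F(1)[OF y(1)] by simp
qed

lemma qi_chain: "f \<in> quasi_isos L X Y \<Longrightarrow> f \<in> chain_maps L X Y"
  by (simp add: quasi_isos_def)

lemma qi_inj: "f \<in> quasi_isos L X Y \<Longrightarrow> x \<in> cycles X i \<Longrightarrow> f i x \<in> boundaries Y i \<Longrightarrow> x \<in> boundaries X i"
  by (simp add: quasi_isos_def)

lemma qi_surj: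
  assumes "f \<in> quasi_isos L X Y" "y \<in> cycles Y i"
  obtains x where "x \<in> cycles X i" "y \<ominus>\<^bsub>Deg Y i\<^esub> f i x \<in> boundaries Y i"
  using assms unfolding quasi_isos_def by blast

lemma qiI:
  assumes "f \<in> chain_maps L X Y"
    and "\<And>i x. x \<in> cycles X i \<Longrightarrow> f i x \<in> boundaries Y i \<Longrightarrow> x \<in> boundaries X i"
    and "\<And>i y. y \<in> cycles Y i \<Longrightarrow> \<exists>x\<in>cycles X i. y \<ominus>\<^bsub>Deg Y i\<^esub> f i x \<in> boundaries Y i"
  shows "f \<in> quasi_isos L X Y"
  using assms unfolding quasi_isos_def by blast

text \<open>On cycles a homotopy makes f - g take values in boundaries, so both maps induce the same
  map in cohomology.\<close>

lemma qi_homotopic: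
  assumes f: "f \<in> quasi_isos L X Y" and h: "homotopic L X Y f g" and g: "g \<in> chain_maps L X Y"
    and [simp]: "X \<in> bcpx L" "Y \<in> bcpx L"
  shows "g \<in> quasi_isos L X Y"
proof -
  obtain s where [simp]: "\<And>x i j. x \<in> carrier (Deg X i) \<Longrightarrow> j = i - 1 \<Longrightarrow> s i x \<in> carrier (Deg Y j)"
    and e: "\<And>x i j. x \<in> carrier (Deg X i) \<Longrightarrow> f i x \<ominus>\<^bsub>Deg Y i\<^esub> g i x =
        Dif Y (i - 1) (s i x) \<oplus>\<^bsub>Deg Y i\<^esub> s (i + 1) (Dif X i x)"
    and z: "\<And>i. s i \<zero>\<^bsub>Deg X i\<^esub> = \<zero>\<^bsub>Deg Y (i - 1)\<^esub>"
    using homotopicE[OF h assms(4,5)] by metis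
  note F = chmap[OF qi_chain[OF f] assms(4,5)] and G = chmap[OF g assms(4,5)]
  have d: "f i x \<ominus>\<^bsub>Deg Y i\<^esub> g i x \<in> boundaries Y i" if "x \<in> cycles X i" for i x
    using that e[OF cycles_carrier[OF that]] z[of "i + 1"] by (simp add: cyclesD boundariesI)
  show ?thesis
  proof (rule qiI[OF g])
    fix i x assume x: "x \<in> cycles X i" "g i x \<in> boundaries Y i"
    have "(f i x \<ominus>\<^bsub>Deg Y i\<^esub> g i x) \<oplus>\<^bsub>Deg Y i\<^esub> g i x \<in> boundaries Y i"
      by (rule boundaries_add[OF assms(5) d[OF x(1)] x(2)])
    moreover have "(f i x \<ominus>\<^bsub>Deg Y i\<^esub> g i x) \<oplus>\<^bsub>Deg Y i\<^esub> g i x = f i x"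
      using x F(1) G(1) by (simp add: agn)
    ultimately show "x \<in> boundaries X i" using qi_inj[OF f x(1)] by simp
  next
    fix i y assume y: "y \<in> cycles Y i"
    then obtain x where x: "x \<in> cycles X i" "y \<ominus>\<^bsub>Deg Y i\<^esub> f i x \<in> boundaries Y i" by (rule qi_surj[OF f])
    have "(y \<ominus>\<^bsub>Deg Y i\<^esub> f i x) \<oplus>\<^bsub>Deg Y i\<^esub> (f i x \<ominus>\<^bsub>Deg Y i\<^esub> g i x) \<in> boundaries Y i"
      by (rule boundaries_add[OF assms(5) x(2) d[OF x(1)]])
    moreover have "(y \<ominus>\<^bsub>Deg Y i\<^esub> f i x) \<oplus>\<^bsub>Deg Y i\<^esub> (f i x \<ominus>\<^bsub>Deg Y i\<^esub> g i x) = y \<ominus>\<^bsub>Deg Y i\<^esub> g i x"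
      using x y F(1) G(1) by (simp add: agn)
    ultimately show "\<exists>x\<in>cycles X i. y \<ominus>\<^bsub>Deg Y i\<^esub> g i x \<in> boundaries Y i" using x by auto
  qed
qed

lemma qi_cid [simp]: "X \<in> bcpx L \<Longrightarrow> cid X \<in> quasi_isos L X X"
  by (rule qiI) (auto simp del: cycles_carrier simp: cycles_iff intro!: bexI)

lemma qi_comp:
  assumes f: "f \<in> quasi_isos L X Y" and g: "g \<in> quasi_isos L Y Z"
    and [simp]: "X \<in> bcpx L" "Y \<in> bcpx L" "Z \<in> bcpx L"
  shows "ccomp X g f \<in> quasi_isos L X Z"
proof (rule qiI)
  note F = chmap[OF qi_chain[OF f] assms(3,4)] and G = chmap[OF qi_chain[OF g] assms(4,5)]
  show "ccomp X g f \<in> chain_maps L X Z" using f g by (simp add: ccomp_chain[OF qi_chain qi_chain])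
  fix i
  show "x \<in> boundaries X i" if "x \<in> cycles X i" "ccomp X g f i x \<in> boundaries Z i" for x
    using that qi_inj[OF f that(1)] qi_inj[OF g chain_cycles[OF qi_chain[OF f] assms(3,4) that(1)]] by simp
  fix z assume z: "z \<in> cycles Z i"
  then obtain y where y: "y \<in> cycles Y i" "z \<ominus>\<^bsub>Deg Z i\<^esub> g i y \<in> boundaries Z i" by (rule qi_surj[OF g])
  obtain x where x: "x \<in> cycles X i" "y \<ominus>\<^bsub>Deg Y i\<^esub> f i x \<in> boundaries Y i" by (rule qi_surj[OF f y(1)])
  have "(z \<ominus>\<^bsub>Deg Z i\<^esub> g i y) \<oplus>\<^bsub>Deg Z i\<^esub> g i (y \<ominus>\<^bsub>Deg Y i\<^esub> f i x) \<in> boundaries Z i"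
    by (rule boundaries_add[OF assms(5) y(2) chain_boundaries[OF qi_chain[OF g] assms(4,5) x(2)]])
  moreover have "(z \<ominus>\<^bsub>Deg Z i\<^esub> g i y) \<oplus>\<^bsub>Deg Z i\<^esub> g i (y \<ominus>\<^bsub>Deg Y i\<^esub> f i x) = z \<ominus>\<^bsub>Deg Z i\<^esub> g i (f i x)"
    using x y z F(1) G(1,7) by (simp add: agn)
  ultimately show "\<exists>x\<in>cycles X i. z \<ominus>\<^bsub>Deg Z i\<^esub> ccomp X g f i x \<in> boundaries Z i"
    using x by (intro bexI[of _ x]) simp_all
qed

text \<open>Isomorphisms in cohomology satisfy two out of three. This case shows later that both
  legs of a common refinement of roofs are quasi-isomorphisms.\<close>

lemma qi_cancel_left:
  assumes f: "f \<in> chain_maps L X Y" and g: "g \<in> quasi_isos L Y Z" and gf: "ccomp X g f \<in> quasi_isos L X Z"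
    and [simp]: "X \<in> bcpx L" "Y \<in> bcpx L" "Z \<in> bcpx L"
  shows "f \<in> quasi_isos L X Y"
proof (rule qiI[OF f])
  note F = chmap[OF f assms(4,5)] and G = chmap[OF qi_chain[OF g] assms(5,6)]
  fix i
  show "x \<in> boundaries X i" if "x \<in> cycles X i" "f i x \<in> boundaries Y i" for x
    using qi_inj[OF gf that(1)] that chain_boundaries[OF qi_chain[OF g] assms(5,6) that(2)] by simp
  fix y assume y: "y \<in> cycles Y i"
  obtain x where x: "x \<in> cycles X i" "g i y \<ominus>\<^bsub>Deg Z i\<^esub> ccomp X g f i x \<in> boundaries Z i"
    by (rule qi_surj[OF gf chain_cycles[OF qi_chain[OF g] assms(5,6) y]])
  have fx: "f i x \<in> cycles Y i" using chain_cycles[OF f assms(4,5) x(1)] .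
  have "g i (y \<ominus>\<^bsub>Deg Y i\<^esub> f i x) \<in> boundaries Z i" using x y F(1) G(7) by simp
  then have "y \<ominus>\<^bsub>Deg Y i\<^esub> f i x \<in> boundaries Y i" using qi_inj[OF g cycles_minus[OF assms(5) y fx]] by simp
  then show "\<exists>x\<in>cycles X i. y \<ominus>\<^bsub>Deg Y i\<^esub> f i x \<in> boundaries Y i" using x by blast
qed

text \<open>The map is an isomorphism of complexes; choosing preimages element by element avoids
  constructing the inverse chain map.\<close>

lemma chain_bij_qi:
  assumes f: "f \<in> chain_maps L X Y" and [simp]: "X \<in> bcpx L" "Y \<in> bcpx L"
    and inj: "\<And>i x. x \<in> carrier (Deg X i) \<Longrightarrow> f i x = \<zero>\<^bsub>Deg Y i\<^esub> \<Longrightarrow> x = \<zero>\<^bsub>Deg X i\<^esub>"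
    and surj: "\<And>i y. y \<in> carrier (Deg Y i) \<Longrightarrow> \<exists>x\<in>carrier (Deg X i). f i x = y"
  shows "f \<in> quasi_isos L X Y"
proof (rule qiI[OF f])
  note F = chmap[OF f assms(2,3)]
  fix i
  show "x \<in> boundaries X i" if x: "x \<in> cycles X i" "f i x \<in> boundaries Y i" for x
  proof -
    obtain y where y: "y \<in> carrier (Deg Y (i - 1))" "f i x = Dif Y (i - 1) y" using x(2) by (rule boundariesE)
    obtain w where w: "w \<in> carrier (Deg X (i - 1))" "f (i - 1) w = y" using surj[OF y(1)] by blast
    have "f i (Dif X (i - 1) w) = f i x" using F(2)[OF w(1), of i] w(2) y(2) by simp
    then have "f i (x \<ominus>\<^bsub>Deg X i\<^esub> Dif X (i - 1) w) = \<zero>\<^bsub>Deg Y i\<^esub>"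
      using F(1,7) x w by simp
    then have "x \<ominus>\<^bsub>Deg X i\<^esub> Dif X (i - 1) w = \<zero>\<^bsub>Deg X i\<^esub>" using x w by (intro inj) simp_all
    then have "x = Dif X (i - 1) w" using x w by (simp add: fg_minus_eq_zero)
    then show ?thesis using w by (simp add: boundariesI)
  qed
  fix y assume y: "y \<in> cycles Y i"
  obtain x where x: "x \<in> carrier (Deg X i)" "f i x = y" using surj[OF cycles_carrier[OF y]] by blast
  have "f (i + 1) (Dif X i x) = \<zero>\<^bsub>Deg Y (i + 1)\<^esub>" using F x y by (simp del: cycles_carrier add: cycles_iff)
  then have "Dif X i x = \<zero>\<^bsub>Deg X (i + 1)\<^esub>" using x by (intro inj) simp_all
  then show "\<exists>x\<in>cycles X i. y \<ominus>\<^bsub>Deg Y i\<^esub> f i x \<in> boundaries Y i"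
    using x y by (intro bexI[of _ x]) (simp_all del: cycles_carrier add: cycles_iff)
qed

definition acyclic :: "'a cpx \<Rightarrow> bool" where
  "acyclic X \<longleftrightarrow> (\<forall>i. cycles X i \<subseteq> boundaries X i)"

lemma acyclicE:
  assumes "acyclic X" "x \<in> carrier (Deg X i)" "Dif X i x = \<zero>\<^bsub>Deg X (i + 1)\<^esub>"
  obtains y where "y \<in> carrier (Deg X (i - 1))" "x = Dif X (i - 1) y"
proof -
  have "x \<in> boundaries X i" using assms unfolding acyclic_def by (simp del: cycles_carrier add: cycles_iff subset_iff)
  then show ?thesis using that by (rule boundariesE)
qed

lemma qi_acyclic:
  assumes f: "f \<in> quasi_isos L X Y" and [simp]: "X \<in> bcpx L" "Y \<in> bcpx L"
  shows "acyclic X \<longleftrightarrow> acyclic Y"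
proof
  note F = chmap[OF qi_chain[OF f] assms(2,3)]
  assume a: "acyclic X"
  show "acyclic Y" unfolding acyclic_def
  proof (intro allI subsetI)
    fix i y assume y: "y \<in> cycles Y i"
    obtain x where x: "x \<in> cycles X i" "y \<ominus>\<^bsub>Deg Y i\<^esub> f i x \<in> boundaries Y i" by (rule qi_surj[OF f y])
    then have "f i x \<in> boundaries Y i"
      using a chain_boundaries[OF qi_chain[OF f] assms(2,3)] unfolding acyclic_def by blast
    then have "(y \<ominus>\<^bsub>Deg Y i\<^esub> f i x) \<oplus>\<^bsub>Deg Y i\<^esub> f i x \<in> boundaries Y i"
      using boundaries_add[OF assms(3) x(2)] by blast
    then show "y \<in> boundaries Y i" using x y F(1) by (simp add: agn)
  qed
next
  assume a: "acyclic Y"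
  then show "acyclic X" unfolding acyclic_def
    using chain_cycles[OF qi_chain[OF f] assms(2,3)] qi_inj[OF f] by blast
qed

section \<open>Shifts\<close>

lemma cshift_Deg [simp]: "Deg (cshift n X) i = Deg X (i + n)"
  by (simp add: cshift_def)

lemma cshift_Dif: "x \<in> carrier (Deg X (i + n)) \<Longrightarrow> Dif (cshift n X) i x =
    (if even n then Dif X (i + n) x else \<ominus>\<^bsub>Deg X (i + n + 1)\<^esub> Dif X (i + n) x)"
  by (simp add: cshift_def)

lemma cshift_bcpx [simp]:
  assumes [simp]: "X \<in> bcpx L"
  shows "cshift n X \<in> bcpx L"
proof (rule bcpxI)
  fix i
  have "(\<lambda>x\<in>carrier (Deg X (i + n)). if even n then Dif X (i + n) x else \<ominus>\<^bsub>Deg X (i + n + 1)\<^esub> Dif X (i + n) x)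
    \<in> rhom L (Deg X (i + n)) (Deg X (i + n + 1))"
    by (cases "even n") (simp_all add: rhom_restrict[OF bcpx_rhom] bcpx_rhom rhom_neg)
  moreover have "i + n + 1 = i + 1 + n" by simp
  ultimately show "Dif (cshift n X) i \<in> rhom L (Deg (cshift n X) i) (Deg (cshift n X) (i + 1))"
    by (simp add: cshift_def)
  fix x assume x: "x \<in> carrier (Deg (cshift n X) i)"
  have e: "i + 1 + n = (i + n) + 1" "i + 2 + n = (i + n) + 2" by auto
  have "Dif (cshift n X) (i + 1) y = (if even n then Dif X (i + n + 1) y else \<ominus>\<^bsub>Deg X (i + n + 2)\<^esub> Dif X (i + n + 1) y)"
    if "y \<in> carrier (Deg X (i + n + 1))" for y
    using cshift_Dif[of y X "i + 1" n] that unfolding e by simp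
  then show "Dif (cshift n X) (i + 1) (Dif (cshift n X) i x) = \<zero>\<^bsub>Deg (cshift n X) (i + 2)\<^esub>"
    using x by (simp add: cshift_Dif dif_neg e)
next
  show "finite ((\<lambda>i. i - n) ` {i. carrier (Deg X i) \<noteq> {\<zero>\<^bsub>Deg X i\<^esub>}})" using bcpx_finite[OF assms] by simp
  fix i x assume i: "i \<notin> (\<lambda>i. i - n) ` {i. carrier (Deg X i) \<noteq> {\<zero>\<^bsub>Deg X i\<^esub>}}" "x \<in> carrier (Deg (cshift n X) i)"
  have "carrier (Deg X (i + n)) = {\<zero>\<^bsub>Deg X (i + n)\<^esub>}"
    using i(1) image_eqI[of i "\<lambda>i. i - n" "i + n"] by force
  then show "x = \<zero>\<^bsub>Deg (cshift n X) i\<^esub>" using i by simp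
qed simp

lemma cshift_cycles [simp]:
  assumes "X \<in> bcpx L"
  shows "cycles (cshift n X) i = cycles X (i + n)"
proof -
  have e: "i + 1 + n = i + n + 1" by simp
  show ?thesis using assms by (auto simp del: cycles_carrier simp: cycles_iff cshift_Dif set_eq_iff e split: if_splits)
qed

lemma cshift_boundaries [simp]:
  assumes [simp]: "X \<in> bcpx L"
  shows "boundaries (cshift n X) i = boundaries X (i + n)"
proof -
  have e: "i - 1 + n = i + n - 1" by simp
  have "Dif (cshift n X) (i - 1) ` carrier (Deg X (i + n - 1)) = Dif X (i + n - 1) ` carrier (Deg X (i + n - 1))"
  proof (cases "even n")
    case True
    then show ?thesis by (intro image_cong) (simp_all add: cshift_Dif e)
  next
    case False
    \<comment> \<open>The sign on the shifted differential moves to the preimage, so the image is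
      the same set.\<close>
    have 1: "Dif (cshift n X) (i - 1) x = Dif X (i + n - 1) (\<ominus>\<^bsub>Deg X (i + n - 1)\<^esub> x)" if "x \<in> carrier (Deg X (i + n - 1))" for x
      using that False by (simp add: cshift_Dif e dif_neg)
    have 2: "Dif X (i + n - 1) x = Dif (cshift n X) (i - 1) (\<ominus>\<^bsub>Deg X (i + n - 1)\<^esub> x)" if "x \<in> carrier (Deg X (i + n - 1))" for x
      using that False by (simp add: cshift_Dif e dif_neg)
    show ?thesis
    proof (intro equalityI subsetI; elim imageE)
      fix y x assume "y = Dif (cshift n X) (i - 1) x" "x \<in> carrier (Deg X (i + n - 1))"
      then show "y \<in> Dif X (i + n - 1) ` carrier (Deg X (i + n - 1))" using 1[of x] by simp
    next
      fix y x assume "y = Dif X (i + n - 1) x" "x \<in> carrier (Deg X (i + n - 1))"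
      then show "y \<in> Dif (cshift n X) (i - 1) ` carrier (Deg X (i + n - 1))" using 2[of x] by simp
    qed
  qed
  then show ?thesis by (simp add: boundaries_def e)
qed

text \<open>Differentials are extensional, so restricting them to the carriers changes nothing and
  the two records are equal. This equality is what lets an object count as a shift of itself in
  \<open>tri_gen1_base\<close>.\<close>

lemma cshift_zero [simp]:
  assumes X: "X \<in> bcpx L"
  shows "cshift 0 X = X"
proof -
  have "restrict (Dif X i) (carrier (Deg X i)) = Dif X i" for i
    by (rule rhom_restrict[OF bcpx_rhom[OF X refl]])
  then show ?thesis by (simp add: cshift_def)
qed

section \<open>Twisted sums, fibres and cones\<close>

text \<open>An extension of A by the subcomplex B: the direct sum in each degree, with an
  off-diagonal term \<alpha> of degree one in the differential. Cones, homotopy fibres, direct sums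
  and the contractible part of the cover in \<open>resolved_reduce\<close> are instances, so their
  exactness properties are proved once for all.\<close>

definition tw :: "'a cpx \<Rightarrow> 'a cpx \<Rightarrow> 'a cmap \<Rightarrow> 'a cpx" where
  "tw A B \<alpha> = \<lparr>Deg = (\<lambda>i. mod_sum (Deg A i) (Deg B i)),
     Dif = (\<lambda>i. \<lambda>z\<in>carrier (mod_sum (Deg A i) (Deg B i)).
        spair (Dif A i (sfst z)) (\<alpha> i (sfst z) \<oplus>\<^bsub>Deg B (i + 1)\<^esub> Dif B i (ssnd z)))\<rparr>"

text \<open>Equivalently, chain maps from A to B[1]; the equation is the off-diagonal entry of d d =
  0 in \<open>tw\<close>.\<close>

definition twists :: "'a cpx \<Rightarrow> 'a cpx \<Rightarrow> 'a cmap set" where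
  "twists A B = {\<alpha>. (\<forall>i. \<alpha> i \<in> rhom L (Deg A i) (Deg B (i + 1))) \<and>
     (\<forall>i. \<forall>x\<in>carrier (Deg A i). Dif B (i + 1) (\<alpha> i x) \<oplus>\<^bsub>Deg B (i + 2)\<^esub> \<alpha> (i + 1) (Dif A i x) = \<zero>\<^bsub>Deg B (i + 2)\<^esub>)}"

lemma tw_Deg [simp]: "Deg (tw A B \<alpha>) i = mod_sum (Deg A i) (Deg B i)"
  by (simp add: tw_def)

lemma tw_Dif [simp]: "sfst z \<in> carrier (Deg A i) \<Longrightarrow> ssnd z \<in> carrier (Deg B i) \<Longrightarrow>
  Dif (tw A B \<alpha>) i z = spair (Dif A i (sfst z)) (\<alpha> i (sfst z) \<oplus>\<^bsub>Deg B (i + 1)\<^esub> Dif B i (ssnd z))"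
  by (simp add: tw_def)

lemma twistsI:
  assumes "\<And>i. \<alpha> i \<in> rhom L (Deg A i) (Deg B (i + 1))"
    and "\<And>i x. x \<in> carrier (Deg A i) \<Longrightarrow>
      Dif B (i + 1) (\<alpha> i x) \<oplus>\<^bsub>Deg B (i + 2)\<^esub> \<alpha> (i + 1) (Dif A i x) = \<zero>\<^bsub>Deg B (i + 2)\<^esub>"
  shows "\<alpha> \<in> twists A B"
  using assms by (simp add: twists_def)

lemma twist:
  assumes a: "\<alpha> \<in> twists A B" and A [simp]: "A \<in> bcpx L" and B [simp]: "B \<in> bcpx L"
  shows "\<And>i j. j = i + 1 \<Longrightarrow> \<alpha> i \<in> rhom L (Deg A i) (Deg B j)"
    and "\<And>x i j. x \<in> carrier (Deg A i) \<Longrightarrow> j = i + 1 \<Longrightarrow> \<alpha> i x \<in> carrier (Deg B j)"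
    and "\<And>x i j. x \<in> carrier (Deg A i) \<Longrightarrow> j = i + 1 \<Longrightarrow> \<alpha> j (Dif A i x) = \<ominus>\<^bsub>Deg B (j + 1)\<^esub> Dif B j (\<alpha> i x)"
    and "\<And>x y i. x \<in> carrier (Deg A i) \<Longrightarrow> y \<in> carrier (Deg A i) \<Longrightarrow>
      \<alpha> i (x \<oplus>\<^bsub>Deg A i\<^esub> y) = \<alpha> i x \<oplus>\<^bsub>Deg B (i + 1)\<^esub> \<alpha> i y"
    and "\<And>a x i. a \<in> carrier L \<Longrightarrow> x \<in> carrier (Deg A i) \<Longrightarrow> \<alpha> i (a \<odot>\<^bsub>Deg A i\<^esub> x) = a \<odot>\<^bsub>Deg B (i + 1)\<^esub> \<alpha> i x"
    and "\<And>i. \<alpha> i \<zero>\<^bsub>Deg A i\<^esub> = \<zero>\<^bsub>Deg B (i + 1)\<^esub>"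
    and "\<And>x i. x \<in> carrier (Deg A i) \<Longrightarrow> \<alpha> i (\<ominus>\<^bsub>Deg A i\<^esub> x) = \<ominus>\<^bsub>Deg B (i + 1)\<^esub> \<alpha> i x"
    and "\<And>x y i. x \<in> carrier (Deg A i) \<Longrightarrow> y \<in> carrier (Deg A i) \<Longrightarrow>
      \<alpha> i (x \<ominus>\<^bsub>Deg A i\<^esub> y) = \<alpha> i x \<ominus>\<^bsub>Deg B (i + 1)\<^esub> \<alpha> i y"
proof -
  have r: "\<alpha> i \<in> rhom L (Deg A i) (Deg B j)" if "j = i + 1" for i j using a that by (simp add: twists_def)
  then show "\<alpha> i \<in> rhom L (Deg A i) (Deg B j)" if "j = i + 1" for i j using that .
  note h = rhom_simps[OF r] rhom_group[OF r]
  show c: "\<alpha> i x \<in> carrier (Deg B j)" if "x \<in> carrier (Deg A i)" "j = i + 1" for i x j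
    using that by (intro h(1)[of j i]) auto
  show "\<alpha> j (Dif A i x) = \<ominus>\<^bsub>Deg B (j + 1)\<^esub> Dif B j (\<alpha> i x)" if "x \<in> carrier (Deg A i)" "j = i + 1" for i x j
  proof -
    have "Dif B (i + 1) (\<alpha> i x) \<oplus>\<^bsub>Deg B (i + 2)\<^esub> \<alpha> (i + 1) (Dif A i x) = \<zero>\<^bsub>Deg B (i + 2)\<^esub>"
      using a that by (simp add: twists_def)
    moreover have "Dif B (i + 1) (\<alpha> i x) \<oplus>\<^bsub>Deg B (i + 2)\<^esub> \<alpha> (i + 1) (Dif A i x) =
      \<alpha> (i + 1) (Dif A i x) \<oplus>\<^bsub>Deg B (i + 2)\<^esub> Dif B (i + 1) (\<alpha> i x)"
      using that c[of "Dif A i x" "i + 1" "i + 2"] c[OF that(1) refl] by (intro fg_a_comm) auto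
    moreover have "\<alpha> (i + 1) (Dif A i x) \<in> carrier (Deg B (i + 2))" "\<alpha> i x \<in> carrier (Deg B (i + 1))"
      using that by (intro c; simp)+
    ultimately show ?thesis using that by (intro fg_neg_unique) auto
  qed
qed (simp_all add: rhom_simps[OF twists_def[THEN equalityD1, THEN subsetD, OF a, simplified, THEN conjunct1, THEN spec]]
   rhom_group[OF twists_def[THEN equalityD1, THEN subsetD, OF a, simplified, THEN conjunct1, THEN spec]])

lemma tw_bcpx [simp]:
  assumes a: "\<alpha> \<in> twists A B" and A [simp]: "A \<in> bcpx L" and B [simp]: "B \<in> bcpx L"
  shows "tw A B \<alpha> \<in> bcpx L"
proof (rule bcpxI)
  note [simp] = twist(2-)[OF a A B]
  fix i
  show "Dif (tw A B \<alpha>) i \<in> rhom L (Deg (tw A B \<alpha>) i) (Deg (tw A B \<alpha>) (i + 1))"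
    unfolding tw_def cpx.simps by (rule rhomI) (simp_all add: difs agn fg_smult_add)
  fix x assume x: "x \<in> carrier (Deg (tw A B \<alpha>) i)"
  then show "Dif (tw A B \<alpha>) (i + 1) (Dif (tw A B \<alpha>) i x) = \<zero>\<^bsub>Deg (tw A B \<alpha>) (i + 2)\<^esub>"
    by (simp add: difs agn)
next
  show "finite ({i. carrier (Deg A i) \<noteq> {\<zero>\<^bsub>Deg A i\<^esub>}} \<union> {i. carrier (Deg B i) \<noteq> {\<zero>\<^bsub>Deg B i\<^esub>}})"
    using bcpx_finite[OF A] bcpx_finite[OF B] by simp
  fix i x assume i: "i \<notin> {i. carrier (Deg A i) \<noteq> {\<zero>\<^bsub>Deg A i\<^esub>}} \<union> {i. carrier (Deg B i) \<noteq> {\<zero>\<^bsub>Deg B i\<^esub>}}"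
    and x: "x \<in> carrier (Deg (tw A B \<alpha>) i)"
  have "sfst x = \<zero>\<^bsub>Deg A i\<^esub>" "ssnd x = \<zero>\<^bsub>Deg B i\<^esub>" using i x by auto
  then show "x = \<zero>\<^bsub>Deg (tw A B \<alpha>) i\<^esub>" using spair_simps(3)[of x] by simp
qed simp

definition tincl :: "'a cpx \<Rightarrow> 'a cpx \<Rightarrow> 'a cmap" where
  "tincl A B = (\<lambda>i. \<lambda>y\<in>carrier (Deg B i). spair \<zero>\<^bsub>Deg A i\<^esub> y)"

definition tproj :: "'a cpx \<Rightarrow> 'a cpx \<Rightarrow> 'a cmap" where
  "tproj A B = (\<lambda>i. \<lambda>z\<in>carrier (mod_sum (Deg A i) (Deg B i)). sfst z)"

lemma tincl_apply [simp]: "y \<in> carrier (Deg B i) \<Longrightarrow> tincl A B i y = spair \<zero>\<^bsub>Deg A i\<^esub> y"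
  by (simp add: tincl_def)

lemma tproj_apply [simp]: "sfst z \<in> carrier (Deg A i) \<Longrightarrow> ssnd z \<in> carrier (Deg B i) \<Longrightarrow> tproj A B i z = sfst z"
  by (simp add: tproj_def)

lemma tincl_chain:
  assumes a: "\<alpha> \<in> twists A B" and [simp]: "A \<in> bcpx L" "B \<in> bcpx L"
  shows "tincl A B \<in> chain_maps L B (tw A B \<alpha>)"
proof (rule chain_mapsI)
  note [simp] = twist(2-)[OF a assms(2,3)]
  show "tincl A B i \<in> rhom L (Deg B i) (Deg (tw A B \<alpha>) i)" for i
    unfolding tincl_def by (rule rhomI) simp_all
qed (simp add: twist(2-)[OF a assms(2,3)])

lemma tproj_chain:
  assumes a: "\<alpha> \<in> twists A B" and [simp]: "A \<in> bcpx L" "B \<in> bcpx L"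
  shows "tproj A B \<in> chain_maps L (tw A B \<alpha>) A"
proof (rule chain_mapsI)
  note [simp] = twist(2-)[OF a assms(2,3)]
  show "tproj A B i \<in> rhom L (Deg (tw A B \<alpha>) i) (Deg A i)" for i
    unfolding tproj_def tw_Deg by (rule rhomI) simp_all
qed (simp add: twist(2-)[OF a assms(2,3)])

text \<open>The kernel of the projection is B, so the long exact sequence gives the claim. The chase
  corrects second components by preimages under the differential of B.\<close>

lemma tproj_qi:
  assumes a: "\<alpha> \<in> twists A B" and B: "acyclic B" and [simp]: "A \<in> bcpx L" "B \<in> bcpx L"
  shows "tproj A B \<in> quasi_isos L (tw A B \<alpha>) A"
proof (rule qiI)
  note [simp] = twist(2-)[OF a assms(3,4)]
  show "tproj A B \<in> chain_maps L (tw A B \<alpha>) A" using a by (rule tproj_chain) simp_all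
  fix i
  show "z \<in> boundaries (tw A B \<alpha>) i" if z: "z \<in> cycles (tw A B \<alpha>) i" "tproj A B i z \<in> boundaries A i" for z
  proof -
    let ?x = "sfst z" and ?y = "ssnd z"
    have [simp]: "?x \<in> carrier (Deg A i)" "?y \<in> carrier (Deg B i)" using cycles_carrier[OF z(1)] by auto
    have zy: "\<alpha> i ?x \<oplus>\<^bsub>Deg B (i + 1)\<^esub> Dif B i ?y = \<zero>\<^bsub>Deg B (i + 1)\<^esub>" using z(1) by (simp del: cycles_carrier add: cycles_iff)
    obtain w where w [simp]: "w \<in> carrier (Deg A (i - 1))" and wx: "?x = Dif A (i - 1) w"
      using z(2) by (auto elim: boundariesE)
    have "Dif B i (?y \<ominus>\<^bsub>Deg B i\<^esub> \<alpha> (i - 1) w) = \<zero>\<^bsub>Deg B (i + 1)\<^esub>"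
      using zy unfolding wx by (simp add: difs agn)
    then obtain v where v [simp]: "v \<in> carrier (Deg B (i - 1))" and vy: "?y \<ominus>\<^bsub>Deg B i\<^esub> \<alpha> (i - 1) w = Dif B (i - 1) v"
      using acyclicE[OF B, of "?y \<ominus>\<^bsub>Deg B i\<^esub> \<alpha> (i - 1) w" i] by (metis \<open>?y \<in> carrier (Deg B i)\<close> assms(4) bcpx_fg diff_add_cancel fg_minus twist(2)[OF a assms(3,4)] w)
    have "?y = \<alpha> (i - 1) w \<oplus>\<^bsub>Deg B i\<^esub> Dif B (i - 1) v" by (simp add: vy[symmetric] agn)
    then have "z = Dif (tw A B \<alpha>) (i - 1) (spair w v)" using wx spair_simps(3)[of z] by simp
    then show ?thesis using boundariesI[of "spair w v" "tw A B \<alpha>" "i - 1" i] by simp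
  qed
  fix x assume x: "x \<in> cycles A i"
  then have [simp]: "x \<in> carrier (Deg A i)" by simp
  have "\<alpha> (i + 1) (Dif A i x) = \<zero>\<^bsub>Deg B (i + 2)\<^esub>" using x by (simp del: cycles_carrier add: cycles_iff del: twist(3)[OF a assms(3,4)])
  then have "Dif B (i + 1) (\<alpha> i x) = \<zero>\<^bsub>Deg B (i + 1 + 1)\<^esub>" by simp
  from acyclicE[OF B _ this] obtain y where "y \<in> carrier (Deg B (i + 1 - 1))" "\<alpha> i x = Dif B (i + 1 - 1) y"
    by auto
  then have y [simp]: "y \<in> carrier (Deg B i)" and yx: "\<alpha> i x = Dif B i y" by simp_all
  \<comment> \<open>The sign is forced: a cycle (x, y') must satisfy \<alpha> x + d y' = 0, while
    \<alpha> x = d y.\<close>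
  have "spair x (\<ominus>\<^bsub>Deg B i\<^esub> y) \<in> cycles (tw A B \<alpha>) i"
    using x by (simp del: cycles_carrier add: cycles_iff yx difs fg_r_neg)
  then show "\<exists>z\<in>cycles (tw A B \<alpha>) i. x \<ominus>\<^bsub>Deg A i\<^esub> tproj A B i z \<in> boundaries A i"
    by (intro bexI[of _ "spair x (\<ominus>\<^bsub>Deg B i\<^esub> y)"]) simp_all
qed

text \<open>Here the quotient A is acyclic. Writing a first component as d w changes the second one
  by \<alpha> w, which is why \<alpha> w appears in every correction.\<close>

lemma tincl_qi:
  assumes a: "\<alpha> \<in> twists A B" and A: "acyclic A" and [simp]: "A \<in> bcpx L" "B \<in> bcpx L"
  shows "tincl A B \<in> quasi_isos L B (tw A B \<alpha>)"
proof (rule qiI)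
  note [simp] = twist(2-)[OF a assms(3,4)]
  show "tincl A B \<in> chain_maps L B (tw A B \<alpha>)" using a by (rule tincl_chain) simp_all
  have key: "\<exists>w\<in>carrier (Deg A (i - 1)). \<exists>y\<in>cycles B i. sfst z = Dif A (i - 1) w \<and> ssnd z = \<alpha> (i - 1) w \<oplus>\<^bsub>Deg B i\<^esub> y"
    if z: "z \<in> cycles (tw A B \<alpha>) i" for z i
  proof -
    let ?x = "sfst z" and ?y = "ssnd z"
    have [simp]: "?x \<in> carrier (Deg A i)" "?y \<in> carrier (Deg B i)" using cycles_carrier[OF z(1)] by auto
    have zy: "Dif A i ?x = \<zero>\<^bsub>Deg A (i + 1)\<^esub>" "\<alpha> i ?x \<oplus>\<^bsub>Deg B (i + 1)\<^esub> Dif B i ?y = \<zero>\<^bsub>Deg B (i + 1)\<^esub>"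
      using z(1) by (simp_all del: cycles_carrier add: cycles_iff)
    obtain w where w [simp]: "w \<in> carrier (Deg A (i - 1))" and wx: "?x = Dif A (i - 1) w"
      using acyclicE[OF A _ zy(1)] by auto
    have "Dif B i (?y \<ominus>\<^bsub>Deg B i\<^esub> \<alpha> (i - 1) w) = \<zero>\<^bsub>Deg B (i + 1)\<^esub>"
      using zy(2) unfolding wx by (simp add: difs agn)
    then have "?y \<ominus>\<^bsub>Deg B i\<^esub> \<alpha> (i - 1) w \<in> cycles B i" by (simp del: cycles_carrier add: cycles_iff)
    moreover have "?y = \<alpha> (i - 1) w \<oplus>\<^bsub>Deg B i\<^esub> (?y \<ominus>\<^bsub>Deg B i\<^esub> \<alpha> (i - 1) w)" by (simp add: agn)
    ultimately show ?thesis using w wx by blast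
  qed
  fix i
  show "y \<in> boundaries B i" if y: "y \<in> cycles B i" "tincl A B i y \<in> boundaries (tw A B \<alpha>) i" for y
  proof -
    have [simp]: "y \<in> carrier (Deg B i)" using y by simp
    obtain z where z: "z \<in> carrier (Deg (tw A B \<alpha>) (i - 1))" "spair \<zero>\<^bsub>Deg A i\<^esub> y = Dif (tw A B \<alpha>) (i - 1) z"
      using y(2) by (auto elim: boundariesE)
    let ?a = "sfst z" and ?b = "ssnd z"
    have [simp]: "?a \<in> carrier (Deg A (i - 1))" "?b \<in> carrier (Deg B (i - 1))" using z by auto
    have ab: "Dif A (i - 1) ?a = \<zero>\<^bsub>Deg A (i - 1 + 1)\<^esub>" "y = \<alpha> (i - 1) ?a \<oplus>\<^bsub>Deg B i\<^esub> Dif B (i - 1) ?b"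
      using z(2) by simp_all
    obtain w where w [simp]: "w \<in> carrier (Deg A (i - 1 - 1))" and wx: "?a = Dif A (i - 1 - 1) w"
      using acyclicE[OF A _ ab(1)] by auto
    have "y = Dif B (i - 1) (?b \<ominus>\<^bsub>Deg B (i - 1)\<^esub> \<alpha> (i - 1 - 1) w)"
      using ab(2) w twist(3)[OF a assms(3,4), of w "i - 2" "i - 1"] dif_minus[OF assms(4), of ?b "i - 1" "\<alpha> (i - 1 - 1) w"]
      unfolding wx by (simp add: agn)
    then show ?thesis using boundariesI[of "?b \<ominus>\<^bsub>Deg B (i - 1)\<^esub> \<alpha> (i - 1 - 1) w" B "i - 1" i] w by simp
  qed
  fix z assume z: "z \<in> cycles (tw A B \<alpha>) i"
  obtain w y where w [simp]: "w \<in> carrier (Deg A (i - 1))" and y: "y \<in> cycles B i"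
    and e: "sfst z = Dif A (i - 1) w" "ssnd z = \<alpha> (i - 1) w \<oplus>\<^bsub>Deg B i\<^esub> y" using key[OF z] by blast
  have "z \<ominus>\<^bsub>Deg (tw A B \<alpha>) i\<^esub> tincl A B i y = Dif (tw A B \<alpha>) (i - 1) (spair w \<zero>\<^bsub>Deg B (i - 1)\<^esub>)"
    using y e dif_zero[OF assms(4), of "i - 1"] by (simp add: agn)
  then show "\<exists>y\<in>cycles B i. z \<ominus>\<^bsub>Deg (tw A B \<alpha>) i\<^esub> tincl A B i y \<in> boundaries (tw A B \<alpha>) i"
    using y boundariesI[of "spair w \<zero>\<^bsub>Deg B (i - 1)\<^esub>" "tw A B \<alpha>" "i - 1" i] by (intro bexI[of _ y]) simp_all
qed

text \<open>\<alpha> is the connecting map of the extension, from the cohomology of A to that of B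
  one degree higher. The two clauses are its injectivity and surjectivity, so for a cone they become
  the two clauses of \<open>quasi_isos\<close>.\<close>

lemma tw_acyclic_iff:
  assumes a: "\<alpha> \<in> twists A B" and [simp]: "A \<in> bcpx L" "B \<in> bcpx L"
  shows "acyclic (tw A B \<alpha>) \<longleftrightarrow>
    (\<forall>i. \<forall>x\<in>cycles A i. \<alpha> i x \<in> boundaries B (i + 1) \<longrightarrow> x \<in> boundaries A i) \<and>
    (\<forall>i. \<forall>y\<in>cycles B (i + 1). \<exists>x\<in>cycles A i. y \<ominus>\<^bsub>Deg B (i + 1)\<^esub> \<alpha> i x \<in> boundaries B (i + 1))"
    (is "?L \<longleftrightarrow> ?I \<and> ?S")
proof (intro iffI conjI)
  note [simp] = twist(2-)[OF a assms(2,3)]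
  assume ac: ?L
  show ?I
  proof (intro allI ballI impI)
    fix i x assume x: "x \<in> cycles A i" "\<alpha> i x \<in> boundaries B (i + 1)"
    then have [simp]: "x \<in> carrier (Deg A i)" by simp
    obtain y where y [simp]: "y \<in> carrier (Deg B i)" and yx: "\<alpha> i x = Dif B i y" using x(2) by (auto elim: boundariesE)
    have "spair x (\<ominus>\<^bsub>Deg B i\<^esub> y) \<in> cycles (tw A B \<alpha>) i" using x by (simp del: cycles_carrier add: cycles_iff yx difs fg_r_neg)
    then have "spair x (\<ominus>\<^bsub>Deg B i\<^esub> y) \<in> boundaries (tw A B \<alpha>) i" using ac by (auto simp: acyclic_def)
    then show "x \<in> boundaries A i" by (auto elim!: boundariesE intro!: boundariesI[where i = "i - 1"])
  qed
  show ?S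
  proof (intro allI ballI)
    fix i y assume y: "y \<in> cycles B (i + 1)"
    then have [simp]: "y \<in> carrier (Deg B (i + 1))" by simp
    have "spair \<zero>\<^bsub>Deg A (i + 1)\<^esub> y \<in> cycles (tw A B \<alpha>) (i + 1)" using y by (simp del: cycles_carrier add: cycles_iff)
    then have "spair \<zero>\<^bsub>Deg A (i + 1)\<^esub> y \<in> boundaries (tw A B \<alpha>) (i + 1)" using ac by (auto simp: acyclic_def)
    then obtain z where z: "sfst z \<in> carrier (Deg A i)" "ssnd z \<in> carrier (Deg B i)"
      "\<zero>\<^bsub>Deg A (i + 1)\<^esub> = Dif A i (sfst z)" "y = \<alpha> i (sfst z) \<oplus>\<^bsub>Deg B (i + 1)\<^esub> Dif B i (ssnd z)"
      by (auto elim!: boundariesE)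
    have "y \<ominus>\<^bsub>Deg B (i + 1)\<^esub> \<alpha> i (sfst z) = Dif B i (ssnd z)" using z by (simp add: agn)
    then show "\<exists>x\<in>cycles A i. y \<ominus>\<^bsub>Deg B (i + 1)\<^esub> \<alpha> i x \<in> boundaries B (i + 1)"
      using z by (intro bexI[of _ "sfst z"]) (simp_all del: cycles_carrier add: cycles_iff boundariesI)
  qed
next
  note [simp] = twist(2-)[OF a assms(2,3)]
  assume "?I \<and> ?S"
  then have I: "\<And>i x. x \<in> cycles A i \<Longrightarrow> \<alpha> i x \<in> boundaries B (i + 1) \<Longrightarrow> x \<in> boundaries A i"
    and S: "\<And>i y. y \<in> cycles B (i + 1) \<Longrightarrow> \<exists>x\<in>cycles A i. y \<ominus>\<^bsub>Deg B (i + 1)\<^esub> \<alpha> i x \<in> boundaries B (i + 1)" by auto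
  show ?L unfolding acyclic_def
  proof (intro allI subsetI)
    fix i z assume z: "z \<in> cycles (tw A B \<alpha>) i"
    let ?x = "sfst z" and ?y = "ssnd z"
    have [simp]: "?x \<in> carrier (Deg A i)" "?y \<in> carrier (Deg B i)" using cycles_carrier[OF z(1)] by auto
    have zy: "?x \<in> cycles A i" "\<alpha> i ?x \<oplus>\<^bsub>Deg B (i + 1)\<^esub> Dif B i ?y = \<zero>\<^bsub>Deg B (i + 1)\<^esub>"
      using z(1) by (simp_all del: cycles_carrier add: cycles_iff)
    have "\<alpha> i ?x = Dif B i (\<ominus>\<^bsub>Deg B i\<^esub> ?y)" using fg_neg_unique[OF _ zy(2)] by (simp add: difs)
    then have "?x \<in> boundaries A i" using I[OF zy(1)] boundariesI[of "\<ominus>\<^bsub>Deg B i\<^esub> ?y" B i] by simp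
    then obtain w where w [simp]: "w \<in> carrier (Deg A (i - 1))" and wx: "?x = Dif A (i - 1) w" by (auto elim: boundariesE)
    let ?c = "?y \<ominus>\<^bsub>Deg B i\<^esub> \<alpha> (i - 1) w"
    have "Dif B i ?c = \<zero>\<^bsub>Deg B (i + 1)\<^esub>"
      using zy(2) unfolding wx by (simp add: difs agn)
    then have "?c \<in> cycles B (i - 1 + 1)" by (simp del: cycles_carrier add: cycles_iff)
    from S[OF this] obtain u where u: "u \<in> cycles A (i - 1)" "?c \<ominus>\<^bsub>Deg B i\<^esub> \<alpha> (i - 1) u \<in> boundaries B i" by auto
    have [simp]: "u \<in> carrier (Deg A (i - 1))" using u by simp
    obtain v where v [simp]: "v \<in> carrier (Deg B (i - 1))" and vu: "?c \<ominus>\<^bsub>Deg B i\<^esub> \<alpha> (i - 1) u = Dif B (i - 1) v"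
      using u(2) by (auto elim: boundariesE)
    have y: "?y = \<alpha> (i - 1) w \<oplus>\<^bsub>Deg B i\<^esub> \<alpha> (i - 1) u \<oplus>\<^bsub>Deg B i\<^esub> Dif B (i - 1) v"
      by (simp add: vu[symmetric] agn)
    have du: "Dif A (i - 1) u = \<zero>\<^bsub>Deg A i\<^esub>" using u by (simp del: cycles_carrier add: cycles_iff)
    have "Dif (tw A B \<alpha>) (i - 1) (spair (w \<oplus>\<^bsub>Deg A (i - 1)\<^esub> u) v) = spair ?x ?y"
      using dif_add[OF assms(2), of w "i - 1" u] twist(4)[OF a assms(2,3), of w "i - 1" u]
      by (simp add: y wx du)
    then show "z \<in> boundaries (tw A B \<alpha>) i"
      using boundariesI[of "spair (w \<oplus>\<^bsub>Deg A (i - 1)\<^esub> u) v" "tw A B \<alpha>" "i - 1" i] by simp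
  qed
qed

section \<open>Mapping cones and homotopy fibres as twisted sums\<close>

lemma cone_twist:
  assumes f: "f \<in> chain_maps L X Y" and [simp]: "X \<in> bcpx L" "Y \<in> bcpx L"
  shows "(\<lambda>i. f (i + 1)) \<in> twists (cshift 1 X) Y"
proof (rule twistsI)
  note [simp] = chmap[OF f assms(2,3)]
  show "f (i + 1) \<in> rhom L (Deg (cshift 1 X) i) (Deg Y (i + 1))" for i
    using chain_maps_rhom[OF f] by simp
  show "Dif Y (i + 1) (f (i + 1) x) \<oplus>\<^bsub>Deg Y (i + 2)\<^esub> f (i + 1 + 1) (Dif (cshift 1 X) i x) = \<zero>\<^bsub>Deg Y (i + 2)\<^esub>"
    if "x \<in> carrier (Deg (cshift 1 X) i)" for i x
    using that by (simp add: cshift_Dif fg_r_neg)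
qed

text \<open>The records agree on the nose: the sums are the same, and the sign in the differential
  of the cone is the sign of the shift by one.\<close>

lemma cone_tw:
  assumes X [simp]: "X \<in> bcpx L"
  shows "cone X Y f = tw (cshift 1 X) Y (\<lambda>i. f (i + 1))"
proof -
  have "(\<lambda>z\<in>carrier (mod_sum (Deg X (i + 1)) (Deg Y i)).
      spair (\<ominus>\<^bsub>Deg X (i + 2)\<^esub> Dif X (i + 1) (sfst z)) (f (i + 1) (sfst z) \<oplus>\<^bsub>Deg Y (i + 1)\<^esub> Dif Y i (ssnd z))) =
    (\<lambda>z\<in>carrier (mod_sum (Deg X (i + 1)) (Deg Y i)).
      spair (Dif (cshift 1 X) i (sfst z)) (f (i + 1) (sfst z) \<oplus>\<^bsub>Deg Y (i + 1)\<^esub> Dif Y i (ssnd z)))" for i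
    by (intro restrict_ext) (simp add: cshift_Dif)
  then show ?thesis by (simp add: cone_def tw_def)
qed

lemma cone_bcpx [simp]:
  assumes "f \<in> chain_maps L X Y" and [simp]: "X \<in> bcpx L" "Y \<in> bcpx L"
  shows "cone X Y f \<in> bcpx L"
  using cone_twist[OF assms] by (simp add: cone_tw)

lemma cone_incl_tincl: "cone_incl X Y = tincl (cshift 1 X) Y"
  by (simp add: cone_incl_def tincl_def)

lemma cone_proj_tproj: "cone_proj X Y = tproj (cshift 1 X) Y"
  by (simp add: cone_proj_def tproj_def)

lemma cone_acyclic_iff:
  assumes f: "f \<in> chain_maps L X Y" and [simp]: "X \<in> bcpx L" "Y \<in> bcpx L"
  shows "acyclic (cone X Y f) \<longleftrightarrow> f \<in> quasi_isos L X Y"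
proof -
  have "acyclic (cone X Y f) \<longleftrightarrow>
    (\<forall>i. \<forall>x\<in>cycles X (i + 1). f (i + 1) x \<in> boundaries Y (i + 1) \<longrightarrow> x \<in> boundaries X (i + 1)) \<and>
    (\<forall>i. \<forall>y\<in>cycles Y (i + 1). \<exists>x\<in>cycles X (i + 1). y \<ominus>\<^bsub>Deg Y (i + 1)\<^esub> f (i + 1) x \<in> boundaries Y (i + 1))"
    using tw_acyclic_iff[OF cone_twist[OF assms]] by (simp add: cone_tw)
  also have "\<dots> \<longleftrightarrow>
    (\<forall>i. \<forall>x\<in>cycles X i. f i x \<in> boundaries Y i \<longrightarrow> x \<in> boundaries X i) \<and>
    (\<forall>i. \<forall>y\<in>cycles Y i. \<exists>x\<in>cycles X i. y \<ominus>\<^bsub>Deg Y i\<^esub> f i x \<in> boundaries Y i)"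
    by (metis (no_types, lifting) diff_add_cancel)
  finally show ?thesis using f by (simp add: quasi_isos_def)
qed

text \<open>The fibre of f with an extra shift by k: k = 1 gives the cone, k = 0 the fibre used in
  \<open>ore\<close>, and k = -1 the one used in \<open>cancel\<close>. The two shifts differ by
  one, hence their differentials by a sign, and this makes f a twist.\<close>

lemma fibre_twist:
  assumes f: "f \<in> chain_maps L X Y" and [simp]: "X \<in> bcpx L" "Y \<in> bcpx L"
  shows "(\<lambda>i. f (i + k)) \<in> twists (cshift k X) (cshift (k - 1) Y)"
proof (rule twistsI)
  note F = chmap[OF f assms(2,3)]
  have e: "i + 1 + (k - 1) = i + k" "i + 2 + (k - 1) = i + k + 1" "i + 1 + k = i + k + 1" for i by auto
  show "f (i + k) \<in> rhom L (Deg (cshift k X) i) (Deg (cshift (k - 1) Y) (i + 1))" for i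
    using chain_maps_rhom[OF f] by (simp add: e)
  show "Dif (cshift (k - 1) Y) (i + 1) (f (i + k) x) \<oplus>\<^bsub>Deg (cshift (k - 1) Y) (i + 2)\<^esub> f (i + 1 + k) (Dif (cshift k X) i x)
      = \<zero>\<^bsub>Deg (cshift (k - 1) Y) (i + 2)\<^esub>"
    if x: "x \<in> carrier (Deg (cshift k X) i)" for i x
  proof -
    have 1: "Dif (cshift (k - 1) Y) (i + 1) y =
      (if even (k - 1) then Dif Y (i + k) y else \<ominus>\<^bsub>Deg Y (i + k + 1)\<^esub> Dif Y (i + k) y)"
      if "y \<in> carrier (Deg Y (i + k))" for y
      using cshift_Dif[of y Y "i + 1" "k - 1"] that unfolding e by simp
    show ?thesis unfolding cshift_Deg e using x F
      by (simp add: 1 cshift_Dif fg_r_neg fg_l_neg)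
  qed
qed

lemma fibre_acyclic:
  assumes f: "f \<in> quasi_isos L X Y" and [simp]: "X \<in> bcpx L" "Y \<in> bcpx L"
  shows "acyclic (tw (cshift k X) (cshift (k - 1) Y) (\<lambda>i. f (i + k)))"
proof -
  have e: "i + 1 + (k - 1) = i + k" for i by auto
  have "\<exists>x\<in>cycles X (i + k). y \<ominus>\<^bsub>Deg Y (i + k)\<^esub> f (i + k) x \<in> boundaries Y (i + k)"
    if "y \<in> cycles Y (i + k)" for i y
    using qi_surj[OF f that] by blast
  then show ?thesis
    using tw_acyclic_iff[OF fibre_twist[OF qi_chain[OF f] assms(2,3), of k]] qi_inj[OF f] by (simp add: e)
qed

section \<open>Calculus of fractions\<close>

text \<open>\<open>arr\<close>, \<open>qarr\<close> and \<open>hq\<close> carry along that their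
  objects are bounded complexes, so that chains of composites and homotopies run without side
  conditions.\<close>

definition arr :: "'a cpx \<Rightarrow> 'a cpx \<Rightarrow> 'a cmap \<Rightarrow> bool" where
  "arr X Y f \<longleftrightarrow> X \<in> bcpx L \<and> Y \<in> bcpx L \<and> f \<in> chain_maps L X Y"

definition qarr :: "'a cpx \<Rightarrow> 'a cpx \<Rightarrow> 'a cmap \<Rightarrow> bool" where
  "qarr X Y f \<longleftrightarrow> X \<in> bcpx L \<and> Y \<in> bcpx L \<and> f \<in> quasi_isos L X Y"

definition hq :: "'a cpx \<Rightarrow> 'a cpx \<Rightarrow> 'a cmap \<Rightarrow> 'a cmap \<Rightarrow> bool" where
  "hq X Y f g \<longleftrightarrow> arr X Y f \<and> arr X Y g \<and> homotopic L X Y f g"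

lemma qarr_arr: "qarr X Y f \<Longrightarrow> arr X Y f"
  by (simp add: arr_def qarr_def qi_chain)

lemma arr_id: "X \<in> bcpx L \<Longrightarrow> arr X X (cid X)"
  by (simp add: arr_def)

lemma qarr_id: "X \<in> bcpx L \<Longrightarrow> qarr X X (cid X)"
  by (simp add: qarr_def)

lemma arr_comp [intro]: "arr X Y f \<Longrightarrow> arr Y Z g \<Longrightarrow> arr X Z (ccomp X g f)"
  by (simp add: arr_def ccomp_chain[of f X Y g Z])

lemma qarr_comp [intro]: "qarr X Y f \<Longrightarrow> qarr Y Z g \<Longrightarrow> qarr X Z (ccomp X g f)"
  by (simp add: qarr_def qi_comp[of f X Y g Z])

lemma qarr_cancel_left: "arr X Y f \<Longrightarrow> qarr Y Z g \<Longrightarrow> qarr X Z (ccomp X g f) \<Longrightarrow> qarr X Y f"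
  unfolding qarr_def arr_def by (blast intro: qi_cancel_left)

lemma arr_ext:
  assumes "arr X Y f" "arr X Y g" "\<And>i x. x \<in> carrier (Deg X i) \<Longrightarrow> f i x = g i x"
  shows "f = g"
  using assms chain_map_ext unfolding arr_def by blast

lemma arr_closed: "arr X Y f \<Longrightarrow> x \<in> carrier (Deg X i) \<Longrightarrow> f i x \<in> carrier (Deg Y i)"
  using chmap(1)[of f X Y] by (simp add: arr_def)

lemma arr_assoc: "arr X Y f \<Longrightarrow> ccomp X (ccomp Y h g) f = ccomp X h (ccomp X g f)"
  unfolding arr_def by (rule ccomp_assoc[symmetric]) auto

lemma arr_unit: "arr X Y f \<Longrightarrow> ccomp X f (cid X) = f" "arr X Y f \<Longrightarrow> ccomp X (cid Y) f = f"
  by (simp_all add: arr_def ccomp_id[of f X Y])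

lemma hq_refl: "arr X Y f \<Longrightarrow> hq X Y f f"
  by (simp add: hq_def arr_def homotopic_refl)

lemma hq_sym: "hq X Y f g \<Longrightarrow> hq X Y g f"
  by (simp add: hq_def arr_def homotopic_sym)

lemma hq_trans [trans]: "hq X Y f g \<Longrightarrow> hq X Y g h \<Longrightarrow> hq X Y f h"
  unfolding hq_def arr_def by (blast intro: homotopic_trans)

lemma hq_pre: "hq V Y f g \<Longrightarrow> arr U V x \<Longrightarrow> hq U Y (ccomp U f x) (ccomp U g x)"
  unfolding hq_def using arr_comp[of U V x Y] by (auto simp: arr_def intro: homotopic_comp_right)

lemma hq_post: "hq X Y f g \<Longrightarrow> arr Y Z h \<Longrightarrow> hq X Z (ccomp X h f) (ccomp X h g)"
  unfolding hq_def using arr_comp[of X Y _ Z h] by (auto simp: arr_def intro: homotopic_comp_left)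

text \<open>Composites are kept nested to the right, the normal form in all later chains of
  homotopies.\<close>

lemma hq_pre2:
  assumes "hq V Y (ccomp V f u) (ccomp V f' u')" "arr U V x"
  shows "hq U Y (ccomp U f (ccomp U u x)) (ccomp U f' (ccomp U u' x))"
  using hq_pre[OF assms] by (simp add: arr_assoc[OF assms(2)])

lemma qarr_hq: "qarr X Y f \<Longrightarrow> hq X Y f g \<Longrightarrow> qarr X Y g"
  unfolding qarr_def hq_def arr_def by (blast intro: qi_homotopic)

text \<open>The homotopy fibre product of \<open>g\<close> and \<open>t\<close>, with the acyclic fibre of \<open>t\<close> as a subcomplex.\<close>

lemma ore:
  assumes t: "qarr W Y t" and g: "arr V Y g"
  shows "\<exists>U p q. qarr U V p \<and> arr U W q \<and> hq U Y (ccomp U g p) (ccomp U t q)"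
proof -
  have [simp]: "W \<in> bcpx L" "Y \<in> bcpx L" "V \<in> bcpx L" and t': "t \<in> quasi_isos L W Y" and g': "g \<in> chain_maps L V Y"
    using assms by (auto simp: arr_def qarr_def)
  note [simp] = chmap[OF qi_chain[OF t'] \<open>W \<in> bcpx L\<close> \<open>Y \<in> bcpx L\<close>] chmap[OF g' \<open>V \<in> bcpx L\<close> \<open>Y \<in> bcpx L\<close>]
  define F where "F = tw W (cshift (-1) Y) t"
  have F [simp]: "F \<in> bcpx L" "acyclic F" and FD: "\<And>i. Deg F i = mod_sum (Deg W i) (Deg Y (i - 1))"
    using fibre_twist[OF qi_chain[OF t'], of 0] fibre_acyclic[OF t', of 0] by (simp_all add: F_def)
  have Fd [simp]: "Dif F i z = spair (Dif W i (sfst z)) (t i (sfst z) \<oplus>\<^bsub>Deg Y i\<^esub> \<ominus>\<^bsub>Deg Y i\<^esub> Dif Y (i - 1) (ssnd z))"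
    if "sfst z \<in> carrier (Deg W i)" "ssnd z \<in> carrier (Deg Y (i - 1))" for i z
    using that by (simp add: F_def cshift_Dif)
  \<comment> \<open>The twist is chosen so that U below consists of triples (v, w, y) whose
    differential has last entry t w - g v - d y, recording the failure of g v = t w.\<close>
  define a where "a = (\<lambda>i. \<lambda>v\<in>carrier (Deg V i). spair \<zero>\<^bsub>Deg W (i + 1)\<^esub> (\<ominus>\<^bsub>Deg Y i\<^esub> g i v))"
  have a [simp]: "a i v = spair \<zero>\<^bsub>Deg W (i + 1)\<^esub> (\<ominus>\<^bsub>Deg Y i\<^esub> g i v)" if "v \<in> carrier (Deg V i)" for i v
    using that by (simp add: a_def)
  have aT: "a \<in> twists V F"
  proof (rule twistsI)
    show "a i \<in> rhom L (Deg V i) (Deg F (i + 1))" for i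
      unfolding a_def by (rule rhomI) (simp_all add: FD fg_neg_add fg_smult_neg)
    show "Dif F (i + 1) (a i x) \<oplus>\<^bsub>Deg F (i + 2)\<^esub> a (i + 1) (Dif V i x) = \<zero>\<^bsub>Deg F (i + 2)\<^esub>"
      if "x \<in> carrier (Deg V i)" for i x
      using that by (simp add: FD difs agn)
  qed
  define U where "U = tw V F a"
  have U [simp]: "U \<in> bcpx L" unfolding U_def using aT by simp
  have UD: "Deg U i = mod_sum (Deg V i) (mod_sum (Deg W i) (Deg Y (i - 1)))" for i by (simp add: U_def FD)
  have Ud [simp]: "Dif U i z = spair (Dif V i (sfst z)) (spair (Dif W i (sfst (ssnd z)))
      (\<ominus>\<^bsub>Deg Y i\<^esub> g i (sfst z) \<oplus>\<^bsub>Deg Y i\<^esub> (t i (sfst (ssnd z)) \<oplus>\<^bsub>Deg Y i\<^esub> \<ominus>\<^bsub>Deg Y i\<^esub> Dif Y (i - 1) (ssnd (ssnd z)))))"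
    if "sfst z \<in> carrier (Deg V i)" "sfst (ssnd z) \<in> carrier (Deg W i)" "ssnd (ssnd z) \<in> carrier (Deg Y (i - 1))" for i z
    using that by (simp add: U_def FD)
  have p: "qarr U V (tproj V F)" unfolding qarr_def U_def using aT by (simp add: tproj_qi)
  define q where "q = (\<lambda>i. \<lambda>z\<in>carrier (Deg U i). sfst (ssnd z))"
  have q: "arr U W q" unfolding arr_def
  proof (intro conjI chain_mapsI)
    show "q i \<in> rhom L (Deg U i) (Deg W i)" for i
      unfolding q_def by (rule rhomI) (simp_all add: UD)
  qed (simp_all add: q_def UD)
  have "homotopic L U Y (ccomp U g (tproj V F)) (ccomp U t q)"
  \<comment> \<open>Minus the last entry is the homotopy: the terms d y cancel and g v - t w
    remains.\<close>
  proof (rule homotopicI[where s = "\<lambda>i. \<lambda>z\<in>carrier (Deg U i). \<ominus>\<^bsub>Deg Y (i - 1)\<^esub> ssnd (ssnd z)"])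
    show "(\<lambda>z\<in>carrier (Deg U i). \<ominus>\<^bsub>Deg Y (i - 1)\<^esub> ssnd (ssnd z)) \<in> rhom L (Deg U i) (Deg Y (i - 1))" for i
      by (rule rhomI) (simp_all add: UD fg_neg_add fg_smult_neg)
    fix i z assume "z \<in> carrier (Deg U i)"
    moreover have "Dif Y (i - 1) (\<ominus>\<^bsub>Deg Y (i - 1)\<^esub> y) = \<ominus>\<^bsub>Deg Y i\<^esub> Dif Y (i - 1) y" if "y \<in> carrier (Deg Y (i - 1))" for y
      using dif_neg[OF \<open>Y \<in> bcpx L\<close> that] by simp
    ultimately show "ccomp U g (tproj V F) i z \<ominus>\<^bsub>Deg Y i\<^esub> ccomp U t q i z =
      Dif Y (i - 1) ((\<lambda>z\<in>carrier (Deg U i). \<ominus>\<^bsub>Deg Y (i - 1)\<^esub> ssnd (ssnd z)) z) \<oplus>\<^bsub>Deg Y i\<^esub>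
      (\<lambda>z\<in>carrier (Deg U (i + 1)). \<ominus>\<^bsub>Deg Y (i + 1 - 1)\<^esub> ssnd (ssnd z)) (Dif U i z)"
      by (simp add: UD FD q_def tproj_def agn)
  qed
  then have "hq U Y (ccomp U g (tproj V F)) (ccomp U t q)"
    unfolding hq_def using arr_comp[OF q qarr_arr[OF t]] arr_comp[OF qarr_arr[OF p] g] by blast
  then show ?thesis using p q by blast
qed

text \<open>A homotopy H from s f to s g says exactly that (f - g, -H) is a twist of V by a shifted
  fibre of s. This fibre is acyclic, so the twisted sum still maps quasi-isomorphically to V, and on
  it f and g become homotopic.\<close>

lemma cancel:
  assumes h: "hq V X (ccomp V s f) (ccomp V s g)" and f: "arr V W f" and g: "arr V W g" and s: "qarr W X s"
  shows "\<exists>U p. qarr U V p \<and> hq U W (ccomp U f p) (ccomp U g p)"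
proof -
  have V [simp]: "V \<in> bcpx L" and W [simp]: "W \<in> bcpx L" and X [simp]: "X \<in> bcpx L"
    and f': "f \<in> chain_maps L V W" and g': "g \<in> chain_maps L V W" and s': "s \<in> quasi_isos L W X"
    using assms by (auto simp: arr_def qarr_def)
  note [simp] = chmap[OF f' V W] chmap[OF g' V W] chmap[OF qi_chain[OF s'] W X]
  obtain H where Hr: "\<And>i j. j = i - 1 \<Longrightarrow> H i \<in> rhom L (Deg V i) (Deg X j)"
    and He: "\<And>x i j. x \<in> carrier (Deg V i) \<Longrightarrow> ccomp V s f i x \<ominus>\<^bsub>Deg X i\<^esub> ccomp V s g i x =
        Dif X (i - 1) (H i x) \<oplus>\<^bsub>Deg X i\<^esub> H (i + 1) (Dif V i x)"
    using homotopicE[OF _ V X, of "ccomp V s f" "ccomp V s g"] h unfolding hq_def by metis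
  have Hc [simp]: "H i x \<in> carrier (Deg X j)" if "x \<in> carrier (Deg V i)" "j = i - 1" for i j x
    using rhom_simps(1)[OF Hr[OF that(2)] that(1)] .
  define F where "F = tw (cshift (-1) W) (cshift (-2) X) (\<lambda>i. s (i - 1))"
  have F [simp]: "F \<in> bcpx L" "acyclic F" and FD: "\<And>i. Deg F i = mod_sum (Deg W (i - 1)) (Deg X (i - 2))"
    using fibre_twist[OF qi_chain[OF s'], of "-1"] fibre_acyclic[OF s', of "-1"] by (simp_all add: F_def)
  have Fd [simp]: "Dif F i z = spair (\<ominus>\<^bsub>Deg W i\<^esub> Dif W (i - 1) (sfst z)) (s (i - 1) (sfst z) \<oplus>\<^bsub>Deg X (i - 1)\<^esub> Dif X (i - 2) (ssnd z))"
    if "sfst z \<in> carrier (Deg W (i - 1))" "ssnd z \<in> carrier (Deg X (i - 2))" for i z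
    using that by (simp add: F_def cshift_Dif)
  define a where "a = (\<lambda>i. \<lambda>v\<in>carrier (Deg V i). spair (f i v \<ominus>\<^bsub>Deg W i\<^esub> g i v) (\<ominus>\<^bsub>Deg X (i - 1)\<^esub> H i v))"
  have a [simp]: "a i v = spair (f i v \<ominus>\<^bsub>Deg W i\<^esub> g i v) (\<ominus>\<^bsub>Deg X (i - 1)\<^esub> H i v)" if "v \<in> carrier (Deg V i)" for i v
    using that by (simp add: a_def)
  have aT: "a \<in> twists V F"
  proof (rule twistsI)
    show "a i \<in> rhom L (Deg V i) (Deg F (i + 1))" for i
      unfolding a_def by (rule rhomI)
        (simp_all add: FD fg_smult_neg fg_smult_add rhom_simps[OF Hr] a_minus_def fg_neg_add, simp_all add: agn)
    show "Dif F (i + 1) (a i x) \<oplus>\<^bsub>Deg F (i + 2)\<^esub> a (i + 1) (Dif V i x) = \<zero>\<^bsub>Deg F (i + 2)\<^esub>"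
      if x: "x \<in> carrier (Deg V i)" for i x
    proof -
      have "s i (f i x) \<ominus>\<^bsub>Deg X i\<^esub> s i (g i x) = Dif X (i - 1) (H i x) \<oplus>\<^bsub>Deg X i\<^esub> H (i + 1) (Dif V i x)"
        using He[OF x] x by simp
      moreover have "Dif X (i - 1) (\<ominus>\<^bsub>Deg X (i - 1)\<^esub> y) = \<ominus>\<^bsub>Deg X i\<^esub> Dif X (i - 1) y" if "y \<in> carrier (Deg X (i - 1))" for y
        using dif_neg[OF X that] by simp
      ultimately show ?thesis using x by (simp add: FD difs) (simp add: agn)
    qed
  qed
  define U where "U = tw V F a"
  have U [simp]: "U \<in> bcpx L" unfolding U_def using aT by simp
  have UD: "Deg U i = mod_sum (Deg V i) (mod_sum (Deg W (i - 1)) (Deg X (i - 2)))" for i by (simp add: U_def FD)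
  have p: "qarr U V (tproj V F)" unfolding qarr_def U_def using aT by (simp add: tproj_qi)
  have "homotopic L U W (ccomp U f (tproj V F)) (ccomp U g (tproj V F))"
  \<comment> \<open>The entry w in the fibre is the homotopy, because the differential has (f - g) v
    - d w in its place.\<close>
  proof (rule homotopicI[where s = "\<lambda>i. \<lambda>z\<in>carrier (Deg U i). sfst (ssnd z)"])
    show "(\<lambda>z\<in>carrier (Deg U i). sfst (ssnd z)) \<in> rhom L (Deg U i) (Deg W (i - 1))" for i
      by (rule rhomI) (simp_all add: UD)
    fix i z assume "z \<in> carrier (Deg U i)"
    then show "ccomp U f (tproj V F) i z \<ominus>\<^bsub>Deg W i\<^esub> ccomp U g (tproj V F) i z =
      Dif W (i - 1) ((\<lambda>z\<in>carrier (Deg U i). sfst (ssnd z)) z) \<oplus>\<^bsub>Deg W i\<^esub>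
      (\<lambda>z\<in>carrier (Deg U (i + 1)). sfst (ssnd z)) (Dif U i z)"
      by (simp add: UD FD U_def tproj_def) (simp add: agn)
  qed
  then have "hq U W (ccomp U f (tproj V F)) (ccomp U g (tproj V F))"
    unfolding hq_def using arr_comp[OF qarr_arr[OF p] f] arr_comp[OF qarr_arr[OF p] g] by blast
  then show ?thesis using p by blast
qed

section \<open>Roofs\<close>

lemma roofs_iff: "(W, s, f) \<in> roofs L X Y \<longleftrightarrow> W \<in> bcpx L \<and> s \<in> quasi_isos L W X \<and> f \<in> chain_maps L W Y"
  by (simp add: roofs_def)

definition roof :: "'a cpx \<Rightarrow> 'a cpx \<Rightarrow> 'a cpx \<Rightarrow> 'a cmap \<Rightarrow> 'a cmap \<Rightarrow> bool" where
  "roof X Y W s f \<longleftrightarrow> qarr W X s \<and> arr W Y f"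

text \<open>\<open>roof_equiv\<close> does not say that its arguments are roofs; the bundled form is
  what behaves as an equivalence relation.\<close>

definition req :: "'a cpx \<Rightarrow> 'a cpx \<Rightarrow> 'a roof \<Rightarrow> 'a roof \<Rightarrow> bool" where
  "req X Y r q \<longleftrightarrow> r \<in> roofs L X Y \<and> q \<in> roofs L X Y \<and> roof_equiv L X Y r q"

lemma reqI:
  assumes "roof X Y W s f" "roof X Y W' s' f'" "arr V W u" "arr V W' u'" "qarr V X (ccomp V s u)"
    "hq V X (ccomp V s u) (ccomp V s' u')" "hq V Y (ccomp V f u) (ccomp V f' u')"
  shows "req X Y (W, s, f) (W', s', f')"
  using assms unfolding req_def roof_def roofs_iff roof_equiv.simps qarr_def arr_def hq_def by blast

text \<open>The definition of \<open>roof_equiv\<close> gives chain maps u and u' only. Cancellation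
  against s and s' shows both to be quasi-isomorphisms, so the Ore condition can be applied along
  either leg.\<close>

lemma reqE:
  assumes "req X Y (W, s, f) (W', s', f')" and [simp]: "X \<in> bcpx L" "Y \<in> bcpx L"
  obtains V u u' where "roof X Y W s f" "roof X Y W' s' f'" "qarr V W u" "qarr V W' u'" "qarr V X (ccomp V s u)"
    "hq V X (ccomp V s u) (ccomp V s' u')" "hq V Y (ccomp V f u) (ccomp V f' u')"
proof -
  have r: "roof X Y W s f" "roof X Y W' s' f'"
    using assms unfolding req_def roof_def roofs_iff qarr_def arr_def by auto
  obtain V u u' where V [simp]: "V \<in> bcpx L" and "u \<in> chain_maps L V W" "u' \<in> chain_maps L V W'"
    "ccomp V s u \<in> quasi_isos L V X" "homotopic L V X (ccomp V s u) (ccomp V s' u')"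
    "homotopic L V Y (ccomp V f u) (ccomp V f' u')"
    using assms(1) unfolding req_def roof_equiv.simps by blast
  moreover from this r have u: "arr V W u" "arr V W' u'" unfolding roof_def by (simp_all add: arr_def qarr_def)
  moreover have "arr W X s" "arr W' X s'" "arr W Y f" "arr W' Y f'" using r by (auto simp: roof_def qarr_arr)
  ultimately have *: "qarr V X (ccomp V s u)" "hq V X (ccomp V s u) (ccomp V s' u')"
    "hq V Y (ccomp V f u) (ccomp V f' u')"
    unfolding hq_def by (auto simp: qarr_def)
  then have "qarr V W u" "qarr V W' u'"
    using r u qarr_cancel_left qarr_hq unfolding roof_def by blast+
  then show ?thesis using that r * by blast
qed

lemma req_refl:
  assumes "roof X Y W s f"
  shows "req X Y (W, s, f) (W, s, f)"
proof -
  have "qarr W X s" "arr W X s" "arr W Y f" "W \<in> bcpx L"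
    using assms qarr_arr by (auto simp: roof_def arr_def qarr_def)
  then show ?thesis
    by (intro reqI[OF assms assms, of W "cid W" "cid W"]) (simp_all add: arr_unit hq_refl arr_id)
qed

lemma req_sym:
  assumes "req X Y r q" "X \<in> bcpx L" "Y \<in> bcpx L"
  shows "req X Y q r"
proof -
  obtain W s f W' s' f' where e: "r = (W, s, f)" "q = (W', s', f')" using prod_cases3 by metis
  show ?thesis using reqE[OF assms[unfolded e]] unfolding e
    by (metis hq_sym qarr_arr qarr_hq reqI)
qed

text \<open>The two common refinements both map to the middle roof; an Ore square over
  \<open>W2\<close> joins them into one refinement of the outer roofs.\<close>

lemma req_trans:
  assumes h: "req X Y r q" "req X Y q p" and [simp]: "X \<in> bcpx L" "Y \<in> bcpx L"
  shows "req X Y r p"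
proof -
  obtain W1 s1 f1 W2 s2 f2 W3 s3 f3 where e: "r = (W1, s1, f1)" "q = (W2, s2, f2)" "p = (W3, s3, f3)"
    using prod_cases3 by metis
  obtain V u u' where 1: "roof X Y W1 s1 f1" "roof X Y W2 s2 f2" "qarr V W1 u" "qarr V W2 u'" "qarr V X (ccomp V s1 u)"
    "hq V X (ccomp V s1 u) (ccomp V s2 u')" "hq V Y (ccomp V f1 u) (ccomp V f2 u')"
    using reqE[OF h(1)[unfolded e] assms(3,4)] by metis
  obtain V' v v' where 2: "roof X Y W3 s3 f3" "qarr V' W2 v" "qarr V' W3 v'"
    "hq V' X (ccomp V' s2 v) (ccomp V' s3 v')" "hq V' Y (ccomp V' f2 v) (ccomp V' f3 v')"
    using reqE[OF h(2)[unfolded e] assms(3,4)] by metis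
  obtain U a b where U: "qarr U V' a" "arr U V b" "hq U W2 (ccomp U v a) (ccomp U u' b)"
    using ore[OF 1(4) qarr_arr[OF 2(2)]] by blast
  have s2: "arr W2 X s2" "arr W2 Y f2" using 1(2) by (auto simp: roof_def qarr_arr)
  have qs3: "qarr U X (ccomp U s3 (ccomp U v' a))" using U(1) 2(1,3) by (auto simp: roof_def)
  have "hq U X (ccomp U s1 (ccomp U u b)) (ccomp U s2 (ccomp U u' b))" by (rule hq_pre2[OF 1(6) U(2)])
  also have "hq U X (ccomp U s2 (ccomp U u' b)) (ccomp U s2 (ccomp U v a))" by (rule hq_post[OF hq_sym[OF U(3)] s2(1)])
  also have "hq U X (ccomp U s2 (ccomp U v a)) (ccomp U s3 (ccomp U v' a))" by (rule hq_pre2[OF 2(4) qarr_arr[OF U(1)]])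
  finally have hs: "hq U X (ccomp U s1 (ccomp U u b)) (ccomp U s3 (ccomp U v' a))" .
  have "hq U Y (ccomp U f1 (ccomp U u b)) (ccomp U f2 (ccomp U u' b))" by (rule hq_pre2[OF 1(7) U(2)])
  also have "hq U Y (ccomp U f2 (ccomp U u' b)) (ccomp U f2 (ccomp U v a))" by (rule hq_post[OF hq_sym[OF U(3)] s2(2)])
  also have "hq U Y (ccomp U f2 (ccomp U v a)) (ccomp U f3 (ccomp U v' a))" by (rule hq_pre2[OF 2(5) qarr_arr[OF U(1)]])
  finally have hf: "hq U Y (ccomp U f1 (ccomp U u b)) (ccomp U f3 (ccomp U v' a))" .
  show ?thesis unfolding e
    by (rule reqI[OF 1(1) 2(1) _ _ qarr_hq[OF qs3 hq_sym[OF hs]] hs hf])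
      (use U(1,2) 1(3) 2(3) in \<open>auto dest: qarr_arr\<close>)
qed

text \<open>This is independence of a composite both from the representing roofs and from the square
  that composes them. Refinements E and E' of the two factors are compared with the squares V and V1
  over a common complex; the comparison in the last corner holds only after composition with t1,
  which \<open>cancel\<close> removes.\<close>

lemma comp_well_defined:
  assumes r: "req X Y (W, s, f) (W1, s1, f1)" and q: "req Y Z (W', t, g) (W1', t1, g1)"
    and V: "qarr V W u" "arr V W' v" "hq V Y (ccomp V f u) (ccomp V t v)"
    and V1: "qarr V1 W1 u1" "arr V1 W1' v1" "hq V1 Y (ccomp V1 f1 u1) (ccomp V1 t1 v1)"
    and [simp]: "X \<in> bcpx L" "Y \<in> bcpx L" "Z \<in> bcpx L"
  shows "req X Z (V, ccomp V s u, ccomp V g v) (V1, ccomp V1 s1 u1, ccomp V1 g1 v1)"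
proof -
  obtain E e e1 where E: "roof X Y W s f" "roof X Y W1 s1 f1" "qarr E W e" "qarr E W1 e1"
    "hq E X (ccomp E s e) (ccomp E s1 e1)" "hq E Y (ccomp E f e) (ccomp E f1 e1)"
    using reqE[OF r assms(9,10)] by metis
  obtain E' e' e1' where E': "roof Y Z W' t g" "roof Y Z W1' t1 g1" "qarr E' W' e'" "qarr E' W1' e1'"
    "hq E' Y (ccomp E' t e') (ccomp E' t1 e1')" "hq E' Z (ccomp E' g e') (ccomp E' g1 e1')"
    using reqE[OF q assms(10,11)] by metis
  have a: "qarr W X s" "arr W Y f" "qarr W1 X s1" "arr W1 Y f1" "qarr W' Y t" "arr W' Z g" "qarr W1' Y t1" "arr W1' Z g1"
    using E(1,2) E'(1,2) by (auto simp: roof_def)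
  \<comment> \<open>Three Ore squares are stacked: over W for V and E, over W1 for E and V1, and
    over W' for V and E'.\<close>
  obtain U1 p1 q1 where U1: "qarr U1 V p1" "arr U1 E q1" "hq U1 W (ccomp U1 u p1) (ccomp U1 e q1)"
    using ore[OF E(3) qarr_arr[OF V(1)]] by blast
  obtain U2 p2 q2 where U2: "qarr U2 U1 p2" "arr U2 V1 q2" "hq U2 W1 (ccomp U2 (ccomp U1 e1 q1) p2) (ccomp U2 u1 q2)"
    using ore[OF V1(1) arr_comp[OF U1(2) qarr_arr[OF E(4)]]] by blast
  have p12: "qarr U2 V (ccomp U2 p1 p2)" using U1 U2 by blast
  obtain U3 p3 q3 where U3: "qarr U3 U2 p3" "arr U3 E' q3"
    "hq U3 W' (ccomp U3 (ccomp U2 v (ccomp U2 p1 p2)) p3) (ccomp U3 e' q3)"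
    using ore[OF E'(3) arr_comp[OF qarr_arr[OF p12] V(2)]] by blast
  let ?a = "ccomp U3 p2 p3"
  let ?P = "ccomp U3 p1 ?a" and ?Q = "ccomp U3 q2 p3" and ?c = "ccomp U3 q1 ?a"
  have p2: "arr U2 U1 p2" and p3: "arr U3 U2 p3" using U2 U3 qarr_arr by auto
  have A: "arr U3 U1 ?a" using p2 p3 by blast
  have P: "qarr U3 V ?P" using U1 U2 U3 by blast
  have Q: "arr U3 V1 ?Q" using U2 p3 by blast
  have C: "arr U3 E ?c" using U1 A by blast
  have h1: "hq U3 W (ccomp U3 u ?P) (ccomp U3 e ?c)" by (rule hq_pre2[OF U1(3) A])
  have h2: "hq U3 W1 (ccomp U3 e1 ?c) (ccomp U3 u1 ?Q)"
    using hq_pre2[OF U2(3) p3] by (simp add: arr_assoc[OF A])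
  have h3: "hq U3 W' (ccomp U3 v ?P) (ccomp U3 e' q3)"
    using U3(3) by (simp add: arr_assoc[OF p3])
  \<comment> \<open>The routes into W1' through E' and through V1 are compared after t1, passing
    through E', V, E and V1 in turn. Cancelling t1 costs one further refinement p.\<close>
  have "hq U3 Y (ccomp U3 t1 (ccomp U3 e1' q3)) (ccomp U3 t (ccomp U3 e' q3))"
    by (rule hq_sym[OF hq_pre2[OF E'(5) U3(2)]])
  also have "hq U3 Y (ccomp U3 t (ccomp U3 e' q3)) (ccomp U3 t (ccomp U3 v ?P))"
    by (rule hq_post[OF hq_sym[OF h3] qarr_arr[OF a(5)]])
  also have "hq U3 Y (ccomp U3 t (ccomp U3 v ?P)) (ccomp U3 f (ccomp U3 u ?P))"
    by (rule hq_sym[OF hq_pre2[OF V(3) qarr_arr[OF P]]])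
  also have "hq U3 Y (ccomp U3 f (ccomp U3 u ?P)) (ccomp U3 f (ccomp U3 e ?c))"
    by (rule hq_post[OF h1 a(2)])
  also have "hq U3 Y (ccomp U3 f (ccomp U3 e ?c)) (ccomp U3 f1 (ccomp U3 e1 ?c))"
    by (rule hq_pre2[OF E(6) C])
  also have "hq U3 Y (ccomp U3 f1 (ccomp U3 e1 ?c)) (ccomp U3 f1 (ccomp U3 u1 ?Q))"
    by (rule hq_post[OF h2 a(4)])
  also have "hq U3 Y (ccomp U3 f1 (ccomp U3 u1 ?Q)) (ccomp U3 t1 (ccomp U3 v1 ?Q))"
    by (rule hq_pre2[OF V1(3) Q])
  finally obtain U p where U: "qarr U U3 p" "hq U W1' (ccomp U (ccomp U3 e1' q3) p) (ccomp U (ccomp U3 v1 ?Q) p)"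
    using cancel[OF _ arr_comp[OF U3(2) qarr_arr[OF E'(4)]] arr_comp[OF Q V1(2)] a(7)] by blast
  have p: "arr U U3 p" using U qarr_arr by blast
  have h4: "hq U W1' (ccomp U e1' (ccomp U q3 p)) (ccomp U v1 (ccomp U ?Q p))"
    using U(2) by (simp add: arr_assoc[OF p])
  have d: "arr U E' (ccomp U q3 p)" using U3 p by blast
  have c: "arr U E (ccomp U ?c p)" using C p by blast
  have PP: "qarr U V (ccomp U ?P p)" using P U by blast
  have "hq U X (ccomp U s (ccomp U u (ccomp U ?P p))) (ccomp U s (ccomp U e (ccomp U ?c p)))"
    by (rule hq_post[OF hq_pre2[OF h1 p] qarr_arr[OF a(1)]])
  also have "hq U X (ccomp U s (ccomp U e (ccomp U ?c p))) (ccomp U s1 (ccomp U e1 (ccomp U ?c p)))"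
    by (rule hq_pre2[OF E(5) c])
  also have "hq U X (ccomp U s1 (ccomp U e1 (ccomp U ?c p))) (ccomp U s1 (ccomp U u1 (ccomp U ?Q p)))"
    by (rule hq_post[OF hq_pre2[OF h2 p] qarr_arr[OF a(3)]])
  finally have hs: "hq U X (ccomp U (ccomp V s u) (ccomp U ?P p)) (ccomp U (ccomp V1 s1 u1) (ccomp U ?Q p))"
    using arr_assoc[OF qarr_arr[OF PP]] arr_assoc[OF arr_comp[OF p Q]] by simp
  have "hq U Z (ccomp U g (ccomp U v (ccomp U ?P p))) (ccomp U g (ccomp U e' (ccomp U q3 p)))"
    by (rule hq_post[OF hq_pre2[OF h3 p] a(6)])
  also have "hq U Z (ccomp U g (ccomp U e' (ccomp U q3 p))) (ccomp U g1 (ccomp U e1' (ccomp U q3 p)))"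
    by (rule hq_pre2[OF E'(6) d])
  also have "hq U Z (ccomp U g1 (ccomp U e1' (ccomp U q3 p))) (ccomp U g1 (ccomp U v1 (ccomp U ?Q p)))"
    by (rule hq_post[OF h4 a(8)])
  finally have hg: "hq U Z (ccomp U (ccomp V g v) (ccomp U ?P p)) (ccomp U (ccomp V1 g1 v1) (ccomp U ?Q p))"
    using arr_assoc[OF qarr_arr[OF PP]] arr_assoc[OF arr_comp[OF p Q]] by simp
  have su: "qarr V X (ccomp V s u)" "qarr V1 X (ccomp V1 s1 u1)" using V(1) V1(1) a by blast+
  show ?thesis
  proof (rule reqI[OF _ _ qarr_arr[OF PP] arr_comp[OF p Q] _ hs hg])
    show "roof X Z V (ccomp V s u) (ccomp V g v)" using su(1) arr_comp[OF V(2) a(6)] by (simp add: roof_def)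
    show "roof X Z V1 (ccomp V1 s1 u1) (ccomp V1 g1 v1)" using su(2) arr_comp[OF V1(2) a(8)] by (simp add: roof_def)
    show "qarr U X (ccomp U (ccomp V s u) (ccomp U ?P p))" using PP su(1) by blast
  qed
qed

section \<open>The derived category\<close>

definition cls :: "'a cpx \<Rightarrow> 'a cpx \<Rightarrow> 'a roof \<Rightarrow> 'a roof set" where
  "cls X Y r = saturate L X Y {r}"

lemma arr_objs: "arr X Y f \<Longrightarrow> X \<in> bcpx L" "arr X Y f \<Longrightarrow> Y \<in> bcpx L"
  by (simp_all add: arr_def)

lemma roof_objs: "roof X Y W s f \<Longrightarrow> X \<in> bcpx L" "roof X Y W s f \<Longrightarrow> Y \<in> bcpx L" "roof X Y W s f \<Longrightarrow> W \<in> bcpx L"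
  by (auto simp: roof_def arr_def qarr_def)

lemma roof_roofs: "roof X Y W s f \<Longrightarrow> (W, s, f) \<in> roofs L X Y"
  by (auto simp: roof_def arr_def qarr_def roofs_iff)

lemma roofs_roof: "(W, s, f) \<in> roofs L X Y \<Longrightarrow> X \<in> bcpx L \<Longrightarrow> Y \<in> bcpx L \<Longrightarrow> roof X Y W s f"
  by (auto simp: roof_def arr_def qarr_def roofs_iff)

lemma mem_cls: "roof X Y W s f \<Longrightarrow> q \<in> cls X Y (W, s, f) \<longleftrightarrow> req X Y (W, s, f) q"
  using roof_roofs[of X Y W s f] by (auto simp: cls_def saturate_def req_def)

lemma cls_eq:
  assumes "req X Y r q" "X \<in> bcpx L" "Y \<in> bcpx L"
  shows "cls X Y r = cls X Y q"
proof -
  have "req X Y r p \<longleftrightarrow> req X Y q p" for p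
    using req_trans[OF _ _ assms(2,3)] req_sym[OF _ assms(2,3)] assms(1) by blast
  moreover have "r \<in> roofs L X Y" "q \<in> roofs L X Y" using assms(1) by (auto simp: req_def)
  ultimately show ?thesis by (auto simp: cls_def saturate_def req_def)
qed

text \<open>Operations on morphisms are saturations of sets of candidate roofs; once all candidates
  are equivalent, one of them represents the result.\<close>

lemma saturate_eq_cls:
  assumes "r \<in> S" and S: "\<And>q. q \<in> S \<Longrightarrow> req X Y r q" and "X \<in> bcpx L" "Y \<in> bcpx L"
  shows "saturate L X Y S = cls X Y r"
proof -
  have 1: "roof_equiv L X Y r p" if "q \<in> S" "roof_equiv L X Y q p" "p \<in> roofs L X Y" for q p
  proof -
    have "req X Y q p" using S[OF that(1)] that by (simp add: req_def)
    then have "req X Y r p" using req_trans[OF S[OF that(1)] _ assms(3,4)] by blast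
    then show ?thesis by (simp add: req_def)
  qed
  show ?thesis
  proof (intro equalityI subsetI)
    fix p assume "p \<in> saturate L X Y S"
    then show "p \<in> cls X Y r" using 1 unfolding saturate_def cls_def by blast
  next
    fix p assume "p \<in> cls X Y r"
    then show "p \<in> saturate L X Y S" using assms(1) unfolding saturate_def cls_def by blast
  qed
qed

text \<open>Any one square commuting up to homotopy may be used to compute a composite, every other
  choice being equivalent by \<open>comp_well_defined\<close>.\<close>

lemma dcomp_cls:
  assumes r: "roof X Y W s f" and q: "roof Y Z W' t g" and V: "qarr V W u" "arr V W' v"
    and h: "hq V Y (ccomp V f u) (ccomp V t v)"
  shows "dcomp L X Y Z (cls Y Z (W', t, g)) (cls X Y (W, s, f)) = cls X Z (V, ccomp V s u, ccomp V g v)"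
  unfolding dcomp_def
proof (rule saturate_eq_cls)
  note o [simp] = roof_objs[OF r] roof_objs[OF q]
  have VB: "V \<in> bcpx L" using V by (simp add: qarr_def)
  have "(W, s, f) \<in> cls X Y (W, s, f)" "(W', t, g) \<in> cls Y Z (W', t, g)"
    using mem_cls r q req_refl by blast+
  moreover have "V \<in> bcpx L" "u \<in> quasi_isos L V W" "v \<in> chain_maps L V W'" "homotopic L V Y (ccomp V f u) (ccomp V t v)"
    using V h by (auto simp: qarr_def arr_def hq_def)
  ultimately show "(V, ccomp V s u, ccomp V g v) \<in> {(Va, ccomp Va sa ua, ccomp Va ga va) | Va Wa W'a sa fa ta ga ua va.
        (Wa, sa, fa) \<in> cls X Y (W, s, f) \<and> (W'a, ta, ga) \<in> cls Y Z (W', t, g) \<and> Va \<in> bcpx L \<and>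
        ua \<in> quasi_isos L Va Wa \<and> va \<in> chain_maps L Va W'a \<and> homotopic L Va Y (ccomp Va fa ua) (ccomp Va ta va)}"
    by blast
next
  note o [simp] = roof_objs[OF r] roof_objs[OF q]
  fix p assume "p \<in> {(Va, ccomp Va sa ua, ccomp Va ga va) | Va Wa W'a sa fa ta ga ua va.
        (Wa, sa, fa) \<in> cls X Y (W, s, f) \<and> (W'a, ta, ga) \<in> cls Y Z (W', t, g) \<and> Va \<in> bcpx L \<and>
        ua \<in> quasi_isos L Va Wa \<and> va \<in> chain_maps L Va W'a \<and> homotopic L Va Y (ccomp Va fa ua) (ccomp Va ta va)}"
  then obtain V1 W1 W1' s1 f1 t1 g1 u1 v1 where p: "p = (V1, ccomp V1 s1 u1, ccomp V1 g1 v1)"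
    and c: "(W1, s1, f1) \<in> cls X Y (W, s, f)" "(W1', t1, g1) \<in> cls Y Z (W', t, g)"
    and V1: "V1 \<in> bcpx L" "u1 \<in> quasi_isos L V1 W1" "v1 \<in> chain_maps L V1 W1'" "homotopic L V1 Y (ccomp V1 f1 u1) (ccomp V1 t1 v1)"
    by blast
  have e: "req X Y (W, s, f) (W1, s1, f1)" "req Y Z (W', t, g) (W1', t1, g1)" using c mem_cls r q by blast+
  then have r1: "roof X Y W1 s1 f1" "roof Y Z W1' t1 g1" by (auto simp: req_def intro: roofs_roof)
  have u1: "qarr V1 W1 u1" "arr V1 W1' v1" using V1 roof_objs(3)[OF r1(1)] roof_objs(3)[OF r1(2)] by (auto simp: qarr_def arr_def)
  have "arr V1 Y (ccomp V1 f1 u1)" "arr V1 Y (ccomp V1 t1 v1)"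
    using r1 u1 qarr_arr unfolding roof_def by blast+
  then have "hq V1 Y (ccomp V1 f1 u1) (ccomp V1 t1 v1)" using V1 by (simp add: hq_def)
  then show "req X Z (V, ccomp V s u, ccomp V g v) p"
    unfolding p using comp_well_defined[OF e V h u1] by simp
qed (use roof_objs[OF r] roof_objs[OF q] in auto)

lemma roof_id: "arr X Y f \<Longrightarrow> roof X Y X (cid X) f"
  using qarr_id[of X] by (simp add: roof_def arr_objs)

lemma dmor_cls: "dmor L X Y f = cls X Y (X, cid X, f)"
  by (simp add: dmor_def cls_def)

lemma dcomp_dmor:
  assumes f: "arr X Y f" and g: "arr Y Z g"
  shows "dcomp L X Y Z (dmor L Y Z g) (dmor L X Y f) = dmor L X Z (ccomp X g f)"
  unfolding dmor_cls
  using dcomp_cls[OF roof_id[OF f] roof_id[OF g] qarr_id[OF arr_objs(1)[OF f]] f] f g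
  by (simp add: arr_unit hq_refl arr_unit(1)[OF arr_id[OF arr_objs(1)[OF f]]])

lemma dcomp_id_left:
  assumes r: "roof X Y W s f"
  shows "dcomp L X Y Y (dmor L Y Y (cid Y)) (cls X Y (W, s, f)) = cls X Y (W, s, f)"
proof -
  have a: "arr W X s" "arr W Y f" using r by (auto simp: roof_def qarr_arr)
  show ?thesis unfolding dmor_cls
    using dcomp_cls[OF r roof_id[OF arr_id[OF roof_objs(2)[OF r]]] qarr_id[OF roof_objs(3)[OF r]] a(2)] a
    by (simp add: arr_unit hq_refl)
qed

lemma dcomp_id_right:
  assumes r: "roof X Y W s f"
  shows "dcomp L X X Y (cls X Y (W, s, f)) (dmor L X X (cid X)) = cls X Y (W, s, f)"
proof -
  have a: "qarr W X s" "arr W X s" "arr W Y f" using r by (auto simp: roof_def qarr_arr)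
  show ?thesis unfolding dmor_cls
    using dcomp_cls[OF roof_id[OF arr_id[OF roof_objs(1)[OF r]]] r a(1) arr_id[OF roof_objs(3)[OF r]]] a
    by (simp add: arr_unit hq_refl)
qed

lemma dcomp_exists:
  assumes "roof X Y W s f" "roof Y Z W' t g"
  obtains V u v where "qarr V W u" "arr V W' v" "hq V Y (ccomp V f u) (ccomp V t v)"
    "roof X Z V (ccomp V s u) (ccomp V g v)"
    "dcomp L X Y Z (cls Y Z (W', t, g)) (cls X Y (W, s, f)) = cls X Z (V, ccomp V s u, ccomp V g v)"
proof -
  have a: "qarr W X s" "arr W Y f" "qarr W' Y t" "arr W' Z g" using assms by (auto simp: roof_def)
  obtain V u v where V: "qarr V W u" "arr V W' v" "hq V Y (ccomp V f u) (ccomp V t v)" using ore[OF a(3,2)] by blast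
  moreover have "roof X Z V (ccomp V s u) (ccomp V g v)" unfolding roof_def using V a by blast
  ultimately show ?thesis using that dcomp_cls[OF assms V] by blast
qed

text \<open>The square A composes the first two roofs, B the last two. A third square V over
  \<open>W2\<close> joins A and B, and both bracketings are represented by the same roof over
  V.\<close>

lemma dcomp_assoc:
  assumes r1: "roof X Y W1 s1 f1" and r2: "roof Y Z W2 s2 f2" and r3: "roof Z T W3 s3 f3"
  shows "dcomp L X Z T (cls Z T (W3, s3, f3)) (dcomp L X Y Z (cls Y Z (W2, s2, f2)) (cls X Y (W1, s1, f1))) =
    dcomp L X Y T (dcomp L Y Z T (cls Z T (W3, s3, f3)) (cls Y Z (W2, s2, f2))) (cls X Y (W1, s1, f1))"
proof -
  obtain A u v where A: "qarr A W1 u" "arr A W2 v" "hq A Y (ccomp A f1 u) (ccomp A s2 v)"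
    "roof X Z A (ccomp A s1 u) (ccomp A f2 v)"
    "dcomp L X Y Z (cls Y Z (W2, s2, f2)) (cls X Y (W1, s1, f1)) = cls X Z (A, ccomp A s1 u, ccomp A f2 v)"
    using dcomp_exists[OF r1 r2] by metis
  obtain B c d where B: "qarr B W2 c" "arr B W3 d" "hq B Z (ccomp B f2 c) (ccomp B s3 d)"
    "roof Y T B (ccomp B s2 c) (ccomp B f3 d)"
    "dcomp L Y Z T (cls Z T (W3, s3, f3)) (cls Y Z (W2, s2, f2)) = cls Y T (B, ccomp B s2 c, ccomp B f3 d)"
    using dcomp_exists[OF r2 r3] by metis
  obtain V a g where V: "qarr V A a" "arr V B g" "hq V W2 (ccomp V v a) (ccomp V c g)"
    using ore[OF B(1) A(2)] by blast
  have s2: "arr W2 Y s2" "arr W2 Z f2" using r2 by (auto simp: roof_def qarr_arr)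
  note as = arr_assoc[OF qarr_arr[OF V(1)]] arr_assoc[OF V(2)]
  have "hq V Z (ccomp V f2 (ccomp V v a)) (ccomp V f2 (ccomp V c g))" by (rule hq_post[OF V(3) s2(2)])
  also have "hq V Z (ccomp V f2 (ccomp V c g)) (ccomp V s3 (ccomp V d g))" by (rule hq_pre2[OF B(3) V(2)])
  finally have 1: "hq V Z (ccomp V (ccomp A f2 v) a) (ccomp V s3 (ccomp V d g))" by (simp add: as)
  have "hq V Y (ccomp V f1 (ccomp V u a)) (ccomp V s2 (ccomp V v a))" by (rule hq_pre2[OF A(3) qarr_arr[OF V(1)]])
  also have "hq V Y (ccomp V s2 (ccomp V v a)) (ccomp V s2 (ccomp V c g))" by (rule hq_post[OF V(3) s2(1)])
  finally have 2: "hq V Y (ccomp V f1 (ccomp V u a)) (ccomp V (ccomp B s2 c) g)" by (simp add: as)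
  have "dcomp L X Z T (cls Z T (W3, s3, f3)) (cls X Z (A, ccomp A s1 u, ccomp A f2 v)) =
    cls X T (V, ccomp V s1 (ccomp V u a), ccomp V f3 (ccomp V d g))"
    using dcomp_cls[OF A(4) r3 V(1) arr_comp[OF V(2) B(2)] 1] by (simp add: as)
  moreover have "dcomp L X Y T (cls Y T (B, ccomp B s2 c, ccomp B f3 d)) (cls X Y (W1, s1, f1)) =
    cls X T (V, ccomp V s1 (ccomp V u a), ccomp V f3 (ccomp V d g))"
    using dcomp_cls[OF r1 B(4) qarr_comp[OF V(1) A(1)] V(2) 2] by (simp add: as)
  ultimately show ?thesis by (simp add: A(5) B(5))
qed

abbreviation D :: "('a cpx, 'a roof set) tricat" where
  "D \<equiv> bounded_derived_cat L"

lemma D_simps [simp]: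
  "Ob D = bcpx L" "Hom D X Y = {cls X Y r | r. r \<in> roofs L X Y}" "IdMor D X = dmor L X X (cid X)"
  "Comp D = dcomp L" "ZeroMor D X Y = dmor L X Y (czero X Y)" "AddMor D = dadd L"
  "Shift D = cshift" "Tri D = derived_triangles L"
  by (simp_all add: bounded_derived_cat_def addcat.extend_def tricat.fields_def derived_addcat_def cls_def)

lemma Hom_D:
  assumes "X \<in> bcpx L" "Y \<in> bcpx L"
  shows "a \<in> Hom D X Y \<longleftrightarrow> (\<exists>W s f. roof X Y W s f \<and> a = cls X Y (W, s, f))"
proof
  assume "a \<in> Hom D X Y"
  then obtain r where "r \<in> roofs L X Y" "a = cls X Y r" by auto
  moreover obtain W s f where "r = (W, s, f)" using prod_cases3 by blast
  ultimately show "\<exists>W s f. roof X Y W s f \<and> a = cls X Y (W, s, f)" using roofs_roof assms by blast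
qed (auto dest: roof_roofs)

lemma cls_Hom: "roof X Y W s f \<Longrightarrow> cls X Y (W, s, f) \<in> Hom D X Y"
  unfolding D_simps using roof_roofs by blast

lemma dmor_Hom: "arr X Y f \<Longrightarrow> dmor L X Y f \<in> Hom D X Y"
  unfolding dmor_cls by (intro cls_Hom roof_id)

lemma Comp_Hom:
  assumes "a \<in> Hom D X Y" "b \<in> Hom D Y Z" "X \<in> bcpx L" "Y \<in> bcpx L" "Z \<in> bcpx L"
  shows "dcomp L X Y Z b a \<in> Hom D X Z"
proof -
  obtain W s f W' t g where r: "roof X Y W s f" "a = cls X Y (W, s, f)" "roof Y Z W' t g" "b = cls Y Z (W', t, g)"
    using assms Hom_D by metis
  show ?thesis using dcomp_exists[OF r(1,3)] cls_Hom unfolding r(2,4) by metis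
qed

lemma Comp_assoc:
  assumes "a \<in> Hom D X Y" "b \<in> Hom D Y Z" "c \<in> Hom D Z T" "X \<in> bcpx L" "Y \<in> bcpx L" "Z \<in> bcpx L" "T \<in> bcpx L"
  shows "dcomp L X Z T c (dcomp L X Y Z b a) = dcomp L X Y T (dcomp L Y Z T c b) a"
proof -
  obtain W1 s1 f1 where r1: "roof X Y W1 s1 f1" "a = cls X Y (W1, s1, f1)" using assms Hom_D by metis
  obtain W2 s2 f2 where r2: "roof Y Z W2 s2 f2" "b = cls Y Z (W2, s2, f2)" using assms Hom_D by metis
  obtain W3 s3 f3 where r3: "roof Z T W3 s3 f3" "c = cls Z T (W3, s3, f3)" using assms Hom_D by metis
  show ?thesis unfolding r1(2) r2(2) r3(2) by (rule dcomp_assoc[OF r1(1) r2(1) r3(1)])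
qed

lemma Comp_id:
  assumes "a \<in> Hom D X Y" "X \<in> bcpx L" "Y \<in> bcpx L"
  shows "dcomp L X Y Y (dmor L Y Y (cid Y)) a = a" "dcomp L X X Y a (dmor L X X (cid X)) = a"
proof -
  obtain W s f where "roof X Y W s f" "a = cls X Y (W, s, f)" using assms Hom_D by metis
  then show "dcomp L X Y Y (dmor L Y Y (cid Y)) a = a" "dcomp L X X Y a (dmor L X X (cid X)) = a"
    using dcomp_id_left dcomp_id_right by auto
qed

section \<open>Zero morphisms, inverses of quasi-isomorphisms, and sums of chain maps in the derived
  category\<close>

lemma arr_zero: "X \<in> bcpx L \<Longrightarrow> Y \<in> bcpx L \<Longrightarrow> arr X Y (czero X Y)"
  by (simp add: arr_def)

lemma ccomp_zero:
  assumes "arr Y Z g" "X \<in> bcpx L"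
  shows "ccomp X g (czero X Y) = czero X Z"
proof (rule chain_map_ext)
  have a: "Y \<in> bcpx L" "Z \<in> bcpx L" "g \<in> chain_maps L Y Z" using assms by (auto simp: arr_def)
  show "ccomp X g (czero X Y) \<in> chain_maps L X Z" "czero X Z \<in> chain_maps L X Z"
    using arr_comp[OF arr_zero[OF assms(2) a(1)] assms(1)] assms(2) a by (auto simp: arr_def)
  show "ccomp X g (czero X Y) i x = czero X Z i x" if "x \<in> carrier (Deg X i)" for i x
    using that chmap(5)[OF a(3,1,2)] by simp
qed

lemma zero_ccomp:
  assumes "arr X Y f" "Z \<in> bcpx L"
  shows "ccomp X (czero Y Z) f = czero X Z"
proof (rule chain_map_ext)
  have a: "X \<in> bcpx L" "Y \<in> bcpx L" "f \<in> chain_maps L X Y" using assms by (auto simp: arr_def)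
  show "ccomp X (czero Y Z) f \<in> chain_maps L X Z" "czero X Z \<in> chain_maps L X Z"
    using arr_comp[OF assms(1) arr_zero[OF a(2) assms(2)]] assms(2) a by (auto simp: arr_def)
  show "ccomp X (czero Y Z) f i x = czero X Z i x" if "x \<in> carrier (Deg X i)" for i x
    using that chmap(1)[OF a(3,1,2)] by simp
qed

lemma Comp_zero:
  assumes "a \<in> Hom D X Y" "X \<in> bcpx L" "Y \<in> bcpx L" "Z \<in> bcpx L"
  shows "dcomp L X Y Z (dmor L Y Z (czero Y Z)) a = dmor L X Z (czero X Z)"
    "dcomp L Z X Y a (dmor L Z X (czero Z X)) = dmor L Z Y (czero Z Y)"
proof -
  obtain W s f where r: "roof X Y W s f" "a = cls X Y (W, s, f)" using assms Hom_D by metis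
  have b: "qarr W X s" "arr W X s" "arr W Y f" "W \<in> bcpx L" using r(1) roof_objs by (auto simp: roof_def qarr_arr)
  have 1: "dcomp L X Y Z (dmor L Y Z (czero Y Z)) a = cls X Z (W, s, czero W Z)"
    unfolding dmor_cls r(2)
    using dcomp_cls[OF r(1) roof_id[OF arr_zero[OF assms(3,4)]] qarr_id[OF b(4)] b(3)] b assms
    by (simp add: arr_unit hq_refl zero_ccomp)
  \<comment> \<open>Zero over W and zero over X are compared over W itself, with the denominator s
    as the leg into X.\<close>
  have "req X Z (W, s, czero W Z) (X, cid X, czero X Z)"
    using assms b by (intro reqI[of _ _ _ _ _ _ _ _ W "cid W" s])
      (simp_all add: roof_def arr_zero qarr_id arr_id arr_unit hq_refl zero_ccomp arr_unit(1)[OF arr_zero])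
  from cls_eq[OF this assms(2,4)]
  show "dcomp L X Y Z (dmor L Y Z (czero Y Z)) a = dmor L X Z (czero X Z)" unfolding 1 unfolding dmor_cls .
  have z: "ccomp Z (czero Z X) (cid Z) = czero Z X" "ccomp Z (cid Z) (cid Z) = cid Z"
    using arr_unit(1)[OF arr_zero[OF assms(4,2)]] arr_unit(1)[OF arr_id[OF assms(4)]] by auto
  show "dcomp L Z X Y a (dmor L Z X (czero Z X)) = dmor L Z Y (czero Z Y)"
    unfolding dmor_cls r(2)
    using dcomp_cls[OF roof_id[OF arr_zero[OF assms(4,2)]] r(1) qarr_id[OF assms(4)] arr_zero[OF assms(4) b(4)]] b assms
    by (simp add: hq_refl ccomp_zero z arr_zero)
qed

text \<open>The inverse is the roof with denominator q and numerator the identity.\<close>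

lemma dmor_iso:
  assumes q: "qarr X Y q"
  shows "iso_mor D X Y (dmor L X Y q)"
proof -
  have o: "X \<in> bcpx L" "Y \<in> bcpx L" and a: "arr X Y q" using q qarr_arr by (auto simp: qarr_def)
  have r: "roof Y X X q (cid X)" using q arr_id[OF o(1)] by (simp add: roof_def)
  have u: "ccomp X (cid X) (cid X) = cid X" "ccomp X q (cid X) = q" "ccomp X (cid Y) q = q"
    using arr_unit[OF a] arr_unit[OF arr_id[OF o(1)]] by auto
  have 1: "dcomp L X Y X (cls Y X (X, q, cid X)) (dmor L X Y q) = dmor L X X (cid X)"
    unfolding dmor_cls using dcomp_cls[OF roof_id[OF a] r qarr_id[OF o(1)] arr_id[OF o(1)]] hq_refl[OF a] by (simp add: u)
  have 2: "dcomp L Y X Y (dmor L X Y q) (cls Y X (X, q, cid X)) = cls Y Y (X, q, q)"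
    unfolding dmor_cls
    using dcomp_cls[OF r roof_id[OF a] qarr_id[OF o(1)] arr_id[OF o(1)]] hq_refl[OF arr_id[OF o(1)]] by (simp add: u)
  have "req Y Y (X, q, q) (Y, cid Y, cid Y)"
    using o a q by (intro reqI[of _ _ _ _ _ _ _ _ X "cid X" q]) (simp_all add: roof_def qarr_id arr_id u hq_refl)
  from cls_eq[OF this o(2,2)] have "cls Y Y (X, q, q) = dmor L Y Y (cid Y)" unfolding dmor_cls .
  with 1 2 show ?thesis
    unfolding iso_mor_def using dmor_Hom[OF a] cls_Hom[OF r] by (auto simp del: D_simps(2))
qed

lemma cadd_ccomp:
  assumes "arr W Y f" "arr W Y g" "arr U W p"
  shows "ccomp U (cadd W Y f g) p = cadd U Y (ccomp U f p) (ccomp U g p)"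
proof (rule chain_map_ext)
  have a: "W \<in> bcpx L" "Y \<in> bcpx L" "U \<in> bcpx L" "f \<in> chain_maps L W Y" "g \<in> chain_maps L W Y" "p \<in> chain_maps L U W"
    using assms by (auto simp: arr_def)
  show "ccomp U (cadd W Y f g) p \<in> chain_maps L U Y" "cadd U Y (ccomp U f p) (ccomp U g p) \<in> chain_maps L U Y"
    using a by (intro ccomp_chain[of _ U W] cadd_chain; simp)+
  show "ccomp U (cadd W Y f g) p i x = cadd U Y (ccomp U f p) (ccomp U g p) i x" if "x \<in> carrier (Deg U i)" for i x
    using that chmap(1)[OF a(6,3,1)] by simp
qed

lemma arr_add: "arr X Y f \<Longrightarrow> arr X Y g \<Longrightarrow> arr X Y (cadd X Y f g)"
  by (simp add: arr_def cadd_chain)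

lemma hq_add:
  assumes "hq X Y f g" "hq X Y f' g'"
  shows "hq X Y (cadd X Y f f') (cadd X Y g g')"
  using assms arr_add unfolding hq_def arr_def by (blast intro: homotopic_add)

text \<open>\<open>dadd\<close> adds roofs with a common denominator (W, s). The two summands are
  related to f and g by separate refinements, which an Ore square over W replaces by a single
  one.\<close>

lemma dadd_dmor:
  assumes f: "arr X Y f" and g: "arr X Y g"
  shows "dadd L X Y (dmor L X Y f) (dmor L X Y g) = dmor L X Y (cadd X Y f g)"
  unfolding dadd_def dmor_cls
proof (rule saturate_eq_cls)
  note o = arr_objs[OF f]
  show "(X, cid X, cadd X Y f g) \<in> {(W, s, cadd W Y f' g') |W s f' g'.
      (W, s, f') \<in> cls X Y (X, cid X, f) \<and> (W, s, g') \<in> cls X Y (X, cid X, g)}"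
    using mem_cls[OF roof_id[OF f]] mem_cls[OF roof_id[OF g]] req_refl roof_id f g by blast
  fix q assume "q \<in> {(W, s, cadd W Y f' g') |W s f' g'.
      (W, s, f') \<in> cls X Y (X, cid X, f) \<and> (W, s, g') \<in> cls X Y (X, cid X, g)}"
  then obtain W s f' g' where q: "q = (W, s, cadd W Y f' g')"
    and e: "req X Y (X, cid X, f) (W, s, f')" "req X Y (X, cid X, g) (W, s, g')"
    using mem_cls[OF roof_id[OF f]] mem_cls[OF roof_id[OF g]] by blast
  obtain V u u' where V: "roof X Y W s f'" "qarr V X u" "qarr V W u'"
    "hq V X (ccomp V (cid X) u) (ccomp V s u')" "hq V Y (ccomp V f u) (ccomp V f' u')"
    using reqE[OF e(1) o] by metis
  obtain V1 w w' where V1: "roof X Y W s g'" "qarr V1 X w" "qarr V1 W w'"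
    "hq V1 X (ccomp V1 (cid X) w) (ccomp V1 s w')" "hq V1 Y (ccomp V1 g w) (ccomp V1 g' w')"
    using reqE[OF e(2) o] by metis
  have a: "arr W Y f'" "arr W Y g'" "arr W X s" "qarr W X s" using V(1) V1(1) by (auto simp: roof_def qarr_arr)
  \<comment> \<open>The legs of V and V1 into W agree up to homotopy on U, so U with the legs P into
    W and s P into X serves both summands.\<close>
  obtain U x y where U: "qarr U V x" "arr U V1 y" "hq U W (ccomp U u' x) (ccomp U w' y)"
    using ore[OF V1(3) qarr_arr[OF V(3)]] by blast
  let ?P = "ccomp U u' x"
  have P: "qarr U W ?P" "arr U W ?P" using U V qarr_arr by blast+
  have xa: "arr U V x" "arr U X (ccomp U u x)" "arr U X (ccomp U w y)" using U V(2) V1(2) qarr_arr by blast+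
  have sP: "hq U X (ccomp U s ?P) (ccomp U u x)"
    using hq_sym[OF hq_pre2[OF V(4) xa(1)]] by (simp add: arr_unit(2)[OF xa(2)])
  have sy: "hq U X (ccomp U s (ccomp U w' y)) (ccomp U w y)"
    using hq_sym[OF hq_pre2[OF V1(4) U(2)]] by (simp add: arr_unit(2)[OF xa(3)])
  have "hq U Y (ccomp U f (ccomp U s ?P)) (ccomp U f (ccomp U u x))" by (rule hq_post[OF sP f])
  also have "hq U Y (ccomp U f (ccomp U u x)) (ccomp U f' ?P)" by (rule hq_pre2[OF V(5) xa(1)])
  finally have h1: "hq U Y (ccomp U f (ccomp U s ?P)) (ccomp U f' ?P)" .
  have "hq U X (ccomp U s ?P) (ccomp U s (ccomp U w' y))" by (rule hq_post[OF U(3) a(3)])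
  also note sy
  finally have "hq U X (ccomp U s ?P) (ccomp U w y)" .
  from hq_post[OF this g] have "hq U Y (ccomp U g (ccomp U s ?P)) (ccomp U g (ccomp U w y))" .
  also have "hq U Y (ccomp U g (ccomp U w y)) (ccomp U g' (ccomp U w' y))" by (rule hq_pre2[OF V1(5) U(2)])
  also have "hq U Y (ccomp U g' (ccomp U w' y)) (ccomp U g' ?P)" by (rule hq_post[OF hq_sym[OF U(3)] a(2)])
  finally have h2: "hq U Y (ccomp U g (ccomp U s ?P)) (ccomp U g' ?P)" .
  have sPa: "arr U X (ccomp U s ?P)" "qarr U X (ccomp U s ?P)" using P a by blast+
  show "req X Y (X, cid X, cadd X Y f g) q" unfolding q
  proof (rule reqI)
    show "roof X Y X (cid X) (cadd X Y f g)" by (intro roof_id arr_add f g)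
    show "roof X Y W s (cadd W Y f' g')" using a arr_add by (simp add: roof_def)
    show "arr U X (ccomp U s ?P)" "arr U W ?P" by fact+
    show "qarr U X (ccomp U (cid X) (ccomp U s ?P))" using sPa by (simp add: arr_unit(2)[OF sPa(1)])
    show "hq U X (ccomp U (cid X) (ccomp U s ?P)) (ccomp U s ?P)" using sPa by (simp add: arr_unit(2)[OF sPa(1)] hq_refl)
    show "hq U Y (ccomp U (cadd X Y f g) (ccomp U s ?P)) (ccomp U (cadd W Y f' g') ?P)"
      using hq_add[OF h1 h2] by (simp add: cadd_ccomp[OF f g sPa(1)] cadd_ccomp[OF a(1,2) P(2)])
  qed
qed (use arr_objs[OF f] in auto)

section \<open>Direct summands and isomorphism in the derived category\<close>

lemma direct_sum_two:
  "direct_sum C [X, X'] Y \<longleftrightarrow> X \<in> Ob C \<and> X' \<in> Ob C \<and> Y \<in> Ob C \<and>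
    (\<exists>i i' p p'. i \<in> Hom C X Y \<and> i' \<in> Hom C X' Y \<and> p \<in> Hom C Y X \<and> p' \<in> Hom C Y X' \<and>
      Comp C X Y X p i = IdMor C X \<and> Comp C X' Y X' p' i' = IdMor C X' \<and>
      Comp C X Y X' p' i = ZeroMor C X X' \<and> Comp C X' Y X p i' = ZeroMor C X' X \<and>
      AddMor C Y Y (Comp C Y X Y i p) (AddMor C Y Y (Comp C Y X' Y i' p') (ZeroMor C Y Y)) = IdMor C Y)"
  (is "?L \<longleftrightarrow> ?R")
proof
  assume ?L
  then have o: "X \<in> Ob C" "X' \<in> Ob C" "Y \<in> Ob C" by (simp_all add: direct_sum_def)
  have l: "length [X, X'] = 2" by simp
  obtain \<iota> \<pi> where h: "\<forall>k<2. \<iota> k \<in> Hom C ([X, X'] ! k) Y \<and> \<pi> k \<in> Hom C Y ([X, X'] ! k)"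
    and e: "\<forall>k<2. \<forall>l<2. Comp C ([X, X'] ! l) Y ([X, X'] ! k) (\<pi> k) (\<iota> l) =
        (if k = l then IdMor C ([X, X'] ! k) else ZeroMor C ([X, X'] ! l) ([X, X'] ! k))"
    and s: "foldr (\<lambda>k. AddMor C Y Y (Comp C Y ([X, X'] ! k) Y (\<iota> k) (\<pi> k))) [0..<2] (ZeroMor C Y Y) = IdMor C Y"
    using \<open>?L\<close> unfolding direct_sum_def l by blast
  have "[0..<2] = [0, 1::nat]" by (simp add: upt_rec)
  then have s': "AddMor C Y Y (Comp C Y X Y (\<iota> 0) (\<pi> 0)) (AddMor C Y Y (Comp C Y X' Y (\<iota> 1) (\<pi> 1)) (ZeroMor C Y Y)) = IdMor C Y"
    using s by simp
  show ?R
    using o h[rule_format, of 0] h[rule_format, of 1] e[rule_format, of 0 0] e[rule_format, of 0 1]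
      e[rule_format, of 1 0] e[rule_format, of 1 1] s'
    by (intro conjI exI[of _ "\<iota> 0"] exI[of _ "\<iota> 1"] exI[of _ "\<pi> 0"] exI[of _ "\<pi> 1"]) simp_all
next
  assume ?R
  then obtain i i' p p' where "X \<in> Ob C" "X' \<in> Ob C" "Y \<in> Ob C"
    and r: "i \<in> Hom C X Y" "i' \<in> Hom C X' Y" "p \<in> Hom C Y X" "p' \<in> Hom C Y X'"
      "Comp C X Y X p i = IdMor C X" "Comp C X' Y X' p' i' = IdMor C X'"
      "Comp C X Y X' p' i = ZeroMor C X X'" "Comp C X' Y X p i' = ZeroMor C X' X"
      "AddMor C Y Y (Comp C Y X Y i p) (AddMor C Y Y (Comp C Y X' Y i' p') (ZeroMor C Y Y)) = IdMor C Y"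
    by blast
  then show ?L unfolding direct_sum_def
    by (intro conjI exI[of _ "\<lambda>k. if k = 0 then i else i'"] exI[of _ "\<lambda>k. if k = 0 then p else p'"])
      (auto simp: less_Suc_eq upt_rec)
qed

text \<open>The complement stays the same; the inclusion and the projection of X are composed with
  the inverse and with the isomorphism.\<close>

lemma iso_summand:
  assumes X: "direct_summand D X Y" and a: "iso_mor D X Z a" and Z: "Z \<in> bcpx L"
  shows "direct_summand D Z Y"
proof -
  obtain X' where "direct_sum D [X, X'] Y" using X by (auto simp: direct_summand_def)
  then obtain i i' p p' where o: "X \<in> bcpx L" "X' \<in> bcpx L" "Y \<in> bcpx L"
    and h: "i \<in> Hom D X Y" "i' \<in> Hom D X' Y" "p \<in> Hom D Y X" "p' \<in> Hom D Y X'"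
    and e: "dcomp L X Y X p i = IdMor D X" "dcomp L X' Y X' p' i' = IdMor D X'"
      "dcomp L X Y X' p' i = ZeroMor D X X'" "dcomp L X' Y X p i' = ZeroMor D X' X"
    and s: "AddMor D Y Y (dcomp L Y X Y i p) (AddMor D Y Y (dcomp L Y X' Y i' p') (ZeroMor D Y Y)) = IdMor D Y"
    unfolding direct_sum_two by (auto simp del: D_simps(2,3,5,6))
  obtain b where ab: "a \<in> Hom D X Z" "b \<in> Hom D Z X" "dcomp L X Z X b a = IdMor D X" "dcomp L Z X Z a b = IdMor D Z"
    using a unfolding iso_mor_def by (auto simp del: D_simps(2,3))
  let ?i = "dcomp L Z X Y i b" and ?p = "dcomp L Y X Z a p"
  have hi: "?i \<in> Hom D Z Y" "?p \<in> Hom D Y Z" using h ab o Z Comp_Hom by blast+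
  note assoc = Comp_assoc
  have ib: "dcomp L Z X X (IdMor D X) b = b" "dcomp L Y X X (IdMor D X) p = p"
    using Comp_id(1) ab h o Z by auto
  have 1: "dcomp L Z Y X p ?i = b"
    using assoc[OF ab(2) h(1) h(3) Z o(1,3,1)] by (simp only: e ib)
  have "dcomp L Z Y Z ?p ?i = dcomp L Z X Z a (dcomp L Z Y X p ?i)"
    using assoc[OF hi(1) h(3) ab(1) Z o(3,1) Z] by simp
  then have e1: "dcomp L Z Y Z ?p ?i = IdMor D Z" using 1 ab by simp
  have "dcomp L Z Y X' p' ?i = dcomp L Z X X' (dcomp L X Y X' p' i) b"
    by (rule assoc[OF ab(2) h(1) h(4) Z o(1,3,2)])
  then have e2: "dcomp L Z Y X' p' ?i = ZeroMor D Z X'" using Comp_zero(1)[OF ab(2) Z o(1,2)] e by simp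
  have "dcomp L X' Y Z ?p i' = dcomp L X' X Z a (dcomp L X' Y X p i')"
    by (rule assoc[OF h(2) h(3) ab(1) o(2,3,1) Z, symmetric])
  then have e3: "dcomp L X' Y Z ?p i' = ZeroMor D X' Z" using Comp_zero(2)[OF ab(1) o(1) Z o(2)] e by simp
  have "dcomp L Y Z X b ?p = dcomp L Y X X (dcomp L X Z X b a) p"
    by (rule assoc[OF h(3) ab(1,2) o(3,1) Z o(1)])
  then have 2: "dcomp L Y Z X b ?p = p" by (simp only: ab ib)
  have "dcomp L Y Z Y ?i ?p = dcomp L Y X Y i (dcomp L Y Z X b ?p)"
    by (rule assoc[OF hi(2) ab(2) h(1) o(3) Z o(1,3), symmetric])
  then have e4: "dcomp L Y Z Y ?i ?p = dcomp L Y X Y i p" by (simp only: 2)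
  have "direct_sum D [Z, X'] Y" unfolding direct_sum_two
    using o Z h(2,4) hi e(2) e1 e2 e3 e4 s
    by (intro conjI exI[of _ ?i] exI[of _ i'] exI[of _ ?p] exI[of _ p']) (simp_all del: D_simps(2,3,5,6))
  then show ?thesis by (auto simp: direct_summand_def)
qed

lemma add_closure_Ob: "add_closure D I \<subseteq> bcpx L"
  by (auto simp: add_closure_def direct_summand_def direct_sum_def)

lemma add_closure_iso:
  assumes "X \<in> add_closure D I" "iso_mor D X Z a" "Z \<in> bcpx L"
  shows "Z \<in> add_closure D I"
  using assms iso_summand unfolding add_closure_def by blast

lemma iso_sym: "iso_mor D X Y a \<Longrightarrow> \<exists>b. iso_mor D Y X b"
  unfolding iso_mor_def by blast

text \<open>From here on complexes may be exchanged along quasi-isomorphisms in all statements about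
  generation.\<close>

lemma add_closure_qi:
  assumes "qarr X Y q"
  shows "X \<in> add_closure D I \<longleftrightarrow> Y \<in> add_closure D I"
proof -
  have o: "X \<in> bcpx L" "Y \<in> bcpx L" using assms by (auto simp: qarr_def)
  show ?thesis using add_closure_iso dmor_iso[OF assms] iso_sym o by blast
qed

section \<open>Distinguished triangles of cones\<close>

lemma arr_shift:
  assumes "arr X Y f"
  shows "arr (cshift 1 X) (cshift 1 Y) (cshift_map 1 f)"
proof -
  have a: "X \<in> bcpx L" "Y \<in> bcpx L" "f \<in> chain_maps L X Y" using assms by (auto simp: arr_def)
  note [simp] = a(1,2) chmap[OF a(3,1,2)]
  have "cshift_map 1 f \<in> chain_maps L (cshift 1 X) (cshift 1 Y)"
  proof (rule chain_mapsI)
    show "cshift_map 1 f i \<in> rhom L (Deg (cshift 1 X) i) (Deg (cshift 1 Y) i)" for i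
      using chain_maps_rhom[OF a(3)] by (simp add: cshift_map_def)
  qed (simp add: cshift_map_def cshift_Dif)
  then show ?thesis by (simp add: arr_def)
qed

lemma qarr_shift:
  assumes "qarr X Y f"
  shows "qarr (cshift 1 X) (cshift 1 Y) (cshift_map 1 f)"
  using arr_shift[OF qarr_arr[OF assms]] assms unfolding qarr_def quasi_isos_def arr_def
  by (simp add: cshift_map_def)

lemma hq_shift:
  assumes "hq X Y f g"
  shows "hq (cshift 1 X) (cshift 1 Y) (cshift_map 1 f) (cshift_map 1 g)"
proof -
  have a: "arr X Y f" "arr X Y g" and h: "homotopic L X Y f g" using assms by (auto simp: hq_def)
  have X [simp]: "X \<in> bcpx L" and Y [simp]: "Y \<in> bcpx L" using a by (auto simp: arr_def)
  obtain s where s: "\<And>i j. j = i - 1 \<Longrightarrow> s i \<in> rhom L (Deg X i) (Deg Y j)"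
    and e: "\<And>x i j. x \<in> carrier (Deg X i) \<Longrightarrow> f i x \<ominus>\<^bsub>Deg Y i\<^esub> g i x =
        Dif Y (i - 1) (s i x) \<oplus>\<^bsub>Deg Y i\<^esub> s (i + 1) (Dif X i x)"
    using homotopicE[OF h X Y] by metis
  have sr: "s (i + 1) \<in> rhom L (Deg X (i + 1)) (Deg Y i)" for i by (rule s) simp
  note S = rhom_simps[OF sr] rhom_group[OF sr bcpx_fg[OF X] bcpx_fg[OF Y]]
  have S2: "s (i + 2) (\<ominus>\<^bsub>Deg X (i + 2)\<^esub> x) = \<ominus>\<^bsub>Deg Y (i + 1)\<^esub> s (i + 2) x" "s (i + 2) x \<in> carrier (Deg Y (i + 1))"
    if "x \<in> carrier (Deg X (i + 2))" for i x
    using rhom_group(2)[OF s[of "i + 1" "i + 2"], of x] rhom_simps(1)[OF s[of "i + 1" "i + 2"], of x] that by simp_all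
  have "homotopic L (cshift 1 X) (cshift 1 Y) (cshift_map 1 f) (cshift_map 1 g)"
  \<comment> \<open>The shift changes the sign of both differentials, hence that of the
    homotopy.\<close>
  proof (rule homotopicI[where s = "\<lambda>i. \<lambda>x\<in>carrier (Deg X (i + 1)). \<ominus>\<^bsub>Deg Y i\<^esub> s (i + 1) x"])
    show "(\<lambda>x\<in>carrier (Deg X (i + 1)). \<ominus>\<^bsub>Deg Y i\<^esub> s (i + 1) x) \<in> rhom L (Deg (cshift 1 X) i) (Deg (cshift 1 Y) (i - 1))" for i
      using rhom_neg[OF sr] by simp
    fix i x assume x: "x \<in> carrier (Deg (cshift 1 X) i)"
    then have "x \<in> carrier (Deg X (i + 1))" by simp
    from e[OF this] show "cshift_map 1 f i x \<ominus>\<^bsub>Deg (cshift 1 Y) i\<^esub> cshift_map 1 g i x =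
      Dif (cshift 1 Y) (i - 1) ((\<lambda>x\<in>carrier (Deg X (i + 1)). \<ominus>\<^bsub>Deg Y i\<^esub> s (i + 1) x) x) \<oplus>\<^bsub>Deg (cshift 1 Y) i\<^esub>
      (\<lambda>x\<in>carrier (Deg X (i + 1 + 1)). \<ominus>\<^bsub>Deg Y (i + 1)\<^esub> s (i + 1 + 1) x) (Dif (cshift 1 X) i x)"
      using x by (simp add: cshift_map_def cshift_Dif S S2 dif_neg)
  qed
  then show ?thesis using arr_shift a by (simp add: hq_def)
qed

lemma shift_ccomp: "ccomp (cshift 1 V) (cshift_map 1 f) (cshift_map 1 u) = cshift_map 1 (ccomp V f u)"
  by (simp add: ccomp_def cshift_map_def)

lemma shift_cid: "cshift_map 1 (cid X) = cid (cshift 1 X)"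
  by (intro ext) (simp add: cid_def cshift_map_def restrict_def)

text \<open>The third square of a distinguished triangle contains the shift of the comparison
  isomorphism; for the triangle of a cone this isomorphism is an identity.\<close>

lemma dshift_id:
  assumes X: "X \<in> bcpx L"
  shows "dshift L 1 X X (dmor L X X (cid X)) = dmor L (cshift 1 X) (cshift 1 X) (cid (cshift 1 X))"
  unfolding dshift_def dmor_cls
proof (rule saturate_eq_cls)
  have r: "roof X X X (cid X) (cid X)" by (rule roof_id[OF arr_id[OF X]])
  have "(X, cid X, cid X) \<in> cls X X (X, cid X, cid X)" using mem_cls[OF r] req_refl[OF r] by simp
  then show "(cshift 1 X, cid (cshift 1 X), cid (cshift 1 X)) \<in>
    {(cshift 1 W, cshift_map 1 s, cshift_map 1 f) |W s f. (W, s, f) \<in> cls X X (X, cid X, cid X)}"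
    by (intro CollectI exI[of _ X] exI[of _ "cid X"]) (simp add: shift_cid)
  fix q assume "q \<in> {(cshift 1 W, cshift_map 1 s, cshift_map 1 f) |W s f. (W, s, f) \<in> cls X X (X, cid X, cid X)}"
  then obtain W s f where q: "q = (cshift 1 W, cshift_map 1 s, cshift_map 1 f)"
    and e: "req X X (X, cid X, cid X) (W, s, f)" using mem_cls[OF r] by auto
  obtain V u u' where V: "roof X X W s f" "qarr V X u" "qarr V W u'" "qarr V X (ccomp V (cid X) u)"
    "hq V X (ccomp V (cid X) u) (ccomp V s u')" "hq V X (ccomp V (cid X) u) (ccomp V f u')"
    using reqE[OF e X X] by metis
  show "req (cshift 1 X) (cshift 1 X) (cshift 1 X, cid (cshift 1 X), cid (cshift 1 X)) q" unfolding q
  proof (rule reqI)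
    show "roof (cshift 1 X) (cshift 1 X) (cshift 1 X) (cid (cshift 1 X)) (cid (cshift 1 X))"
      by (rule roof_id[OF arr_id]) (simp add: X)
    show "roof (cshift 1 X) (cshift 1 X) (cshift 1 W) (cshift_map 1 s) (cshift_map 1 f)"
      using V(1) qarr_shift arr_shift by (simp add: roof_def)
    show "arr (cshift 1 V) (cshift 1 X) (cshift_map 1 u)" "arr (cshift 1 V) (cshift 1 W) (cshift_map 1 u')"
      using V arr_shift qarr_arr by blast+
  qed (use qarr_shift[OF V(4)] hq_shift[OF V(5)] hq_shift[OF V(6)] in \<open>simp_all add: shift_ccomp[symmetric] shift_cid\<close>)
qed (use X in simp_all)

lemma arr_cone_incl:
  assumes "arr A X \<phi>"
  shows "arr X (cone A X \<phi>) (cone_incl A X)"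
proof -
  have a: "A \<in> bcpx L" "X \<in> bcpx L" "\<phi> \<in> chain_maps L A X" using assms by (auto simp: arr_def)
  then show ?thesis using tincl_chain[OF cone_twist[OF a(3,1,2)]]
    by (simp add: arr_def cone_tw cone_incl_tincl cone_twist)
qed

lemma arr_cone_proj:
  assumes "arr A X \<phi>"
  shows "arr (cone A X \<phi>) (cshift 1 A) (cone_proj A X)"
proof -
  have a: "A \<in> bcpx L" "X \<in> bcpx L" "\<phi> \<in> chain_maps L A X" using assms by (auto simp: arr_def)
  then show ?thesis using tproj_chain[OF cone_twist[OF a(3,1,2)]]
    by (simp add: arr_def cone_tw cone_proj_tproj cone_twist)
qed

lemma cone_triangle:
  assumes \<phi>: "arr A X \<phi>"
  shows "(A, X, cone A X \<phi>, dmor L A X \<phi>, dmor L X (cone A X \<phi>) (cone_incl A X),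
    dmor L (cone A X \<phi>) (cshift 1 A) (cone_proj A X)) \<in> Tri D"
proof -
  let ?C = "cone A X \<phi>"
  have o: "A \<in> bcpx L" "X \<in> bcpx L" "?C \<in> bcpx L" "cshift 1 A \<in> bcpx L" and c: "\<phi> \<in> chain_maps L A X"
    using \<phi> by (auto simp: arr_def)
  note i = arr_cone_incl[OF \<phi>] and p = arr_cone_proj[OF \<phi>]
  have idm: "iso_mor D Y Y (dmor L Y Y (cid Y))" if "Y \<in> bcpx L" for Y using dmor_iso[OF qarr_id[OF that]] .
  \<comment> \<open>\<open>derived_triangles\<close> refers to the additive category that
    \<open>D\<close> extends, so the facts about \<open>D\<close> are transferred to it.\<close>
  have idm': "iso_mor (derived_addcat L) Y Y (dmor L Y Y (cid Y))" if "Y \<in> bcpx L" for Y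
    using idm[OF that] unfolding iso_mor_def D_simps by (simp add: derived_addcat_def cls_def)
  note h = dmor_Hom[OF \<phi>] dmor_Hom[OF i] dmor_Hom[OF p]
  have u: "dcomp L A X X (dmor L X X (cid X)) (dmor L A X \<phi>) = dcomp L A A X (dmor L A X \<phi>) (dmor L A A (cid A))"
    "dcomp L X ?C ?C (dmor L ?C ?C (cid ?C)) (dmor L X ?C (cone_incl A X)) =
      dcomp L X X ?C (dmor L X ?C (cone_incl A X)) (dmor L X X (cid X))"
    "dcomp L ?C (cshift 1 A) (cshift 1 A) (dshift L 1 A A (dmor L A A (cid A))) (dmor L ?C (cshift 1 A) (cone_proj A X)) =
      dcomp L ?C ?C (cshift 1 A) (dmor L ?C (cshift 1 A) (cone_proj A X)) (dmor L ?C ?C (cid ?C))"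
    using Comp_id[OF h(1) o(1,2)] Comp_id[OF h(2) o(2,3)] Comp_id[OF h(3) o(3,4)] dshift_id[OF o(1)] by simp_all
  have hh: "dmor L A X \<phi> \<in> Hom (derived_addcat L) A X" "dmor L X ?C (cone_incl A X) \<in> Hom (derived_addcat L) X ?C"
    "dmor L ?C (cshift 1 A) (cone_proj A X) \<in> Hom (derived_addcat L) ?C (cshift 1 A)"
    using h unfolding D_simps by (simp_all add: derived_addcat_def cls_def)
  have simps: "Ob (derived_addcat L) = bcpx L" "Comp (derived_addcat L) = dcomp L" by (simp_all add: derived_addcat_def)
  show ?thesis unfolding D_simps derived_triangles_def Let_def
    using o c hh idm'[OF o(1)] idm'[OF o(2)] idm'[OF o(3)] u unfolding simps by blast
qed

section \<open>Generation in finitely many steps\<close>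

definition zcpx :: "'a cpx" where
  "zcpx = \<lparr>Deg = (\<lambda>_. zmod), Dif = (\<lambda>_. \<lambda>x\<in>carrier zmod. \<zero>\<^bsub>zmod\<^esub>)\<rparr>"

lemma zcpx_bcpx [simp]: "zcpx \<in> bcpx L"
  by (rule bcpxI[where S = "{}"]) (auto simp: zcpx_def rhom_zero[of zmod zmod, simplified])

lemma zcpx_id: "cid zcpx = czero zcpx zcpx"
  unfolding cid_def czero_def zcpx_def by (intro ext) (simp add: restrict_def)

lemma direct_sum_twoI:
  assumes "X \<in> Ob C" "X' \<in> Ob C" "Y \<in> Ob C"
    and "i \<in> Hom C X Y" "i' \<in> Hom C X' Y" "p \<in> Hom C Y X" "p' \<in> Hom C Y X'"
    and "Comp C X Y X p i = IdMor C X" "Comp C X' Y X' p' i' = IdMor C X'"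
    and "Comp C X Y X' p' i = ZeroMor C X X'" "Comp C X' Y X p i' = ZeroMor C X' X"
    and "AddMor C Y Y (Comp C Y X Y i p) (AddMor C Y Y (Comp C Y X' Y i' p') (ZeroMor C Y Y)) = IdMor C Y"
  shows "direct_sum C [X, X'] Y"
  unfolding direct_sum_two using assms by blast

text \<open>The complement is the zero complex.\<close>

lemma summand_refl:
  assumes X: "X \<in> bcpx L"
  shows "direct_summand D X X"
proof -
  let ?i = "dmor L X X (cid X)" and ?z = "dmor L zcpx X (czero zcpx X)" and ?w = "dmor L X zcpx (czero X zcpx)"
  have a: "arr X X (cid X)" "arr zcpx X (czero zcpx X)" "arr X zcpx (czero X zcpx)" "arr X X (czero X X)"
    using X arr_id arr_zero by auto
  have h: "?i \<in> Hom D X X" "?z \<in> Hom D zcpx X" "?w \<in> Hom D X zcpx" using a dmor_Hom by blast+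
  have u: "ccomp X (cid X) (cid X) = cid X" using arr_unit a by blast
  have s: "cadd X X (czero X X) (czero X X) = czero X X" "cadd X X (cid X) (czero X X) = cid X"
    using X by (auto intro!: chain_map_ext[OF cadd_chain])
  have "direct_sum D [X, zcpx] X"
  proof (rule direct_sum_twoI[of _ D _ _ ?i ?z ?i ?w])
    show "Comp D zcpx X zcpx ?w ?z = IdMor D zcpx"
      using dcomp_dmor[OF a(2,3)] by (simp add: zcpx_id ccomp_zero[OF a(3)])
    show "Comp D X X X ?i ?i = IdMor D X" using dcomp_dmor[OF a(1,1)] by (simp add: u)
    show "Comp D X X zcpx ?w ?i = ZeroMor D X zcpx" using dcomp_dmor[OF a(1,3)] arr_unit(1)[OF a(3)] by simp
    show "Comp D zcpx X X ?i ?z = ZeroMor D zcpx X" using dcomp_dmor[OF a(2,1)] arr_unit(2)[OF a(2)] by simp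
    show "AddMor D X X (Comp D X X X ?i ?i) (AddMor D X X (Comp D X zcpx X ?z ?w) (ZeroMor D X X)) = IdMor D X"
      using dcomp_dmor[OF a(1,1)] dcomp_dmor[OF a(3,2)] dadd_dmor[OF a(4,4)] dadd_dmor[OF a(1,4)]
      by (simp add: u ccomp_zero[OF a(2)] s X)
  qed (use X h in \<open>simp_all del: D_simps(2)\<close>)
  then show ?thesis by (auto simp: direct_summand_def)
qed

lemma direct_sum_single:
  assumes X: "X \<in> bcpx L"
  shows "direct_sum D [X] X"
proof -
  let ?i = "dmor L X X (cid X)"
  have a: "arr X X (cid X)" "arr X X (czero X X)" using X arr_id arr_zero by auto
  have u: "ccomp X (cid X) (cid X) = cid X" using arr_unit a by blast
  have s: "cadd X X (cid X) (czero X X) = cid X"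
    using X by (auto intro!: chain_map_ext[OF cadd_chain])
  have c: "dcomp L X X X ?i ?i = ?i" using dcomp_dmor[OF a(1,1)] by (simp add: u)
  have d: "dadd L X X ?i (dmor L X X (czero X X)) = ?i" using dadd_dmor[OF a] by (simp add: s)
  show ?thesis unfolding direct_sum_def
    using X dmor_Hom[OF a(1)] c d
    by (intro conjI exI[of _ "\<lambda>_. ?i"]) (simp_all del: D_simps(2))
qed

lemma tri_gen1_base:
  assumes "X \<in> I" "X \<in> bcpx L"
  shows "X \<in> tri_gen1 D I"
proof -
  have "cshift 0 X = X" using assms by simp
  then have "X \<in> {Shift D k Y | k Y. Y \<in> I}" using assms(1) by (metis (mono_tags, lifting) D_simps(7) mem_Collect_eq)
  then show ?thesis unfolding tri_gen1_def add_closure_def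
    using direct_sum_single[OF assms(2)] summand_refl[OF assms(2)]
    by (intro CollectI exI[of _ "[X]"] exI[of _ X]) simp
qed

text \<open>From level one on, every level is an additive closure, which is how invariance under
  quasi-isomorphism passes to all of them at once.\<close>

lemma tri_gen_Suc_closure: "\<exists>J. tri_gen D I (Suc k) = add_closure D J"
  by (cases k) (auto simp: tri_gen1_def tri_diamond_def)

lemma tri_gen_qi: "qarr X Y q \<Longrightarrow> X \<in> tri_gen D I (Suc k) \<longleftrightarrow> Y \<in> tri_gen D I (Suc k)"
  using tri_gen_Suc_closure[of I k] add_closure_qi by metis

lemma tri_gen_Ob: "X \<in> tri_gen D I (Suc k) \<Longrightarrow> X \<in> bcpx L"
  using tri_gen_Suc_closure[of I k] add_closure_Ob by blast

text \<open>In the triangle A -> X -> cone the generated part stands on the left and the single new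
  factor on the right, the order that \<open>tri_gen\<close> prescribes.\<close>

lemma tri_gen_cone:
  assumes \<phi>: "arr A X \<phi>" and A: "A \<in> tri_gen D I (Suc k)" and C: "cone A X \<phi> \<in> tri_gen D I (Suc 0)"
  shows "X \<in> tri_gen D I (Suc (Suc k))"
proof -
  have "X \<in> tri_star D (tri_gen D I (Suc k)) (tri_gen1 D I)"
    unfolding tri_star_def
    by (intro CollectI bexI[OF _ A] bexI[OF _ C[unfolded tri_gen.simps]] exI) (rule cone_triangle[OF \<phi>])
  then show ?thesis using tri_gen1_base arr_objs(2)[OF \<phi>] by (simp add: tri_diamond_def)
qed

section \<open>Maps of twisted sums\<close>

text \<open>A triangular matrix with diagonal entries f, g and off-diagonal entry H. The equation
  \<open>e\<close> says that H is a homotopy in the square formed by the two twists.\<close>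

lemma tw_map:
  assumes al: "\<alpha> \<in> twists A B" and be: "\<beta> \<in> twists A' B'"
    and f: "f \<in> chain_maps L A A'" and g: "g \<in> chain_maps L B B'"
    and A [simp]: "A \<in> bcpx L" and B [simp]: "B \<in> bcpx L" and A' [simp]: "A' \<in> bcpx L" and B' [simp]: "B' \<in> bcpx L"
    and H: "\<And>i. H i \<in> rhom L (Deg A i) (Deg B' i)"
    and e: "\<And>i x. x \<in> carrier (Deg A i) \<Longrightarrow>
      g (i + 1) (\<alpha> i x) \<oplus>\<^bsub>Deg B' (i + 1)\<^esub> H (i + 1) (Dif A i x) =
      \<beta> i (f i x) \<oplus>\<^bsub>Deg B' (i + 1)\<^esub> Dif B' i (H i x)"
    and c: "c = (\<lambda>i. \<lambda>z\<in>carrier (mod_sum (Deg A i) (Deg B i)).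
      spair (f i (sfst z)) (g i (ssnd z) \<oplus>\<^bsub>Deg B' i\<^esub> H i (sfst z)))"
  shows "arr (tw A B \<alpha>) (tw A' B' \<beta>) c"
proof -
  note [simp] = twist(2-)[OF al A B] twist(2-)[OF be A' B'] chmap[OF f A A'] chmap[OF g B B'] rhom_simps[OF H] rhom_group[OF H bcpx_fg[OF A] bcpx_fg[OF B']]
  have [simp]: "tw A B \<alpha> \<in> bcpx L" "tw A' B' \<beta> \<in> bcpx L" using al be by simp_all
  have "c \<in> chain_maps L (tw A B \<alpha>) (tw A' B' \<beta>)"
  proof (rule chain_mapsI)
    show "c i \<in> rhom L (Deg (tw A B \<alpha>) i) (Deg (tw A' B' \<beta>) i)" for i
      unfolding c tw_Deg by (rule rhomI) (simp_all add: agn fg_smult_add)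
    fix i z assume "z \<in> carrier (Deg (tw A B \<alpha>) i)"
    then have z [simp]: "sfst z \<in> carrier (Deg A i)" "ssnd z \<in> carrier (Deg B i)" by simp_all
    have "g (i + 1) (\<alpha> i (sfst z)) \<oplus>\<^bsub>Deg B' (i + 1)\<^esub> Dif B' i (g i (ssnd z)) \<oplus>\<^bsub>Deg B' (i + 1)\<^esub> H (i + 1) (Dif A i (sfst z)) =
       (g (i + 1) (\<alpha> i (sfst z)) \<oplus>\<^bsub>Deg B' (i + 1)\<^esub> H (i + 1) (Dif A i (sfst z))) \<oplus>\<^bsub>Deg B' (i + 1)\<^esub> Dif B' i (g i (ssnd z))"
      by (simp add: agn)
    then show "c (i + 1) (Dif (tw A B \<alpha>) i z) = Dif (tw A' B' \<beta>) i (c i z)"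
      unfolding c by (simp add: e difs) (simp add: agn)
  qed
  then show ?thesis by (simp add: arr_def)
qed

text \<open>The five lemma for the long exact cohomology sequences of the two extensions, carried
  out as a chase.\<close>

lemma tw_map_qi:
  assumes al: "\<alpha> \<in> twists A B" and be: "\<beta> \<in> twists A' B'"
    and f: "f \<in> quasi_isos L A A'" and g: "g \<in> quasi_isos L B B'"
    and A [simp]: "A \<in> bcpx L" and B [simp]: "B \<in> bcpx L" and A' [simp]: "A' \<in> bcpx L" and B' [simp]: "B' \<in> bcpx L"
    and H: "\<And>i. H i \<in> rhom L (Deg A i) (Deg B' i)"
    and e: "\<And>i x. x \<in> carrier (Deg A i) \<Longrightarrow>
      g (i + 1) (\<alpha> i x) \<oplus>\<^bsub>Deg B' (i + 1)\<^esub> H (i + 1) (Dif A i x) =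
      \<beta> i (f i x) \<oplus>\<^bsub>Deg B' (i + 1)\<^esub> Dif B' i (H i x)"
    and c: "c = (\<lambda>i. \<lambda>z\<in>carrier (mod_sum (Deg A i) (Deg B i)).
      spair (f i (sfst z)) (g i (ssnd z) \<oplus>\<^bsub>Deg B' i\<^esub> H i (sfst z)))"
  shows "qarr (tw A B \<alpha>) (tw A' B' \<beta>) c"
proof -
  note [simp] = twist(2-)[OF al A B] twist(2-)[OF be A' B'] chmap[OF qi_chain[OF f] A A'] chmap[OF qi_chain[OF g] B B']
    rhom_simps[OF H] rhom_group[OF H bcpx_fg[OF A] bcpx_fg[OF B']]
  let ?X = "tw A B \<alpha>" and ?Y = "tw A' B' \<beta>"
  have X [simp]: "?X \<in> bcpx L" and Y [simp]: "?Y \<in> bcpx L" using al be by simp_all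
  have carr: "arr ?X ?Y c" by (rule tw_map[OF al be qi_chain[OF f] qi_chain[OF g] A B A' B' H e c])
  then have cc: "c \<in> chain_maps L ?X ?Y" by (simp add: arr_def)
  have ca [simp]: "c i z = spair (f i (sfst z)) (g i (ssnd z) \<oplus>\<^bsub>Deg B' i\<^esub> H i (sfst z))"
    if "sfst z \<in> carrier (Deg A i)" "ssnd z \<in> carrier (Deg B i)" for i z using that by (simp add: c)
  \<comment> \<open>Injectivity is shown first for classes coming from the subcomplex B; the general
    case is reduced to this one by subtracting a boundary.\<close>
  have inj0: "spair \<zero>\<^bsub>Deg A i\<^esub> y \<in> boundaries ?X i"
    if y: "y \<in> cycles B i" and b: "spair \<zero>\<^bsub>Deg A' i\<^esub> (g i y) \<in> boundaries ?Y i" for i y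
  proof -
    have yc [simp]: "y \<in> carrier (Deg B i)" using y by simp
    obtain u v where uv [simp]: "u \<in> carrier (Deg A' (i - 1))" "v \<in> carrier (Deg B' (i - 1))"
      and eq: "Dif A' (i - 1) u = \<zero>\<^bsub>Deg A' i\<^esub>" "g i y = \<beta> (i - 1) u \<oplus>\<^bsub>Deg B' i\<^esub> Dif B' (i - 1) v"
    proof -
      obtain z where z: "z \<in> carrier (Deg ?Y (i - 1))" "spair \<zero>\<^bsub>Deg A' i\<^esub> (g i y) = Dif ?Y (i - 1) z"
        using b by (rule boundariesE)
      then show ?thesis using that[of "sfst z" "ssnd z"] by simp
    qed
    have "u \<in> cycles A' (i - 1)" using eq uv by (simp del: cycles_carrier add: cycles_iff)
    then obtain x where x: "x \<in> cycles A (i - 1)" "u \<ominus>\<^bsub>Deg A' (i - 1)\<^esub> f (i - 1) x \<in> boundaries A' (i - 1)" by (rule qi_surj[OF f])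
    have xc [simp]: "x \<in> carrier (Deg A (i - 1))" and dx: "Dif A (i - 1) x = \<zero>\<^bsub>Deg A i\<^esub>" using x(1) cyclesD[OF x(1)] by simp_all
    obtain w where w: "w \<in> carrier (Deg A' (i - 1 - 1))" "u \<ominus>\<^bsub>Deg A' (i - 1)\<^esub> f (i - 1) x = Dif A' (i - 1 - 1) w"
      using x(2) by (rule boundariesE)
    have w1 [simp]: "w \<in> carrier (Deg A' (i - 2))" using w by simp
    have w2: "u \<ominus>\<^bsub>Deg A' (i - 1)\<^esub> f (i - 1) x = Dif A' (i - 2) w" using w(2) by simp
    have u: "u = f (i - 1) x \<oplus>\<^bsub>Deg A' (i - 1)\<^esub> Dif A' (i - 2) w"
      by (simp add: agn flip: w2)
    have bw: "\<beta> (i - 1) (Dif A' (i - 2) w) = \<ominus>\<^bsub>Deg B' i\<^esub> Dif B' (i - 1) (\<beta> (i - 2) w)"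
      using twist(3)[OF be A' B', of w "i - 2" "i - 1"] by simp
    have ex: "g i (\<alpha> (i - 1) x) = \<beta> (i - 1) (f (i - 1) x) \<oplus>\<^bsub>Deg B' i\<^esub> Dif B' (i - 1) (H (i - 1) x)"
      using e[OF xc] dx by simp
    have buf: "\<beta> (i - 1) u = \<beta> (i - 1) (f (i - 1) x) \<oplus>\<^bsub>Deg B' i\<^esub> \<ominus>\<^bsub>Deg B' i\<^esub> Dif B' (i - 1) (\<beta> (i - 2) w)"
      using twist(4)[OF be A' B', of "f (i - 1) x" "i - 1" "Dif A' (i - 2) w"] unfolding u by (simp add: bw)
    let ?r = "v \<ominus>\<^bsub>Deg B' (i - 1)\<^esub> \<beta> (i - 2) w \<ominus>\<^bsub>Deg B' (i - 1)\<^esub> H (i - 1) x"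
    have "g i (y \<ominus>\<^bsub>Deg B i\<^esub> \<alpha> (i - 1) x) = Dif B' (i - 1) ?r"
      using dif_minus[OF B', of "v \<ominus>\<^bsub>Deg B' (i - 1)\<^esub> \<beta> (i - 2) w" "i - 1" "H (i - 1) x"] dif_minus[OF B', of v "i - 1" "\<beta> (i - 2) w"]
      by (simp add: eq(2) buf ex) (simp add: agn)
    then have "g i (y \<ominus>\<^bsub>Deg B i\<^esub> \<alpha> (i - 1) x) \<in> boundaries B' i" using boundariesI[of ?r B' "i - 1" i] by simp
    moreover have "\<ominus>\<^bsub>Deg B (i + 1)\<^esub> Dif B i (\<alpha> (i - 1) x) = \<zero>\<^bsub>Deg B (i + 1)\<^esub>"
      using twist(3)[OF al A B xc, of i, symmetric] unfolding dx by simp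
    then have "Dif B i (\<alpha> (i - 1) x) = \<zero>\<^bsub>Deg B (i + 1)\<^esub>" by simp
    then have "y \<ominus>\<^bsub>Deg B i\<^esub> \<alpha> (i - 1) x \<in> cycles B i"
      using cyclesD[OF y] by (simp del: cycles_carrier add: cycles_iff difs)
    ultimately have "y \<ominus>\<^bsub>Deg B i\<^esub> \<alpha> (i - 1) x \<in> boundaries B i" using qi_inj[OF g] by blast
    then obtain t where t [simp]: "t \<in> carrier (Deg B (i - 1))" and ty: "y \<ominus>\<^bsub>Deg B i\<^esub> \<alpha> (i - 1) x = Dif B (i - 1) t"
      by (rule boundariesE)
    have "y = \<alpha> (i - 1) x \<oplus>\<^bsub>Deg B i\<^esub> Dif B (i - 1) t" by (simp add: agn flip: ty)
    then have "spair \<zero>\<^bsub>Deg A i\<^esub> y = Dif ?X (i - 1) (spair x t)" using dx by simp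
    then show ?thesis using boundariesI[of "spair x t" ?X "i - 1" i] by simp
  qed
  have "c \<in> quasi_isos L ?X ?Y"
  proof (rule qiI[OF cc])
    fix i z assume z: "z \<in> cycles ?X i" "c i z \<in> boundaries ?Y i"
    have zc [simp]: "sfst z \<in> carrier (Deg A i)" "ssnd z \<in> carrier (Deg B i)" using cycles_carrier[OF z(1)] by simp_all
    obtain q where q: "q \<in> carrier (Deg ?Y (i - 1))" "c i z = Dif ?Y (i - 1) q" using z(2) by (rule boundariesE)
    have "f i (sfst z) = Dif A' (i - 1) (sfst q)" using q by simp
    then have "f i (sfst z) \<in> boundaries A' i" using boundariesI[of "sfst q" A' "i - 1" i] q(1) by simp
    moreover have "sfst z \<in> cycles A i" using cyclesD[OF z(1)] by (simp del: cycles_carrier add: cycles_iff)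
    ultimately have "sfst z \<in> boundaries A i" using qi_inj[OF f] by blast
    then obtain x where x [simp]: "x \<in> carrier (Deg A (i - 1))" and xz: "sfst z = Dif A (i - 1) x" by (rule boundariesE)
    \<comment> \<open>The first component of z is already known to be a boundary d x. Subtracting
      the boundary of (x, 0) moves z into B, where \<open>inj0\<close> applies.\<close>
    let ?b = "Dif ?X (i - 1) (spair x \<zero>\<^bsub>Deg B (i - 1)\<^esub>)"
    have b: "?b \<in> boundaries ?X i" using boundariesI[of "spair x \<zero>\<^bsub>Deg B (i - 1)\<^esub>" ?X "i - 1" i] by simp
    let ?y = "ssnd z \<ominus>\<^bsub>Deg B i\<^esub> \<alpha> (i - 1) x"
    have dz: "z \<ominus>\<^bsub>Deg ?X i\<^esub> ?b = spair \<zero>\<^bsub>Deg A i\<^esub> ?y" using dif_zero[OF B, of "i - 1"] by (simp add: xz)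
    have cyc: "z \<ominus>\<^bsub>Deg ?X i\<^esub> ?b \<in> cycles ?X i" by (rule cycles_minus[OF X z(1) boundaries_cycles[OF X b]])
    have y: "?y \<in> cycles B i" using cyclesD[OF cyc] unfolding dz by (simp del: cycles_carrier add: cycles_iff)
    have "c i (z \<ominus>\<^bsub>Deg ?X i\<^esub> ?b) \<in> boundaries ?Y i"
      using boundaries_minus[OF Y z(2) chain_boundaries[OF cc X Y b]] chmap(7)[OF cc X Y cycles_carrier[OF z(1)] boundaries_carrier[OF X b]]
      by (simp del: ca tw_Deg tw_Dif)
    then have "spair \<zero>\<^bsub>Deg A' i\<^esub> (g i ?y) \<in> boundaries ?Y i" unfolding dz by simp
    from inj0[OF y this] have "(z \<ominus>\<^bsub>Deg ?X i\<^esub> ?b) \<oplus>\<^bsub>Deg ?X i\<^esub> ?b \<in> boundaries ?X i"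
      using boundaries_add[OF X _ b] unfolding dz by blast
    moreover have "(z \<ominus>\<^bsub>Deg ?X i\<^esub> ?b) \<oplus>\<^bsub>Deg ?X i\<^esub> ?b = z"
      using cycles_carrier[OF z(1)] boundaries_carrier[OF X b] fg_r_neg1 bcpx_fg[OF X]
      by (simp add: agn del: tw_Deg tw_Dif)
    ultimately show "z \<in> boundaries ?X i" by simp
  next
    fix i z assume z: "z \<in> cycles ?Y i"
    let ?s = "sfst z" and ?t = "ssnd z"
    have zc [simp]: "?s \<in> carrier (Deg A' i)" "?t \<in> carrier (Deg B' i)" using cycles_carrier[OF z(1)] by simp_all
    have dz: "Dif A' i ?s = \<zero>\<^bsub>Deg A' (i + 1)\<^esub>" "\<beta> i ?s \<oplus>\<^bsub>Deg B' (i + 1)\<^esub> Dif B' i ?t = \<zero>\<^bsub>Deg B' (i + 1)\<^esub>"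
      using cyclesD[OF z] by simp_all
    have "?s \<in> cycles A' i" using dz by (simp del: cycles_carrier add: cycles_iff)
    then obtain x where x: "x \<in> cycles A i" "?s \<ominus>\<^bsub>Deg A' i\<^esub> f i x \<in> boundaries A' i" by (rule qi_surj[OF f])
    have xc [simp]: "x \<in> carrier (Deg A i)" and dx: "Dif A i x = \<zero>\<^bsub>Deg A (i + 1)\<^esub>" using x(1) cyclesD[OF x(1)] by simp_all
    obtain w where w [simp]: "w \<in> carrier (Deg A' (i - 1))" and ws: "?s \<ominus>\<^bsub>Deg A' i\<^esub> f i x = Dif A' (i - 1) w"
      using x(2) by (rule boundariesE)
    have s: "?s = f i x \<oplus>\<^bsub>Deg A' i\<^esub> Dif A' (i - 1) w" by (simp add: agn flip: ws)
    have bs: "\<beta> i ?s = \<beta> i (f i x) \<oplus>\<^bsub>Deg B' (i + 1)\<^esub> \<ominus>\<^bsub>Deg B' (i + 1)\<^esub> Dif B' i (\<beta> (i - 1) w)"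
      using twist(4)[OF be A' B', of "f i x" i "Dif A' (i - 1) w"] unfolding s by simp
    have ex: "g (i + 1) (\<alpha> i x) = \<beta> i (f i x) \<oplus>\<^bsub>Deg B' (i + 1)\<^esub> Dif B' i (H i x)"
      using e[OF xc] dx by simp
    \<comment> \<open>The cycle x lifting the first component extends to a cycle of
      \<open>?X\<close> only if \<alpha> x is a boundary. As g detects boundaries, it is enough that
      g (\<alpha> x) is the differential of \<open>?r\<close>.\<close>
    let ?r = "H i x \<ominus>\<^bsub>Deg B' i\<^esub> ?t \<oplus>\<^bsub>Deg B' i\<^esub> \<beta> (i - 1) w"
    have "g (i + 1) (\<alpha> i x) = Dif B' i ?r \<oplus>\<^bsub>Deg B' (i + 1)\<^esub> (\<beta> i ?s \<oplus>\<^bsub>Deg B' (i + 1)\<^esub> Dif B' i ?t)"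
      unfolding ex bs by (simp add: difs) (simp add: agn)
    also have "\<dots> = Dif B' i ?r" by (simp add: dz(2))
    finally have "g (i + 1) (\<alpha> i x) \<in> boundaries B' (i + 1)" using boundariesI[of ?r B' i "i + 1"] by simp
    moreover have "\<ominus>\<^bsub>Deg B (i + 2)\<^esub> Dif B (i + 1) (\<alpha> i x) = \<zero>\<^bsub>Deg B (i + 2)\<^esub>"
      using twist(3)[OF al A B xc, of "i + 1", symmetric] unfolding dx by simp
    then have "\<alpha> i x \<in> cycles B (i + 1)" by (simp del: cycles_carrier add: cycles_iff)
    ultimately have "\<alpha> i x \<in> boundaries B (i + 1)" using qi_inj[OF g] by blast
    then obtain y where y [simp]: "y \<in> carrier (Deg B i)" and yx: "\<alpha> i x = Dif B i y" by (auto elim: boundariesE)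
    let ?p = "spair x (\<ominus>\<^bsub>Deg B i\<^esub> y)"
    have p: "?p \<in> cycles ?X i" using dx by (simp del: cycles_carrier add: cycles_iff yx difs fg_r_neg)
    let ?b = "Dif ?Y (i - 1) (spair w \<zero>\<^bsub>Deg B' (i - 1)\<^esub>)"
    have b: "?b \<in> boundaries ?Y i" using boundariesI[of "spair w \<zero>\<^bsub>Deg B' (i - 1)\<^esub>" ?Y "i - 1" i] by simp
    have cp: "c i ?p \<in> cycles ?Y i" by (rule chain_cycles[OF cc X Y p])
    let ?d = "z \<ominus>\<^bsub>Deg ?Y i\<^esub> c i ?p \<ominus>\<^bsub>Deg ?Y i\<^esub> ?b"
    have dcyc: "?d \<in> cycles ?Y i" by (intro cycles_minus[OF Y] z cp boundaries_cycles[OF Y b])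
    \<comment> \<open>After the corrections by \<open>?p\<close> and \<open>?b\<close> the
      difference lies in the subcomplex B'. Its component k there is removed by surjectivity of g in
      cohomology.\<close>
    define k where "k = ?t \<ominus>\<^bsub>Deg B' i\<^esub> (g i (\<ominus>\<^bsub>Deg B i\<^esub> y) \<oplus>\<^bsub>Deg B' i\<^esub> H i x) \<ominus>\<^bsub>Deg B' i\<^esub> \<beta> (i - 1) w"
    have kc [simp]: "k \<in> carrier (Deg B' i)" by (simp add: k_def)
    have de: "?d = spair \<zero>\<^bsub>Deg A' i\<^esub> k"
      using dif_zero[OF B', of "i - 1"] by (simp add: k_def s del: chmap(6)) (simp add: agn)
    have "k \<in> cycles B' i" using cyclesD[OF dcyc] unfolding de by (simp del: cycles_carrier add: cycles_iff)
    then obtain l where l: "l \<in> cycles B i" "k \<ominus>\<^bsub>Deg B' i\<^esub> g i l \<in> boundaries B' i" by (rule qi_surj[OF g])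
    have lc [simp]: "l \<in> carrier (Deg B i)" using l by simp
    obtain m where m [simp]: "m \<in> carrier (Deg B' (i - 1))" and mk: "k \<ominus>\<^bsub>Deg B' i\<^esub> g i l = Dif B' (i - 1) m"
      using l(2) by (rule boundariesE)
    let ?l = "spair \<zero>\<^bsub>Deg A i\<^esub> l"
    have lcyc: "?l \<in> cycles ?X i" using cyclesD[OF l(1)] by (simp del: cycles_carrier add: cycles_iff)
    have cl: "c i ?l = spair \<zero>\<^bsub>Deg A' i\<^esub> (g i l)" by simp
    have "?d \<ominus>\<^bsub>Deg ?Y i\<^esub> c i ?l = spair \<zero>\<^bsub>Deg A' i\<^esub> (k \<ominus>\<^bsub>Deg B' i\<^esub> g i l)" unfolding de cl by simp
    also have "\<dots> = Dif ?Y (i - 1) (spair \<zero>\<^bsub>Deg A' (i - 1)\<^esub> m)"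
      using dif_zero[OF A', of "i - 1"] twist(6)[OF be A' B', of "i - 1"] by (simp add: mk)
    finally have "?d \<ominus>\<^bsub>Deg ?Y i\<^esub> c i ?l \<in> boundaries ?Y i"
      using boundariesI[of "spair \<zero>\<^bsub>Deg A' (i - 1)\<^esub> m" ?Y "i - 1" i] by simp
    from boundaries_add[OF Y this b] have "(?d \<ominus>\<^bsub>Deg ?Y i\<^esub> c i ?l) \<oplus>\<^bsub>Deg ?Y i\<^esub> ?b \<in> boundaries ?Y i" .
    moreover have "(?d \<ominus>\<^bsub>Deg ?Y i\<^esub> c i ?l) \<oplus>\<^bsub>Deg ?Y i\<^esub> ?b = z \<ominus>\<^bsub>Deg ?Y i\<^esub> c i (?p \<oplus>\<^bsub>Deg ?X i\<^esub> ?l)"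
    proof -
      have cs: "z \<in> carrier (Deg ?Y i)" "c i ?p \<in> carrier (Deg ?Y i)" "c i ?l \<in> carrier (Deg ?Y i)" "?b \<in> carrier (Deg ?Y i)"
        using z cp chain_cycles[OF cc X Y lcyc] boundaries_carrier[OF Y b] cycles_carrier by blast+
      have "c i (?p \<oplus>\<^bsub>Deg ?X i\<^esub> ?l) = c i ?p \<oplus>\<^bsub>Deg ?Y i\<^esub> c i ?l"
        by (rule chmap(3)[OF cc X Y cycles_carrier[OF p] cycles_carrier[OF lcyc]])
      then show ?thesis using cs bcpx_fg[OF Y, of i] by (simp add: agn del: ca tw_Deg tw_Dif mod_sum_simps mod_sum_neg mod_sum_minus)
    qed
    ultimately show "\<exists>x\<in>cycles ?X i. z \<ominus>\<^bsub>Deg ?Y i\<^esub> c i x \<in> boundaries ?Y i"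
      using cycles_add[OF X p lcyc] by (intro bexI[of _ "?p \<oplus>\<^bsub>Deg ?X i\<^esub> ?l"]) simp_all
  qed
  then show ?thesis by (simp add: qarr_def)
qed

section \<open>Short exact sequences of complexes\<close>

definition ses :: "'a cpx \<Rightarrow> 'a cpx \<Rightarrow> 'a cpx \<Rightarrow> 'a cmap \<Rightarrow> 'a cmap \<Rightarrow> bool" where
  "ses K P X \<iota> \<pi> \<longleftrightarrow> arr K P \<iota> \<and> arr P X \<pi> \<and>
     (\<forall>i. \<forall>x\<in>carrier (Deg K i). \<iota> i x = \<zero>\<^bsub>Deg P i\<^esub> \<longrightarrow> x = \<zero>\<^bsub>Deg K i\<^esub>) \<and>
     (\<forall>i. \<forall>x\<in>carrier (Deg K i). \<pi> i (\<iota> i x) = \<zero>\<^bsub>Deg X i\<^esub>) \<and>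
     (\<forall>i. \<forall>y\<in>carrier (Deg P i). \<pi> i y = \<zero>\<^bsub>Deg X i\<^esub> \<longrightarrow> (\<exists>x\<in>carrier (Deg K i). y = \<iota> i x)) \<and>
     (\<forall>i. \<forall>z\<in>carrier (Deg X i). \<exists>y\<in>carrier (Deg P i). z = \<pi> i y)"

lemma sesE:
  assumes "ses K P X \<iota> \<pi>"
  shows "K \<in> bcpx L" "P \<in> bcpx L" "X \<in> bcpx L" "\<iota> \<in> chain_maps L K P" "\<pi> \<in> chain_maps L P X"
    and "\<And>i x. x \<in> carrier (Deg K i) \<Longrightarrow> \<iota> i x = \<zero>\<^bsub>Deg P i\<^esub> \<Longrightarrow> x = \<zero>\<^bsub>Deg K i\<^esub>"
    and "\<And>i x. x \<in> carrier (Deg K i) \<Longrightarrow> \<pi> i (\<iota> i x) = \<zero>\<^bsub>Deg X i\<^esub>"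
    and "\<And>i y. y \<in> carrier (Deg P i) \<Longrightarrow> \<pi> i y = \<zero>\<^bsub>Deg X i\<^esub> \<Longrightarrow> \<exists>x\<in>carrier (Deg K i). y = \<iota> i x"
    and "\<And>i z. z \<in> carrier (Deg X i) \<Longrightarrow> \<exists>y\<in>carrier (Deg P i). z = \<pi> i y"
  using assms by (auto simp: ses_def arr_def)

lemma ses_eqI:
  assumes s: "ses K P X \<iota> \<pi>" and "x \<in> carrier (Deg K i)" "y \<in> carrier (Deg K i)" "\<iota> i x = \<iota> i y"
  shows "x = y"
proof -
  note E = sesE[OF s]
  have "\<iota> i (x \<ominus>\<^bsub>Deg K i\<^esub> y) = \<zero>\<^bsub>Deg P i\<^esub>"
    using assms chmap(1,7)[OF E(4,1,2)] E(1,2) by simp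
  then have "x \<ominus>\<^bsub>Deg K i\<^esub> y = \<zero>\<^bsub>Deg K i\<^esub>" using E(1) assms by (intro E(6)) simp_all
  then show ?thesis using assms fg_minus_eq_zero[OF bcpx_fg[OF E(1)]] by blast
qed

text \<open>The cone of an epimorphism is its shifted kernel up to quasi-isomorphism; the map sends
  k to (\<iota> k, 0).\<close>

lemma ses_shift_cone_qi:
  assumes s: "ses K P X \<iota> \<pi>"
  shows "\<exists>q. qarr (cshift 1 K) (cone P X \<pi>) q"
proof -
  note E = sesE[OF s]
  have K [simp]: "K \<in> bcpx L" and P [simp]: "P \<in> bcpx L" and X [simp]: "X \<in> bcpx L" using E by simp_all
  note I = chmap[OF E(4) K P] and Q = chmap[OF E(5) P X]
  note [simp] = I Q
  define C where "C = cone P X \<pi>"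
  have C [simp]: "C \<in> bcpx L" using E by (simp add: C_def)
  have CD [simp]: "Deg C i = mod_sum (Deg P (i + 1)) (Deg X i)" for i by (simp add: C_def cone_tw)
  have Cd [simp]: "Dif C i z = spair (\<ominus>\<^bsub>Deg P (i + 2)\<^esub> Dif P (i + 1) (sfst z)) (\<pi> (i + 1) (sfst z) \<oplus>\<^bsub>Deg X (i + 1)\<^esub> Dif X i (ssnd z))"
    if "sfst z \<in> carrier (Deg P (i + 1))" "ssnd z \<in> carrier (Deg X i)" for i z
    using that by (simp add: C_def cone_tw cshift_Dif)
  define q where "q = (\<lambda>i. \<lambda>k\<in>carrier (Deg K (i + 1)). spair (\<iota> (i + 1) k) \<zero>\<^bsub>Deg X i\<^esub>)"
  have qa [simp]: "q i k = spair (\<iota> (i + 1) k) \<zero>\<^bsub>Deg X i\<^esub>" if "k \<in> carrier (Deg K (i + 1))" for i k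
    using that by (simp add: q_def)
  have qc: "q \<in> chain_maps L (cshift 1 K) C"
  proof (rule chain_mapsI)
    show "q i \<in> rhom L (Deg (cshift 1 K) i) (Deg C i)" for i
      unfolding q_def cshift_Deg by (rule rhomI) simp_all
  qed (simp add: cshift_Dif E(7))
  have "q \<in> quasi_isos L (cshift 1 K) C"
  proof (rule qiI[OF qc])
    fix i k assume k: "k \<in> cycles (cshift 1 K) i" "q i k \<in> boundaries C i"
    have kc [simp]: "k \<in> carrier (Deg K (i + 1))" using k(1) by simp
    obtain z where z: "z \<in> carrier (Deg C (i - 1))" "q i k = Dif C (i - 1) z" using k(2) by (rule boundariesE)
    let ?y = "sfst z" and ?x = "ssnd z"
    have yx [simp]: "?y \<in> carrier (Deg P i)" "?x \<in> carrier (Deg X (i - 1))" using z(1) by simp_all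
    have e: "\<iota> (i + 1) k = \<ominus>\<^bsub>Deg P (i + 1)\<^esub> Dif P i ?y" "\<pi> i ?y \<oplus>\<^bsub>Deg X i\<^esub> Dif X (i - 1) ?x = \<zero>\<^bsub>Deg X i\<^esub>" using z(2) by simp_all
    obtain y' where y' [simp]: "y' \<in> carrier (Deg P (i - 1))" and px: "?x = \<pi> (i - 1) y'" using E(9)[OF yx(2)] by blast
    \<comment> \<open>With y' a lift of the second component, adding d y' moves the first one into
      the kernel of \<pi>.\<close>
    let ?u = "?y \<oplus>\<^bsub>Deg P i\<^esub> Dif P (i - 1) y'"
    have "\<pi> i ?u = \<zero>\<^bsub>Deg X i\<^esub>" using e(2) Q(2)[OF y', of i] by (simp add: px)
    then obtain k' where k' [simp]: "k' \<in> carrier (Deg K i)" and u: "?u = \<iota> i k'" using E(8)[of ?u i] by auto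
    have "Dif P i ?u = Dif P i ?y" by (simp add: dif_add)
    then have "\<iota> (i + 1) k = \<iota> (i + 1) (\<ominus>\<^bsub>Deg K (i + 1)\<^esub> Dif K i k')" by (simp add: e(1) u)
    from ses_eqI[OF s kc _ this] have "k = \<ominus>\<^bsub>Deg K (i + 1)\<^esub> Dif K i k'" by simp
    then have "k = Dif K i (\<ominus>\<^bsub>Deg K i\<^esub> k')" by (simp add: dif_neg)
    then show "k \<in> boundaries (cshift 1 K) i" by (simp add: boundariesI)
  next
    fix i z assume z: "z \<in> cycles C i"
    let ?y = "sfst z" and ?x = "ssnd z"
    have yx [simp]: "?y \<in> carrier (Deg P (i + 1))" "?x \<in> carrier (Deg X i)" using cycles_carrier[OF z] by simp_all
    have e: "Dif P (i + 1) ?y = \<zero>\<^bsub>Deg P (i + 2)\<^esub>" "\<pi> (i + 1) ?y \<oplus>\<^bsub>Deg X (i + 1)\<^esub> Dif X i ?x = \<zero>\<^bsub>Deg X (i + 1)\<^esub>"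
      using cyclesD[OF z] by simp_all
    obtain y' where y' [simp]: "y' \<in> carrier (Deg P i)" and px: "?x = \<pi> i y'" using E(9)[OF yx(2)] by blast
    let ?u = "?y \<oplus>\<^bsub>Deg P (i + 1)\<^esub> Dif P i y'"
    have "\<pi> (i + 1) ?u = \<zero>\<^bsub>Deg X (i + 1)\<^esub>" using e(2) by (simp add: px)
    then obtain k where k [simp]: "k \<in> carrier (Deg K (i + 1))" and u: "?u = \<iota> (i + 1) k" using E(8)[of ?u "i + 1"] by auto
    have "\<iota> (i + 2) (Dif K (i + 1) k) = Dif P (i + 1) ?u" by (simp add: u)
    also have "\<dots> = \<zero>\<^bsub>Deg P (i + 2)\<^esub>" using e(1) dif_add[OF P yx(1), of "Dif P i y'"] by simp
    finally have "Dif K (i + 1) k = \<zero>\<^bsub>Deg K (i + 2)\<^esub>" by (intro E(6)) simp_all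
    then have kc: "k \<in> cycles (cshift 1 K) i" by (simp del: cycles_carrier add: cycles_iff)
    have "z \<ominus>\<^bsub>Deg C i\<^esub> q i k = Dif C (i - 1) (spair y' \<zero>\<^bsub>Deg X (i - 1)\<^esub>)"
      using dif_zero[OF X, of "i - 1"] by (simp add: u[symmetric] px) (simp add: agn)
    then show "\<exists>x\<in>cycles (cshift 1 K) i. z \<ominus>\<^bsub>Deg C i\<^esub> q i x \<in> boundaries C i"
      using kc boundariesI[of "spair y' \<zero>\<^bsub>Deg X (i - 1)\<^esub>" C "i - 1" i] by (intro bexI[of _ k]) simp_all
  qed
  then show ?thesis unfolding C_def[symmetric] by (intro exI[of _ q]) (simp add: qarr_def)
qed

text \<open>The long exact sequence with acyclic kernel: elements are lifted along \<pi>, and the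
  error, a cycle of K, is the differential of an element of K.\<close>

lemma ses_acyclic_qi:
  assumes s: "ses K P X \<iota> \<pi>" and a: "acyclic K"
  shows "qarr P X \<pi>"
proof -
  note E = sesE[OF s]
  have K [simp]: "K \<in> bcpx L" and P [simp]: "P \<in> bcpx L" and X [simp]: "X \<in> bcpx L" using E by simp_all
  note I = chmap[OF E(4) K P] and Q = chmap[OF E(5) P X]
  note [simp] = I Q
  have "\<pi> \<in> quasi_isos L P X"
  proof (rule qiI[OF E(5)])
    fix i x assume x: "x \<in> cycles P i" "\<pi> i x \<in> boundaries X i"
    have xc [simp]: "x \<in> carrier (Deg P i)" and dx: "Dif P i x = \<zero>\<^bsub>Deg P (i + 1)\<^esub>" using x cyclesD[OF x(1)] by simp_all
    obtain n where n: "n \<in> carrier (Deg X (i - 1))" "\<pi> i x = Dif X (i - 1) n" using x(2) by (rule boundariesE)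
    obtain y where y [simp]: "y \<in> carrier (Deg P (i - 1))" and ny: "n = \<pi> (i - 1) y" using E(9)[OF n(1)] by blast
    have "\<pi> i (x \<ominus>\<^bsub>Deg P i\<^esub> Dif P (i - 1) y) = \<zero>\<^bsub>Deg X i\<^esub>" using n(2) Q(2)[OF y, of i] by (simp add: ny)
    then obtain k where k [simp]: "k \<in> carrier (Deg K i)" and xk: "x \<ominus>\<^bsub>Deg P i\<^esub> Dif P (i - 1) y = \<iota> i k"
      using E(8)[of "x \<ominus>\<^bsub>Deg P i\<^esub> Dif P (i - 1) y" i] by auto
    have "\<iota> (i + 1) (Dif K i k) = Dif P i (x \<ominus>\<^bsub>Deg P i\<^esub> Dif P (i - 1) y)" by (simp add: xk)
    also have "\<dots> = \<zero>\<^bsub>Deg P (i + 1)\<^esub>" by (simp add: dif_minus dx)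
    finally have "Dif K i k = \<zero>\<^bsub>Deg K (i + 1)\<^esub>" by (intro E(6)) simp_all
    from acyclicE[OF a k this] obtain l where l [simp]: "l \<in> carrier (Deg K (i - 1))" and kl: "k = Dif K (i - 1) l" by auto
    have "x = Dif P (i - 1) (y \<oplus>\<^bsub>Deg P (i - 1)\<^esub> \<iota> (i - 1) l)"
    proof -
      have "x = Dif P (i - 1) y \<oplus>\<^bsub>Deg P i\<^esub> \<iota> i k" unfolding xk[symmetric] by (simp add: agn)
      then show ?thesis using I(2)[OF l, of i] dif_add[OF P y, of "\<iota> (i - 1) l"] by (simp add: kl)
    qed
    then show "x \<in> boundaries P i" using boundariesI[of "y \<oplus>\<^bsub>Deg P (i - 1)\<^esub> \<iota> (i - 1) l" P "i - 1" i] by simp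
  next
    fix i n assume n: "n \<in> cycles X i"
    obtain x where x [simp]: "x \<in> carrier (Deg P i)" and nx: "n = \<pi> i x" using E(9)[OF cycles_carrier[OF n]] by blast
    have "\<pi> (i + 1) (Dif P i x) = \<zero>\<^bsub>Deg X (i + 1)\<^esub>" using cyclesD[OF n] by (simp add: nx)
    then obtain k where k [simp]: "k \<in> carrier (Deg K (i + 1))" and xk: "Dif P i x = \<iota> (i + 1) k" using E(8)[of "Dif P i x" "i + 1"] by auto
    have "\<iota> (i + 2) (Dif K (i + 1) k) = Dif P (i + 1) (Dif P i x)" by (simp add: xk del: dif_dif)
    also have "\<dots> = \<zero>\<^bsub>Deg P (i + 2)\<^esub>" by simp
    finally have "Dif K (i + 1) k = \<zero>\<^bsub>Deg K (i + 1 + 1)\<^esub>" by simp (intro E(6), simp_all)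
    from acyclicE[OF a k this] obtain l where "l \<in> carrier (Deg K (i + 1 - 1))" "k = Dif K (i + 1 - 1) l" by blast
    then have l [simp]: "l \<in> carrier (Deg K i)" and kl: "k = Dif K i l" by simp_all
    have "x \<ominus>\<^bsub>Deg P i\<^esub> \<iota> i l \<in> cycles P i"
      by (simp del: cycles_carrier add: cycles_iff dif_minus xk kl)
    moreover have "n \<ominus>\<^bsub>Deg X i\<^esub> \<pi> i (x \<ominus>\<^bsub>Deg P i\<^esub> \<iota> i l) = \<zero>\<^bsub>Deg X i\<^esub>" by (simp add: nx E(7))
    ultimately show "\<exists>x\<in>cycles P i. n \<ominus>\<^bsub>Deg X i\<^esub> \<pi> i x \<in> boundaries X i" by force
  qed
  then show ?thesis by (simp add: qarr_def)
qed

text \<open>Coning off S both in the subobject K and in P leaves the quotient X unchanged, so pieces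
  can be removed from K inside an extension.\<close>

lemma ses_cone:
  assumes s: "ses K P X \<iota> \<pi>" and p: "arr S K p"
  shows "\<exists>\<iota>' \<pi>'. ses (cone S K p) (cone S P (ccomp S \<iota> p)) X \<iota>' \<pi>'"
proof -
  note E = sesE[OF s]
  have K [simp]: "K \<in> bcpx L" and P [simp]: "P \<in> bcpx L" and X [simp]: "X \<in> bcpx L" and S [simp]: "S \<in> bcpx L"
    and pc: "p \<in> chain_maps L S K" using E p by (simp_all add: arr_def)
  have ipc: "ccomp S \<iota> p \<in> chain_maps L S P" using ccomp_chain[OF pc E(4)] by simp
  note I = chmap[OF E(4) K P] and Q = chmap[OF E(5) P X] and R = chmap[OF pc S K]
  note [simp] = I Q R
  define A where "A = cone S K p"
  define B where "B = cone S P (ccomp S \<iota> p)"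
  have A [simp]: "A \<in> bcpx L" and B [simp]: "B \<in> bcpx L" using pc ipc by (simp_all add: A_def B_def)
  have AD [simp]: "Deg A i = mod_sum (Deg S (i + 1)) (Deg K i)" and BD [simp]: "Deg B i = mod_sum (Deg S (i + 1)) (Deg P i)" for i
    by (simp_all add: A_def B_def cone_tw)
  have Ad [simp]: "Dif A i z = spair (\<ominus>\<^bsub>Deg S (i + 2)\<^esub> Dif S (i + 1) (sfst z)) (p (i + 1) (sfst z) \<oplus>\<^bsub>Deg K (i + 1)\<^esub> Dif K i (ssnd z))"
    if "sfst z \<in> carrier (Deg S (i + 1))" "ssnd z \<in> carrier (Deg K i)" for i z
    using that by (simp add: A_def cone_tw cshift_Dif)
  have Bd [simp]: "Dif B i z = spair (\<ominus>\<^bsub>Deg S (i + 2)\<^esub> Dif S (i + 1) (sfst z)) (\<iota> (i + 1) (p (i + 1) (sfst z)) \<oplus>\<^bsub>Deg P (i + 1)\<^esub> Dif P i (ssnd z))"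
    if "sfst z \<in> carrier (Deg S (i + 1))" "ssnd z \<in> carrier (Deg P i)" for i z
    using that by (simp add: B_def cone_tw cshift_Dif)
  define j where "j = (\<lambda>i. \<lambda>z\<in>carrier (Deg A i). spair (sfst z) (\<iota> i (ssnd z)))"
  define r where "r = (\<lambda>i. \<lambda>z\<in>carrier (Deg B i). \<pi> i (ssnd z))"
  have ja [simp]: "j i z = spair (sfst z) (\<iota> i (ssnd z))" if "sfst z \<in> carrier (Deg S (i + 1))" "ssnd z \<in> carrier (Deg K i)" for i z
    using that by (simp add: j_def)
  have ra [simp]: "r i z = \<pi> i (ssnd z)" if "sfst z \<in> carrier (Deg S (i + 1))" "ssnd z \<in> carrier (Deg P i)" for i z
    using that by (simp add: r_def)
  have "arr A B j" unfolding arr_def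
  proof (intro conjI chain_mapsI)
    show "j i \<in> rhom L (Deg A i) (Deg B i)" for i unfolding j_def by (rule rhomI) simp_all
  qed simp_all
  moreover have "arr B X r" unfolding arr_def
  proof (intro conjI chain_mapsI)
    show "r i \<in> rhom L (Deg B i) (Deg X i)" for i unfolding r_def by (rule rhomI) simp_all
  qed (simp_all add: E(7))
  moreover have "x = \<zero>\<^bsub>Deg A i\<^esub>" if "x \<in> carrier (Deg A i)" "j i x = \<zero>\<^bsub>Deg B i\<^esub>" for i x
  proof -
    have "sfst x = \<zero>\<^bsub>Deg S (i + 1)\<^esub>" "ssnd x = \<zero>\<^bsub>Deg K i\<^esub>" using that E(6)[of "ssnd x" i] by simp_all
    then show ?thesis using spair_simps(3)[of x] by simp
  qed
  moreover have "r i (j i x) = \<zero>\<^bsub>Deg X i\<^esub>" if "x \<in> carrier (Deg A i)" for i x using that E(7) by simp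
  moreover have "\<exists>x\<in>carrier (Deg A i). y = j i x" if y: "y \<in> carrier (Deg B i)" "r i y = \<zero>\<^bsub>Deg X i\<^esub>" for i y
  proof -
    obtain k where k: "k \<in> carrier (Deg K i)" "ssnd y = \<iota> i k" using E(8)[of "ssnd y" i] y by auto
    then have "y = j i (spair (sfst y) k)" using y spair_simps(3)[of y] by simp
    then show ?thesis using y k by (intro bexI[of _ "spair (sfst y) k"]) simp_all
  qed
  moreover have "\<exists>y\<in>carrier (Deg B i). z = r i y" if z: "z \<in> carrier (Deg X i)" for i z
  proof -
    obtain y where "y \<in> carrier (Deg P i)" "z = \<pi> i y" using E(9)[OF z] by blast
    then show ?thesis by (intro bexI[of _ "spair \<zero>\<^bsub>Deg S (i + 1)\<^esub> y"]) simp_all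
  qed
  ultimately have "ses A B X j r" unfolding ses_def by blast
  then show ?thesis unfolding A_def B_def by blast
qed

section \<open>Resolutions by successive cones\<close>

text \<open>m successive cones over maps from members of T make X acyclic. The triangles S -> X ->
  cone put each piece on the left of what remains, a bracketing opposite to that of
  \<open>tri_gen\<close>; \<open>resolved_tri_gen\<close> reconciles the two.\<close>

fun resolved :: "'a cpx set \<Rightarrow> nat \<Rightarrow> 'a cpx \<Rightarrow> bool" where
  "resolved T 0 X \<longleftrightarrow> X \<in> bcpx L \<and> acyclic X"
| "resolved T (Suc m) X \<longleftrightarrow> (\<exists>S\<in>T. \<exists>p. arr S X p \<and> resolved T m (cone S X p))"

definition qi_closed :: "'a cpx set \<Rightarrow> bool" where
  "qi_closed T \<longleftrightarrow> (\<forall>X Y q. qarr X Y q \<longrightarrow> (X \<in> T \<longleftrightarrow> Y \<in> T))"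

lemma tri_gen1_qi_closed: "qi_closed (tri_gen1 D I)"
  using tri_gen_qi[of _ _ _ I 0] by (simp add: qi_closed_def)

text \<open>A square commuting up to a homotopy s induces a map of cones with s as off-diagonal
  entry, so \<open>tw_map_qi\<close> applies.\<close>

lemma cone_map_qi:
  assumes p: "arr S Z p" and p': "arr S' Z' p'" and a: "qarr S S' a" and h: "qarr Z Z' h"
    and H: "hq S Z' (ccomp S h p) (ccomp S p' a)"
  shows "\<exists>c. qarr (cone S Z p) (cone S' Z' p') c"
proof -
  have S [simp]: "S \<in> bcpx L" and Z [simp]: "Z \<in> bcpx L" and S' [simp]: "S' \<in> bcpx L" and Z' [simp]: "Z' \<in> bcpx L"
    and pc: "p \<in> chain_maps L S Z" and pc': "p' \<in> chain_maps L S' Z'"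
    and ac: "a \<in> quasi_isos L S S'" and hc: "h \<in> quasi_isos L Z Z'"
    using p p' a h by (auto simp: arr_def qarr_def)
  obtain s where s: "\<And>i j. j = i - 1 \<Longrightarrow> s i \<in> rhom L (Deg S i) (Deg Z' j)"
    and e: "\<And>x i j. x \<in> carrier (Deg S i) \<Longrightarrow> ccomp S h p i x \<ominus>\<^bsub>Deg Z' i\<^esub> ccomp S p' a i x =
        Dif Z' (i - 1) (s i x) \<oplus>\<^bsub>Deg Z' i\<^esub> s (i + 1) (Dif S i x)"
    using homotopicE[OF _ S Z', of "ccomp S h p" "ccomp S p' a"] H unfolding hq_def by metis
  have sr: "s (i + 1) \<in> rhom L (Deg S (i + 1)) (Deg Z' i)" for i by (rule s) simp
  note [simp] = chmap[OF pc S Z] chmap[OF pc' S' Z'] chmap[OF qi_chain[OF ac] S S'] chmap[OF qi_chain[OF hc] Z Z']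
  have sc [simp]: "s (i + 1) x \<in> carrier (Deg Z' i)" if "x \<in> carrier (Deg S (i + 1))" for i x
    using rhom_simps(1)[OF sr that] .
  have sn: "s (i + 2) (\<ominus>\<^bsub>Deg S (i + 2)\<^esub> x) = \<ominus>\<^bsub>Deg Z' (i + 1)\<^esub> s (i + 2) x" "s (i + 2) x \<in> carrier (Deg Z' (i + 1))"
    if "x \<in> carrier (Deg S (i + 2))" for i x
    using rhom_group(2)[OF s[of "i + 1" "i + 2"], of x] rhom_simps(1)[OF s[of "i + 1" "i + 2"], of x] that by simp_all
  have aq: "cshift_map 1 a \<in> quasi_isos L (cshift 1 S) (cshift 1 S')"
    using qarr_shift[OF a] by (simp add: qarr_def)
  have "qarr (tw (cshift 1 S) Z (\<lambda>i. p (i + 1))) (tw (cshift 1 S') Z' (\<lambda>i. p' (i + 1)))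
    (\<lambda>i. \<lambda>z\<in>carrier (mod_sum (Deg (cshift 1 S) i) (Deg Z i)).
      spair (cshift_map 1 a i (sfst z)) (h i (ssnd z) \<oplus>\<^bsub>Deg Z' i\<^esub> s (i + 1) (sfst z)))"
  proof (rule tw_map_qi[OF cone_twist[OF pc S Z] cone_twist[OF pc' S' Z'] aq hc _ _ _ _ _ _ refl])
    show "s (i + 1) \<in> rhom L (Deg (cshift 1 S) i) (Deg Z' i)" for i using sr by simp
    fix i x assume "x \<in> carrier (Deg (cshift 1 S) i)"
    then have x [simp]: "x \<in> carrier (Deg S (i + 1))" by simp
    have "h (i + 1) (p (i + 1) x) = (h (i + 1) (p (i + 1) x) \<ominus>\<^bsub>Deg Z' (i + 1)\<^esub> p' (i + 1) (a (i + 1) x)) \<oplus>\<^bsub>Deg Z' (i + 1)\<^esub> p' (i + 1) (a (i + 1) x)"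
      by (simp add: agn)
    also have "\<dots> = (Dif Z' i (s (i + 1) x) \<oplus>\<^bsub>Deg Z' (i + 1)\<^esub> s (i + 2) (Dif S (i + 1) x)) \<oplus>\<^bsub>Deg Z' (i + 1)\<^esub> p' (i + 1) (a (i + 1) x)"
      using e[OF x] by simp
    finally have "h (i + 1) (p (i + 1) x) = (Dif Z' i (s (i + 1) x) \<oplus>\<^bsub>Deg Z' (i + 1)\<^esub> s (i + 2) (Dif S (i + 1) x)) \<oplus>\<^bsub>Deg Z' (i + 1)\<^esub> p' (i + 1) (a (i + 1) x)" .
    then show "h (i + 1) (p (i + 1) x) \<oplus>\<^bsub>Deg Z' (i + 1)\<^esub> s (i + 1 + 1) (Dif (cshift 1 S) i x) =
      p' (i + 1) (cshift_map 1 a i x) \<oplus>\<^bsub>Deg Z' (i + 1)\<^esub> Dif Z' i (s (i + 1) x)"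
      by (simp add: cshift_Dif cshift_map_def sn) (simp add: sn agn)
  qed simp_all
  then show ?thesis unfolding cone_tw[OF S] cone_tw[OF S'] by blast
qed

lemma resolved_covariant: "resolved T m Z \<Longrightarrow> qarr Z Z' h \<Longrightarrow> resolved T m Z'"
proof (induction m arbitrary: Z Z' h)
  case 0
  then show ?case using qi_acyclic by (auto simp: qarr_def)
next
  case (Suc m)
  then obtain S p where S: "S \<in> T" "arr S Z p" "resolved T m (cone S Z p)" by auto
  have hp: "arr S Z' (ccomp S h p)" using S(2) qarr_arr[OF Suc.prems(2)] by blast
  have "hq S Z' (ccomp S h p) (ccomp S (ccomp S h p) (cid S))" using hp hq_refl arr_unit by simp
  then obtain c where "qarr (cone S Z p) (cone S Z' (ccomp S h p)) c"
    using cone_map_qi[OF S(2) hp qarr_id[OF arr_objs(1)[OF hp]] Suc.prems(2)] by blast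
  then have "resolved T m (cone S Z' (ccomp S h p))" by (rule Suc.IH[OF S(3)])
  then show ?case using S(1) hp unfolding resolved.simps by blast
qed

text \<open>A map from S to Z' does not lift along h itself. The Ore condition replaces S by a
  quasi-isomorphic U that maps to Z, and \<open>qi_closed\<close> keeps U in T.\<close>

lemma resolved_contravariant:
  assumes T: "qi_closed T"
  shows "resolved T m Z' \<Longrightarrow> qarr Z Z' h \<Longrightarrow> resolved T m Z"
proof (induction m arbitrary: Z Z' h)
  case 0
  then show ?case using qi_acyclic by (auto simp: qarr_def)
next
  case (Suc m)
  then obtain S p where S: "S \<in> T" "arr S Z' p" "resolved T m (cone S Z' p)" by auto
  obtain U a b where U: "qarr U S a" "arr U Z b" "hq U Z' (ccomp U p a) (ccomp U h b)"
    using ore[OF Suc.prems(2) S(2)] by blast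
  obtain c where "qarr (cone U Z b) (cone S Z' p) c"
    using cone_map_qi[OF U(2) S(2) U(1) Suc.prems(2) hq_sym[OF U(3)]] by blast
  then have "resolved T m (cone U Z b)" by (rule Suc.IH[OF S(3)])
  moreover have "U \<in> T" using T U(1) S(1) by (auto simp: qi_closed_def)
  ultimately show ?case using U(2) unfolding resolved.simps by blast
qed

text \<open>The cone of the identity is acyclic.\<close>

lemma resolved_one:
  assumes "X \<in> T" "X \<in> bcpx L"
  shows "resolved T (Suc 0) X"
  using assms cone_acyclic_iff[of "cid X" X X] arr_id by (auto intro!: bexI[of _ X] exI[of _ "cid X"])

text \<open>P is one piece, and the cone of P -> X that remains is K[1] up to
  quasi-isomorphism.\<close>

lemma resolved_step:
  assumes "ses K P X \<iota> \<pi>" "P \<in> T" "resolved T m (cshift 1 K)"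
  shows "resolved T (Suc m) X"
  using ses_shift_cone_qi[OF assms(1)] resolved_covariant[OF assms(3)] assms(1,2) by (auto simp: ses_def)

text \<open>The pieces of K are coned off from P as well, with the quotient X fixed by
  \<open>ses_cone\<close>. Once K has become acyclic, P and X are quasi-isomorphic and the pieces of
  X are used.\<close>

lemma resolved_extension:
  assumes T: "qi_closed T"
  shows "ses K P X \<iota> \<pi> \<Longrightarrow> resolved T a K \<Longrightarrow> resolved T b X \<Longrightarrow> resolved T (a + b) P"
proof (induction a arbitrary: K P \<iota> \<pi>)
  case 0
  then have "qarr P X \<pi>" using ses_acyclic_qi by simp
  then show ?case using resolved_contravariant[OF T 0(3)] by simp
next
  case (Suc a)
  then obtain S p where S: "S \<in> T" "arr S K p" "resolved T a (cone S K p)" by auto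
  obtain \<iota>' \<pi>' where "ses (cone S K p) (cone S P (ccomp S \<iota> p)) X \<iota>' \<pi>'" using ses_cone[OF Suc.prems(1) S(2)] by blast
  from Suc.IH[OF this S(3) Suc.prems(3)] have "resolved T (a + b) (cone S P (ccomp S \<iota> p))" .
  moreover have "arr S P (ccomp S \<iota> p)" using S(2) Suc.prems(1) by (auto simp: ses_def)
  ultimately show ?case using S(1) by auto
qed

text \<open>A map \<open>p = (a, b)\<close> into the cone of \<open>\<psi> : F \<rightarrow> X\<close> is the same as an extension \<open>F'\<close> of its source by \<open>F\<close>
  together with an extension of \<open>\<psi>\<close> to \<open>F'\<close>. Since \<open>F'\<close> is again an extension with the new object on the
  right, the brackets accumulate on the left, without appeal to the octahedral axiom.\<close>

lemma tri_gen_extend: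
  assumes F: "F \<in> tri_gen D I (Suc k)" and \<psi>: "arr F X \<psi>" and S: "S \<in> tri_gen1 D I" and p: "arr S (cone F X \<psi>) p"
  shows "\<exists>F' \<psi>' c. F' \<in> tri_gen D I (Suc (Suc k)) \<and> arr F' X \<psi>' \<and> qarr (cone S (cone F X \<psi>) p) (cone F' X \<psi>') c"
proof -
  have FB [simp]: "F \<in> bcpx L" and X [simp]: "X \<in> bcpx L" and SB [simp]: "S \<in> bcpx L"
    and fc: "\<psi> \<in> chain_maps L F X" and pc: "p \<in> chain_maps L S (cone F X \<psi>)"
    using \<psi> p by (auto simp: arr_def)
  define C where "C = cone F X \<psi>"
  have C [simp]: "C \<in> bcpx L" using fc by (simp add: C_def)
  have CD [simp]: "Deg C i = mod_sum (Deg F (i + 1)) (Deg X i)" for i by (simp add: C_def cone_tw)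
  note [simp] = chmap[OF fc FB X]
  have Cd [simp]: "Dif C i z = spair (\<ominus>\<^bsub>Deg F (i + 2)\<^esub> Dif F (i + 1) (sfst z)) (\<psi> (i + 1) (sfst z) \<oplus>\<^bsub>Deg X (i + 1)\<^esub> Dif X i (ssnd z))"
    if "sfst z \<in> carrier (Deg F (i + 1))" "ssnd z \<in> carrier (Deg X i)" for i z
    using that by (simp add: C_def cone_tw cshift_Dif)
  have pC: "p \<in> chain_maps L S C" using pc by (simp add: C_def)
  note P = chmap[OF pC SB C]
  \<comment> \<open>That p = (a, b) is a chain map means, by \<open>d\<close>, that a is a twist of
    S by F and that b supplies the extension of \<psi> to the resulting F'.\<close>
  define a where "a = (\<lambda>i. \<lambda>s\<in>carrier (Deg S i). sfst (p i s))"
  define b where "b = (\<lambda>i. \<lambda>s\<in>carrier (Deg S i). ssnd (p i s))"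
  have pab: "p i s = spair (a i s) (b i s)" if "s \<in> carrier (Deg S i)" for i s using that by (simp add: a_def b_def)
  have pm: "sfst (p i s) \<in> carrier (Deg F (i + 1))" "ssnd (p i s) \<in> carrier (Deg X i)" if "s \<in> carrier (Deg S i)" for i s
    using P(1)[OF that] by simp_all
  have P3: "p i (x \<oplus>\<^bsub>Deg S i\<^esub> y) = spair (sfst (p i x) \<oplus>\<^bsub>Deg F (i + 1)\<^esub> sfst (p i y)) (ssnd (p i x) \<oplus>\<^bsub>Deg X i\<^esub> ssnd (p i y))"
    if "x \<in> carrier (Deg S i)" "y \<in> carrier (Deg S i)" for i x y using P(3)[OF that] by simp
  have P4: "p i (r \<odot>\<^bsub>Deg S i\<^esub> x) = spair (r \<odot>\<^bsub>Deg F (i + 1)\<^esub> sfst (p i x)) (r \<odot>\<^bsub>Deg X i\<^esub> ssnd (p i x))"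
    if "r \<in> carrier L" "x \<in> carrier (Deg S i)" for i x r using P(4)[OF that] by simp
  have ar: "a i \<in> rhom L (Deg S i) (Deg F (i + 1))" for i
    unfolding a_def by (rule rhomI) (simp_all add: pm P3 P4)
  have br: "b i \<in> rhom L (Deg S i) (Deg X i)" for i
    unfolding b_def by (rule rhomI) (simp_all add: pm P3 P4)
  note [simp] = rhom_simps[OF ar] rhom_group[OF ar bcpx_fg[OF SB] bcpx_fg[OF FB]]
    rhom_simps[OF br] rhom_group[OF br bcpx_fg[OF SB] bcpx_fg[OF X]]
  have d: "a (i + 1) (Dif S i s) = \<ominus>\<^bsub>Deg F (i + 2)\<^esub> Dif F (i + 1) (a i s)"
    "b (i + 1) (Dif S i s) = \<psi> (i + 1) (a i s) \<oplus>\<^bsub>Deg X (i + 1)\<^esub> Dif X i (b i s)"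
    if s: "s \<in> carrier (Deg S i)" for i s
    using P(2)[OF s refl] s by (simp_all add: pab)
  have aT: "a \<in> twists S F"
    using ar by (intro twistsI) (simp_all add: d fg_r_neg rhom_simps(1)[OF ar])
  define F' where "F' = tw S F a"
  have F' [simp]: "F' \<in> bcpx L" unfolding F'_def using aT by simp
  have FD [simp]: "Deg F' i = mod_sum (Deg S i) (Deg F i)" for i by (simp add: F'_def)
  have Fd [simp]: "Dif F' i z = spair (Dif S i (sfst z)) (a i (sfst z) \<oplus>\<^bsub>Deg F (i + 1)\<^esub> Dif F i (ssnd z))"
    if "sfst z \<in> carrier (Deg S i)" "ssnd z \<in> carrier (Deg F i)" for i z
    using that by (simp add: F'_def)
  \<comment> \<open>The minus sign cancels the term \<psi> a in the formula for b after the
    differential.\<close>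
  define \<psi>' where "\<psi>' = (\<lambda>i. \<lambda>z\<in>carrier (Deg F' i). \<psi> i (ssnd z) \<ominus>\<^bsub>Deg X i\<^esub> b i (sfst z))"
  have \<psi>'a [simp]: "\<psi>' i z = \<psi> i (ssnd z) \<ominus>\<^bsub>Deg X i\<^esub> b i (sfst z)"
    if "sfst z \<in> carrier (Deg S i)" "ssnd z \<in> carrier (Deg F i)" for i z using that by (simp add: \<psi>'_def)
  have \<psi>': "arr F' X \<psi>'" unfolding arr_def
  proof (intro conjI chain_mapsI)
    show "\<psi>' i \<in> rhom L (Deg F' i) (Deg X i)" for i unfolding \<psi>'_def
      by (rule rhomI) (simp_all add: a_minus_def fg_smult_add fg_smult_neg, simp_all add: agn)
  qed (simp_all add: d difs, simp_all add: agn)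
  have inc: "arr F F' (tincl S F)" unfolding arr_def F'_def using tincl_chain[OF aT SB FB] aT by simp
  \<comment> \<open>The cone of the inclusion of F into F' is quasi-isomorphic to the quotient S,
    which places F' one level above F.\<close>
  define E where "E = cone F F' (tincl S F)"
  have E [simp]: "E \<in> bcpx L" using inc by (simp add: E_def arr_def)
  have ED [simp]: "Deg E i = mod_sum (Deg F (i + 1)) (mod_sum (Deg S i) (Deg F i))" for i by (simp add: E_def cone_tw)
  have Ed [simp]: "Dif E i z = spair (\<ominus>\<^bsub>Deg F (i + 2)\<^esub> Dif F (i + 1) (sfst z))
      (spair (Dif S i (sfst (ssnd z))) (sfst z \<oplus>\<^bsub>Deg F (i + 1)\<^esub> (a i (sfst (ssnd z)) \<oplus>\<^bsub>Deg F (i + 1)\<^esub> Dif F i (ssnd (ssnd z)))))"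
    if "sfst z \<in> carrier (Deg F (i + 1))" "sfst (ssnd z) \<in> carrier (Deg S i)" "ssnd (ssnd z) \<in> carrier (Deg F i)" for i z
    using that by (simp add: E_def cone_tw cshift_Dif)
  define r where "r = (\<lambda>i. \<lambda>z\<in>carrier (Deg E i). sfst (ssnd z))"
  have ra [simp]: "r i z = sfst (ssnd z)"
    if "sfst z \<in> carrier (Deg F (i + 1))" "sfst (ssnd z) \<in> carrier (Deg S i)" "ssnd (ssnd z) \<in> carrier (Deg F i)" for i z
    using that by (simp add: r_def)
  have rc: "r \<in> chain_maps L E S"
  proof (rule chain_mapsI)
    show "r i \<in> rhom L (Deg E i) (Deg S i)" for i unfolding r_def by (rule rhomI) simp_all
  qed simp
  have "r \<in> quasi_isos L E S"
  proof (rule qiI[OF rc])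
    fix i z assume z: "z \<in> cycles E i" "r i z \<in> boundaries S i"
    let ?f = "sfst z" and ?s = "sfst (ssnd z)" and ?g = "ssnd (ssnd z)"
    have zc [simp]: "?f \<in> carrier (Deg F (i + 1))" "?s \<in> carrier (Deg S i)" "?g \<in> carrier (Deg F i)"
      using cycles_carrier[OF z(1)] by simp_all
    have e: "?f \<oplus>\<^bsub>Deg F (i + 1)\<^esub> (a i ?s \<oplus>\<^bsub>Deg F (i + 1)\<^esub> Dif F i ?g) = \<zero>\<^bsub>Deg F (i + 1)\<^esub>"
      using cyclesD[OF z(1)] by simp
    obtain t where t [simp]: "t \<in> carrier (Deg S (i - 1))" and st: "?s = Dif S (i - 1) t" using z(2) by (auto elim: boundariesE)
    have at [simp]: "a (i - 1) t \<in> carrier (Deg F i)" using rhom_simps(1)[OF ar t] by simp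
    have "a i ?s = \<ominus>\<^bsub>Deg F (i + 1)\<^esub> Dif F i (a (i - 1) t)" using d(1)[OF t] by (simp add: st)
    then have "?f = \<ominus>\<^bsub>Deg F (i + 1)\<^esub> Dif F i (?g \<ominus>\<^bsub>Deg F i\<^esub> a (i - 1) t)"
      using fg_neg_unique[OF _ e] by (simp add: difs agn)
    then have "z = Dif E (i - 1) (spair (?g \<ominus>\<^bsub>Deg F i\<^esub> a (i - 1) t) (spair t \<zero>\<^bsub>Deg F (i - 1)\<^esub>))"
      using spair_simps(3)[of z] spair_simps(3)[of "ssnd z"] dif_zero[OF FB, of "i - 1"] st
      by (simp add: sfst_ext[of z] sfst_ext[of "ssnd z"] del: spair_simps(3)) (simp add: agn)
    then show "z \<in> boundaries E i"
      using boundariesI[of "spair (?g \<ominus>\<^bsub>Deg F i\<^esub> a (i - 1) t) (spair t \<zero>\<^bsub>Deg F (i - 1)\<^esub>)" E "i - 1" i] by simp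
  next
    fix i s assume s: "s \<in> cycles S i"
    have sc [simp]: "s \<in> carrier (Deg S i)" and ds: "Dif S i s = \<zero>\<^bsub>Deg S (i + 1)\<^esub>" using s cyclesD[OF s] by simp_all
    have "Dif F (i + 1) (a i s) = \<zero>\<^bsub>Deg F (i + 2)\<^esub>"
    proof -
      have "\<ominus>\<^bsub>Deg F (i + 2)\<^esub> Dif F (i + 1) (a i s) = a (i + 1) (Dif S i s)" using d(1)[OF sc] by simp
      also have "\<dots> = \<zero>\<^bsub>Deg F (i + 2)\<^esub>" unfolding ds by simp
      finally show ?thesis by simp
    qed
    then have "spair (\<ominus>\<^bsub>Deg F (i + 1)\<^esub> a i s) (spair s \<zero>\<^bsub>Deg F i\<^esub>) \<in> cycles E i"
      by (simp del: cycles_carrier add: cycles_iff ds difs fg_l_neg)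
    then show "\<exists>z\<in>cycles E i. s \<ominus>\<^bsub>Deg S i\<^esub> r i z \<in> boundaries S i"
      by (intro bexI[of _ "spair (\<ominus>\<^bsub>Deg F (i + 1)\<^esub> a i s) (spair s \<zero>\<^bsub>Deg F i\<^esub>)"]) simp_all
  qed
  then have "qarr E S r" by (simp add: qarr_def)
  then have "E \<in> tri_gen1 D I" using S tri_gen1_qi_closed by (auto simp: qi_closed_def)
  then have 1: "F' \<in> tri_gen D I (Suc (Suc k))" using tri_gen_cone[OF inc F] by (simp add: E_def)
  define A where "A = cone S C p"
  define B where "B = cone F' X \<psi>'"
  have A [simp]: "A \<in> bcpx L" and B [simp]: "B \<in> bcpx L" using pC \<psi>' by (simp_all add: A_def B_def arr_def)
  have AD [simp]: "Deg A i = mod_sum (Deg S (i + 1)) (mod_sum (Deg F (i + 1)) (Deg X i))"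
    and BD [simp]: "Deg B i = mod_sum (mod_sum (Deg S (i + 1)) (Deg F (i + 1))) (Deg X i)" for i
    by (simp_all add: A_def B_def cone_tw)
  have Ad [simp]: "Dif A i (spair s (spair f x)) = spair (\<ominus>\<^bsub>Deg S (i + 2)\<^esub> Dif S (i + 1) s)
      (spair (a (i + 1) s \<oplus>\<^bsub>Deg F (i + 2)\<^esub> \<ominus>\<^bsub>Deg F (i + 2)\<^esub> Dif F (i + 1) f)
        (b (i + 1) s \<oplus>\<^bsub>Deg X (i + 1)\<^esub> (\<psi> (i + 1) f \<oplus>\<^bsub>Deg X (i + 1)\<^esub> Dif X i x)))"
    if "s \<in> carrier (Deg S (i + 1))" "f \<in> carrier (Deg F (i + 1))" "x \<in> carrier (Deg X i)" for i s f x
    using that by (simp add: A_def cone_tw cshift_Dif pab)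
  have Bd [simp]: "Dif B i (spair (spair s f) x) = spair (spair (\<ominus>\<^bsub>Deg S (i + 2)\<^esub> Dif S (i + 1) s)
      (\<ominus>\<^bsub>Deg F (i + 2)\<^esub> (a (i + 1) s \<oplus>\<^bsub>Deg F (i + 2)\<^esub> Dif F (i + 1) f)))
      (\<psi> (i + 1) f \<ominus>\<^bsub>Deg X (i + 1)\<^esub> b (i + 1) s \<oplus>\<^bsub>Deg X (i + 1)\<^esub> Dif X i x)"
    if "s \<in> carrier (Deg S (i + 1))" "f \<in> carrier (Deg F (i + 1))" "x \<in> carrier (Deg X i)" for i s f x
    using that rhom_simps(1)[OF ar, of s "i + 1"] by (simp add: B_def cone_tw cshift_Dif)
  \<comment> \<open>The iterated cone A and the cone B differ in bracketing and in the signs of the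
    entries a and b; negating the S coordinate removes the difference.\<close>
  define c where "c = (\<lambda>i. \<lambda>z\<in>carrier (Deg A i). spair (spair (\<ominus>\<^bsub>Deg S (i + 1)\<^esub> sfst z) (sfst (ssnd z))) (ssnd (ssnd z)))"
  have ca [simp]: "c i (spair s (spair f x)) = spair (spair (\<ominus>\<^bsub>Deg S (i + 1)\<^esub> s) f) x"
    if "s \<in> carrier (Deg S (i + 1))" "f \<in> carrier (Deg F (i + 1))" "x \<in> carrier (Deg X i)" for i s f x
    using that by (simp add: c_def)
  have split: "\<exists>s f x. z = spair s (spair f x)" for z :: "nat \<Rightarrow> 'a" by (metis spair_simps(3))
  have a2 [simp]: "a (i + 1) s \<in> carrier (Deg F (i + 2))" if "s \<in> carrier (Deg S (i + 1))" for i s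
    using rhom_simps(1)[OF ar that] by simp
  have a3 [simp]: "a (i + 1) (\<ominus>\<^bsub>Deg S (i + 1)\<^esub> s) = \<ominus>\<^bsub>Deg F (i + 2)\<^esub> a (i + 1) s" if "s \<in> carrier (Deg S (i + 1))" for i s
    using rhom_group(2)[OF ar bcpx_fg[OF SB] bcpx_fg[OF FB] that] by simp
  have cc: "c \<in> chain_maps L A B"
  proof (rule chain_mapsI)
    show "c i \<in> rhom L (Deg A i) (Deg B i)" for i unfolding c_def
      by (rule rhomI) (simp_all add: fg_neg_add fg_smult_neg)
    fix i z assume z: "z \<in> carrier (Deg A i)"
    obtain s f x where e: "z = spair s (spair f x)" using split by blast
    show "c (i + 1) (Dif A i z) = Dif B i (c i z)" using z unfolding e by (simp add: dif_neg agn)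
  qed
  have "c \<in> quasi_isos L A B"
  proof (rule chain_bij_qi[OF cc A B])
    fix i z assume z: "z \<in> carrier (Deg A i)" "c i z = \<zero>\<^bsub>Deg B i\<^esub>"
    obtain s f x where e: "z = spair s (spair f x)" using split by blast
    show "z = \<zero>\<^bsub>Deg A i\<^esub>" using z unfolding e by simp
  next
    fix i y assume y: "y \<in> carrier (Deg B i)"
    have "y = spair (spair (sfst (sfst y)) (ssnd (sfst y))) (ssnd y)" by simp
    then show "\<exists>z\<in>carrier (Deg A i). c i z = y"
      using y by (intro bexI[of _ "spair (\<ominus>\<^bsub>Deg S (i + 1)\<^esub> sfst (sfst y)) (spair (ssnd (sfst y)) (ssnd y))"]) simp_all
  qed
  then have "qarr A B c" by (simp add: qarr_def)
  then show ?thesis using 1 \<psi>' unfolding A_def B_def C_def by blast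
qed

text \<open>An accumulator form: F is what has been assembled so far and
  \<open>cone F X \<psi>\<close> is what is still to be resolved. When nothing remains, \<psi> is a
  quasi-isomorphism.\<close>

lemma tri_gen_resolved_cone:
  "F \<in> tri_gen D I (Suc k) \<Longrightarrow> arr F X \<psi> \<Longrightarrow> resolved (tri_gen1 D I) m (cone F X \<psi>) \<Longrightarrow> X \<in> tri_gen D I (Suc (k + m))"
proof (induction m arbitrary: F \<psi> k)
  case 0
  then have "qarr F X \<psi>" using cone_acyclic_iff by (auto simp: qarr_def arr_def)
  then show ?case using 0 tri_gen_qi by auto
next
  case (Suc m)
  obtain S p where S: "S \<in> tri_gen1 D I" "arr S (cone F X \<psi>) p"
    "resolved (tri_gen1 D I) m (cone S (cone F X \<psi>) p)" using Suc.prems(3) by auto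
  obtain F' \<psi>' c where F': "F' \<in> tri_gen D I (Suc (Suc k))" "arr F' X \<psi>'"
    "qarr (cone S (cone F X \<psi>) p) (cone F' X \<psi>') c"
    using tri_gen_extend[OF Suc.prems(1,2) S(1,2)] by blast
  have "X \<in> tri_gen D I (Suc (Suc k + m))"
    by (rule Suc.IH[OF F'(1,2) resolved_covariant[OF S(3) F'(3)]])
  then show ?case by simp
qed

theorem resolved_tri_gen:
  assumes "resolved (tri_gen1 D I) (Suc m) X"
  shows "X \<in> tri_gen D I (Suc m)"
proof -
  obtain S p where "S \<in> tri_gen1 D I" "arr S X p" "resolved (tri_gen1 D I) m (cone S X p)" using assms by auto
  then show ?thesis using tri_gen_resolved_cone[of S I 0 X p m] by simp
qed

section \<open>Homomorphisms factoring through sums\<close>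

text \<open>A module lies in the additive closure of \<open>J\<close> iff its identity is in the ideal of
  homomorphisms factoring through finite direct sums of members of \<open>J\<close>.\<close>

inductive factors :: "'a smod set \<Rightarrow> 'a smod \<Rightarrow> 'a smod \<Rightarrow> ((nat \<Rightarrow> 'a) \<Rightarrow> nat \<Rightarrow> 'a) \<Rightarrow> bool"
  for J M N where
  zero: "factors J M N (\<lambda>x\<in>carrier M. \<zero>\<^bsub>N\<^esub>)"
| step: "factors J M N h \<Longrightarrow> B \<in> J \<Longrightarrow> B \<in> fgmod L \<Longrightarrow> f \<in> rhom L M B \<Longrightarrow> g \<in> rhom L B N \<Longrightarrow>
    factors J M N (\<lambda>x\<in>carrier M. h x \<oplus>\<^bsub>N\<^esub> g (f x))"

lemma rhom_comp:
  assumes "f \<in> rhom L M B" "g \<in> rhom L B N" "M \<in> fgmod L"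
  shows "(\<lambda>x\<in>carrier M. g (f x)) \<in> rhom L M N"
  using rhom_compose[OF assms] by (simp add: compose_def)

lemma rhom_lam_add:
  assumes "f \<in> rhom L M N" "(\<lambda>x\<in>carrier M. g x) \<in> rhom L M N" "M \<in> fgmod L" "N \<in> fgmod L"
  shows "(\<lambda>x\<in>carrier M. f x \<oplus>\<^bsub>N\<^esub> g x) \<in> rhom L M N"
proof -
  have "(\<lambda>x\<in>carrier M. f x \<oplus>\<^bsub>N\<^esub> (\<lambda>x\<in>carrier M. g x) x) = (\<lambda>x\<in>carrier M. f x \<oplus>\<^bsub>N\<^esub> g x)"
    by (intro restrict_ext) simp
  then show ?thesis using rhom_add[OF assms] by simp
qed

lemma factors_rhom:
  assumes "factors J M N h" "M \<in> fgmod L" "N \<in> fgmod L"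
  shows "h \<in> rhom L M N"
  using assms(1)
proof induction
  case zero
  show ?case by (rule rhom_zero[OF assms(2,3)])
next
  case (step h B f g)
  show ?case by (rule rhom_lam_add[OF step.IH rhom_comp[OF step(4,5) assms(2)] assms(2,3)])
qed

lemma factors_add:
  assumes "factors J M N h" "factors J M N k" and M [simp]: "M \<in> fgmod L" and N [simp]: "N \<in> fgmod L"
  shows "factors J M N (\<lambda>x\<in>carrier M. h x \<oplus>\<^bsub>N\<^esub> k x)"
  using assms(2)
proof induction
  case zero
  have eq: "(\<lambda>x\<in>carrier M. h x \<oplus>\<^bsub>N\<^esub> (\<lambda>x\<in>carrier M. \<zero>\<^bsub>N\<^esub>) x) = h"
    using factors_rhom[OF assms(1) M N] rhom_simps(1)[OF factors_rhom[OF assms(1) M N]]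
    by (intro rhom_ext[of _ M N] rhom_add rhom_zero) simp_all
  show ?case using assms(1) by (simp only: eq)
next
  case (step k B f g)
  note [simp] = rhom_simps(1)[OF factors_rhom[OF assms(1) M N]] rhom_simps(1)[OF factors_rhom[OF step(1) M N]]
    rhom_simps(1)[OF step(4)] rhom_simps(1)[OF step(5)]
  have eq: "(\<lambda>x\<in>carrier M. h x \<oplus>\<^bsub>N\<^esub> (\<lambda>x\<in>carrier M. k x \<oplus>\<^bsub>N\<^esub> g (f x)) x) =
    (\<lambda>x\<in>carrier M. (\<lambda>x\<in>carrier M. h x \<oplus>\<^bsub>N\<^esub> k x) x \<oplus>\<^bsub>N\<^esub> g (f x))"
    by (intro restrict_ext) (simp add: fg_a_assoc)
  show ?case using factors.step[OF step.IH step(2-5)] by (simp only: eq)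
qed

lemma factors_comp_left:
  assumes "factors J M N h" "k \<in> rhom L N N'" and M [simp]: "M \<in> fgmod L" and N [simp]: "N \<in> fgmod L" and N' [simp]: "N' \<in> fgmod L"
  shows "factors J M N' (\<lambda>x\<in>carrier M. k (h x))"
  using assms(1)
proof induction
  case zero
  have "(\<lambda>x\<in>carrier M. k ((\<lambda>x\<in>carrier M. \<zero>\<^bsub>N\<^esub>) x)) = (\<lambda>x\<in>carrier M. \<zero>\<^bsub>N'\<^esub>)"
    using rhom_group(1)[OF assms(2)] by (intro restrict_ext) simp
  then show ?case using factors.zero[of J M N'] by (simp only:)
next
  case (step h B f g)
  note [simp] = rhom_simps(1)[OF factors_rhom[OF step(1) M N]]
    rhom_simps(1)[OF step(4)] rhom_simps(1)[OF step(5)]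
  have kg: "(\<lambda>x\<in>carrier B. k (g x)) \<in> rhom L B N'" by (rule rhom_comp[OF step(5) assms(2) step(3)])
  have eq: "(\<lambda>x\<in>carrier M. k ((\<lambda>x\<in>carrier M. h x \<oplus>\<^bsub>N\<^esub> g (f x)) x)) =
    (\<lambda>x\<in>carrier M. (\<lambda>x\<in>carrier M. k (h x)) x \<oplus>\<^bsub>N'\<^esub> (\<lambda>x\<in>carrier B. k (g x)) (f x))"
    by (intro restrict_ext) (simp add: rhom_simps(2)[OF assms(2)])
  show ?case using factors.step[OF step.IH step(2-4) kg] by (simp only: eq)
qed

lemma factors_comp_right:
  assumes "factors J M N h" "k \<in> rhom L M' M" and M [simp]: "M \<in> fgmod L" and N [simp]: "N \<in> fgmod L" and M' [simp]: "M' \<in> fgmod L"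
  shows "factors J M' N (\<lambda>x\<in>carrier M'. h (k x))"
  using assms(1)
proof induction
  case zero
  have "(\<lambda>x\<in>carrier M'. (\<lambda>x\<in>carrier M. \<zero>\<^bsub>N\<^esub>) (k x)) = (\<lambda>x\<in>carrier M'. \<zero>\<^bsub>N\<^esub>)"
    using rhom_simps(1)[OF assms(2)] by (intro restrict_ext) simp
  then show ?case using factors.zero[of J M' N] by (simp only:)
next
  case (step h B f g)
  have eq: "(\<lambda>x\<in>carrier M'. (\<lambda>x\<in>carrier M. h x \<oplus>\<^bsub>N\<^esub> g (f x)) (k x)) =
    (\<lambda>x\<in>carrier M'. (\<lambda>x\<in>carrier M'. h (k x)) x \<oplus>\<^bsub>N\<^esub> g ((\<lambda>x\<in>carrier M'. f (k x)) x))"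
    using rhom_simps(1)[OF assms(2)] by (intro restrict_ext) simp
  show ?case using factors.step[OF step.IH step(2,3) rhom_comp[OF assms(2) step(4) M'] step(5)] by (simp only: eq)
qed

definition acl :: "'a smod set \<Rightarrow> 'a smod set" where
  "acl J = {A \<in> fgmod L. factors J A A (\<lambda>x\<in>carrier A. x)}"

lemma acl_fg [simp]: "A \<in> acl J \<Longrightarrow> A \<in> fgmod L"
  by (simp add: acl_def)

lemma factors_through:
  assumes "factors J B B (\<lambda>x\<in>carrier B. x)" "f \<in> rhom L M B" "g \<in> rhom L B N"
    and M [simp]: "M \<in> fgmod L" and B [simp]: "B \<in> fgmod L" and N [simp]: "N \<in> fgmod L"
  shows "factors J M N (\<lambda>x\<in>carrier M. g (f x))"
proof -
  have "factors J M N (\<lambda>x\<in>carrier M. g ((\<lambda>x\<in>carrier M. (\<lambda>x\<in>carrier B. x) (f x)) x))"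
    by (intro factors_comp_left[OF factors_comp_right[OF assms(1,2)] assms(3)]) simp_all
  moreover have eq: "(\<lambda>x\<in>carrier M. g ((\<lambda>x\<in>carrier M. (\<lambda>x\<in>carrier B. x) (f x)) x)) = (\<lambda>x\<in>carrier M. g (f x))"
    using rhom_simps(1)[OF assms(2)] by (intro restrict_ext) simp
  ultimately show ?thesis by (simp only: eq)
qed

text \<open>A map through a member B of J factors through J' because the identity of B does.\<close>

lemma acl_trans:
  assumes "J \<subseteq> acl J'"
  shows "acl J \<subseteq> acl J'"
proof
  fix A assume "A \<in> acl J"
  then have A [simp]: "A \<in> fgmod L" and f: "factors J A A (\<lambda>x\<in>carrier A. x)" by (auto simp: acl_def simp del: acl_fg)
  have "factors J' A A h" if "factors J A A h" for h
    using that
  proof induction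
    case zero
    show ?case by (rule factors.zero)
  next
    case (step h B f g)
    have B: "B \<in> fgmod L" "factors J' B B (\<lambda>x\<in>carrier B. x)" using step(2) assms by (auto simp: acl_def simp del: acl_fg)
    have "factors J' A A (\<lambda>x\<in>carrier A. g (f x))" by (rule factors_through[OF B(2) step(4,5) A B(1) A])
    from factors_add[OF step.IH this A A]
    have "factors J' A A (\<lambda>x\<in>carrier A. h x \<oplus>\<^bsub>A\<^esub> (\<lambda>x\<in>carrier A. g (f x)) x)" .
    moreover have eq: "(\<lambda>x\<in>carrier A. h x \<oplus>\<^bsub>A\<^esub> (\<lambda>x\<in>carrier A. g (f x)) x) = (\<lambda>x\<in>carrier A. h x \<oplus>\<^bsub>A\<^esub> g (f x))"
      by (intro restrict_ext) simp
    ultimately show ?case by (simp only: eq)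
  qed
  then show "A \<in> acl J'" using f by (simp add: acl_def del: acl_fg)
qed

lemma acl_retract:
  assumes B: "B \<in> acl J" and [simp]: "A \<in> fgmod L" and f: "f \<in> rhom L A B" and g: "g \<in> rhom L B A"
    and e: "\<And>x. x \<in> carrier A \<Longrightarrow> g (f x) = x"
  shows "A \<in> acl J"
proof -
  have "factors J A A (\<lambda>x\<in>carrier A. g (f x))"
    using B by (intro factors_through[OF _ f g]) (auto simp: acl_def simp del: acl_fg)
  moreover have eq: "(\<lambda>x\<in>carrier A. g (f x)) = (\<lambda>x\<in>carrier A. x)" using e by (intro restrict_ext) simp
  ultimately have "factors J A A (\<lambda>x\<in>carrier A. x)" by (simp only: eq)
  then show ?thesis unfolding acl_def by simp
qed

lemma acl_base:
  assumes "B \<in> J" and [simp]: "B \<in> fgmod L"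
  shows "B \<in> acl J"
proof -
  have "factors J B B (\<lambda>x\<in>carrier B. (\<lambda>x\<in>carrier B. \<zero>\<^bsub>B\<^esub>) x \<oplus>\<^bsub>B\<^esub> (\<lambda>x\<in>carrier B. x) ((\<lambda>x\<in>carrier B. x) x))"
    by (intro factors.step[OF factors.zero assms(1)] rhom_id) simp_all
  moreover have eq: "(\<lambda>x\<in>carrier B. (\<lambda>x\<in>carrier B. \<zero>\<^bsub>B\<^esub>) x \<oplus>\<^bsub>B\<^esub> (\<lambda>x\<in>carrier B. x) ((\<lambda>x\<in>carrier B. x) x)) = (\<lambda>x\<in>carrier B. x)"
    by (intro restrict_ext) simp
  ultimately have "factors J B B (\<lambda>x\<in>carrier B. x)" by (simp only: eq)
  then show ?thesis unfolding acl_def by simp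
qed

lemma rhom_inl: "M \<in> fgmod L \<Longrightarrow> N \<in> fgmod L \<Longrightarrow> (\<lambda>x\<in>carrier M. spair x \<zero>\<^bsub>N\<^esub>) \<in> rhom L M (mod_sum M N)"
  by (rule rhomI) simp_all

lemma rhom_inr: "M \<in> fgmod L \<Longrightarrow> N \<in> fgmod L \<Longrightarrow> (\<lambda>x\<in>carrier N. spair \<zero>\<^bsub>M\<^esub> x) \<in> rhom L N (mod_sum M N)"
  by (rule rhomI) simp_all

lemma rhom_sfst: "M \<in> fgmod L \<Longrightarrow> N \<in> fgmod L \<Longrightarrow> (\<lambda>z\<in>carrier (mod_sum M N). sfst z) \<in> rhom L (mod_sum M N) M"
  by (rule rhomI) simp_all

lemma rhom_ssnd: "M \<in> fgmod L \<Longrightarrow> N \<in> fgmod L \<Longrightarrow> (\<lambda>z\<in>carrier (mod_sum M N). ssnd z) \<in> rhom L (mod_sum M N) N"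
  by (rule rhomI) simp_all

lemma acl_mod_sum:
  assumes A: "A \<in> acl J" and B: "B \<in> acl J"
  shows "mod_sum A B \<in> acl J"
proof -
  have A' [simp]: "A \<in> fgmod L" and B' [simp]: "B \<in> fgmod L" using A B by auto
  have fA: "factors J A A (\<lambda>x\<in>carrier A. x)" and fB: "factors J B B (\<lambda>x\<in>carrier B. x)"
    using A B unfolding acl_def by simp_all
  let ?S = "mod_sum A B"
  have "factors J ?S ?S (\<lambda>z\<in>carrier ?S. (\<lambda>x\<in>carrier A. spair x \<zero>\<^bsub>B\<^esub>) ((\<lambda>z\<in>carrier ?S. sfst z) z))"
    "factors J ?S ?S (\<lambda>z\<in>carrier ?S. (\<lambda>x\<in>carrier B. spair \<zero>\<^bsub>A\<^esub> x) ((\<lambda>z\<in>carrier ?S. ssnd z) z))"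
    by (rule factors_through[OF fA rhom_sfst rhom_inl] factors_through[OF fB rhom_ssnd rhom_inr]; simp)+
  from factors_add[OF this mod_sum_fg[OF A' B'] mod_sum_fg[OF A' B']]
  have "factors J ?S ?S (\<lambda>z\<in>carrier ?S. (\<lambda>z\<in>carrier ?S. (\<lambda>x\<in>carrier A. spair x \<zero>\<^bsub>B\<^esub>) ((\<lambda>z\<in>carrier ?S. sfst z) z)) z
     \<oplus>\<^bsub>?S\<^esub> (\<lambda>z\<in>carrier ?S. (\<lambda>x\<in>carrier B. spair \<zero>\<^bsub>A\<^esub> x) ((\<lambda>z\<in>carrier ?S. ssnd z) z)) z)" .
  moreover have eq: "(\<lambda>z\<in>carrier ?S. (\<lambda>z\<in>carrier ?S. (\<lambda>x\<in>carrier A. spair x \<zero>\<^bsub>B\<^esub>) ((\<lambda>z\<in>carrier ?S. sfst z) z)) z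
     \<oplus>\<^bsub>?S\<^esub> (\<lambda>z\<in>carrier ?S. (\<lambda>x\<in>carrier B. spair \<zero>\<^bsub>A\<^esub> x) ((\<lambda>z\<in>carrier ?S. ssnd z) z)) z) = (\<lambda>z\<in>carrier ?S. z)"
    by (intro restrict_ext) simp
  ultimately have "factors J ?S ?S (\<lambda>z\<in>carrier ?S. z)" by (simp only: eq)
  then show ?thesis unfolding acl_def by simp
qed

lemma acl_trivial:
  assumes "M \<in> fgmod L" "carrier M = {\<zero>\<^bsub>M\<^esub>}"
  shows "M \<in> acl J"
proof -
  have eq: "(\<lambda>x\<in>carrier M. x) = (\<lambda>x\<in>carrier M. \<zero>\<^bsub>M\<^esub>)" using assms by (intro restrict_ext) simp
  show ?thesis using factors.zero[of J M M] assms(1) unfolding acl_def by (simp only: eq mem_Collect_eq simp_thms)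
qed

lemma mod_cat_simps [simp]:
  "Ob (mod_cat L) = fgmod L" "Hom (mod_cat L) = rhom L" "IdMor (mod_cat L) M = (\<lambda>x\<in>carrier M. x)"
  "Comp (mod_cat L) M N K g f = compose (carrier M) g f" "ZeroMor (mod_cat L) M N = (\<lambda>x\<in>carrier M. \<zero>\<^bsub>N\<^esub>)"
  "AddMor (mod_cat L) M N f g = (\<lambda>x\<in>carrier M. f x \<oplus>\<^bsub>N\<^esub> g x)"
  by (simp_all add: mod_cat_def)

text \<open>The biproduct equation writes the identity of the sum as a sum of maps through members
  of J, and a direct summand is a retract.\<close>

lemma add_closure_acl:
  assumes X: "X \<in> add_closure (mod_cat L) J" and J: "J \<subseteq> fgmod L"
  shows "X \<in> acl J"
proof -
  obtain Ys Y where Ys: "set Ys \<subseteq> J" "direct_sum (mod_cat L) Ys Y" and XY: "direct_summand (mod_cat L) X Y"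
    using X by (auto simp: add_closure_def)
  have Y [simp]: "Y \<in> fgmod L" using Ys(2) by (simp add: direct_sum_def)
  obtain \<iota> \<pi> where h: "\<forall>k<length Ys. \<iota> k \<in> rhom L (Ys ! k) Y \<and> \<pi> k \<in> rhom L Y (Ys ! k)"
    and s: "foldr (\<lambda>k. AddMor (mod_cat L) Y Y (Comp (mod_cat L) Y (Ys ! k) Y (\<iota> k) (\<pi> k))) [0..<length Ys]
       (ZeroMor (mod_cat L) Y Y) = IdMor (mod_cat L) Y"
    using Ys(2) unfolding direct_sum_def mod_cat_simps(2) by blast
  have "factors J Y Y (foldr (\<lambda>k. AddMor (mod_cat L) Y Y (Comp (mod_cat L) Y (Ys ! k) Y (\<iota> k) (\<pi> k))) ks
       (ZeroMor (mod_cat L) Y Y))" if "set ks \<subseteq> {..<length Ys}" for ks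
    using that
  proof (induction ks)
    case Nil
    show ?case using factors.zero[of J Y Y] by (simp only: foldr.simps id_apply mod_cat_simps)
  next
    case (Cons k ks)
    let ?r = "foldr (\<lambda>k. AddMor (mod_cat L) Y Y (Comp (mod_cat L) Y (Ys ! k) Y (\<iota> k) (\<pi> k))) ks (ZeroMor (mod_cat L) Y Y)"
    have r: "factors J Y Y ?r" by (rule Cons.IH) (use Cons.prems in simp)
    have k: "\<iota> k \<in> rhom L (Ys ! k) Y" "\<pi> k \<in> rhom L Y (Ys ! k)" "Ys ! k \<in> J" using h Cons(2) Ys(1) by auto
    note [simp] = rhom_simps(1)[OF k(1)] rhom_simps(1)[OF k(2)] rhom_simps(1)[OF factors_rhom[OF r Y Y]]
    have eq: "(\<lambda>x\<in>carrier Y. ?r x \<oplus>\<^bsub>Y\<^esub> \<iota> k (\<pi> k x)) = (\<lambda>x\<in>carrier Y. compose (carrier Y) (\<iota> k) (\<pi> k) x \<oplus>\<^bsub>Y\<^esub> ?r x)"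
      by (intro restrict_ext) (simp add: compose_eq fg_a_comm del: mod_cat_simps)
    have "Ys ! k \<in> fgmod L" using k(3) J by blast
    from factors.step[OF r k(3) this k(2,1)]
    have "factors J Y Y (AddMor (mod_cat L) Y Y (Comp (mod_cat L) Y (Ys ! k) Y (\<iota> k) (\<pi> k)) ?r)"
      unfolding eq mod_cat_simps(6)[of Y Y _ ?r] mod_cat_simps(4)[of Y "Ys ! k"] .
    then show ?case unfolding foldr.simps o_apply .
  qed
  moreover have "set [0..<length Ys] \<subseteq> {..<length Ys}" by auto
  ultimately have "factors J Y Y (IdMor (mod_cat L) Y)" unfolding s[symmetric] by (simp only:)
  then have YJ: "Y \<in> acl J" using Y unfolding acl_def mod_cat_simps(3) by blast
  obtain X' where "direct_sum (mod_cat L) [X, X'] Y" using XY by (auto simp: direct_summand_def)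
  then obtain i p where ip: "X \<in> fgmod L" "i \<in> rhom L X Y" "p \<in> rhom L Y X" "compose (carrier X) p i = (\<lambda>x\<in>carrier X. x)"
    unfolding direct_sum_two by auto
  have "p (i x) = x" if "x \<in> carrier X" for x
    using fun_cong[OF ip(4), of x] that by (simp add: compose_eq)
  then show ?thesis by (rule acl_retract[OF YJ ip(1-3)])
qed

section \<open>Projective modules and free covers\<close>

lemma projective_lift:
  assumes "projective L P" "M \<in> fgmod L" "N \<in> fgmod L" "g \<in> rhom L M N" "f \<in> rhom L P N" "g ` carrier M = carrier N"
  shows "\<exists>h\<in>rhom L P M. \<forall>x\<in>carrier P. g (h x) = f x"
proof -
  obtain h where h: "h \<in> rhom L P M" "compose (carrier P) g h = f"
    using assms unfolding projective_def by blast
  have "g (h x) = f x" if "x \<in> carrier P" for x using fun_cong[OF h(2), of x] that by (simp add: compose_eq)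
  then show ?thesis using h(1) by blast
qed

lemma projective_fg: "projective L P \<Longrightarrow> P \<in> fgmod L"
  by (simp add: projective_def)

lemma projective_mod_sum:
  assumes P: "projective L P" and Q: "projective L Q"
  shows "projective L (mod_sum P Q)"
  unfolding projective_def
proof (intro conjI ballI impI)
  have [simp]: "P \<in> fgmod L" "Q \<in> fgmod L" using P Q by (simp_all add: projective_fg)
  show "mod_sum P Q \<in> fgmod L" by simp
  fix M N g f assume M [simp]: "M \<in> fgmod L" and N [simp]: "N \<in> fgmod L" and g: "g \<in> rhom L M N"
    and f: "f \<in> rhom L (mod_sum P Q) N" and s: "g ` carrier M = carrier N"
  note F = rhom_simps[OF f] and G = rhom_simps[OF g]
  have "(\<lambda>x\<in>carrier P. f ((\<lambda>x\<in>carrier P. spair x \<zero>\<^bsub>Q\<^esub>) x)) \<in> rhom L P N" "(\<lambda>x\<in>carrier Q. f ((\<lambda>x\<in>carrier Q. spair \<zero>\<^bsub>P\<^esub> x) x)) \<in> rhom L Q N"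
    by (intro rhom_comp[OF rhom_inl f] rhom_comp[OF rhom_inr f]; simp)+
  note i = this
  obtain h where h: "h \<in> rhom L P M" and h': "\<forall>x\<in>carrier P. g (h x) = (\<lambda>x\<in>carrier P. f ((\<lambda>x\<in>carrier P. spair x \<zero>\<^bsub>Q\<^esub>) x)) x"
    using projective_lift[OF P M N g i(1) s] by blast
  obtain k where k: "k \<in> rhom L Q M" and k': "\<forall>x\<in>carrier Q. g (k x) = (\<lambda>x\<in>carrier Q. f ((\<lambda>x\<in>carrier Q. spair \<zero>\<^bsub>P\<^esub> x) x)) x"
    using projective_lift[OF Q M N g i(2) s] by blast
  have gh: "g (h x) = f (spair x \<zero>\<^bsub>Q\<^esub>)" if "x \<in> carrier P" for x using h' that by simp
  have gk: "g (k x) = f (spair \<zero>\<^bsub>P\<^esub> x)" if "x \<in> carrier Q" for x using k' that by simp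
  let ?l = "\<lambda>z\<in>carrier (mod_sum P Q). h (sfst z) \<oplus>\<^bsub>M\<^esub> k (ssnd z)"
  note H = rhom_simps[OF h] and K = rhom_simps[OF k]
  have l: "?l \<in> rhom L (mod_sum P Q) M"
    by (rule rhomI) (simp_all add: H K agn fg_smult_add)
  have "compose (carrier (mod_sum P Q)) g ?l = f"
  proof (rule rhom_ext[OF rhom_compose[OF l g] f])
    fix z assume z: "z \<in> carrier (mod_sum P Q)"
    then have "g (h (sfst z)) \<oplus>\<^bsub>N\<^esub> g (k (ssnd z)) = f (spair (sfst z) \<zero>\<^bsub>Q\<^esub>) \<oplus>\<^bsub>N\<^esub> f (spair \<zero>\<^bsub>P\<^esub> (ssnd z))" using gh gk by simp
    also have "\<dots> = f (spair (sfst z) \<zero>\<^bsub>Q\<^esub> \<oplus>\<^bsub>mod_sum P Q\<^esub> spair \<zero>\<^bsub>P\<^esub> (ssnd z))" using z by (intro F(2)[symmetric]) simp_all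
    also have "\<dots> = f z" using z by simp
    finally show "compose (carrier (mod_sum P Q)) g ?l z = f z" using z by (simp add: compose_eq G H K)
  qed simp
  then show "\<exists>h\<in>rhom L (mod_sum P Q) M. compose (carrier (mod_sum P Q)) g h = f" using l by blast
qed

lemma projective_trivial:
  assumes "M \<in> fgmod L" "carrier M = {\<zero>\<^bsub>M\<^esub>}"
  shows "projective L M"
  unfolding projective_def
proof (intro conjI ballI impI)
  fix A N g f assume A: "A \<in> fgmod L" and N: "N \<in> fgmod L" and g: "g \<in> rhom L A N" and f: "f \<in> rhom L M N"
  let ?z = "\<lambda>x\<in>carrier M. \<zero>\<^bsub>A\<^esub>"
  have z: "?z \<in> rhom L M A" by (rule rhom_zero[OF assms(1) A])
  moreover have "compose (carrier M) g ?z = f"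
    using rhom_group(1)[OF f assms(1) N] rhom_group(1)[OF g A N] assms
    by (intro rhom_ext[OF rhom_compose[OF z g] f]) (simp_all add: compose_eq)
  ultimately show "\<exists>h\<in>rhom L M A. compose (carrier M) g h = f" by blast
qed fact

text \<open>F is the regular module, transported to sequences by \<open>fg_module_iso_seq\<close>.
  It is recorded only as a generator: the map taking the unit to x reaches x.\<close>

lemma regular_module:
  "\<exists>F\<in>fgmod L. \<forall>M\<in>fgmod L. \<forall>x\<in>carrier M. \<exists>h\<in>rhom L F M. x \<in> h ` carrier F"
proof -
  interpret L: ring L by (rule ring_L)
  define R :: "('a, 'a) module" where "R = \<lparr>carrier = carrier L, monoid.mult = undefined, one = undefined,
     zero = \<zero>\<^bsub>L\<^esub>, add = (\<oplus>\<^bsub>L\<^esub>), smult = (\<lambda>a x. x \<otimes>\<^bsub>L\<^esub> a)\<rparr>"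
  have Rs: "carrier R = carrier L" "\<zero>\<^bsub>R\<^esub> = \<zero>\<^bsub>L\<^esub>" "\<And>x y. x \<oplus>\<^bsub>R\<^esub> y = x \<oplus>\<^bsub>L\<^esub> y" "\<And>a x. a \<odot>\<^bsub>R\<^esub> x = x \<otimes>\<^bsub>L\<^esub> a"
    by (simp_all add: R_def)
  have ab: "abelian_group R"
    by (rule abelian_groupI) (auto simp: Rs L.a_ac intro: L.l_neg L.a_inv_closed)
  have rm: "right_module L R"
    using ab by (intro right_module.intro right_module_axioms.intro L.ring_axioms)
      (auto simp: Rs L.r_distr L.l_distr L.m_assoc)
  interpret R: right_module L R by (rule rm)
  have "fin_gen L R" unfolding fin_gen_def
  proof (intro exI[of _ "{\<one>\<^bsub>L\<^esub>}"] conjI allI impI)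
    fix H assume H: "submodule H L R \<and> {\<one>\<^bsub>L\<^esub>} \<subseteq> H"
    have "x \<in> H" if "x \<in> carrier L" for x
      using R.right_submoduleE(4)[OF conjunct1[OF H] that, of "\<one>\<^bsub>L\<^esub>"] H that by (simp add: Rs)
    then show "H = carrier R" using R.right_submoduleE(1)[OF conjunct1[OF H]] by (auto simp: Rs)
  qed (auto simp: Rs)
  from fg_module_iso_seq[OF rm this] obtain F f where F [simp]: "F \<in> fgmod L" and f: "f \<in> rhom L R F"
    and b: "bij_betw f (carrier R) (carrier F)" by blast
  note h = rhom_simps[OF f]
  define e where "e = inv_into (carrier R) f"
  have e: "e y \<in> carrier L" "f (e y) = y" if "y \<in> carrier F" for y
    using that b inv_into_into[of y f "carrier R"] f_inv_into_f[of y f "carrier R"]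
    by (auto simp: e_def bij_betw_def Rs)
  have ef: "e (f x) = x" if "x \<in> carrier L" for x
    using that b inv_into_f_f[of f "carrier R" x] by (auto simp: e_def bij_betw_def Rs)
  have ea: "e (x \<oplus>\<^bsub>F\<^esub> y) = e x \<oplus>\<^bsub>L\<^esub> e y" if "x \<in> carrier F" "y \<in> carrier F" for x y
    using h(2)[of "e x" "e y"] ef[of "e x \<oplus>\<^bsub>L\<^esub> e y"] e that by (simp add: Rs)
  have es: "e (a \<odot>\<^bsub>F\<^esub> x) = e x \<otimes>\<^bsub>L\<^esub> a" if "a \<in> carrier L" "x \<in> carrier F" for a x
    using h(3)[of a "e x"] ef[of "e x \<otimes>\<^bsub>L\<^esub> a"] e that by (simp add: Rs)
  have "\<exists>h\<in>rhom L F M. x \<in> h ` carrier F" if M: "M \<in> fgmod L" and x: "x \<in> carrier M" for M x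
  proof -
    interpret M: right_module L M by (rule fg_rm[OF M])
    have "(\<lambda>y\<in>carrier F. e y \<odot>\<^bsub>M\<^esub> x) \<in> rhom L F M"
      using M x e by (intro rhomI) (simp_all add: ea es M.ract_add_scalar M.ract_assoc)
    moreover have "f \<one>\<^bsub>L\<^esub> \<in> carrier F" using h(1)[of "\<one>\<^bsub>L\<^esub>"] by (simp add: Rs)
    then have "x \<in> (\<lambda>y\<in>carrier F. e y \<odot>\<^bsub>M\<^esub> x) ` carrier F"
      using ef[of "\<one>\<^bsub>L\<^esub>"] M.ract_one[OF x] by (intro image_eqI[of _ _ "f \<one>\<^bsub>L\<^esub>"]) simp_all
    ultimately show ?thesis by blast
  qed
  then show ?thesis using F by blast
qed

text \<open>A finite sum of copies of F maps onto P, one copy for each generator, and projectivity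
  splits this map.\<close>

lemma projective_acl:
  assumes F: "F \<in> fgmod L" and gen: "\<forall>M\<in>fgmod L. \<forall>x\<in>carrier M. \<exists>h\<in>rhom L F M. x \<in> h ` carrier F"
    and P: "projective L P"
  shows "P \<in> acl {F}"
proof -
  have PB [simp]: "P \<in> fgmod L" using P by (rule projective_fg)
  obtain S where S: "finite S" "S \<subseteq> carrier P" and Sm: "\<And>H. submodule H L P \<Longrightarrow> S \<subseteq> H \<Longrightarrow> H = carrier P"
    using PB unfolding fgmod_def fin_gen_def by auto
  have "\<exists>E\<in>acl {F}. \<exists>\<phi>\<in>rhom L E P. S \<subseteq> \<phi> ` carrier E" using S
  proof (induction S rule: finite_induct)
    case empty
    then show ?case using acl_trivial[OF zmod_fg zmod_simps(1)] rhom_zero[OF zmod_fg PB] by blast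
  next
    case (insert x S)
    then obtain E \<phi> where E: "E \<in> acl {F}" "\<phi> \<in> rhom L E P" "S \<subseteq> \<phi> ` carrier E" by blast
    obtain h where h: "h \<in> rhom L F P" "x \<in> h ` carrier F" using gen PB insert by blast
    have EB [simp]: "E \<in> fgmod L" by (rule acl_fg[OF E(1)])
    note [simp] = F
    let ?\<psi> = "\<lambda>z\<in>carrier (mod_sum E F). \<phi> (sfst z) \<oplus>\<^bsub>P\<^esub> h (ssnd z)"
    note H = rhom_simps[OF E(2)] rhom_simps[OF h(1)] rhom_group(1)[OF E(2) EB PB] rhom_group(1)[OF h(1) F PB]
    have "?\<psi> \<in> rhom L (mod_sum E F) P" by (rule rhomI) (simp_all add: H agn fg_smult_add)
    moreover have "insert x S \<subseteq> ?\<psi> ` carrier (mod_sum E F)"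
    proof
      fix y assume "y \<in> insert x S"
      then consider u where "u \<in> carrier E" "y = \<phi> u" | v where "v \<in> carrier F" "y = h v" using E(3) h(2) by auto
      then show "y \<in> ?\<psi> ` carrier (mod_sum E F)"
      proof cases
        case 1
        then show ?thesis by (intro image_eqI[of _ _ "spair u \<zero>\<^bsub>F\<^esub>"]) (simp_all add: H)
      next
        case 2
        then show ?thesis by (intro image_eqI[of _ _ "spair \<zero>\<^bsub>E\<^esub> v"]) (simp_all add: H)
      qed
    qed
    ultimately show ?case using acl_mod_sum[OF E(1) acl_base[OF _ F, of "{F}"]] by blast
  qed
  then obtain E \<phi> where E: "E \<in> acl {F}" "\<phi> \<in> rhom L E P" "S \<subseteq> \<phi> ` carrier E" by blast
  have s: "\<phi> ` carrier E = carrier P" by (rule Sm[OF image_submodule[OF E(2) acl_fg[OF E(1)] PB] E(3)])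
  obtain h where h: "h \<in> rhom L P E" and e: "\<forall>x\<in>carrier P. \<phi> (h x) = (\<lambda>x\<in>carrier P. x) x"
    using projective_lift[OF P acl_fg[OF E(1)] PB E(2) rhom_id[OF PB] s] by blast
  show ?thesis by (rule acl_retract[OF E(1) PB h E(2)]) (use e in simp)
qed

section \<open>Syzygies\<close>

lemma short_exactD:
  assumes s: "short_exact L A B C f g"
  shows "f \<in> rhom L A B" "g \<in> rhom L B C"
    and "\<And>x y. x \<in> carrier A \<Longrightarrow> y \<in> carrier A \<Longrightarrow> f x = f y \<Longrightarrow> x = y"
    and "\<And>x. x \<in> carrier A \<Longrightarrow> g (f x) = \<zero>\<^bsub>C\<^esub>"
    and "\<And>y. y \<in> carrier B \<Longrightarrow> g y = \<zero>\<^bsub>C\<^esub> \<Longrightarrow> \<exists>x\<in>carrier A. y = f x"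
    and "\<And>z. z \<in> carrier C \<Longrightarrow> \<exists>y\<in>carrier B. z = g y"
proof -
  have k: "f ` carrier A = {x \<in> carrier B. g x = \<zero>\<^bsub>C\<^esub>}" using s by (simp add: short_exact_def a_kernel_eq)
  show "f \<in> rhom L A B" "g \<in> rhom L B C" using s by (auto simp: short_exact_def)
  show "x = y" if "x \<in> carrier A" "y \<in> carrier A" "f x = f y" for x y
    using s that by (auto simp: short_exact_def dest: inj_onD)
  show "g (f x) = \<zero>\<^bsub>C\<^esub>" if "x \<in> carrier A" for x using k that by blast
  show "\<exists>x\<in>carrier A. y = f x" if "y \<in> carrier B" "g y = \<zero>\<^bsub>C\<^esub>" for y using k that by blast
  show "\<exists>y\<in>carrier B. z = g y" if "z \<in> carrier C" for z using s that unfolding short_exact_def by blast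
qed

lemma short_exactI:
  assumes f: "f \<in> rhom L A B" and g: "g \<in> rhom L B C" and [simp]: "A \<in> fgmod L" "B \<in> fgmod L"
    and inj: "\<And>x. x \<in> carrier A \<Longrightarrow> f x = \<zero>\<^bsub>B\<^esub> \<Longrightarrow> x = \<zero>\<^bsub>A\<^esub>"
    and z: "\<And>x. x \<in> carrier A \<Longrightarrow> g (f x) = \<zero>\<^bsub>C\<^esub>"
    and k: "\<And>y. y \<in> carrier B \<Longrightarrow> g y = \<zero>\<^bsub>C\<^esub> \<Longrightarrow> \<exists>x\<in>carrier A. y = f x"
    and s: "\<And>z. z \<in> carrier C \<Longrightarrow> \<exists>y\<in>carrier B. z = g y"
  shows "short_exact L A B C f g"
  unfolding short_exact_def a_kernel_eq
proof (intro conjI f g)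
  show "inj_on f (carrier A)"
  proof
    fix x y assume xy: "x \<in> carrier A" "y \<in> carrier A" "f x = f y"
    have "f (x \<ominus>\<^bsub>A\<^esub> y) = \<zero>\<^bsub>B\<^esub>" using xy rhom_simps(1)[OF f] rhom_group(3)[OF f] by simp
    then have "x \<ominus>\<^bsub>A\<^esub> y = \<zero>\<^bsub>A\<^esub>" using xy inj by simp
    then show "x = y" using xy fg_minus_eq_zero[of A x y] by simp
  qed
  show "f ` carrier A = {x \<in> carrier B. g x = \<zero>\<^bsub>C\<^esub>}" using z k rhom_simps(1)[OF f] by blast
  show "g ` carrier B = carrier C" using s rhom_simps(1)[OF g] by blast
qed

text \<open>An extension \<open>M\<close> of a projective \<open>Q\<close> by \<open>N\<close> splits, so a presentation of \<open>N\<close> extends to one of \<open>M\<close>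
  with the same kernel.\<close>

lemma presentation_extend:
  assumes ab: "short_exact L A B N f g" and nm: "short_exact L N M Q i p" and Q: "projective L Q"
    and [simp]: "A \<in> fgmod L" "B \<in> fgmod L" "N \<in> fgmod L" "M \<in> fgmod L"
  shows "\<exists>f g. short_exact L A (mod_sum B Q) M f g"
proof -
  have QB [simp]: "Q \<in> fgmod L" using Q by (rule projective_fg)
  note s = short_exactD[OF ab] and t = short_exactD[OF nm]
  have "p ` carrier M = carrier Q" using nm by (simp add: short_exact_def)
  from projective_lift[OF Q \<open>M \<in> fgmod L\<close> QB t(2) rhom_id[OF QB] this]
  obtain \<sigma> where \<sigma>1: "\<sigma> \<in> rhom L Q M" and e: "\<forall>x\<in>carrier Q. p (\<sigma> x) = (\<lambda>x\<in>carrier Q. x) x" by blast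
  have \<sigma>: "\<sigma> \<in> rhom L Q M" "\<And>x. x \<in> carrier Q \<Longrightarrow> p (\<sigma> x) = x" using \<sigma>1 e by simp_all
  note F = rhom_simps[OF s(1)] rhom_group[OF s(1) \<open>A \<in> fgmod L\<close> \<open>B \<in> fgmod L\<close>]
    and G = rhom_simps[OF s(2)] rhom_group[OF s(2) \<open>B \<in> fgmod L\<close> \<open>N \<in> fgmod L\<close>]
    and I = rhom_simps[OF t(1)] rhom_group[OF t(1) \<open>N \<in> fgmod L\<close> \<open>M \<in> fgmod L\<close>]
    and P = rhom_simps[OF t(2)] rhom_group[OF t(2) \<open>M \<in> fgmod L\<close> QB]
    and S = rhom_simps[OF \<sigma>(1)] rhom_group[OF \<sigma>(1) QB \<open>M \<in> fgmod L\<close>]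
  note [simp] = F G I P S
  let ?f = "\<lambda>x\<in>carrier A. spair (f x) \<zero>\<^bsub>Q\<^esub>" and ?g = "\<lambda>z\<in>carrier (mod_sum B Q). i (g (sfst z)) \<oplus>\<^bsub>M\<^esub> \<sigma> (ssnd z)"
  have "short_exact L A (mod_sum B Q) M ?f ?g"
  proof (rule short_exactI)
    show "?f \<in> rhom L A (mod_sum B Q)" by (rule rhomI) simp_all
    show "?g \<in> rhom L (mod_sum B Q) M" by (rule rhomI) (simp_all add: agn fg_smult_add)
    show "x = \<zero>\<^bsub>A\<^esub>" if "x \<in> carrier A" "?f x = \<zero>\<^bsub>mod_sum B Q\<^esub>" for x
      using that s(3)[of x "\<zero>\<^bsub>A\<^esub>"] by simp
    show "?g (?f x) = \<zero>\<^bsub>M\<^esub>" if "x \<in> carrier A" for x using that s(4) by simp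
    show "\<exists>x\<in>carrier A. z = ?f x" if z: "z \<in> carrier (mod_sum B Q)" "?g z = \<zero>\<^bsub>M\<^esub>" for z
    proof -
      have e: "i (g (sfst z)) \<oplus>\<^bsub>M\<^esub> \<sigma> (ssnd z) = \<zero>\<^bsub>M\<^esub>" and zc: "sfst z \<in> carrier B" "ssnd z \<in> carrier Q" using z by simp_all
      have "p (i (g (sfst z)) \<oplus>\<^bsub>M\<^esub> \<sigma> (ssnd z)) = ssnd z" using zc t(4) \<sigma>(2) by simp
      then have z2: "ssnd z = \<zero>\<^bsub>Q\<^esub>" unfolding e by simp
      then have "i (g (sfst z)) = i \<zero>\<^bsub>N\<^esub>" using e zc by simp
      then have "g (sfst z) = \<zero>\<^bsub>N\<^esub>" using t(3)[of "g (sfst z)" "\<zero>\<^bsub>N\<^esub>"] zc by simp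
      then obtain x where "x \<in> carrier A" "sfst z = f x" using s(5) zc by blast
      then show ?thesis using z2 spair_simps(3)[of z] by (intro bexI[of _ x]) simp_all
    qed
    show "\<exists>z\<in>carrier (mod_sum B Q). m = ?g z" if m: "m \<in> carrier M" for m
    proof -
      have "p (m \<ominus>\<^bsub>M\<^esub> \<sigma> (p m)) = \<zero>\<^bsub>Q\<^esub>" using m \<sigma>(2) by simp
      then obtain n where n: "n \<in> carrier N" "m \<ominus>\<^bsub>M\<^esub> \<sigma> (p m) = i n" using t(5)[of "m \<ominus>\<^bsub>M\<^esub> \<sigma> (p m)"] m by auto
      obtain b where b: "b \<in> carrier B" "n = g b" using s(6)[OF n(1)] by blast
      have "m = i (g b) \<oplus>\<^bsub>M\<^esub> \<sigma> (p m)" unfolding b(2)[symmetric] n(2)[symmetric] using m by (simp add: agn)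
      then show ?thesis using b m by (intro bexI[of _ "spair b (p m)"]) simp_all
    qed
  qed simp_all
  then show ?thesis by blast
qed

text \<open>n projective presentations followed by one with terms in \<open>acl J\<close>. They are
  arbitrary presentations instead of projective covers because the kernels produced in
  \<open>resolved_reduce\<close> are syzygies only up to projective summands.\<close>

fun stage :: "'a smod set \<Rightarrow> nat \<Rightarrow> 'a smod \<Rightarrow> bool" where
  "stage J 0 M \<longleftrightarrow> (\<exists>V1\<in>acl J. \<exists>V0\<in>acl J. \<exists>f g. short_exact L V1 V0 M f g)"
| "stage J (Suc n) M \<longleftrightarrow> (\<exists>K\<in>fgmod L. \<exists>P f g. projective L P \<and> stage J n K \<and> short_exact L K P M f g)"

text \<open>The projective Q is absorbed into the middle term of the first presentation. At stage 0
  this term must stay in \<open>acl J\<close>, whence the assumption on projectives.\<close>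

lemma stage_extend:
  assumes J: "\<And>P. projective L P \<Longrightarrow> P \<in> acl J" and N: "stage J n N" and s: "short_exact L N M Q i p" and Q: "projective L Q"
    and [simp]: "N \<in> fgmod L" "M \<in> fgmod L"
  shows "stage J n M"
proof (cases n)
  case 0
  then obtain V1 V0 f g where V: "V1 \<in> acl J" "V0 \<in> acl J" "short_exact L V1 V0 N f g" using N by auto
  obtain f g where "short_exact L V1 (mod_sum V0 Q) M f g" using presentation_extend[OF V(3) s Q] V by auto
  then show ?thesis using V acl_mod_sum[OF V(2) J[OF Q]] 0 by auto
next
  case (Suc k)
  then obtain K P f g where V: "K \<in> fgmod L" "projective L P" "stage J k K" "short_exact L K P N f g" using N by auto
  obtain f g where "short_exact L K (mod_sum P Q) M f g" using presentation_extend[OF V(4) s Q] V projective_fg by auto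
  then show ?thesis using V projective_mod_sum[OF V(2) Q] Suc by auto
qed

lemma short_exact_trivial:
  assumes [simp]: "M \<in> fgmod L" and M: "carrier M = {\<zero>\<^bsub>M\<^esub>}"
  shows "short_exact L zmod zmod M (\<lambda>x\<in>carrier zmod. \<zero>\<^bsub>zmod\<^esub>) (\<lambda>x\<in>carrier zmod. \<zero>\<^bsub>M\<^esub>)"
  using M by (intro short_exactI rhom_zero) auto

lemma stage_trivial:
  assumes "M \<in> fgmod L" "carrier M = {\<zero>\<^bsub>M\<^esub>}"
  shows "stage J n M"
  using assms
proof (induction n arbitrary: M)
  case 0
  then show ?case using short_exact_trivial acl_trivial[OF zmod_fg zmod_simps(1)] unfolding stage.simps by blast
next
  case (Suc n)
  then show ?case using short_exact_trivial projective_trivial[OF zmod_fg zmod_simps(1)] Suc.IH[OF zmod_fg zmod_simps(1)]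
    zmod_fg unfolding stage.simps by blast
qed

text \<open>The last clause assigns zero terms to zero modules. Presentations chosen degree by
  degree for a bounded complex then form bounded families; \<open>stage_cover\<close> does the same
  for covers.\<close>

lemma stage_presentation:
  assumes "stage J 0 M" "M \<in> fgmod L"
  shows "\<exists>A B f g. A \<in> acl J \<and> B \<in> acl J \<and> short_exact L A B M f g \<and>
    (carrier M = {\<zero>\<^bsub>M\<^esub>} \<longrightarrow> carrier A = {\<zero>\<^bsub>A\<^esub>} \<and> carrier B = {\<zero>\<^bsub>B\<^esub>})"
proof (cases "carrier M = {\<zero>\<^bsub>M\<^esub>}")
  case True
  show ?thesis
    by (rule exI[of _ zmod], rule exI[of _ zmod]) (use short_exact_trivial[OF assms(2) True] acl_trivial[OF zmod_fg zmod_simps(1)] in auto)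
qed (use assms in auto)

lemma stage_cover:
  assumes "stage J (Suc n) M" "M \<in> fgmod L"
  shows "\<exists>K P f g. K \<in> fgmod L \<and> projective L P \<and> stage J n K \<and> short_exact L K P M f g \<and>
    (carrier M = {\<zero>\<^bsub>M\<^esub>} \<longrightarrow> carrier P = {\<zero>\<^bsub>P\<^esub>})"
proof (cases "carrier M = {\<zero>\<^bsub>M\<^esub>}")
  case True
  show ?thesis
    by (rule exI[of _ zmod], rule exI[of _ zmod])
      (use short_exact_trivial[OF assms(2) True] projective_trivial[OF zmod_fg zmod_simps(1)] stage_trivial[OF zmod_fg zmod_simps(1)] in auto)
qed (use assms in auto)

text \<open>Each of the n covers counts as one presentation. The outermost syzygy is taken off
  first, so j has to vary in the induction.\<close>

lemma syzygy_stage: "syzygy L n M K \<Longrightarrow> M \<in> fgmod L \<Longrightarrow> stage J j K \<Longrightarrow> stage J (j + n) M"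
proof (induction n arbitrary: K j)
  case 0
  then show ?case by simp
next
  case (Suc n)
  then obtain N P i p where s: "syzygy L n M N" "K \<in> fgmod L" "projective_cover L N P p" "short_exact L K P N i p" by auto
  have "stage J (Suc j) N" using s(2-4) Suc.prems(3) by (auto simp: projective_cover_def)
  then have "stage J (Suc j + n) M" by (rule Suc.IH[OF s(1) Suc.prems(2)])
  then show ?case by (simp del: stage.simps)
qed

lemma igusa_todorov_stage:
  assumes "igusa_todorov n L"
  shows "\<exists>M0\<in>fgmod L. (\<forall>P. projective L P \<longrightarrow> P \<in> acl {M0}) \<and> (\<forall>M\<in>fgmod L. stage {M0} n M)"
proof -
  obtain V where V [simp]: "V \<in> fgmod L" and VK: "\<And>M. M \<in> fgmod L \<Longrightarrow> \<exists>K. syzygy L n M K \<and>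
     (\<exists>V1\<in>add_closure (mod_cat L) {V}. \<exists>V0\<in>add_closure (mod_cat L) {V}. \<exists>f g. short_exact L V1 V0 K f g)"
    using assms unfolding igusa_todorov_def by blast
  obtain F where F [simp]: "F \<in> fgmod L" and Fg: "\<forall>M\<in>fgmod L. \<forall>x\<in>carrier M. \<exists>h\<in>rhom L F M. x \<in> h ` carrier F"
    using regular_module by blast
  let ?M = "mod_sum V F"
  have M: "?M \<in> acl {?M}" by (rule acl_base) simp_all
  have "V \<in> acl {?M}" by (rule acl_retract[OF M _ rhom_inl rhom_sfst]) simp_all
  then have VV: "acl {V} \<subseteq> acl {?M}" by (intro acl_trans) simp
  have "F \<in> acl {?M}" by (rule acl_retract[OF M _ rhom_inr rhom_ssnd]) simp_all
  then have FF: "acl {F} \<subseteq> acl {?M}" by (intro acl_trans) simp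
  have "stage {?M} n M" if "M \<in> fgmod L" for M
  proof -
    obtain K V1 V0 f g where K: "syzygy L n M K" "V1 \<in> add_closure (mod_cat L) {V}" "V0 \<in> add_closure (mod_cat L) {V}"
      "short_exact L V1 V0 K f g" using VK[OF \<open>M \<in> fgmod L\<close>] by blast
    have "V1 \<in> acl {?M}" "V0 \<in> acl {?M}" using K(2,3) add_closure_acl[of _ "{V}"] VV by auto
    then have "stage {?M} 0 K" using K(4) by auto
    then show ?thesis using syzygy_stage[OF K(1) that, of "{?M}" 0] by simp
  qed
  moreover have "P \<in> acl {?M}" if "projective L P" for P using projective_acl[OF F Fg that] FF by blast
  ultimately show ?thesis using mod_sum_fg[OF V F] by blast
qed

section \<open>Complexes with zero differential\<close>

definition gcpx :: "(int \<Rightarrow> 'a smod) \<Rightarrow> 'a cpx" where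
  "gcpx M = \<lparr>Deg = M, Dif = (\<lambda>i. \<lambda>x\<in>carrier (M i). \<zero>\<^bsub>M (i + 1)\<^esub>)\<rparr>"

definition graded :: "(int \<Rightarrow> 'a smod) \<Rightarrow> bool" where
  "graded M \<longleftrightarrow> (\<forall>i. M i \<in> fgmod L) \<and> finite {i. carrier (M i) \<noteq> {\<zero>\<^bsub>M i\<^esub>}}"

lemma gcpx_Deg [simp]: "Deg (gcpx M) i = M i"
  by (simp add: gcpx_def)

lemma gcpx_Dif [simp]: "x \<in> carrier (M i) \<Longrightarrow> Dif (gcpx M) i x = \<zero>\<^bsub>M (i + 1)\<^esub>"
  by (simp add: gcpx_def)

lemma graded_fg [simp]: "graded M \<Longrightarrow> M i \<in> fgmod L"
  by (simp add: graded_def)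

lemma gcpx_bcpx [simp]:
  assumes M: "graded M"
  shows "gcpx M \<in> bcpx L"
proof (rule bcpxI)
  show "finite {i. carrier (M i) \<noteq> {\<zero>\<^bsub>M i\<^esub>}}" using M by (simp add: graded_def)
  show "Dif (gcpx M) i \<in> rhom L (Deg (gcpx M) i) (Deg (gcpx M) (i + 1))" for i
    using M unfolding gcpx_def cpx.simps by (intro rhom_zero graded_fg)
qed (use M in auto)

lemma gcpx_arr:
  assumes "graded M" "graded N" "\<And>i. f i \<in> rhom L (M i) (N i)"
  shows "arr (gcpx M) (gcpx N) f"
  unfolding arr_def
proof (intro conjI chain_mapsI)
  fix i x assume "x \<in> carrier (Deg (gcpx M) i)"
  then show "f (i + 1) (Dif (gcpx M) i x) = Dif (gcpx N) i (f i x)"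
    using rhom_simps(1)[OF assms(3)] rhom_group(1)[OF assms(3)] assms(1,2) by simp
qed (use assms in auto)

text \<open>The sign of the shift acts on zero maps, so shifting only renumbers the degrees.\<close>

lemma cshift_gcpx:
  assumes M: "graded M"
  shows "cshift k (gcpx M) = gcpx (\<lambda>i. M (i + k))"
proof -
  have e: "i + k + 1 = i + 1 + k" for i by simp
  have "Dif (cshift k (gcpx M)) i = Dif (gcpx (\<lambda>i. M (i + k))) i" for i
    unfolding cshift_def cpx.simps gcpx_def[of "\<lambda>i. M (i + k)"] gcpx_Deg
    using M by (intro restrict_ext) (simp add: e)
  moreover have "Deg (cshift k (gcpx M)) = Deg (gcpx (\<lambda>i. M (i + k)))" by (simp add: cshift_def fun_eq_iff)
  ultimately show ?thesis by (intro cpx.equality ext) simp_all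
qed

lemma graded_shift:
  assumes "graded M"
  shows "graded (\<lambda>i. M (i + k))"
proof -
  have "{i. carrier (M (i + k)) \<noteq> {\<zero>\<^bsub>M (i + k)\<^esub>}} = (\<lambda>i. i - k) ` {i. carrier (M i) \<noteq> {\<zero>\<^bsub>M i\<^esub>}}"
  proof (intro equalityI subsetI)
    fix i assume "i \<in> {i. carrier (M (i + k)) \<noteq> {\<zero>\<^bsub>M (i + k)\<^esub>}}"
    then show "i \<in> (\<lambda>i. i - k) ` {i. carrier (M i) \<noteq> {\<zero>\<^bsub>M i\<^esub>}}" by (intro image_eqI[of _ _ "i + k"]) simp_all
  qed auto
  then show ?thesis using assms by (simp add: graded_def)
qed

section \<open>Direct sums of complexes\<close>

text \<open>Complexes before localisation. Biproducts are verified here element by element and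
  carried over to \<open>D\<close> by \<open>direct_sum_dmor\<close>.\<close>

definition cpx_cat :: "('a cpx, 'a cmap) addcat" where
  "cpx_cat = \<lparr>Ob = bcpx L, Hom = chain_maps L, IdMor = cid, Comp = (\<lambda>X Y Z g f. ccomp X g f),
     ZeroMor = czero, AddMor = cadd\<rparr>"

lemma cpx_cat_simps [simp]:
  "Ob cpx_cat = bcpx L" "Hom cpx_cat = chain_maps L" "IdMor cpx_cat = cid" "Comp cpx_cat X Y Z = ccomp X"
  "ZeroMor cpx_cat = czero" "AddMor cpx_cat = cadd"
  by (auto simp: cpx_cat_def)

lemma direct_sumI:
  assumes "set Xs \<subseteq> Ob C" "Y \<in> Ob C"
    and "\<forall>k<length Xs. \<iota> k \<in> Hom C (Xs ! k) Y \<and> \<pi> k \<in> Hom C Y (Xs ! k)"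
    and "\<forall>k<length Xs. \<forall>l<length Xs. Comp C (Xs ! l) Y (Xs ! k) (\<pi> k) (\<iota> l) =
        (if k = l then IdMor C (Xs ! k) else ZeroMor C (Xs ! l) (Xs ! k))"
    and "foldr (\<lambda>k. AddMor C Y Y (Comp C Y (Xs ! k) Y (\<iota> k) (\<pi> k))) [0..<length Xs] (ZeroMor C Y Y) = IdMor C Y"
  shows "direct_sum C Xs Y"
  using assms unfolding direct_sum_def by blast

text \<open>\<open>dmor\<close> respects composition, sums, identities and zero maps, hence also the
  biproduct equations.\<close>

lemma direct_sum_dmor:
  assumes s: "direct_sum cpx_cat Xs Y"
  shows "direct_sum D Xs Y"
proof -
  obtain \<iota> \<pi> where o: "set Xs \<subseteq> bcpx L" "Y \<in> bcpx L"
    and h: "\<forall>k<length Xs. \<iota> k \<in> chain_maps L (Xs ! k) Y \<and> \<pi> k \<in> chain_maps L Y (Xs ! k)"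
    and e: "\<forall>k<length Xs. \<forall>l<length Xs. ccomp (Xs ! l) (\<pi> k) (\<iota> l) =
        (if k = l then cid (Xs ! k) else czero (Xs ! l) (Xs ! k))"
    and f: "foldr (\<lambda>k. cadd Y Y (ccomp Y (\<iota> k) (\<pi> k))) [0..<length Xs] (czero Y Y) = cid Y"
    using s unfolding direct_sum_def cpx_cat_simps by blast
  have a: "arr (Xs ! k) Y (\<iota> k)" "arr Y (Xs ! k) (\<pi> k)" if "k < length Xs" for k
    using that h o nth_mem[OF that] by (auto simp: arr_def)
  let ?\<iota> = "\<lambda>k. dmor L (Xs ! k) Y (\<iota> k)" and ?\<pi> = "\<lambda>k. dmor L Y (Xs ! k) (\<pi> k)"
  have fold: "foldr (\<lambda>k. dadd L Y Y (dcomp L Y (Xs ! k) Y (?\<iota> k) (?\<pi> k))) ks (dmor L Y Y (czero Y Y)) =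
      dmor L Y Y (foldr (\<lambda>k. cadd Y Y (ccomp Y (\<iota> k) (\<pi> k))) ks (czero Y Y)) \<and>
      arr Y Y (foldr (\<lambda>k. cadd Y Y (ccomp Y (\<iota> k) (\<pi> k))) ks (czero Y Y))"
    if "set ks \<subseteq> {..<length Xs}" for ks
    using that
  proof (induction ks)
    case Nil
    then show ?case using arr_zero o by simp
  next
    case (Cons k ks)
    let ?r = "foldr (\<lambda>k. cadd Y Y (ccomp Y (\<iota> k) (\<pi> k))) ks (czero Y Y)"
    have k: "arr (Xs ! k) Y (\<iota> k)" "arr Y (Xs ! k) (\<pi> k)" using a Cons.prems by auto
    have c: "arr Y Y (ccomp Y (\<iota> k) (\<pi> k))" by (rule arr_comp[OF k(2,1)])
    have r: "foldr (\<lambda>k. dadd L Y Y (dcomp L Y (Xs ! k) Y (?\<iota> k) (?\<pi> k))) ks (dmor L Y Y (czero Y Y)) = dmor L Y Y ?r"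
      "arr Y Y ?r" using Cons by simp_all
    show ?case using dadd_dmor[OF c r(2)] arr_add[OF c r(2)] r(1) dcomp_dmor[OF k(2,1)] by simp
  qed
  have "set [0..<length Xs] \<subseteq> {..<length Xs}" by auto
  from fold[OF this] have F: "foldr (\<lambda>k. dadd L Y Y (dcomp L Y (Xs ! k) Y (?\<iota> k) (?\<pi> k))) [0..<length Xs] (dmor L Y Y (czero Y Y)) = dmor L Y Y (cid Y)"
    unfolding f by blast
  have C: "dcomp L (Xs ! l) Y (Xs ! k) (?\<pi> k) (?\<iota> l) = (if k = l then dmor L (Xs ! k) (Xs ! k) (cid (Xs ! k)) else dmor L (Xs ! l) (Xs ! k) (czero (Xs ! l) (Xs ! k)))"
    if "k < length Xs" "l < length Xs" for k l
    using dcomp_dmor[OF a(1)[OF that(2)] a(2)[OF that(1)]] e that by simp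
  have H: "?\<iota> k \<in> Hom D (Xs ! k) Y \<and> ?\<pi> k \<in> Hom D Y (Xs ! k)" if "k < length Xs" for k
    using dmor_Hom a[OF that] by blast
  show ?thesis
  proof (intro direct_sumI[of _ D _ ?\<iota> ?\<pi>] allI impI)
    show "set Xs \<subseteq> Ob D" "Y \<in> Ob D" using o by simp_all
    show "foldr (\<lambda>k. AddMor D Y Y (Comp D Y (Xs ! k) Y (?\<iota> k) (?\<pi> k))) [0..<length Xs] (ZeroMor D Y Y) = IdMor D Y"
      unfolding D_simps by (rule F)
    show "Comp D (Xs ! l) Y (Xs ! k) (?\<pi> k) (?\<iota> l) = (if k = l then IdMor D (Xs ! k) else ZeroMor D (Xs ! l) (Xs ! k))"
      if "k < length Xs" "l < length Xs" for k l unfolding D_simps by (rule C[OF that])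
  qed (use H in blast)+
qed

text \<open>The zero twist, by which direct sums of complexes become twisted sums and inherit their
  lemmas.\<close>

definition ztw :: "'a cpx \<Rightarrow> 'a cpx \<Rightarrow> 'a cmap" where
  "ztw A B = (\<lambda>i. \<lambda>x\<in>carrier (Deg A i). \<zero>\<^bsub>Deg B (i + 1)\<^esub>)"

lemma ztw_apply [simp]: "x \<in> carrier (Deg A i) \<Longrightarrow> ztw A B i x = \<zero>\<^bsub>Deg B (i + 1)\<^esub>"
  by (simp add: ztw_def)

lemma ztw_twists [simp]:
  assumes [simp]: "A \<in> bcpx L" "B \<in> bcpx L"
  shows "ztw A B \<in> twists A B"
proof (rule twistsI)
  show "ztw A B i \<in> rhom L (Deg A i) (Deg B (i + 1))" for i
    unfolding ztw_def by (rule rhom_zero) simp_all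
qed (use dif_zero[OF assms(2)] in simp)

abbreviation csum :: "'a cpx \<Rightarrow> 'a cpx \<Rightarrow> 'a cpx" where
  "csum A B \<equiv> tw A B (ztw A B)"

lemma csum_incl:
  assumes [simp]: "A \<in> bcpx L" "B \<in> bcpx L"
  shows "arr A (csum A B) (\<lambda>i. \<lambda>x\<in>carrier (Deg A i). spair x \<zero>\<^bsub>Deg B i\<^esub>)"
  unfolding arr_def
proof (intro conjI chain_mapsI)
  show "(\<lambda>x\<in>carrier (Deg A i). spair x \<zero>\<^bsub>Deg B i\<^esub>) \<in> rhom L (Deg A i) (Deg (csum A B) i)" for i
    by (rule rhomI) simp_all
qed simp_all

lemma csum_proj:
  assumes [simp]: "A \<in> bcpx L" "B \<in> bcpx L"
  shows "arr (csum A B) B (\<lambda>i. \<lambda>z\<in>carrier (Deg (csum A B) i). ssnd z)"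
  unfolding arr_def
proof (intro conjI chain_mapsI)
  show "(\<lambda>z\<in>carrier (Deg (csum A B) i). ssnd z) \<in> rhom L (Deg (csum A B) i) (Deg B i)" for i
    by (rule rhomI) simp_all
qed simp_all

lemma direct_sum_Cons:
  assumes B [simp]: "B \<in> bcpx L" and s: "direct_sum cpx_cat Ys Y"
  shows "direct_sum cpx_cat (B # Ys) (csum B Y)"
proof -
  obtain \<iota> \<pi> where o: "set Ys \<subseteq> bcpx L" and Y [simp]: "Y \<in> bcpx L"
    and h: "\<forall>k<length Ys. \<iota> k \<in> chain_maps L (Ys ! k) Y \<and> \<pi> k \<in> chain_maps L Y (Ys ! k)"
    and e: "\<forall>k<length Ys. \<forall>l<length Ys. ccomp (Ys ! l) (\<pi> k) (\<iota> l) =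
        (if k = l then cid (Ys ! k) else czero (Ys ! l) (Ys ! k))"
    and f: "foldr (\<lambda>k. cadd Y Y (ccomp Y (\<iota> k) (\<pi> k))) [0..<length Ys] (czero Y Y) = cid Y"
    using s unfolding direct_sum_def cpx_cat_simps by blast
  have yb [simp]: "Ys ! k \<in> bcpx L" if "k < length Ys" for k using o nth_mem[OF that] by blast
  let ?Z = "csum B Y"
  have Z [simp]: "?Z \<in> bcpx L" by simp
  define l where "l = (\<lambda>i. \<lambda>x\<in>carrier (Deg B i). spair x \<zero>\<^bsub>Deg Y i\<^esub>)"
  define q where "q = (\<lambda>i. \<lambda>z\<in>carrier (Deg ?Z i). ssnd z)"
  have l: "arr B ?Z l" and q: "arr ?Z Y q" unfolding l_def q_def by (rule csum_incl[OF B Y], rule csum_proj[OF B Y])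
  have r: "arr Y ?Z (tincl B Y)" and p: "arr ?Z B (tproj B Y)" by (simp_all add: arr_def tincl_chain tproj_chain)
  have la [simp]: "l i x = spair x \<zero>\<^bsub>Deg Y i\<^esub>" if "x \<in> carrier (Deg B i)" for i x using that by (simp add: l_def)
  have qa [simp]: "q i z = ssnd z" if "sfst z \<in> carrier (Deg B i)" "ssnd z \<in> carrier (Deg Y i)" for i z using that by (simp add: q_def)
  define I where "I k = (case k of 0 \<Rightarrow> l | Suc k \<Rightarrow> ccomp (Ys ! k) (tincl B Y) (\<iota> k))" for k
  define J where "J k = (case k of 0 \<Rightarrow> tproj B Y | Suc k \<Rightarrow> ccomp ?Z (\<pi> k) q)" for k
  have a: "arr (Ys ! k) Y (\<iota> k)" "arr Y (Ys ! k) (\<pi> k)" if "k < length Ys" for k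
    using that h by (auto simp: arr_def)
  have IJ: "arr ((B # Ys) ! k) ?Z (I k)" "arr ?Z ((B # Ys) ! k) (J k)" if "k < length (B # Ys)" for k
    using that l p arr_comp[OF a(1) r] arr_comp[OF q a(2)] by (cases k; simp add: I_def J_def)+
  have am: "\<iota> k i x \<in> carrier (Deg Y i)" if "k < length Ys" "x \<in> carrier (Deg (Ys ! k) i)" for k i x
    using chmap(1)[of "\<iota> k" "Ys ! k" Y] h that by simp
  have am2: "\<pi> k i x \<in> carrier (Deg (Ys ! k) i)" "\<pi> k i \<zero>\<^bsub>Deg Y i\<^esub> = \<zero>\<^bsub>Deg (Ys ! k) i\<^esub>" if "k < length Ys" "x \<in> carrier (Deg Y i)" for k i x
    using chmap(1,5)[of "\<pi> k" Y "Ys ! k"] h that by simp_all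
  have comp: "ccomp ((B # Ys) ! m) (J k) (I m) = (if k = m then cid ((B # Ys) ! k) else czero ((B # Ys) ! m) ((B # Ys) ! k))"
    if k: "k < length (B # Ys)" and m: "m < length (B # Ys)" for k m
  proof -
    have t: "arr ((B # Ys) ! m) ((B # Ys) ! k) (if k = m then cid ((B # Ys) ! k) else czero ((B # Ys) ! m) ((B # Ys) ! k))"
      using arr_id arr_zero arr_objs(1)[OF IJ(1)[OF k]] arr_objs(1)[OF IJ(1)[OF m]] by auto
    show ?thesis
    proof (rule arr_ext[OF arr_comp[OF IJ(1)[OF m] IJ(2)[OF k]] t])
      fix i x assume x: "x \<in> carrier (Deg ((B # Ys) ! m) i)"
      show "ccomp ((B # Ys) ! m) (J k) (I m) i x = (if k = m then cid ((B # Ys) ! k) else czero ((B # Ys) ! m) ((B # Ys) ! k)) i x"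
      proof (cases m)
        case m0: 0
        then show ?thesis using x k am2(2)[of _ "\<zero>\<^bsub>Deg Y i\<^esub>" i] by (cases k) (simp_all add: I_def J_def)
      next
        case ms: (Suc m')
        show ?thesis
        proof (cases k)
          case 0
          then show ?thesis using x ms m am by (simp add: I_def J_def)
        next
          case (Suc k')
          have "ccomp (Ys ! m') (\<pi> k') (\<iota> m') i x = (if k' = m' then cid (Ys ! k') else czero (Ys ! m') (Ys ! k')) i x"
            using e Suc ms k m by simp
          then show ?thesis using x Suc ms m am by (auto simp: I_def J_def)
        qed
      qed
    qed
  qed
  \<comment> \<open>The part of the sum belonging to the tail is the corresponding sum for Y,
    preceded by the projection onto Y and followed by the inclusion of Y.\<close>
  have fold: "arr Y Y (foldr (\<lambda>k. cadd Y Y (ccomp Y (\<iota> k) (\<pi> k))) ks (czero Y Y)) \<and>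
     foldr (\<lambda>k. cadd ?Z ?Z (ccomp ?Z (I k) (J k))) (map Suc ks) (czero ?Z ?Z) =
     ccomp ?Z (tincl B Y) (ccomp ?Z (foldr (\<lambda>k. cadd Y Y (ccomp Y (\<iota> k) (\<pi> k))) ks (czero Y Y)) q)"
    if "set ks \<subseteq> {..<length Ys}" for ks
    using that
  proof (induction ks)
    case Nil
    have "czero ?Z ?Z = ccomp ?Z (tincl B Y) (ccomp ?Z (czero Y Y) q)"
      using ccomp_zero[OF r Z] zero_ccomp[OF q Y] by simp
    then show ?case using arr_zero by simp
  next
    case (Cons k ks)
    let ?r = "foldr (\<lambda>k. cadd Y Y (ccomp Y (\<iota> k) (\<pi> k))) ks (czero Y Y)"
    have k: "k < length Ys" using Cons.prems by simp
    have R: "arr Y Y ?r" and eq: "foldr (\<lambda>k. cadd ?Z ?Z (ccomp ?Z (I k) (J k))) (map Suc ks) (czero ?Z ?Z) =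
      ccomp ?Z (tincl B Y) (ccomp ?Z ?r q)" using Cons by simp_all
    have c: "arr Y Y (ccomp Y (\<iota> k) (\<pi> k))" by (rule arr_comp[OF a(2)[OF k] a(1)[OF k]])
    have A: "arr Y Y (cadd Y Y (ccomp Y (\<iota> k) (\<pi> k)) ?r)" by (rule arr_add[OF c R])
    have IJk: "arr ?Z ?Z (ccomp ?Z (I (Suc k)) (J (Suc k)))" using arr_comp[OF IJ(2) IJ(1), of "Suc k"] k by simp
    have Rm: "?r i x \<in> carrier (Deg Y i)" if "x \<in> carrier (Deg Y i)" for i x
      using chmap(1)[of ?r Y Y] R that by (simp add: arr_def)
    have "cadd ?Z ?Z (ccomp ?Z (I (Suc k)) (J (Suc k))) (ccomp ?Z (tincl B Y) (ccomp ?Z ?r q)) =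
      ccomp ?Z (tincl B Y) (ccomp ?Z (cadd Y Y (ccomp Y (\<iota> k) (\<pi> k)) ?r) q)"
    proof (rule arr_ext[OF arr_add[OF IJk arr_comp[OF arr_comp[OF q R] r]] arr_comp[OF arr_comp[OF q A] r]])
      fix i x assume "x \<in> carrier (Deg ?Z i)"
      then show "cadd ?Z ?Z (ccomp ?Z (I (Suc k)) (J (Suc k))) (ccomp ?Z (tincl B Y) (ccomp ?Z ?r q)) i x =
        ccomp ?Z (tincl B Y) (ccomp ?Z (cadd Y Y (ccomp Y (\<iota> k) (\<pi> k)) ?r) q) i x"
        using k am am2 Rm by (simp add: I_def J_def)
    qed
    then show ?case using A eq by simp
  qed
  have sub: "set [0..<length Ys] \<subseteq> {..<length Ys}" by auto
  have up: "[0..<length (B # Ys)] = 0 # map Suc [0..<length Ys]"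
    unfolding list.size(4) add_Suc_right add_0_right by (simp only: upt_conv_Cons[of 0 "Suc (length Ys)"] map_Suc_upt zero_less_Suc One_nat_def)
  have lp: "arr ?Z ?Z (ccomp ?Z l (tproj B Y))" "arr ?Z ?Z (ccomp ?Z (tincl B Y) (ccomp ?Z (cid Y) q))"
    using arr_comp[OF p l] arr_comp[OF arr_comp[OF q arr_id[OF Y]] r] by auto
  have "foldr (\<lambda>k. cadd ?Z ?Z (ccomp ?Z (I k) (J k))) [0..<length (B # Ys)] (czero ?Z ?Z) =
    cadd ?Z ?Z (ccomp ?Z l (tproj B Y)) (ccomp ?Z (tincl B Y) (ccomp ?Z (cid Y) q))"
    unfolding up using fold[OF sub] f by (simp add: I_def J_def)
  also have "\<dots> = cid ?Z"
    by (rule arr_ext[OF arr_add[OF lp] arr_id[OF Z]]) simp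
  finally have F: "foldr (\<lambda>k. cadd ?Z ?Z (ccomp ?Z (I k) (J k))) [0..<length (B # Ys)] (czero ?Z ?Z) = cid ?Z" .
  show ?thesis
  proof (intro direct_sumI[of _ cpx_cat _ I J] allI impI; unfold cpx_cat_simps)
    show "set (B # Ys) \<subseteq> bcpx L" using o by simp
    show "I k \<in> chain_maps L ((B # Ys) ! k) ?Z \<and> J k \<in> chain_maps L ?Z ((B # Ys) ! k)" if "k < length (B # Ys)" for k
      using IJ[OF that] by (simp add: arr_def)
  qed (use Z comp F in \<open>simp_all only:\<close>)
qed

lemma direct_sum_Nil: "direct_sum cpx_cat [] zcpx"
  by (simp add: direct_sum_def zcpx_id)

text \<open>The analogue of \<open>factors\<close> for chain maps. A factorisation of the identity
  exhibits a complex as a retract of a finite direct sum.\<close>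

inductive cfactors :: "'a cpx set \<Rightarrow> 'a cpx \<Rightarrow> 'a cpx \<Rightarrow> 'a cmap \<Rightarrow> bool" for J X Z where
  zero: "cfactors J X Z (czero X Z)"
| step: "cfactors J X Z h \<Longrightarrow> B \<in> J \<Longrightarrow> arr X B f \<Longrightarrow> arr B Z g \<Longrightarrow> cfactors J X Z (cadd X Z h (ccomp X g f))"

lemma cfactors_arr:
  assumes "cfactors J X Z h" "X \<in> bcpx L" "Z \<in> bcpx L"
  shows "arr X Z h"
  using assms(1) by induction (use assms arr_zero arr_add arr_comp in blast)+

lemma cfactors_add:
  assumes h: "cfactors J X Z h" and k: "cfactors J X Z k" and X [simp]: "X \<in> bcpx L" and Z [simp]: "Z \<in> bcpx L"
  shows "cfactors J X Z (cadd X Z h k)"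
  using k
proof induction
  case zero
  have H: "arr X Z h" by (rule cfactors_arr[OF h X Z])
  have "cadd X Z h (czero X Z) = h"
    by (rule arr_ext[OF arr_add[OF H arr_zero[OF X Z]] H]) (simp add: arr_closed[OF H])
  then show ?case using h by simp
next
  case (step k B f g)
  have H: "arr X Z h" "arr X Z k" "arr X Z (ccomp X g f)" using cfactors_arr[OF h X Z] cfactors_arr[OF step(1) X Z] arr_comp[OF step(3,4)] by auto
  have "cadd X Z h (cadd X Z k (ccomp X g f)) = cadd X Z (cadd X Z h k) (ccomp X g f)"
    by (rule arr_ext[of X Z]; (intro arr_add H)?)
      (use arr_closed[OF H(1)] arr_closed[OF H(2)] arr_closed[OF step(3)] arr_closed[OF step(4)] in \<open>simp add: fg_a_assoc\<close>)
  then show ?case using cfactors.step[OF step.IH step(2-4)] by simp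
qed

text \<open>The summands of h are collected into a single map through their direct sum, with the two
  factors as a column and a row.\<close>

lemma cfactors_direct_sum:
  assumes "cfactors J X Z h" and X [simp]: "X \<in> bcpx L" and Z [simp]: "Z \<in> bcpx L"
  shows "\<exists>Ys Y f g. set Ys \<subseteq> J \<and> direct_sum cpx_cat Ys Y \<and> arr X Y f \<and> arr Y Z g \<and> h = ccomp X g f"
  using assms(1)
proof induction
  case zero
  have "czero X Z = ccomp X (czero zcpx Z) (czero X zcpx)"
    using zero_ccomp[OF arr_zero[OF X zcpx_bcpx] Z] by simp
  then show ?case using direct_sum_Nil arr_zero[OF X zcpx_bcpx] arr_zero[OF zcpx_bcpx Z] by (intro exI[of _ "[]"]) auto
next
  case (step h B u v)
  then obtain Ys Y f g where Y: "set Ys \<subseteq> J" "direct_sum cpx_cat Ys Y" "arr X Y f" "arr Y Z g" "h = ccomp X g f" by blast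
  have B [simp]: "B \<in> bcpx L" and YB [simp]: "Y \<in> bcpx L" using step Y by (auto simp: arr_def)
  let ?S = "csum B Y"
  have m: "u i \<in> rhom L (Deg X i) (Deg B i)" "f i \<in> rhom L (Deg X i) (Deg Y i)"
    "v i \<in> rhom L (Deg B i) (Deg Z i)" "g i \<in> rhom L (Deg Y i) (Deg Z i)" for i
    using step(3,4) Y(3,4) by (auto simp: arr_def chain_maps_rhom)
  have uf: "u \<in> chain_maps L X B" "f \<in> chain_maps L X Y" "v \<in> chain_maps L B Z" "g \<in> chain_maps L Y Z"
    using step(3,4) Y(3,4) by (auto simp: arr_def)
  note [simp] = chmap[OF uf(1) X B] chmap[OF uf(2) X YB] chmap[OF uf(3) B Z] chmap[OF uf(4) YB Z]
  let ?f = "\<lambda>i. \<lambda>x\<in>carrier (Deg X i). spair (u i x) (f i x)"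
  let ?g = "\<lambda>i. \<lambda>z\<in>carrier (Deg ?S i). g i (ssnd z) \<oplus>\<^bsub>Deg Z i\<^esub> v i (sfst z)"
  have F: "arr X ?S ?f" unfolding arr_def
  proof (intro conjI chain_mapsI)
    show "?f i \<in> rhom L (Deg X i) (Deg ?S i)" for i by (rule rhomI) simp_all
  qed simp_all
  have G: "arr ?S Z ?g" unfolding arr_def
  proof (intro conjI chain_mapsI)
    show "?g i \<in> rhom L (Deg ?S i) (Deg Z i)" for i by (rule rhomI) (simp_all add: agn fg_smult_add)
  qed (simp_all add: difs)
  have "cadd X Z h (ccomp X v u) = ccomp X ?g ?f"
    unfolding Y(5) by (rule arr_ext[OF arr_add[OF arr_comp[OF Y(3,4)] arr_comp[OF step(3,4)]] arr_comp[OF F G]]) simp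
  moreover have "set (B # Ys) \<subseteq> J" using step(2) Y(1) by simp
  ultimately show ?case using direct_sum_Cons[OF B Y(2)] F G by blast
qed

section \<open>Kernels\<close>

definition kcpx :: "'a cpx \<Rightarrow> 'a cpx \<Rightarrow> 'a cmap \<Rightarrow> 'a cpx" where
  "kcpx P X f = \<lparr>Deg = (\<lambda>i. sub (Deg P i) {x \<in> carrier (Deg P i). f i x = \<zero>\<^bsub>Deg X i\<^esub>}),
     Dif = (\<lambda>i. \<lambda>x\<in>{x \<in> carrier (Deg P i). f i x = \<zero>\<^bsub>Deg X i\<^esub>}. Dif P i x)\<rparr>"

definition kincl :: "'a cpx \<Rightarrow> 'a cpx \<Rightarrow> 'a cmap \<Rightarrow> 'a cmap" where
  "kincl P X f = (\<lambda>i. \<lambda>x\<in>{x \<in> carrier (Deg P i). f i x = \<zero>\<^bsub>Deg X i\<^esub>}. x)"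

lemma kcpx_Deg: "Deg (kcpx P X f) i = sub (Deg P i) {x \<in> carrier (Deg P i). f i x = \<zero>\<^bsub>Deg X i\<^esub>}"
  by (simp add: kcpx_def)

lemma kcpx_Dif: "x \<in> carrier (Deg P i) \<Longrightarrow> f i x = \<zero>\<^bsub>Deg X i\<^esub> \<Longrightarrow> Dif (kcpx P X f) i x = Dif P i x"
  by (simp add: kcpx_def)

lemma kcpx_bcpx:
  assumes f: "arr P X f"
  shows "kcpx P X f \<in> bcpx L" "arr (kcpx P X f) P (kincl P X f)"
proof -
  have P [simp]: "P \<in> bcpx L" and X [simp]: "X \<in> bcpx L" and fc: "f \<in> chain_maps L P X" using f by (auto simp: arr_def)
  note [simp] = chmap[OF fc P X]
  have sm: "submodule {x \<in> carrier (Deg P i). f i x = \<zero>\<^bsub>Deg X i\<^esub>} L (Deg P i)" for i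
    by (rule kernel_submodule[OF chain_maps_rhom[OF fc]]) simp_all
  have fg [simp]: "Deg (kcpx P X f) i \<in> fgmod L" for i using sm by (simp add: kcpx_Deg)
  show K: "kcpx P X f \<in> bcpx L"
  proof (rule bcpxI)
    fix i
    show "Dif (kcpx P X f) i \<in> rhom L (Deg (kcpx P X f) i) (Deg (kcpx P X f) (i + 1))"
    proof -
      have "restrict (Dif P i) (carrier (Deg (kcpx P X f) i)) \<in> rhom L (Deg (kcpx P X f) i) (Deg (kcpx P X f) (i + 1))"
        using fg[of i] by (intro rhomI) (auto simp: kcpx_Deg dif_add dif_smult)
      then show ?thesis by (simp add: kcpx_def)
    qed
    show "Dif (kcpx P X f) (i + 1) (Dif (kcpx P X f) i x) = \<zero>\<^bsub>Deg (kcpx P X f) (i + 2)\<^esub>"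
      if "x \<in> carrier (Deg (kcpx P X f) i)" for x
      using that by (simp add: kcpx_Deg kcpx_Dif)
  next
    show "finite {i. carrier (Deg P i) \<noteq> {\<zero>\<^bsub>Deg P i\<^esub>}}" by (rule bcpx_finite[OF P])
    fix i x assume "i \<notin> {i. carrier (Deg P i) \<noteq> {\<zero>\<^bsub>Deg P i\<^esub>}}" "x \<in> carrier (Deg (kcpx P X f) i)"
    then show "x = \<zero>\<^bsub>Deg (kcpx P X f) i\<^esub>" by (auto simp: kcpx_Deg)
  qed simp
  show "arr (kcpx P X f) P (kincl P X f)" unfolding arr_def
  proof (intro conjI chain_mapsI K P)
    show "kincl P X f i \<in> rhom L (Deg (kcpx P X f) i) (Deg P i)" for i
    proof -
      have "restrict (\<lambda>x. x) (carrier (Deg (kcpx P X f) i)) \<in> rhom L (Deg (kcpx P X f) i) (Deg P i)"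
        using fg[of i] by (intro rhomI) (auto simp: kcpx_Deg)
      then show ?thesis by (simp add: kincl_def kcpx_Deg)
    qed
  qed (simp add: kcpx_Deg kcpx_Dif kincl_def)
qed

lemma kcpx_ses:
  assumes f: "arr P X f" and s: "\<And>i z. z \<in> carrier (Deg X i) \<Longrightarrow> \<exists>y\<in>carrier (Deg P i). z = f i y"
  shows "ses (kcpx P X f) P X (kincl P X f) f"
  unfolding ses_def using kcpx_bcpx[OF f] f s by (auto simp: kcpx_Deg kincl_def)

text \<open>The complement is the kernel of g, with projection 1 - f g. Forming it as a complex
  makes the splitting of idempotents explicit.\<close>

lemma retract_summand:
  assumes f: "arr S Y f" and g: "arr Y S g" and gf: "ccomp S g f = cid S"
  shows "direct_summand D S Y"
proof -
  have S [simp]: "S \<in> bcpx L" and Y [simp]: "Y \<in> bcpx L" and fc: "f \<in> chain_maps L S Y" and gc: "g \<in> chain_maps L Y S"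
    using f g by (auto simp: arr_def)
  note [simp] = chmap[OF fc S Y] chmap[OF gc Y S]
  have gfx [simp]: "g i (f i x) = x" if "x \<in> carrier (Deg S i)" for i x
  proof -
    have "ccomp S g f i x = cid S i x" by (simp only: gf)
    then show ?thesis using that by simp
  qed
  let ?K = "kcpx Y S g"
  note K = kcpx_bcpx[OF g]
  let ?q = "\<lambda>i y. y \<ominus>\<^bsub>Deg Y i\<^esub> f i (g i y)"
  let ?p = "\<lambda>i. \<lambda>y\<in>carrier (Deg Y i). y \<ominus>\<^bsub>Deg Y i\<^esub> f i (g i y)"
  have p: "arr Y ?K ?p" unfolding arr_def
  proof (intro conjI chain_mapsI Y K)
    show "?p i \<in> rhom L (Deg Y i) (Deg ?K i)" for i
    proof (rule rhomI)
      show "?q i x \<in> carrier (Deg ?K i)" if "x \<in> carrier (Deg Y i)" for x using that by (simp add: kcpx_Deg)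
      show "?q i (x \<oplus>\<^bsub>Deg Y i\<^esub> y) = ?q i x \<oplus>\<^bsub>Deg ?K i\<^esub> ?q i y"
        if "x \<in> carrier (Deg Y i)" "y \<in> carrier (Deg Y i)" for x y using that by (simp add: kcpx_Deg agn)
      show "?q i (a \<odot>\<^bsub>Deg Y i\<^esub> x) = a \<odot>\<^bsub>Deg ?K i\<^esub> ?q i x"
        if "a \<in> carrier L" "x \<in> carrier (Deg Y i)" for a x
        using that by (simp add: kcpx_Deg a_minus_def fg_smult_add fg_smult_neg)
    qed (use bcpx_fg[OF Y] bcpx_fg[OF K(1)] in simp_all)
  qed (simp add: kcpx_Deg kcpx_Dif dif_minus)
  note E = arr_ext
  have "direct_sum cpx_cat [S, ?K] Y"
  proof (rule direct_sum_twoI[of _ cpx_cat _ _ f "kincl Y S g" g ?p])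
    show "Comp cpx_cat S Y S g f = IdMor cpx_cat S" using gf by simp
    show "Comp cpx_cat ?K Y ?K ?p (kincl Y S g) = IdMor cpx_cat ?K"
      unfolding cpx_cat_simps
      by (rule E[OF arr_comp[OF K(2) p] arr_id[OF K(1)]]) (simp add: kcpx_Deg kincl_def)
    show "Comp cpx_cat S Y ?K ?p f = ZeroMor cpx_cat S ?K"
      unfolding cpx_cat_simps
      by (rule E[OF arr_comp[OF f p] arr_zero[OF S K(1)]]) (simp add: kcpx_Deg)
    show "Comp cpx_cat ?K Y S g (kincl Y S g) = ZeroMor cpx_cat ?K S"
      unfolding cpx_cat_simps
      by (rule E[OF arr_comp[OF K(2) g] arr_zero[OF K(1) S]]) (simp add: kcpx_Deg kincl_def)
    show "AddMor cpx_cat Y Y (Comp cpx_cat Y S Y f g) (AddMor cpx_cat Y Y (Comp cpx_cat Y ?K Y (kincl Y S g) ?p) (ZeroMor cpx_cat Y Y)) = IdMor cpx_cat Y"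
      unfolding cpx_cat_simps
      by (rule E[OF arr_add[OF arr_comp[OF g f] arr_add[OF arr_comp[OF p K(2)] arr_zero[OF Y Y]]] arr_id[OF Y]])
        (simp add: kincl_def, simp add: agn)
  qed (use f g p K in \<open>auto simp: arr_def\<close>)
  then show ?thesis using direct_sum_dmor by (auto simp: direct_summand_def)
qed

section \<open>Graded modules as summands of sums of shifted stalks\<close>

definition stalk :: "'a smod \<Rightarrow> int \<Rightarrow> 'a smod" where
  "stalk M = (\<lambda>i. if i = 0 then M else zmod)"

lemma stalk_graded [simp]: "M \<in> fgmod L \<Longrightarrow> graded (stalk M)"
  using finite_subset[of "{i. carrier (stalk M i) \<noteq> {\<zero>\<^bsub>stalk M i\<^esub>}}" "{0}"]
  by (auto simp: graded_def stalk_def)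

text \<open>The identity of \<open>gcpx M\<close> is a finite sum of maps concentrated in one
  degree, and each of these factors through copies of \<open>M0\<close> placed in that
  degree.\<close>

theorem graded_tri_gen1:
  assumes M: "graded M" and A: "\<And>i. M i \<in> acl {M0}" and M0 [simp]: "M0 \<in> fgmod L"
  shows "gcpx M \<in> tri_gen1 D {gcpx (stalk M0)}"
proof -
  let ?S = "gcpx M"
  define J where "J = {cshift k X | k X. X \<in> {gcpx (stalk M0)}}"
  have S [simp]: "?S \<in> bcpx L" and Mi [simp]: "M i \<in> fgmod L" for i using M by auto
  have z: "graded (\<lambda>j. stalk M0 (j + k))" for k by (rule graded_shift) simp
  define emb where "emb i h = (\<lambda>j. if j = i then h else (\<lambda>x\<in>carrier (M j). \<zero>\<^bsub>M j\<^esub>))" for i :: int and h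
  have embr: "arr ?S ?S (emb i h)" if "h \<in> rhom L (M i) (M i)" for i h
    using that M by (intro gcpx_arr) (auto simp: emb_def intro!: rhom_zero)
  have 1: "cfactors J ?S ?S (emb i h)" if "factors {M0} (M i) (M i) h" for i h
    using that
  proof induction
    case zero
    have "emb i (\<lambda>x\<in>carrier (M i). \<zero>\<^bsub>M i\<^esub>) = czero ?S ?S"
      by (intro ext) (simp add: emb_def czero_def)
    then show ?case using cfactors.zero[of J ?S ?S] by (simp only:)
  next
    case (step h B f g)
    have B: "B = M0" using step(2) by simp
    define F where "F = (\<lambda>j. if j = i then f else (\<lambda>x\<in>carrier (M j). \<zero>\<^bsub>zmod\<^esub>))"
    define G where "G = (\<lambda>j. if j = i then g else (\<lambda>x\<in>carrier zmod. \<zero>\<^bsub>M j\<^esub>))"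
    \<comment> \<open>\<open>M0\<close> in degree i, which is the shift by -i of the stalk in degree
      0.\<close>
    let ?B = "gcpx (\<lambda>j. stalk M0 (j - i))"
    have gB: "graded (\<lambda>j. stalk M0 (j - i))" using z[of "- i"] by simp
    have BJ: "?B \<in> J" unfolding J_def using cshift_gcpx[OF stalk_graded[OF M0], of "- i"]
      by (intro CollectI exI[of _ "- i"] exI[of _ "gcpx (stalk M0)"]) simp
    have F: "arr ?S ?B F"
    proof (rule gcpx_arr[OF M gB])
      show "F j \<in> rhom L (M j) (stalk M0 (j - i))" for j
        using step(4) rhom_zero[OF Mi[of j] zmod_fg] by (cases "j = i") (simp_all add: F_def B stalk_def del: zmod_simps)
    qed
    have G: "arr ?B ?S G"
    proof (rule gcpx_arr[OF gB M])
      show "G j \<in> rhom L (stalk M0 (j - i)) (M j)" for j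
        using step(5) rhom_zero[OF zmod_fg Mi[of j]] by (cases "j = i") (simp_all add: G_def B stalk_def del: zmod_simps)
    qed
    have hr: "h \<in> rhom L (M i) (M i)" by (rule factors_rhom[OF step(1)]) simp_all
    have r: "(\<lambda>x\<in>carrier (M i). h x \<oplus>\<^bsub>M i\<^esub> g (f x)) \<in> rhom L (M i) (M i)"
      by (rule factors_rhom[OF factors.step[OF step(1-5)]]) simp_all
    have "emb i (\<lambda>x\<in>carrier (M i). h x \<oplus>\<^bsub>M i\<^esub> g (f x)) = cadd ?S ?S (emb i h) (ccomp ?S G F)"
      by (rule arr_ext[OF embr[OF r] arr_add[OF embr[OF hr] arr_comp[OF F G]]])
        (auto simp: emb_def F_def G_def)
    then show ?case using cfactors.step[OF step.IH BJ F G] by (simp only:)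
  qed
  have 2: "cfactors J ?S ?S (\<lambda>j. if j \<in> N then (\<lambda>x\<in>carrier (M j). x) else (\<lambda>x\<in>carrier (M j). \<zero>\<^bsub>M j\<^esub>))" if "finite N" for N
    using that
  proof (induction N rule: finite_induct)
    case empty
    have "(\<lambda>j. if j \<in> {} then (\<lambda>x\<in>carrier (M j). x) else (\<lambda>x\<in>carrier (M j). \<zero>\<^bsub>M j\<^esub>)) = czero ?S ?S"
      by (intro ext) (simp add: czero_def)
    then show ?case using cfactors.zero[of J ?S ?S] by (simp only:)
  next
    case (insert i N)
    let ?f = "\<lambda>N. \<lambda>j. if j \<in> N then (\<lambda>x\<in>carrier (M j). x) else (\<lambda>x\<in>carrier (M j). \<zero>\<^bsub>M j\<^esub>)"
    have "factors {M0} (M i) (M i) (\<lambda>x\<in>carrier (M i). x)" using A[of i] unfolding acl_def by simp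
    from cfactors_add[OF 1[OF this] insert.IH S S]
    have c: "cfactors J ?S ?S (cadd ?S ?S (emb i (\<lambda>x\<in>carrier (M i). x)) (?f N))" .
    have fr: "arr ?S ?S (?f N)" for N
      using M by (intro gcpx_arr) (auto intro!: rhom_zero rhom_id)
    have "cadd ?S ?S (emb i (\<lambda>x\<in>carrier (M i). x)) (?f N) = ?f (insert i N)"
      by (rule arr_ext[OF arr_add[OF embr[OF rhom_id[OF Mi]] fr] fr]) (use insert(2) in \<open>auto simp: emb_def\<close>)
    then show ?case using c by (simp only:)
  qed
  let ?N = "{i. carrier (M i) \<noteq> {\<zero>\<^bsub>M i\<^esub>}}"
  \<comment> \<open>Outside \<open>?N\<close> the modules are zero, so the finite sum over
    \<open>?N\<close> is the whole identity.\<close>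
  have "(\<lambda>j. if j \<in> ?N then (\<lambda>x\<in>carrier (M j). x) else (\<lambda>x\<in>carrier (M j). \<zero>\<^bsub>M j\<^esub>)) = cid ?S"
  proof (rule arr_ext[OF gcpx_arr[OF M M] arr_id[OF S]])
    show "(if j \<in> ?N then (\<lambda>x\<in>carrier (M j). x) else (\<lambda>x\<in>carrier (M j). \<zero>\<^bsub>M j\<^esub>)) \<in> rhom L (M j) (M j)" for j
      using rhom_id[OF Mi] rhom_zero[OF Mi Mi] by (simp only: split: if_split) blast
  qed auto
  then have "cfactors J ?S ?S (cid ?S)" using 2[of ?N] M by (simp only: graded_def)
  from cfactors_direct_sum[OF this S S] obtain Ys Y f g where Y: "set Ys \<subseteq> J" "direct_sum cpx_cat Ys Y"
    "arr ?S Y f" "arr Y ?S g" "cid ?S = ccomp ?S g f" by blast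
  then show ?thesis
    using direct_sum_dmor[OF Y(2)] retract_summand[OF Y(3,4) Y(5)[symmetric]]
    unfolding tri_gen1_def add_closure_def J_def D_simps by blast
qed

section \<open>Resolving complexes\<close>

abbreviation Zmod :: "'a cpx \<Rightarrow> int \<Rightarrow> 'a smod" where
  "Zmod X i \<equiv> sub (Deg X i) (cycles X i)"

abbreviation Bmod :: "'a cpx \<Rightarrow> int \<Rightarrow> 'a smod" where
  "Bmod X i \<equiv> sub (Deg X i) (boundaries X i)"

abbreviation pieces :: "'a smod \<Rightarrow> 'a cpx set" where
  "pieces M0 \<equiv> tri_gen1 D {gcpx (stalk M0)}"

text \<open>Bounded support comes from X, provided that zero modules were chosen over its zero
  terms.\<close>

lemma gradedI:
  assumes X: "X \<in> bcpx L" and "\<And>i. Q i \<in> fgmod L"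
    and "\<And>i. carrier (Deg X i) = {\<zero>\<^bsub>Deg X i\<^esub>} \<Longrightarrow> carrier (Q i) = {\<zero>\<^bsub>Q i\<^esub>}"
  shows "graded Q"
  unfolding graded_def
  using assms(2,3) by (auto intro!: finite_subset[OF _ bcpx_finite[OF X]])

lemma ses_degreewise:
  assumes "arr K P f" "arr P X g" "\<And>i. short_exact L (Deg K i) (Deg P i) (Deg X i) (f i) (g i)"
  shows "ses K P X f g"
proof -
  have K: "K \<in> bcpx L" and P: "P \<in> bcpx L" using assms(1) by (auto simp: arr_def)
  have "x = \<zero>\<^bsub>Deg K i\<^esub>" if "x \<in> carrier (Deg K i)" "f i x = \<zero>\<^bsub>Deg P i\<^esub>" for i x
    using short_exactD(3)[OF assms(3) that(1), of "\<zero>\<^bsub>Deg K i\<^esub>"] that(2)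
      rhom_group(1)[OF short_exactD(1)[OF assms(3)]] K P by simp
  then show ?thesis unfolding ses_def using assms(1,2) short_exactD(4-6)[OF assms(3)] by blast
qed

text \<open>The presentations form a short exact sequence of complexes with zero differential, with
  kernel A and middle term B, so Z is built from B and A[1]. The shift of A is graded again and
  therefore a single piece.\<close>

lemma resolved_graded:
  assumes Z: "graded Z" and s: "\<And>i. stage {M0} 0 (Z i)" and M0: "M0 \<in> fgmod L"
  shows "resolved (pieces M0) 2 (gcpx Z)"
proof -
  have "\<forall>i. \<exists>A B f g. A \<in> acl {M0} \<and> B \<in> acl {M0} \<and> short_exact L A B (Z i) f g \<and>
    (carrier (Z i) = {\<zero>\<^bsub>Z i\<^esub>} \<longrightarrow> carrier A = {\<zero>\<^bsub>A\<^esub>} \<and> carrier B = {\<zero>\<^bsub>B\<^esub>})"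
    using stage_presentation[OF s graded_fg[OF Z]] by blast
  then obtain A B f g where AB: "\<forall>i. A i \<in> acl {M0} \<and> B i \<in> acl {M0} \<and> short_exact L (A i) (B i) (Z i) (f i) (g i) \<and>
    (carrier (Z i) = {\<zero>\<^bsub>Z i\<^esub>} \<longrightarrow> carrier (A i) = {\<zero>\<^bsub>A i\<^esub>} \<and> carrier (B i) = {\<zero>\<^bsub>B i\<^esub>})"
    unfolding choice_iff by blast
  have fg: "A i \<in> fgmod L" "B i \<in> fgmod L" for i using AB by (auto intro: acl_fg)
  have A: "graded A" and B: "graded B"
    by (rule gradedI[OF gcpx_bcpx[OF Z]]; use AB fg in \<open>simp del: acl_fg\<close>)+
  have s: "ses (gcpx A) (gcpx B) (gcpx Z) f g"
    using AB short_exactD(1,2)[of "A i" "B i" "Z i" "f i" "g i" for i] by (intro ses_degreewise gcpx_arr A B Z) simp_all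
  have 1: "gcpx B \<in> pieces M0" using AB M0 B by (intro graded_tri_gen1) auto
  have 2: "cshift 1 (gcpx A) \<in> pieces M0"
    unfolding cshift_gcpx[OF A] using AB M0 by (intro graded_tri_gen1 graded_shift[OF A]) auto
  have "resolved (pieces M0) (Suc 0) (cshift 1 (gcpx A))" by (rule resolved_one[OF 2]) (simp add: A)
  from resolved_step[OF s 1 this] show ?thesis by (simp only: numeral_2_eq_2)
qed

lemma Zmod_fg [simp]: "X \<in> bcpx L \<Longrightarrow> Zmod X i \<in> fgmod L"
  by (simp add: cycles_submodule)

lemma Bmod_fg [simp]: "X \<in> bcpx L \<Longrightarrow> Bmod X i \<in> fgmod L"
  by (simp add: boundaries_submodule)

lemma trivial_cycles:
  assumes "X \<in> bcpx L" "carrier (Deg X i) = {\<zero>\<^bsub>Deg X i\<^esub>}"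
  shows "cycles X i = {\<zero>\<^bsub>Deg X i\<^esub>}" "boundaries X i = {\<zero>\<^bsub>Deg X i\<^esub>}"
proof -
  show c: "cycles X i = {\<zero>\<^bsub>Deg X i\<^esub>}"
    using assms cycles_carrier[of _ X i] cycles_zero[OF assms(1), of i] by blast
  have "\<zero>\<^bsub>Deg X i\<^esub> \<in> boundaries X i" using fg_zero[OF Bmod_fg[OF assms(1)], of i] by (simp only: sub_simps)
  moreover have "boundaries X i \<subseteq> cycles X i" using boundaries_cycles[OF assms(1)] by (rule subsetI)
  ultimately show "boundaries X i = {\<zero>\<^bsub>Deg X i\<^esub>}" unfolding c by blast
qed

lemma graded_Zmod: "X \<in> bcpx L \<Longrightarrow> graded (Zmod X)"
  by (rule gradedI[of X]) (simp_all add: trivial_cycles)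

lemma graded_Bmod: "X \<in> bcpx L \<Longrightarrow> graded (Bmod X)"
  by (rule gradedI[of X]) (simp_all add: trivial_cycles)

lemma Dif_Bmod:
  assumes X: "X \<in> bcpx L"
  shows "Dif X i \<in> rhom L (Deg X i) (Bmod X (i + 1))" "Dif X i ` carrier (Deg X i) = boundaries X (i + 1)"
proof -
  show "Dif X i ` carrier (Deg X i) = boundaries X (i + 1)" by (simp add: boundaries_def)
  then show "Dif X i \<in> rhom L (Deg X i) (Bmod X (i + 1))"
    using bcpx_rhom[OF X refl, of i] by (auto simp: rhom_def)
qed

lemma rhom_sub:
  assumes "f \<in> rhom L A (sub M N)" "M \<in> fgmod L" "submodule N L M"
  shows "f \<in> rhom L A M" "x \<in> carrier A \<Longrightarrow> f x \<in> N"
  using assms submodule_carrier[OF assms(2,3)] by (auto simp: rhom_def)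

lemma resolved_base:
  assumes X [simp]: "X \<in> bcpx L" and M0: "M0 \<in> fgmod L"
    and sZ: "\<And>i. stage {M0} 0 (Zmod X i)" and sB: "\<And>i. stage {M0} 0 (Bmod X i)"
  shows "resolved (pieces M0) 4 X"
proof -
  \<comment> \<open>The differential identifies X modulo its cycles in degree i with the boundaries
    in degree i + 1.\<close>
  let ?B = "\<lambda>i. Bmod X (i + 1)"
  have gZ: "graded (Zmod X)" and gB: "graded ?B" using graded_Zmod[OF X] graded_shift[OF graded_Bmod[OF X]] by auto
  let ?f = "\<lambda>i. \<lambda>x\<in>cycles X i. x"
  have f: "?f i \<in> rhom L (Zmod X i) (Deg X i)" for i
    using rhom_sub(1)[OF rhom_id[OF Zmod_fg[OF X]] bcpx_fg[OF X] cycles_submodule[OF X]] by simp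
  have "ses (gcpx (Zmod X)) X (gcpx ?B) ?f (Dif X)"
  proof (rule ses_degreewise)
    show "arr (gcpx (Zmod X)) X ?f" unfolding arr_def
      by (intro conjI chain_mapsI) (use f gZ in \<open>simp_all add: cyclesD\<close>)
    show "arr X (gcpx ?B) (Dif X)" unfolding arr_def
      by (intro conjI chain_mapsI) (use Dif_Bmod(1)[OF X] gB in \<open>simp_all add: boundariesI\<close>)
    show "short_exact L (Deg (gcpx (Zmod X)) i) (Deg X i) (Deg (gcpx ?B) i) (?f i) (Dif X i)" for i
    proof (rule short_exactI)
      show "\<exists>y\<in>carrier (Deg X i). z = Dif X i y" if "z \<in> carrier (Deg (gcpx ?B) i)" for z
        using that Dif_Bmod(2)[OF X, of i] by auto
      show "\<exists>x\<in>carrier (Deg (gcpx (Zmod X)) i). y = ?f i x"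
        if "y \<in> carrier (Deg X i)" "Dif X i y = \<zero>\<^bsub>Deg (gcpx ?B) i\<^esub>" for y
      proof -
        have "y \<in> cycles X i" using that by (simp del: cycles_carrier add: cycles_iff)
        then show ?thesis by (intro bexI[of _ y]) simp_all
      qed
    qed (use f Dif_Bmod(1)[OF X] gZ in \<open>simp_all add: cyclesD\<close>)
  qed
  moreover have "resolved (pieces M0) 2 (gcpx (Zmod X))" by (rule resolved_graded[OF gZ sZ M0])
  moreover have "resolved (pieces M0) 2 (gcpx ?B)" by (rule resolved_graded[OF gB sB M0])
  ultimately have "resolved (pieces M0) (2 + 2) X" by (rule resolved_extension[OF tri_gen1_qi_closed])
  then show ?thesis by simp
qed

text \<open>The Cartan-Eilenberg step. With covers \<open>Q i\<close> of the cycles and \<open>T i\<close> of the boundaries, \<open>P\<close> is the sum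
  of the graded module \<open>Q\<close> and the contractible complex with terms \<open>T (i + 1)\<close> plus \<open>T i\<close>; its map to \<open>X\<close>
  lifts \<open>T (i + 1) \<rightarrow> Bmod X (i + 1)\<close> along the differential of \<open>X\<close>.\<close>

lemma resolved_reduce:
  assumes X [simp]: "X \<in> bcpx L" and M0: "M0 \<in> fgmod L" and proj: "\<And>P. projective L P \<Longrightarrow> P \<in> acl {M0}"
    and sZ: "\<And>i. stage {M0} (Suc j) (Zmod X i)" and sB: "\<And>i. stage {M0} (Suc j) (Bmod X i)"
  shows "\<exists>K P \<iota> \<phi>. ses K P X \<iota> \<phi> \<and> P \<in> pieces M0 \<and>
    (\<forall>i. stage {M0} j (Zmod K i)) \<and> (\<forall>i. stage {M0} j (Bmod K i))"
proof -
  have "\<forall>i. \<exists>K P f g. K \<in> fgmod L \<and> projective L P \<and> stage {M0} j K \<and> short_exact L K P (Zmod X i) f g \<and>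
    (carrier (Zmod X i) = {\<zero>\<^bsub>Zmod X i\<^esub>} \<longrightarrow> carrier P = {\<zero>\<^bsub>P\<^esub>})"
    using stage_cover[OF sZ Zmod_fg[OF X]] by blast
  then obtain KZ Q \<iota> \<pi> where Q: "\<forall>i. KZ i \<in> fgmod L \<and> projective L (Q i) \<and> stage {M0} j (KZ i) \<and>
    short_exact L (KZ i) (Q i) (Zmod X i) (\<iota> i) (\<pi> i) \<and> (carrier (Zmod X i) = {\<zero>\<^bsub>Zmod X i\<^esub>} \<longrightarrow> carrier (Q i) = {\<zero>\<^bsub>Q i\<^esub>})"
    unfolding choice_iff by blast
  have "\<forall>i. \<exists>K P f g. K \<in> fgmod L \<and> projective L P \<and> stage {M0} j K \<and> short_exact L K P (Bmod X i) f g \<and>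
    (carrier (Bmod X i) = {\<zero>\<^bsub>Bmod X i\<^esub>} \<longrightarrow> carrier P = {\<zero>\<^bsub>P\<^esub>})"
    using stage_cover[OF sB Bmod_fg[OF X]] by blast
  then obtain KB T \<kappa> \<tau> where T: "\<forall>i. KB i \<in> fgmod L \<and> projective L (T i) \<and> stage {M0} j (KB i) \<and>
    short_exact L (KB i) (T i) (Bmod X i) (\<kappa> i) (\<tau> i) \<and> (carrier (Bmod X i) = {\<zero>\<^bsub>Bmod X i\<^esub>} \<longrightarrow> carrier (T i) = {\<zero>\<^bsub>T i\<^esub>})"
    unfolding choice_iff by blast
  have fg [simp]: "KZ i \<in> fgmod L" "Q i \<in> fgmod L" "KB i \<in> fgmod L" "T i \<in> fgmod L" for i
    using Q T by (auto intro: projective_fg)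
  have seZ: "short_exact L (KZ i) (Q i) (Zmod X i) (\<iota> i) (\<pi> i)" and seB: "short_exact L (KB i) (T i) (Bmod X i) (\<kappa> i) (\<tau> i)" for i
    using Q T by auto
  note \<pi>' = rhom_sub[OF short_exactD(2)[OF seZ] bcpx_fg[OF X] cycles_submodule[OF X]]
  note \<tau>' = rhom_sub[OF short_exactD(2)[OF seB] bcpx_fg[OF X] boundaries_submodule[OF X]]
  have gQ [simp]: "graded Q" and gT [simp]: "graded T"
    by (rule gradedI[OF X]; use Q T in \<open>simp add: trivial_cycles\<close>)+
  have gT' [simp]: "graded (\<lambda>i. T (i + 1))" by (rule graded_shift) simp
  have "\<forall>i. \<exists>h. h \<in> rhom L (T (i + 1)) (Deg X i) \<and> (\<forall>t\<in>carrier (T (i + 1)). Dif X i (h t) = \<tau> (i + 1) t)"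
  proof
    fix i
    have "projective L (T (i + 1))" using T by blast
    from projective_lift[OF this bcpx_fg[OF X] Bmod_fg[OF X] Dif_Bmod(1)[OF X] short_exactD(2)[OF seB]]
    show "\<exists>h. h \<in> rhom L (T (i + 1)) (Deg X i) \<and> (\<forall>t\<in>carrier (T (i + 1)). Dif X i (h t) = \<tau> (i + 1) t)"
      using Dif_Bmod(2)[OF X] by auto
  qed
  then obtain \<mu> where L: "\<forall>i. \<mu> i \<in> rhom L (T (i + 1)) (Deg X i) \<and> (\<forall>t\<in>carrier (T (i + 1)). Dif X i (\<mu> i t) = \<tau> (i + 1) t)"
    unfolding choice_iff by blast
  have Lr: "\<mu> i \<in> rhom L (T (i + 1)) (Deg X i)" for i using L by blast
  have Ld [simp]: "Dif X i (\<mu> i t) = \<tau> (i + 1) t" if "t \<in> carrier (T (i + 1))" for i t using L that by blast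
  note [simp] = rhom_simps[OF \<pi>'(1)] rhom_group[OF \<pi>'(1)] rhom_simps[OF \<tau>'(1)] rhom_group[OF \<tau>'(1)] rhom_simps[OF Lr] rhom_group[OF Lr]
    rhom_simps[OF short_exactD(1)[OF seZ]] rhom_group[OF short_exactD(1)[OF seZ]] rhom_simps[OF short_exactD(1)[OF seB]] rhom_group[OF short_exactD(1)[OF seB]]
  have [simp]: "\<mu> (i + 1) \<zero>\<^bsub>T (i + 2)\<^esub> = \<zero>\<^bsub>Deg X (i + 1)\<^esub>" for i
  proof -
    have e: "i + 1 + 1 = i + 2" by simp
    show ?thesis using rhom_group(1)[OF Lr[of "i + 1"] fg(4) bcpx_fg[OF X]] unfolding e .
  qed
  have Dp [simp]: "Dif X i (\<pi> i q) = \<zero>\<^bsub>Deg X (i + 1)\<^esub>" if "q \<in> carrier (Q i)" for i q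
    using cyclesD[OF \<pi>'(2)[OF that]] .
  have Dt [simp]: "Dif X i (\<tau> i s) = \<zero>\<^bsub>Deg X (i + 1)\<^esub>" if "s \<in> carrier (T i)" for i s
    using cyclesD[OF boundaries_cycles[OF X \<tau>'(2)[OF that]]] .
  let ?T1 = "gcpx (\<lambda>i. T (i + 1))" and ?T0 = "gcpx T" and ?Q = "gcpx Q"
  \<comment> \<open>The identity as twist makes \<open>?E\<close> contractible: it matches T (i + 1)
    in degree i with the same module in degree i + 1.\<close>
  let ?a = "\<lambda>i. \<lambda>t\<in>carrier (T (i + 1)). t"
  have a: "?a \<in> twists ?T1 ?T0"
  proof (rule twistsI)
    show "?a i \<in> rhom L (Deg ?T1 i) (Deg ?T0 (i + 1))" for i using rhom_id[OF fg(4)] by simp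
    fix i x assume x: "x \<in> carrier (Deg ?T1 i)"
    have e: "i + 1 + 1 = i + 2" by simp
    show "Dif ?T0 (i + 1) (?a i x) \<oplus>\<^bsub>Deg ?T0 (i + 2)\<^esub> ?a (i + 1) (Dif ?T1 i x) = \<zero>\<^bsub>Deg ?T0 (i + 2)\<^esub>"
      using x by (simp add: e)
  qed
  let ?E = "tw ?T1 ?T0 ?a"
  have E [simp]: "?E \<in> bcpx L" using a by simp
  have acE: "acyclic ?E" unfolding acyclic_def
  proof (intro allI subsetI)
    fix i z assume z: "z \<in> cycles ?E i"
    then have zc: "sfst z \<in> carrier (T (i + 1))" "ssnd z \<in> carrier (T i)" using cycles_carrier[OF z] by auto
    have "sfst z = \<zero>\<^bsub>T (i + 1)\<^esub>" using cyclesD[OF z] zc by simp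
    then have "z = Dif ?E (i - 1) (spair (ssnd z) \<zero>\<^bsub>T (i - 1)\<^esub>)" using zc by (intro sfst_ext[THEN iffD2]) simp
    moreover have "Dif ?E (i - 1) (spair (ssnd z) \<zero>\<^bsub>T (i - 1)\<^esub>) \<in> boundaries ?E i"
      by (rule boundariesI) (use zc in simp_all)
    ultimately show "z \<in> boundaries ?E i" by (simp only:)
  qed
  let ?P = "csum ?E ?Q"
  have Qb [simp]: "?Q \<in> bcpx L" by simp
  have P [simp]: "?P \<in> bcpx L" using ztw_twists[OF E Qb] by simp
  \<comment> \<open>Only \<open>?Q\<close> has zero differential, but the acyclic summand
    \<open>?E\<close> does not change the quasi-isomorphism type, so \<open>?P\<close> is a piece as
    well.\<close>
  have "?Q \<in> pieces M0" using Q proj M0 by (intro graded_tri_gen1) auto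
  moreover have "qarr ?Q ?P (tincl ?E ?Q)" using tincl_qi[OF ztw_twists[OF E Qb] acE E Qb] by (simp add: qarr_def)
  ultimately have Pp: "?P \<in> pieces M0" using tri_gen1_qi_closed unfolding qi_closed_def by blast
  let ?\<phi> = "\<lambda>i. \<lambda>z\<in>carrier (Deg ?P i). \<mu> i (sfst (sfst z)) \<oplus>\<^bsub>Deg X i\<^esub> (\<tau> i (ssnd (sfst z)) \<oplus>\<^bsub>Deg X i\<^esub> \<pi> i (ssnd z))"
  have f: "arr ?P X ?\<phi>" unfolding arr_def
  proof (intro conjI chain_mapsI P X)
    show "?\<phi> i \<in> rhom L (Deg ?P i) (Deg X i)" for i
      by (rule rhomI) (use bcpx_fg[OF P] in \<open>simp_all add: agn fg_smult_add\<close>)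
    show "?\<phi> (i + 1) (Dif ?P i z) = Dif X i (?\<phi> i z)" if "z \<in> carrier (Deg ?P i)" for i z
      using that by (simp add: dif_add)
  qed
  define K where "K = kcpx ?P X ?\<phi>"
  have Kops [simp]: "add (Deg K i) = add (Deg ?P i)" "smult (Deg K i) = smult (Deg ?P i)"
    "\<zero>\<^bsub>Deg K i\<^esub> = spair (spair \<zero>\<^bsub>T (i + 1)\<^esub> \<zero>\<^bsub>T i\<^esub>) \<zero>\<^bsub>Q i\<^esub>" for i
    by (simp_all add: K_def kcpx_Deg)
  have Kc: "z \<in> carrier (Deg K i) \<longleftrightarrow> sfst (sfst z) \<in> carrier (T (i + 1)) \<and> ssnd (sfst z) \<in> carrier (T i) \<and>
      ssnd z \<in> carrier (Q i) \<and> \<mu> i (sfst (sfst z)) \<oplus>\<^bsub>Deg X i\<^esub> (\<tau> i (ssnd (sfst z)) \<oplus>\<^bsub>Deg X i\<^esub> \<pi> i (ssnd z)) = \<zero>\<^bsub>Deg X i\<^esub>" for z i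
    by (auto simp: K_def kcpx_Deg)
  have Kd: "Dif K i z = spair (spair \<zero>\<^bsub>T (i + 2)\<^esub> (sfst (sfst z))) \<zero>\<^bsub>Q (i + 1)\<^esub>" if "z \<in> carrier (Deg K i)" for z i
    using that unfolding Kc by (simp add: K_def kcpx_Dif)
  have ses: "ses K ?P X (kincl ?P X ?\<phi>) ?\<phi>"
    unfolding K_def
  proof (rule kcpx_ses[OF f])
    fix i x assume x: "x \<in> carrier (Deg X i)"
    then have "Dif X i x \<in> carrier (Bmod X (i + 1))" by (simp add: boundariesI)
    \<comment> \<open>Surjectivity: t covers the boundary d x; then x - \<mu> t is a cycle and is
      covered by some q.\<close>
    from short_exactD(6)[OF seB this] obtain t where t: "t \<in> carrier (T (i + 1))" "Dif X i x = \<tau> (i + 1) t" by blast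
    then have "x \<ominus>\<^bsub>Deg X i\<^esub> \<mu> i t \<in> carrier (Zmod X i)" using x by (simp del: cycles_carrier add: cycles_iff dif_minus)
    from short_exactD(6)[OF seZ this] obtain q where q: "q \<in> carrier (Q i)" "x \<ominus>\<^bsub>Deg X i\<^esub> \<mu> i t = \<pi> i q" by blast
    have "x = \<mu> i t \<oplus>\<^bsub>Deg X i\<^esub> (x \<ominus>\<^bsub>Deg X i\<^esub> \<mu> i t)" using x t by (simp add: agn)
    then have "x = ?\<phi> i (spair (spair t \<zero>\<^bsub>T i\<^esub>) q)" using t q by simp
    then show "\<exists>z\<in>carrier (Deg ?P i). x = ?\<phi> i z" using t q by (intro bexI[of _ "spair (spair t \<zero>\<^bsub>T i\<^esub>) q"]) simp_all
  qed
  note Kb = sesE(1)[OF ses]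
  have kz: "z \<in> cycles K i \<longleftrightarrow> sfst (sfst z) = \<zero>\<^bsub>T (i + 1)\<^esub> \<and> ssnd (sfst z) \<in> carrier (T i) \<and> ssnd z \<in> carrier (Q i) \<and>
    \<tau> i (ssnd (sfst z)) \<oplus>\<^bsub>Deg X i\<^esub> \<pi> i (ssnd z) = \<zero>\<^bsub>Deg X i\<^esub>" for z i
    unfolding cycles_iff by (auto simp: Kc Kd)
  \<comment> \<open>A cycle of K amounts to a pair (s, q) with \<tau> s + \<pi> q = 0. The
    projection to s is onto T i because boundaries are cycles and \<pi> covers these; its kernel is
    the syzygy KZ i.\<close>
  have stZ: "stage {M0} j (Zmod K i)" for i
  proof (rule stage_extend[OF proj])
    let ?i = "\<lambda>k\<in>carrier (KZ i). spair (spair \<zero>\<^bsub>T (i + 1)\<^esub> \<zero>\<^bsub>T i\<^esub>) (\<iota> i k)"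
    let ?p = "\<lambda>z\<in>carrier (Zmod K i). ssnd (sfst z)"
    show "short_exact L (KZ i) (Zmod K i) (T i) ?i ?p"
    proof (rule short_exactI)
      show "?i \<in> rhom L (KZ i) (Zmod K i)"
        by (rule rhomI) (use short_exactD(4)[OF seZ] in \<open>simp_all add: kz\<close>)
      show "?p \<in> rhom L (Zmod K i) (T i)"
        by (rule rhomI) (use Zmod_fg[OF Kb] in \<open>simp_all add: kz\<close>)
      show "x = \<zero>\<^bsub>KZ i\<^esub>" if "x \<in> carrier (KZ i)" "?i x = \<zero>\<^bsub>Zmod K i\<^esub>" for x
        using that short_exactD(3)[OF seZ that(1), of "\<zero>\<^bsub>KZ i\<^esub>"] by simp
      show "?p (?i x) = \<zero>\<^bsub>T i\<^esub>" if "x \<in> carrier (KZ i)" for x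
        using that short_exactD(4)[OF seZ that] by (simp add: kz)
      show "\<exists>x\<in>carrier (KZ i). z = ?i x" if z: "z \<in> carrier (Zmod K i)" "?p z = \<zero>\<^bsub>T i\<^esub>" for z
      proof -
        have zz: "sfst (sfst z) = \<zero>\<^bsub>T (i + 1)\<^esub>" "ssnd (sfst z) = \<zero>\<^bsub>T i\<^esub>" "ssnd z \<in> carrier (Q i)" "\<pi> i (ssnd z) = \<zero>\<^bsub>Deg X i\<^esub>"
          using z by (auto simp: kz)
        from short_exactD(5)[OF seZ zz(3)] zz(4) obtain k where "k \<in> carrier (KZ i)" "ssnd z = \<iota> i k" by auto
        moreover have "sfst z = spair \<zero>\<^bsub>T (i + 1)\<^esub> \<zero>\<^bsub>T i\<^esub>" unfolding sfst_ext[of "sfst z"] using zz by simp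
        ultimately have "k \<in> carrier (KZ i)" "z = ?i k" unfolding sfst_ext[of z] by simp_all
        then show ?thesis by blast
      qed
      show "\<exists>z\<in>carrier (Zmod K i). s = ?p z" if s: "s \<in> carrier (T i)" for s
      proof -
        have "\<tau> i s \<in> carrier (Zmod X i)" using boundaries_cycles[OF X \<tau>'(2)[OF s]] by simp
        from short_exactD(6)[OF seZ this] obtain q where q: "q \<in> carrier (Q i)" "\<tau> i s = \<pi> i q" by blast
        then show ?thesis using s
          by (intro bexI[of _ "spair (spair \<zero>\<^bsub>T (i + 1)\<^esub> s) (\<ominus>\<^bsub>Q i\<^esub> q)"]) (simp_all add: kz fg_r_neg)
      qed
    qed (use Zmod_fg[OF Kb] in simp_all)
  qed (use Q T Zmod_fg[OF Kb] in simp_all)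
  \<comment> \<open>A boundary is determined by one entry t in T (i + 1), and \<tau> t = 0 is the
    exact condition on it: then \<mu> t is a cycle, cancelled by some \<pi> q. Hence the boundaries
    form a copy of the syzygy KB (i + 1).\<close>
  have kb: "z \<in> boundaries K (i + 1) \<longleftrightarrow> (\<exists>t\<in>carrier (T (i + 1)). \<tau> (i + 1) t = \<zero>\<^bsub>Deg X (i + 1)\<^esub> \<and>
    z = spair (spair \<zero>\<^bsub>T (i + 2)\<^esub> t) \<zero>\<^bsub>Q (i + 1)\<^esub>)" (is "?l \<longleftrightarrow> ?r") for z i
  proof
    assume ?l
    then obtain w where w: "w \<in> carrier (Deg K i)" "z = Dif K i w" by (auto elim: boundariesE)
    define t s q where "t = sfst (sfst w)" and "s = ssnd (sfst w)" and "q = ssnd w"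
    have c: "t \<in> carrier (T (i + 1))" "s \<in> carrier (T i)" "q \<in> carrier (Q i)"
      and eq: "\<mu> i t \<oplus>\<^bsub>Deg X i\<^esub> (\<tau> i s \<oplus>\<^bsub>Deg X i\<^esub> \<pi> i q) = \<zero>\<^bsub>Deg X i\<^esub>"
      and zw: "z = spair (spair \<zero>\<^bsub>T (i + 2)\<^esub> t) \<zero>\<^bsub>Q (i + 1)\<^esub>"
      using w by (auto simp: Kc Kd t_def s_def q_def)
    have "Dif X i (\<mu> i t \<oplus>\<^bsub>Deg X i\<^esub> (\<tau> i s \<oplus>\<^bsub>Deg X i\<^esub> \<pi> i q)) = \<tau> (i + 1) t" using c by (simp add: dif_add)
    then show ?r using c zw unfolding eq by auto
  next
    assume ?r
    then obtain t where t: "t \<in> carrier (T (i + 1))" "\<tau> (i + 1) t = \<zero>\<^bsub>Deg X (i + 1)\<^esub>"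
      "z = spair (spair \<zero>\<^bsub>T (i + 2)\<^esub> t) \<zero>\<^bsub>Q (i + 1)\<^esub>" by blast
    have "\<mu> i t \<in> carrier (Zmod X i)" using t by (simp del: cycles_carrier add: cycles_iff)
    from short_exactD(6)[OF seZ this] obtain q where q: "q \<in> carrier (Q i)" "\<mu> i t = \<pi> i q" by blast
    let ?w = "spair (spair t \<zero>\<^bsub>T i\<^esub>) (\<ominus>\<^bsub>Q i\<^esub> q)"
    have w: "?w \<in> carrier (Deg K i)" "z = Dif K i ?w" using t q by (simp_all add: Kc Kd fg_r_neg)
    show ?l unfolding w(2) by (rule boundariesI[OF w(1)]) simp
  qed
  \<comment> \<open>\<open>stage_extend\<close> with the zero module as projective quotient
    transports \<open>stage\<close> along this isomorphism.\<close>
  have stB': "stage {M0} j (Bmod K (i + 1))" for i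
  proof (rule stage_extend[OF proj])
    let ?i = "\<lambda>k\<in>carrier (KB (i + 1)). spair (spair \<zero>\<^bsub>T (i + 2)\<^esub> (\<kappa> (i + 1) k)) \<zero>\<^bsub>Q (i + 1)\<^esub>"
    let ?p = "\<lambda>z\<in>carrier (Bmod K (i + 1)). \<zero>\<^bsub>zmod\<^esub>"
    show "short_exact L (KB (i + 1)) (Bmod K (i + 1)) zmod ?i ?p"
    proof (rule short_exactI)
      have k: "\<tau> (i + 1) (\<kappa> (i + 1) k) = \<zero>\<^bsub>Deg X (i + 1)\<^esub>" if "k \<in> carrier (KB (i + 1))" for k
        using short_exactD(4)[OF seB that] by simp
      show "?i \<in> rhom L (KB (i + 1)) (Bmod K (i + 1))"
      proof (rule rhomI)
        show "spair (spair \<zero>\<^bsub>T (i + 2)\<^esub> (\<kappa> (i + 1) k)) \<zero>\<^bsub>Q (i + 1)\<^esub> \<in> carrier (Bmod K (i + 1))"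
          if "k \<in> carrier (KB (i + 1))" for k
          unfolding sub_simps kb using that k[OF that] by (intro bexI[of _ "\<kappa> (i + 1) k"]) simp_all
      qed simp_all
      show "?p \<in> rhom L (Bmod K (i + 1)) zmod" by (rule rhom_zero[OF Bmod_fg[OF Kb] zmod_fg])
      show "x = \<zero>\<^bsub>KB (i + 1)\<^esub>" if "x \<in> carrier (KB (i + 1))" "?i x = \<zero>\<^bsub>Bmod K (i + 1)\<^esub>" for x
        using that short_exactD(3)[OF seB that(1), of "\<zero>\<^bsub>KB (i + 1)\<^esub>"] by simp
      show "?p (?i x) = \<zero>\<^bsub>zmod\<^esub>" if "x \<in> carrier (KB (i + 1))" for x
      proof -
        have "?i x \<in> carrier (Bmod K (i + 1))"
          unfolding sub_simps kb using that k[OF that] by (intro bexI[of _ "\<kappa> (i + 1) x"]) simp_all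
        then show ?thesis by (simp only: restrict_apply if_True)
      qed
      show "\<exists>x\<in>carrier (KB (i + 1)). z = ?i x" if z: "z \<in> carrier (Bmod K (i + 1))" for z
      proof -
        obtain t where t: "t \<in> carrier (T (i + 1))" "\<tau> (i + 1) t = \<zero>\<^bsub>Deg X (i + 1)\<^esub>"
          "z = spair (spair \<zero>\<^bsub>T (i + 2)\<^esub> t) \<zero>\<^bsub>Q (i + 1)\<^esub>" using z unfolding sub_simps kb by blast
        from short_exactD(5)[OF seB t(1)] t(2) obtain k where "k \<in> carrier (KB (i + 1))" "t = \<kappa> (i + 1) k" by auto
        then show ?thesis using t(3) by (intro bexI[of _ k]) simp_all
      qed
      show "\<exists>y\<in>carrier (Bmod K (i + 1)). z = ?p y" if "z \<in> carrier zmod" for z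
        using that fg_zero[OF Bmod_fg[OF Kb, of "i + 1"]]
        by (intro bexI[of _ "\<zero>\<^bsub>Bmod K (i + 1)\<^esub>"]) (simp_all only: restrict_apply if_True zmod_simps singleton_iff)
    qed (use Bmod_fg[OF Kb] in simp_all)
    show "projective L zmod" by (rule projective_trivial) simp_all
  qed (use T Bmod_fg[OF Kb] in simp_all)
  have stB: "stage {M0} j (Bmod K i)" for i using stB'[of "i - 1"] by (simp only: diff_add_cancel)
  show ?thesis using ses Pp stZ stB by blast
qed

theorem resolved_stage:
  assumes "X \<in> bcpx L" and M0: "M0 \<in> fgmod L" and proj: "\<And>P. projective L P \<Longrightarrow> P \<in> acl {M0}"
    and "\<And>i. stage {M0} j (Zmod X i)" "\<And>i. stage {M0} j (Bmod X i)"
  shows "resolved (pieces M0) (j + 4) X"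
  using assms(1,4,5)
proof (induction j arbitrary: X)
  case 0
  then show ?case using resolved_base[OF 0(1) M0] by simp
next
  case (Suc j)
  obtain K P \<iota> \<phi> where K: "ses K P X \<iota> \<phi>" "P \<in> pieces M0" "\<forall>i. stage {M0} j (Zmod K i)" "\<forall>i. stage {M0} j (Bmod K i)"
    using resolved_reduce[OF Suc.prems(1) M0 proj Suc.prems(2,3)] by blast
  have Kb: "K \<in> bcpx L" by (rule sesE(1)[OF K(1)])
  \<comment> \<open>The cycles and boundaries of K[1] are those of K with degrees renumbered, so the
    induction hypothesis applies to K[1].\<close>
  have "resolved (pieces M0) (j + 4) (cshift 1 K)" using K Kb by (intro Suc.IH) simp_all
  then show ?case using resolved_step[OF K(1,2)] by (simp only: add_Suc)
qed

theorem tri_dim_le: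
  assumes "igusa_todorov n L"
  shows "tri_dim D \<le> enat (n + 3)"
proof -
  obtain M0 where M0: "M0 \<in> fgmod L" and proj: "\<forall>P. projective L P \<longrightarrow> P \<in> acl {M0}" and st: "\<forall>M\<in>fgmod L. stage {M0} n M"
    using igusa_todorov_stage[OF assms] by blast
  let ?G = "gcpx (stalk M0)"
  have G: "?G \<in> Ob D" using M0 by simp
  have "X \<in> tri_gen D {?G} (Suc (n + 3))" if X: "X \<in> bcpx L" for X
  proof -
    have "resolved (pieces M0) (n + 4) X" using proj st M0 X by (intro resolved_stage) simp_all
    \<comment> \<open>n + 4 pieces fill level d + 1 for d = n + 3.\<close>
    moreover have "n + 4 = Suc (n + 3)" by simp
    ultimately show ?thesis using resolved_tri_gen by metis
  qed
  moreover have "tri_gen D {?G} (Suc (n + 3)) \<subseteq> Ob D" using tri_gen_Ob unfolding D_simps by (intro subsetI)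
  ultimately have "tri_gen D {?G} (Suc (n + 3)) = Ob D" by auto
  then show ?thesis unfolding tri_dim_def using G by (intro Inf_lower) auto
qed

end

theorem corollary1p5:
  fixes n :: nat and R :: "'r ring" and \<Lambda> :: "('r, 'a) module"
  assumes "artin_algebra R \<Lambda>" and "igusa_todorov n \<Lambda>"
  shows "tri_dim (bounded_derived_cat \<Lambda>) \<le> enat (n + 3)"
proof -
  interpret artin_algebra R \<Lambda> by fact
  interpret noeth_mods \<Lambda>
  proof
    show "M\<lparr>carrier := N\<rparr> \<in> fgmod \<Lambda>" if "M \<in> fgmod \<Lambda>" "submodule N \<Lambda> M" for M N
      using that fin_gen_submodule right_submodule_right_module unfolding fgmod_def by blast
  qed
  show ?thesis using assms(2) by (rule tri_dim_le)
qed

end
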